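(* Let $f$ satisfy either (S1) $f\in C[0,+\infty)\cap C^\infty(0,+\infty)$, $f(0)=0$ and $f$ is strictly increasing on $[0,+\infty)$, or (S01) $f\in C^\infty(\mathbb{R})$, $f>0$ and $f$ is strictly increasing on $\mathbb{R}$. Assume $\int_t^{+\infty}(f(s))^{-1/k}ds<+\infty$ for all $t>0$ (respectively $t\in\mathbb{R}$) and that $$\lim_{t\to+\infty}((f(t))^{1/k})'\int_t^{+\infty}(f(s))^{-1/k}ds=C_f^{+\infty}\in(0,+\infty).$$ Let $b\in C^\infty(\Omega)$ be positive in $\Omega$ and suppose there are a function $\theta\in\Lambda$ (see context) and positive constants $b_1<b_2$ with $$b_1=\liminf_{d(x)\to0}\frac{b(x)}{\theta^{k+1}(d(x))}\le\limsup_{d(x)\to0}\frac{b(x)}{\theta^{k+1}(d(x))}=b_2 .$$ Assume further that either $C_f^{+\infty}>1$, or $C_f^{+\infty}=1$ and $D_\theta>0$. Then any classical $k$-convex solution $u$ of problem (P) (see context) satisfies $$\tau_{10}^{1-C_f^{+\infty}}\le\liminf_{d(x)\to0}\frac{u(x)}{\psi\big((\Theta(d(x)))^{\frac{k+1}{k}}\big)}\le\limsup_{d(x)\to0}\frac{u(x)}{\psi\big((\Theta(d(x)))^{\frac{k+1}{k}}\big)}\le\tau_9^{1-C_f^{+\infty}},$$ where $$\tau_9=\frac{k}{k+1}\Big(\frac{b_1k}{((k+1)(C_f^{+\infty}-1)+kD_\theta)M_{k-1}^{+}}\Big)^{1/k},\qquad \tau_{10}=\frac{k}{k+1}\Big(\frac{b_2k}{((k+1)(C_f^{+\infty}-1)+kD_\theta)M_{k-1}^{-}}\Big)^{1/k},$$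 $$M_{k-1}^{+}=\max_{x\in\partial\Omega}S_{k-1}(\kappa_1,\dots,\kappa_{N-1}),\qquad M_{k-1}^{-}=\min_{x\in\partial\Omega}S_{k-1}(\kappa_1,\dots,\kappa_{N-1}).$$ In particular, if $C_f^{+\infty}=1$, then $$\lim_{d(x)\to0}\frac{u(x)}{\psi\big((\Theta(d(x)))^{\frac{k+1}{k}}\big)}=1 .$$
   Context: $\Omega\subset\mathbb{R}^N$ ($N\ge2$) is a smooth, bounded, strictly convex domain; $\kappa_1(x),\dots,\kappa_{N-1}(x)$ are the principal curvatures of $\partial\Omega$ at $x$, and strict convexity means $S_i(\kappa_1,\dots,\kappa_{N-1})>0$ on $\partial\Omega$ for $i=1,\dots,N-1$. $k\in\{1,\dots,N\}$, $d(x)=\mathrm{dist}(x,\partial\Omega)$. $S_k$ is the $k$-th elementary symmetric polynomial ($S_0=1$), and $S_k(D^2u)$ is $S_k$ of the eigenvalues of the Hessian $D^2u$. $u\in C^2(\Omega)$ is $k$-convex if $S_i(D^2u)\ge0$ in $\Omega$ for $i=1,\dots,k$. Problem (P): $S_k(D^2u)=b(x)f(u)$ in $\Omega$, $u=+\infty$ on $\partial\Omega$ (i.e. $u(x)\to+\infty$ as $d(x)\to0$). A classical $k$-convex solution is a $k$-convex $u\in C^2(\Omega)$, with values in the domain of $f$, satisfying (P). $\Lambda$ is the set of all positive monotonic functions $\theta\in C^1(0,\delta_0)\cap L^1(0,\delta_0)$ (for some $\delta_0>0$) such that $$\lim_{t\to0^+}\frac{d}{dt}\Big(\frac{\Theta(t)}{\theta(t)}\Big)=:D_\theta\in[0,+\infty),\qquad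 \Theta(t)=\int_0^t\theta(s)ds .$$ $\psi$ is uniquely determined, for (small) $t>0$, by $\int_{\psi(t)}^{+\infty}(f(s))^{-1/k}ds=t$. *)

theory Defs
  imports "HOL-Analysis.Analysis" "HOL-Computational_Algebra.Polynomial"
begin

subsection \<open>Classical differentiability on open sets\<close>

text \<open>The set \<open>S\<close> is meant to be open. The general \<^class>\<open>euclidean_space\<close> version
  covers both functions on \<open>real ^ 'n\<close> and functions of one real variable.\<close>

primrec Ck_on :: "nat \<Rightarrow> ('a::euclidean_space \<Rightarrow> real) \<Rightarrow> 'a set \<Rightarrow> bool" where
  "Ck_on 0 f S \<longleftrightarrow> continuous_on S f"
| "Ck_on (Suc m) f S \<longleftrightarrow> (\<forall>x\<in>S. f differentiable (at x)) \<and>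
     (\<forall>e\<in>Basis. Ck_on m (\<lambda>x. frechet_derivative f (at x) e) S)"

definition smooth_on :: "('a::euclidean_space \<Rightarrow> real) \<Rightarrow> 'a set \<Rightarrow> bool" where
  "smooth_on f S \<longleftrightarrow> (\<forall>m. Ck_on m f S)"

definition partial :: "'n \<Rightarrow> (real ^ 'n \<Rightarrow> real) \<Rightarrow> real ^ 'n \<Rightarrow> real" where
  "partial i f x = frechet_derivative f (at x) (axis i 1)"

definition gradient :: "(real ^ 'n \<Rightarrow> real) \<Rightarrow> real ^ 'n \<Rightarrow> real ^ 'n" where
  "gradient f x = (\<chi> i. partial i f x)"

definition hessian :: "(real ^ 'n \<Rightarrow> real) \<Rightarrow> real ^ 'n \<Rightarrow> real ^ 'n ^ 'n" where
  "hessian f x = (\<chi> i j. partial i (partial j f) x)"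

subsection \<open>Elementary symmetric polynomials and Hessian operators\<close>

definition elem_sym :: "nat \<Rightarrow> real list \<Rightarrow> real" where
  "elem_sym k xs = (\<Sum>I | I \<subseteq> {..<length xs} \<and> card I = k. \<Prod>i\<in>I. xs ! i)"

definition charpoly :: "real ^ 'n ^ 'n \<Rightarrow> real poly" where
  "charpoly A = det (\<chi> i j. (if i = j then [:0, 1:] else 0) - [:A $ i $ j:])"

text \<open>The real eigenvalues repeated according to algebraic multiplicity; for a symmetric matrix,
  such as the Hessian of a \<open>C\<^sup>2\<close> function, these are all \<open>N\<close> eigenvalues.\<close>

definition eigenvalues :: "real ^ 'n ^ 'n \<Rightarrow> real list" where
  "eigenvalues A = sorted_list_of_multiset (proots (charpoly A))"

definition S_hess :: "nat \<Rightarrow> (real ^ 'n \<Rightarrow> real) \<Rightarrow> real ^ 'n \<Rightarrow> real" where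
  "S_hess k u x = elem_sym k (eigenvalues (hessian u x))"

definition k_convex_on :: "nat \<Rightarrow> (real ^ 'n) set \<Rightarrow> (real ^ 'n \<Rightarrow> real) \<Rightarrow> bool" where
  "k_convex_on k \<Omega> u \<longleftrightarrow> Ck_on 2 u \<Omega> \<and> (\<forall>i\<in>{1..k}. \<forall>x\<in>\<Omega>. S_hess i u x \<ge> 0)"

subsection \<open>Smooth strictly convex domains and principal curvatures\<close>

definition local_defining_function ::
    "(real ^ 'n) set \<Rightarrow> real ^ 'n \<Rightarrow> (real ^ 'n) set \<Rightarrow> (real ^ 'n \<Rightarrow> real) \<Rightarrow> bool" where
  "local_defining_function \<Omega> x U \<rho> \<longleftrightarrow>
     open U \<and> x \<in> U \<and> smooth_on \<rho> U \<and> (\<forall>y\<in>U. gradient \<rho> y \<noteq> 0) \<and>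
     \<Omega> \<inter> U = {y\<in>U. \<rho> y < 0}"

definition smooth_bounded_domain :: "(real ^ 'n) set \<Rightarrow> bool" where
  "smooth_bounded_domain \<Omega> \<longleftrightarrow>
     open \<Omega> \<and> connected \<Omega> \<and> \<Omega> \<noteq> {} \<and> bounded \<Omega> \<and>
     (\<forall>x\<in>frontier \<Omega>. \<exists>U \<rho>. local_defining_function \<Omega> x U \<rho>)"

text \<open>At a boundary point of a smooth domain the normalised gradient below does not depend on
  the local defining function.\<close>

definition outer_normal :: "(real ^ 'n) set \<Rightarrow> real ^ 'n \<Rightarrow> real ^ 'n" where
  "outer_normal \<Omega> x =
     (THE v. \<exists>U \<rho>. local_defining_function \<Omega> x U \<rho> \<and> v = gradient \<rho> x /\<^sub>R norm (gradient \<rho> x))"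

text \<open>The principal curvatures are the eigenvalues, with multiplicity, of the Weingarten map: the
  differential \<open>W\<close> of the Gauss map (the outer unit normal) along the boundary, acting on the
  tangent space; \<open>e\<close> is an orthonormal basis of principal directions. The derivative within
  \<open>frontier \<Omega>\<close> determines \<open>W\<close> only on tangent vectors, and only these are used.
  With this sign the unit sphere, as boundary of the unit ball, has all curvatures equal to 1.
  They are listed in increasing order.\<close>

definition principal_curvatures :: "(real ^ 'n) set \<Rightarrow> real ^ 'n \<Rightarrow> real list" where
  "principal_curvatures \<Omega> x = (THE \<kappa>. sorted \<kappa> \<and> length \<kappa> = CARD('n) - 1 \<and>
     (\<exists>W e. (outer_normal \<Omega> has_derivative W) (at x within frontier \<Omega>) \<and>
        (\<forall>i<length \<kappa>. norm (e i) = 1 \<and> e i \<bullet> outer_normal \<Omega> x = 0 \<and> W (e i) = (\<kappa> ! i) *\<^sub>R e i) \<and>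
        (\<forall>i<length \<kappa>. \<forall>j<length \<kappa>. i \<noteq> j \<longrightarrow> e i \<bullet> e j = 0)))"

definition S_curv :: "nat \<Rightarrow> (real ^ 'n) set \<Rightarrow> real ^ 'n \<Rightarrow> real" where
  "S_curv i \<Omega> x = elem_sym i (principal_curvatures \<Omega> x)"

definition strictly_convex_boundary :: "(real ^ 'n) set \<Rightarrow> bool" where
  "strictly_convex_boundary \<Omega> \<longleftrightarrow> (\<forall>x\<in>frontier \<Omega>. \<forall>i\<in>{1..CARD('n) - 1}. S_curv i \<Omega> x > 0)"

text \<open>Maximum and minimum over the boundary (\<^const>\<open>Max\<close> and \<^const>\<open>Min\<close> are for finite sets).\<close>

definition M_plus :: "nat \<Rightarrow> (real ^ 'n) set \<Rightarrow> real" where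
  "M_plus i \<Omega> = (GREATEST m. m \<in> S_curv i \<Omega> ` frontier \<Omega>)"

definition M_minus :: "nat \<Rightarrow> (real ^ 'n) set \<Rightarrow> real" where
  "M_minus i \<Omega> = (LEAST m. m \<in> S_curv i \<Omega> ` frontier \<Omega>)"

subsection \<open>Boundary blow-up problem\<close>

definition bdist :: "(real ^ 'n) set \<Rightarrow> real ^ 'n \<Rightarrow> real" where
  "bdist \<Omega> x = infdist x (frontier \<Omega>)"

text \<open>The filter of \<open>d(x) \<rightarrow> 0\<close> with \<open>x \<in> \<Omega>\<close>.\<close>

definition near_boundary :: "(real ^ 'n) set \<Rightarrow> (real ^ 'n) filter" where
  "near_boundary \<Omega> = inf (filtercomap (bdist \<Omega>) (nhds 0)) (principal \<Omega>)"

text \<open>\<open>J\<close> is the domain of the nonlinearity \<open>f\<close>.\<close>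

definition classical_k_convex_solution ::
    "nat \<Rightarrow> (real ^ 'n) set \<Rightarrow> (real ^ 'n \<Rightarrow> real) \<Rightarrow> real set \<Rightarrow> (real \<Rightarrow> real) \<Rightarrow>
     (real ^ 'n \<Rightarrow> real) \<Rightarrow> bool" where
  "classical_k_convex_solution k \<Omega> b J f u \<longleftrightarrow>
     k_convex_on k \<Omega> u \<and> u ` \<Omega> \<subseteq> J \<and>
     (\<forall>x\<in>\<Omega>. S_hess k u x = b x * f (u x)) \<and>
     filterlim u at_top (near_boundary \<Omega>)"

definition S1 :: "(real \<Rightarrow> real) \<Rightarrow> bool" where
  "S1 f \<longleftrightarrow> continuous_on {0..} f \<and> smooth_on f {0<..} \<and> f 0 = 0 \<and> strict_mono_on {0..} f"

definition S01 :: "(real \<Rightarrow> real) \<Rightarrow> bool" where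
  "S01 f \<longleftrightarrow> smooth_on f UNIV \<and> (\<forall>t. f t > 0) \<and> strict_mono f"

definition tail_integrable :: "nat \<Rightarrow> (real \<Rightarrow> real) \<Rightarrow> real \<Rightarrow> bool" where
  "tail_integrable k f t \<longleftrightarrow> set_integrable lborel {t<..} (\<lambda>s. f s powr (- 1 / real k))"

definition tail_integral :: "nat \<Rightarrow> (real \<Rightarrow> real) \<Rightarrow> real \<Rightarrow> real" where
  "tail_integral k f t = (LINT s:{t<..}|lborel. f s powr (- 1 / real k))"

subsection \<open>The weight class\<close>

definition Theta :: "(real \<Rightarrow> real) \<Rightarrow> real \<Rightarrow> real" where
  "Theta \<theta> t = (LINT s:{0<..<t}|lborel. \<theta> s)"

definition Lambda :: "(real \<Rightarrow> real) set" where
  "Lambda = {\<theta>. \<exists>\<delta>0>0. (\<forall>t\<in>{0<..<\<delta>0}. \<theta> t > 0) \<and>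
     (mono_on {0<..<\<delta>0} \<theta> \<or> antimono_on {0<..<\<delta>0} \<theta>) \<and>
     Ck_on 1 \<theta> {0<..<\<delta>0} \<and> set_integrable lborel {0<..<\<delta>0} \<theta> \<and>
     (\<exists>D\<ge>0. (deriv (\<lambda>t. Theta \<theta> t / \<theta> t) \<longlongrightarrow> D) (at_right 0))}"

definition D_of :: "(real \<Rightarrow> real) \<Rightarrow> real" where
  "D_of \<theta> = Lim (at_right 0) (deriv (\<lambda>t. Theta \<theta> t / \<theta> t))"

end

theory Submission
  imports Defs "HOL-Computational_Algebra.Fundamental_Theorem_Algebra"
begin

text \<open>
  Near the boundary the function \<open>h (d (x))\<close> with \<open>h = \<psi> (\<tau> \<Theta>\<^sup>\<alpha>)\<close>, \<open>\<alpha> = (k + 1) / k\<close>, has Hessian eigenvalues \<open>h''\<close> and \<open>- h' \<kappa>\<^sub>i\<close> to leading order, so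
  its \<open>k\<close>-Hessian is about \<open>f (h) \<theta>\<^bsup>k + 1\<^esup> (\<tau> \<alpha>)\<^sup>k (\<alpha> (C - 1) + D) S\<^bsub>k - 1\<^esub> (\<kappa>)\<close>. For \<open>\<tau> < \<tau>9\<close> this is a
  supersolution and for \<open>\<tau> > \<tau>10\<close> a subsolution near the boundary. Perturbing \<open>\<Theta>\<close> by a parameter \<open>\<rho>\<close>
  makes the barrier infinite on \<open>d = \<rho>\<close>, respectively finite on the boundary, so that \<open>u\<close> compares with
  it up to an additive constant; \<open>\<rho> \<rightarrow> 0\<close> and the regular variation of \<open>\<psi>\<close> with index \<open>1 - C\<close> give the
  bounds on the quotient.

  The distance function need not be differentiated. At the point where \<open>u - h (d)\<close> is extremal, \<open>d\<close> is
  replaced by explicit polynomials touching it from below and from above; only a second-order Taylor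
  expansion of a defining function is needed to find them. The comparison of \<open>k\<close>-Hessians at that point
  is the monotonicity of \<open>S\<^sub>k\<close> on the Garding cone. It is proved by adding rank-one matrices one at a
  time and rests on Newton's inequalities.
\<close>

section \<open>Elementary symmetric polynomials\<close>

text \<open>Let F be the k-th root of f. Then \<open>\<psi>' = - F(\<psi>)\<close> and f (h) is a
  k-th power, which makes the barrier computable: the bracket in its k-Hessian tends to \<alpha> C -
  1 / k + (D - 1) = \<alpha> (C - 1) + D. Equating (\<tau> \<alpha>)^k times this limit times an
  extreme value of S_{k-1}(\<kappa>) with b1 or b2 gives \<tau>9 and \<tau>10. Nothing relates u to
  the barrier on an inner level d = \<delta>, whence the additive constant M >= 0. Where u - h is
  extremal beyond M one has u > h, respectively u < h, and strict monotonicity of f yields the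
  contradiction. M has to be independent of \<rho> to survive \<rho> -> 0; it is harmless in the
  quotient because \<psi> tends to infinity. The two bounds are not mirror images. Monotonicity of
  S_k requires only the smaller matrix to lie in the Garding cone. In the upper bound this is the
  Hessian of u, placed there by k-convexity; in the lower bound it is the model Hessian of the
  barrier, placed there by convexity of the profile and positivity of every S_j(\<kappa>).\<close>

lemma elem_sym_0 [simp]: "elem_sym 0 xs = 1"
proof -
  have "{I. I \<subseteq> {..<length xs} \<and> card I = 0} = {{}}"
    by (auto dest: finite_subset)
  then show ?thesis by (simp add: elem_sym_def)
qed

text \<open>Since \<open>elem_sym\<close> sums over sets of positions, the recurrence is cleanest at
  the end of the list: the position \<open>length xs\<close> is new and no other position moves. The
  sets split by whether they contain it.\<close>

lemma elem_sym_snoc: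
  "elem_sym (Suc k) (xs @ [x]) = elem_sym (Suc k) xs + x * elem_sym k xs"
proof -
  let ?n = "length xs"
  let ?A = "{I. I \<subseteq> {..<?n} \<and> card I = Suc k}"
  let ?B = "{I. I \<subseteq> {..<?n} \<and> card I = k}"
  have fin: "finite ?A" "finite ?B" by auto
  have split: "{I. I \<subseteq> {..<length (xs @ [x])} \<and> card I = Suc k} = ?A \<union> insert ?n ` ?B" (is "?L = ?R")
  proof
    show "?L \<subseteq> ?R"
    proof
      fix I assume I: "I \<in> ?L"
      then have finI: "finite I" by (auto intro: finite_subset)
      show "I \<in> ?R"
      proof (cases "?n \<in> I")
        case True
        then have "I = insert ?n (I - {?n})" by auto
        moreover have "I - {?n} \<in> ?B"
          using I True finI by (auto simp: less_Suc_eq)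
        ultimately show ?thesis by blast
      next
        case False
        then have "I \<in> ?A" using I by (auto simp: subset_iff less_Suc_eq)
        then show ?thesis by blast
      qed
    qed
    show "?R \<subseteq> ?L"
    proof
      fix I assume "I \<in> ?R"
      then show "I \<in> ?L"
      proof
        assume "I \<in> insert ?n ` ?B"
        then obtain J where J: "J \<subseteq> {..<?n}" "card J = k" "I = insert ?n J" by auto
        then have "finite J" "?n \<notin> J" by (auto intro: finite_subset)
        then show ?thesis using J by (auto simp: less_Suc_eq)
      qed (auto simp: less_Suc_eq)
    qed
  qed
  have disj: "?A \<inter> insert ?n ` ?B = {}" by auto
  have inj: "inj_on (insert ?n) ?B"
    by (rule inj_onI) (metis (mono_tags, lifting) insert_ident lessThan_iff less_irrefl mem_Collect_eq subsetD)
  have 1: "(\<Sum>I\<in>?A. \<Prod>i\<in>I. (xs @ [x]) ! i) = elem_sym (Suc k) xs"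
    unfolding elem_sym_def by (intro sum.cong prod.cong) (auto simp: nth_append)
  have 2: "(\<Sum>I\<in>insert ?n ` ?B. \<Prod>i\<in>I. (xs @ [x]) ! i) = x * elem_sym k xs"
  proof -
    have "(\<Prod>i\<in>insert ?n J. (xs @ [x]) ! i) = x * (\<Prod>i\<in>J. xs ! i)" if "J \<in> ?B" for J
    proof -
      have "finite J" "?n \<notin> J" using that by (auto intro: finite_subset)
      moreover have "(\<Prod>i\<in>J. (xs @ [x]) ! i) = (\<Prod>i\<in>J. xs ! i)"
        using that by (intro prod.cong) (auto simp: nth_append)
      ultimately show ?thesis by simp
    qed
    then show ?thesis
      by (simp add: sum.reindex[OF inj] elem_sym_def sum_distrib_left)
  qed
  show ?thesis
    unfolding elem_sym_def[of _ "xs @ [x]"] split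
    by (subst sum.union_disjoint) (use fin disj 1 2 in auto)
qed

text \<open>The generating polynomial. Multiplication of polynomials commutes, so the recurrence at
  the head and invariance under permutation become immediate; real-rootedness of the product leads
  to Newton's inequalities.\<close>

lemma elem_sym_eq_coeff: "elem_sym k xs = coeff (\<Prod>x\<leftarrow>xs. [:1, x:]) k"
proof (induction xs arbitrary: k rule: rev_induct)
  case Nil
  have "{I::nat set. I \<subseteq> {} \<and> card I = k} = (if k = 0 then {{}} else {})" by auto
  then show ?case by (simp add: elem_sym_def coeff_1)
next
  case (snoc x xs)
  then show ?case
    by (cases k) (auto simp: elem_sym_snoc algebra_simps coeff_pCons simp flip: snoc.IH)
qed

lemma elem_sym_Cons:
  "elem_sym (Suc k) (x # xs) = elem_sym (Suc k) xs + x * elem_sym k xs"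
  by (simp add: elem_sym_eq_coeff coeff_pCons)

lemma elem_sym_mset: "mset xs = mset ys \<Longrightarrow> elem_sym k xs = elem_sym k ys"
  by (simp only: elem_sym_eq_coeff mset_map flip: prod_mset_prod_list)

lemma elem_sym_scale: "elem_sym k (map (\<lambda>x. c * x) xs) = c ^ k * elem_sym k xs"
proof (induction xs arbitrary: k)
  case Nil
  then show ?case by (cases k) (auto simp: elem_sym_eq_coeff)
next
  case (Cons x xs)
  then show ?case by (cases k) (auto simp: elem_sym_Cons algebra_simps)
qed

lemma elem_sym_length_less: "length xs < k \<Longrightarrow> elem_sym k xs = 0"
proof (induction xs arbitrary: k)
  case Nil
  then show ?case by (cases k) (auto simp: elem_sym_eq_coeff)
next
  case (Cons x xs)
  then show ?case by (cases k) (auto simp: elem_sym_Cons)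
qed

text \<open>Real-rootedness is stable under differentiation: off the real axis the logarithmic
  derivative of a polynomial with real roots has imaginary part of a strict sign.\<close>

definition real_rooted :: "real poly \<Rightarrow> bool" where
  "real_rooted p \<longleftrightarrow> (\<exists>c A. p = smult c (\<Prod>x\<in>#A. [:-x, 1:]))"

lemma poly_of_real_linear_prod:
  "poly (map_poly complex_of_real (\<Prod>x\<in>#A. [:-x, 1:])) z = (\<Prod>x\<in>#A. z - of_real x)"
proof -
  have "map_poly complex_of_real (\<Prod>x\<in>#A. [:-x, 1:]) = (\<Prod>x\<in>#A. [:- of_real x, 1:])"
  proof (induction A)
    case (add x A)
    have "map_poly complex_of_real ([:- x, 1:] * q)
        = map_poly complex_of_real [:- x, 1:] * map_poly complex_of_real q" for q
      by (intro poly_eqI) (simp only: coeff_map_poly coeff_mult of_real_sum of_real_mult of_real_0)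
    then show ?case using add by (simp add: map_poly_pCons)
  qed simp
  then show ?thesis by (simp add: poly_prod_mset image_mset.compositionality comp_def)
qed

text \<open>\<open>w\<close> is the sum of 1 / (z - x) over the roots, each summand having imaginary
  part of sign opposite to \<open>Im z\<close>. As a multiplier it avoids division by the
  polynomial; without roots the sum would be 0 and have no strict sign.\<close>

lemma logderiv_Im:
  fixes A :: "real multiset"
  assumes "Im z \<noteq> 0" "A \<noteq> {#}"
  shows "\<exists>w. poly (pderiv (map_poly complex_of_real (\<Prod>x\<in>#A. [:-x, 1:]))) z
     = w * poly (map_poly complex_of_real (\<Prod>x\<in>#A. [:-x, 1:])) z \<and> Im w * Im z < 0"
  using assms(2)
proof (induction A)
  case (add x A)
  let ?P = "\<lambda>A. map_poly complex_of_real (\<Prod>x\<in>#A. [:-x, 1:])"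
  have mult: "?P (add_mset x A) = [:- of_real x, 1:] * ?P A"
    by (intro poly_eqI) (auto simp: coeff_map_poly coeff_pCons split: nat.splits)
  have nz: "z - of_real x \<noteq> 0" using assms(1) by (auto simp: complex_eq_iff)
  define v where "v = 1 / (z - of_real x)"
  have v: "Im v * Im z < 0"
    using assms(1) nz
    by (auto simp: v_def Im_divide power2_eq_square[symmetric] complex_eq_iff sum_power2_gt_zero_iff
        intro!: divide_neg_pos)
  have d: "poly (pderiv (?P (add_mset x A))) z =
     poly (?P A) z + (z - of_real x) * poly (pderiv (?P A)) z"
    unfolding mult pderiv_mult by (simp add: pderiv_pCons algebra_simps)
  show ?case
  proof (cases "A = {#}")
    case True
    then show ?thesis using v nz unfolding d unfolding mult
      by (intro exI[of _ v]) (auto simp: v_def)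
  next
    case False
    then obtain w where w: "poly (pderiv (?P A)) z = w * poly (?P A) z" "Im w * Im z < 0"
      using add.IH by auto
    have "poly (pderiv (?P (add_mset x A))) z = (v + w) * poly (?P (add_mset x A)) z"
      unfolding d unfolding mult w using nz by (simp add: v_def field_simps)
    moreover have "Im (v + w) * Im z < 0" using v w by (simp add: algebra_simps)
    ultimately show ?thesis by blast
  qed
qed simp

lemma map_poly_of_real_smult: "map_poly complex_of_real (smult c p) = smult (of_real c) (map_poly of_real p)"
  by (intro poly_eqI) (simp add: coeff_map_poly)

lemma real_rooted_if_complex_roots:
  assumes "\<And>z. poly (map_poly complex_of_real p) z = 0 \<Longrightarrow> Im z = 0"
  shows "real_rooted p"
proof -
  let ?P = "map_poly complex_of_real p"
  \<comment> \<open>The zero polynomial would vanish at the non-real point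
    \<open>\<i>\<close>.\<close>
  have nz: "?P \<noteq> 0" using assms[of \<i>] by auto
  obtain A where A: "?P = smult (lead_coeff ?P) (\<Prod>x\<in>#A. [:-x, 1:])"
    using alg_closed_imp_factorization[OF nz] by blast
  have re: "x = of_real (Re x)" if "x \<in># A" for x
  proof -
    have "poly ?P x = 0" using that nz
      by (subst A) (auto simp: poly_prod_mset prod_mset_zero_iff image_iff)
    then show ?thesis using assms by (simp add: complex_eq_iff)
  qed
  let ?B = "image_mset Re A"
  have lc: "lead_coeff ?P = of_real (lead_coeff p)" by (simp add: coeff_map_poly degree_map_poly)
  have "(\<Prod>x\<in>#A. [:-x, 1:]) = map_poly complex_of_real (\<Prod>x\<in>#?B. [:-x, 1:])"
    using re
  proof (induction A)
    case (add x A)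
    have 1: "map_poly complex_of_real ([:- y, 1:] * q)
        = map_poly complex_of_real [:- y, 1:] * map_poly complex_of_real q" for q y
      by (intro poly_eqI) (simp only: coeff_map_poly coeff_mult of_real_sum of_real_mult of_real_0)
    have 2: "[:-x, 1:] = map_poly complex_of_real [:- Re x, 1:]"
      using add.prems[of x] by (simp add: map_poly_pCons)
    have 3: "(\<Prod>x\<in>#A. [:-x, 1:]) = map_poly complex_of_real (\<Prod>x\<in>#image_mset Re A. [:-x, 1:])"
      using add by auto
    show ?case by (simp only: image_mset_add_mset prod_mset.add_mset 1 2 3)
  qed simp
  then have "?P = map_poly complex_of_real (smult (lead_coeff p) (\<Prod>x\<in>#?B. [:-x, 1:]))"
    using A lc by (metis map_poly_of_real_smult)
  then have "p = smult (lead_coeff p) (\<Prod>x\<in>#?B. [:-x, 1:])"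
    by (metis (mono_tags, lifting) coeff_map_poly of_real_0 of_real_eq_iff poly_eqI)
  then show ?thesis unfolding real_rooted_def by blast
qed

lemma real_rooted_pderiv:
  assumes "real_rooted p"
  shows "real_rooted (pderiv p)"
proof -
  obtain c A where p: "p = smult c (\<Prod>x\<in>#A. [:-x, 1:])"
    using assms by (auto simp: real_rooted_def)
  show ?thesis
  proof (cases "c = 0 \<or> A = {#}")
    \<comment> \<open>A constant has derivative 0, which counts as real-rooted because the factor
      \<open>c\<close> may be 0.\<close>
    case True
    then have "pderiv p = smult 0 (\<Prod>x\<in>#{#}. [:-x, 1:])" by (auto simp: p pderiv_1 pderiv_smult)
    then show ?thesis unfolding real_rooted_def by blast
  next
    case False
    let ?Q = "map_poly complex_of_real (\<Prod>x\<in>#A. [:-x, 1:])"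
    show ?thesis
    proof (rule real_rooted_if_complex_roots, rule ccontr)
      fix z assume z: "poly (map_poly complex_of_real (pderiv p)) z = 0" "Im z \<noteq> 0"
      have "map_poly complex_of_real (pderiv p) = smult (of_real c) (pderiv ?Q)"
        unfolding p by (intro poly_eqI) (simp add: coeff_map_poly coeff_pderiv)
      then have "poly (pderiv ?Q) z = 0" using z False by simp
      moreover obtain w where w: "poly (pderiv ?Q) z = w * poly ?Q z" "Im w * Im z < 0"
        using logderiv_Im z False by blast
      moreover have "poly ?Q z \<noteq> 0" unfolding poly_of_real_linear_prod
        using z(2) by (auto simp: prod_mset_zero_iff)
      ultimately show False by auto
    qed
  qed
qed

text \<open>Induction over the roots: for q = (X - a) r the difference q'^2 - q q'' equals r^2 + (x
  - a)^2 (r'^2 - r r''). No quotient is formed, so zeros of the polynomial need no separate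
  treatment.\<close>

lemma laguerre_inequality:
  assumes "real_rooted p"
  shows "poly p x * poly (pderiv (pderiv p)) x \<le> (poly (pderiv p) x)\<^sup>2"
proof -
  obtain c A where p: "p = smult c (\<Prod>x\<in>#A. [:-x, 1:])"
    using assms by (auto simp: real_rooted_def)
  have "poly q x * poly (pderiv (pderiv q)) x \<le> (poly (pderiv q) x)\<^sup>2"
    if "q = (\<Prod>x\<in>#A. [:-x, 1:])" for q
    using that
  proof (induction A arbitrary: q)
    case empty
    then show ?case by simp
  next
    case (add a A)
    define r where "r = (\<Prod>x\<in>#A. [:-x, 1:])"
    have q: "q = [:-a, 1:] * r" using add by (simp add: r_def)
    have 1: "poly (pderiv q) x = poly r x + (x - a) * poly (pderiv r) x"
      unfolding q pderiv_mult by (simp add: pderiv_pCons algebra_simps)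
    have 2: "poly (pderiv (pderiv q)) x = 2 * poly (pderiv r) x + (x - a) * poly (pderiv (pderiv r)) x"
      unfolding q pderiv_mult pderiv_add by (simp add: pderiv_pCons pderiv_add pderiv_mult algebra_simps)
    have 3: "poly q x = (x - a) * poly r x" unfolding q by (simp add: algebra_simps)
    have "(poly (pderiv q) x)\<^sup>2 - poly q x * poly (pderiv (pderiv q)) x
      = (poly r x)\<^sup>2 + (x - a)\<^sup>2 * ((poly (pderiv r) x)\<^sup>2 - poly r x * poly (pderiv (pderiv r)) x)"
      unfolding 1 2 3 by (simp add: power2_eq_square algebra_simps)
    moreover have "\<dots> \<ge> 0" using add.IH[OF r_def] by simp
    ultimately show ?case by linarith
  qed
  from mult_left_mono[OF this[OF refl], of "c\<^sup>2"] show ?thesis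
    unfolding p by (simp add: pderiv_smult power_mult_distrib power2_eq_square mult_ac)
qed

lemma real_rooted_linear_prod: "real_rooted (\<Prod>x\<leftarrow>xs. [:1, x:])"
proof (induction xs)
  case Nil
  have "1 = smult 1 (\<Prod>x\<in>#{#}. [:- x, 1:]::real poly)" by simp
  then show ?case unfolding real_rooted_def by (metis list.map(1) prod_list.Nil)
next
  case (Cons x xs)
  then obtain c A where cA: "(\<Prod>x\<leftarrow>xs. [:1, x:]) = smult c (\<Prod>x\<in>#A. [:- x, 1:])"
    by (auto simp: real_rooted_def)
  show ?case
  \<comment> \<open>For x = 0 the factor is the constant 1 and contributes no root; otherwise its
    root is - 1 / x.\<close>
  proof (cases "x = 0")
    case True
    then show ?thesis using Cons by (simp flip: one_pCons)
  next
    case False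
    have e: "[:1, x:] = smult x [:- (- 1 / x), 1:]" using False by simp
    have "(\<Prod>x\<leftarrow>x # xs. [:1, x:]) = smult (c * x) (\<Prod>x\<in>#add_mset (- 1 / x) A. [:- x, 1:])"
      by (simp only: list.map prod_list.Cons cA e image_mset_add_mset prod_mset.add_mset
          mult_smult_left mult_smult_right smult_smult mult.commute[of c x])
    then show ?thesis unfolding real_rooted_def by blast
  qed
qed

lemma real_rooted_pderiv_iter: "real_rooted p \<Longrightarrow> real_rooted ((pderiv ^^ m) p)"
  by (induction m) (auto intro: real_rooted_pderiv)

text \<open>Laguerre's inequality at 0 for the j-th derivative of the generating polynomial. The
  constants are dimension-free and weaker than the sharp ones; what matters is that the factor j + 2
  on one side exceeds j + 1 on the other, which the subtracted term displays.\<close>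

lemma newton_inequality:
  "real (Suc j) * (elem_sym (Suc (Suc j)) xs * elem_sym j xs) \<le> real (Suc j) * (elem_sym (Suc j) xs)\<^sup>2
    - elem_sym (Suc (Suc j)) xs * elem_sym j xs"
proof -
  define p where "p = (\<Prod>x\<leftarrow>xs. [:1, x:])"
  have cf: "poly ((pderiv ^^ m) p) 0 = fact m * elem_sym m xs" for m
    by (simp add: poly_0_coeff_0 coeff_higher_pderiv elem_sym_eq_coeff p_def pochhammer_fact)
  have "poly ((pderiv ^^ j) p) 0 * poly ((pderiv ^^ Suc (Suc j)) p) 0 \<le> (poly ((pderiv ^^ Suc j) p) 0)\<^sup>2"
    using laguerre_inequality[OF real_rooted_pderiv_iter[OF real_rooted_linear_prod[of xs]], of j 0]
    by (simp add: p_def)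
  then have "fact j * fact j * (real (Suc j) * (real (Suc (Suc j)) * (elem_sym (Suc (Suc j)) xs * elem_sym j xs)))
      \<le> fact j * fact j * (real (Suc j) * (real (Suc j) * (elem_sym (Suc j) xs)\<^sup>2))"
    unfolding cf by (simp add: power2_eq_square algebra_simps)
  then have "real (Suc j) * (real (Suc (Suc j)) * (elem_sym (Suc (Suc j)) xs * elem_sym j xs))
      \<le> real (Suc j) * (real (Suc j) * (elem_sym (Suc j) xs)\<^sup>2)"
    by (simp only: mult_le_cancel_left_pos fact_gt_zero mult_pos_pos)
  then have "real (Suc (Suc j)) * (elem_sym (Suc (Suc j)) xs * elem_sym j xs)
      \<le> real (Suc j) * (elem_sym (Suc j) xs)\<^sup>2"
    by (simp only: mult_le_cancel_left_pos of_nat_0_less_iff zero_less_Suc)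
  then show ?thesis by (simp add: algebra_simps)
qed

text \<open>Deleting an entry maps the closed Garding cone of order k into that of order k - 1.
  Write a_i for the values on \<open>ys\<close>. If a_{j+1} were the first negative one, the
  conditions of index j + 1 and j + 2 on \<open>y # ys\<close> would force y > 0 and a_{j+1}^2 <=
  a_j a_{j+2} with a positive right side, against Newton's inequality. The use of index j + 2
  explains \<open>i < k\<close>.\<close>

lemma elem_sym_tail_nonneg:
  assumes "\<forall>i\<le>k. elem_sym i (y # ys) \<ge> 0" "i < k"
  shows "elem_sym i ys \<ge> 0"
  using assms(2)
proof (induction i)
  case (Suc j)
  let ?a = "\<lambda>i. elem_sym i ys"
  show ?case
  proof (rule ccontr)
    assume "\<not> ?thesis"
    then have neg: "?a (Suc j) < 0" by simp
    have aj: "?a j \<ge> 0" using Suc by simp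
    have 1: "?a (Suc j) + y * ?a j \<ge> 0" using assms(1)[rule_format, of "Suc j"] Suc.prems by (simp add: elem_sym_Cons)
    have 2: "?a (Suc (Suc j)) + y * ?a (Suc j) \<ge> 0"
      using assms(1)[rule_format, of "Suc (Suc j)"] Suc.prems by (simp add: elem_sym_Cons)
    have yaj: "y * ?a j > 0" using 1 neg by linarith
    then have y: "y > 0" and ajp: "?a j > 0" using aj by (auto simp: zero_less_mult_iff)
    have "y * - ?a (Suc j) > 0" using y neg by (intro mult_pos_pos) auto
    then have a2: "?a (Suc (Suc j)) > 0" using 2 by simp
    have "(?a (Suc j))\<^sup>2 \<le> (- ?a (Suc j)) * (y * ?a j)"
      using mult_left_mono[of "- ?a (Suc j)" "y * ?a j" "- ?a (Suc j)"] 1 neg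
      by (simp add: power2_eq_square)
    also have "\<dots> = (- y * ?a (Suc j)) * ?a j" by simp
    also have "\<dots> \<le> ?a (Suc (Suc j)) * ?a j" using 2 ajp by (intro mult_right_mono) auto
    finally have "real (Suc j) * (?a (Suc j))\<^sup>2 \<le> real (Suc j) * (?a (Suc (Suc j)) * ?a j)"
      by (intro mult_left_mono) auto
    moreover have "?a (Suc (Suc j)) * ?a j > 0" using a2 ajp by simp
    ultimately show False using newton_inequality[of j ys] by linarith
  qed
qed simp

lemma elem_sym_remove_nonneg:
  assumes "\<forall>i\<le>k. elem_sym i xs \<ge> 0" "j < length xs" "i < k"
  shows "elem_sym i (take j xs @ drop (Suc j) xs) \<ge> 0"
proof -
  have "mset (xs ! j # (take j xs @ drop (Suc j) xs)) = mset xs"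
    by (metis Cons_nth_drop_Suc append_take_drop_id assms(2) mset.simps(2) mset_append
        union_mset_add_mset_right)
  then have "elem_sym i (xs ! j # (take j xs @ drop (Suc j) xs)) = elem_sym i xs" for i
    by (rule elem_sym_mset)
  then show ?thesis using elem_sym_tail_nonneg[OF _ assms(3), of "xs ! j"] assms(1) by simp
qed

section \<open>Symmetric matrices\<close>

definition orthonormal_list :: "'a::real_inner list \<Rightarrow> bool" where
  "orthonormal_list es \<longleftrightarrow>
     (\<forall>i<length es. \<forall>j<length es. es ! i \<bullet> es ! j = (if i = j then 1 else 0))"

definition orthonormal_basis :: "(real ^ 'n) list \<Rightarrow> bool" where
  "orthonormal_basis es \<longleftrightarrow> orthonormal_list es \<and> length es = CARD('n)"

lemma orthonormal_list_distinct: "orthonormal_list es \<Longrightarrow> distinct es"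
  unfolding orthonormal_list_def distinct_conv_nth by (metis zero_neq_one)

lemma orthonormal_basis_expansion:
  fixes es :: "(real ^ 'n) list"
  assumes "orthonormal_basis es"
  shows "(\<Sum>i<CARD('n). (es ! i \<bullet> v) *\<^sub>R es ! i) = v"
proof -
  have on: "orthonormal_list es" and len: "length es = CARD('n)"
    using assms by (auto simp: orthonormal_basis_def)
  have orth: "pairwise orthogonal (set es)"
    using on by (auto simp: pairwise_def orthogonal_def orthonormal_list_def in_set_conv_nth)
  have n1: "norm e = 1" if "e \<in> set es" for e
    using on that by (auto simp: orthonormal_list_def in_set_conv_nth norm_eq_1)
  have "independent (set es)"
    using orth n1 by (intro pairwise_orthogonal_independent) force+
  then have sp: "span (set es) = UNIV"
    using card_ge_dim_independent[of "set es" UNIV] distinct_card[OF orthonormal_list_distinct[OF on]] len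
    by (simp add: dim_UNIV top.extremum_unique)
  have "(\<Sum>e\<in>set es. (v \<bullet> e) *\<^sub>R e) = v"
    by (rule orthonormal_basis_expand) (use orth n1 sp in auto)
  moreover have "(\<Sum>e\<in>set es. (v \<bullet> e) *\<^sub>R e) = (\<Sum>i<CARD('n). (es ! i \<bullet> v) *\<^sub>R es ! i)"
    using bij_betw_nth[OF orthonormal_list_distinct[OF on] refl refl]
    by (subst sum.reindex_bij_betw[symmetric, where h="\<lambda>i. es ! i" and S="{..<CARD('n)}"])
       (auto simp: len inner_commute)
  ultimately show ?thesis by simp
qed

lemma orthonormal_basis_inner:
  fixes es :: "(real ^ 'n) list"
  assumes "orthonormal_basis es"
  shows "v \<bullet> w = (\<Sum>i<CARD('n). (es ! i \<bullet> v) * (es ! i \<bullet> w))"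
proof -
  have "v \<bullet> w = (\<Sum>i<CARD('n). (es ! i \<bullet> v) *\<^sub>R es ! i) \<bullet> w"
    using orthonormal_basis_expansion[OF assms, of v] by simp
  then show ?thesis by (simp add: inner_sum_left)
qed

text \<open>The spectral decomposition. Frame and eigenvalues are parallel lists, so that
  \<open>ls\<close> can be fed to \<open>elem_sym\<close> directly.\<close>

definition spec :: "(real ^ 'n) list \<Rightarrow> real list \<Rightarrow> real ^ 'n ^ 'n" where
  "spec es ls = (\<chi> a b. \<Sum>i<CARD('n). ls ! i * (es ! i) $ a * (es ! i) $ b)"

definition outer :: "real ^ 'n \<Rightarrow> real ^ 'n ^ 'n" where
  "outer f = (\<chi> a b. f $ a * f $ b)"

lemma outer_mult: "outer f *v v = (f \<bullet> v) *\<^sub>R f"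
  by (simp add: outer_def vec_eq_iff matrix_vector_mult_def inner_vec_def sum_distrib_right sum_distrib_left mult_ac)

lemma spec_mult: "spec es ls *v v = (\<Sum>i<CARD('n). (ls ! i * (es ! i \<bullet> v)) *\<^sub>R es ! i)"
  for es :: "(real ^ 'n) list"
proof -
  have "(\<Sum>b\<in>UNIV. (\<Sum>i<CARD('n). ls ! i * es ! i $ a * es ! i $ b) * v $ b)
     = (\<Sum>i<CARD('n). ls ! i * (es ! i \<bullet> v) * es ! i $ a)" for a
    unfolding sum_distrib_right inner_vec_def sum_distrib_left
    by (subst sum.swap) (simp add: mult_ac)
  then show ?thesis by (simp add: spec_def vec_eq_iff matrix_vector_mult_def)
qed

lemma spec_quadratic_form: "v \<bullet> (spec es ls *v v) = (\<Sum>i<CARD('n). ls ! i * (es ! i \<bullet> v)\<^sup>2)"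
  for es :: "(real ^ 'n) list"
  by (simp add: spec_mult inner_sum_right power2_eq_square inner_commute mult_ac)

lemma spec_symmetric: "transpose (spec es ls) = spec es ls"
  by (simp add: spec_def transpose_def vec_eq_iff mult_ac)

lemma spec_eigenvector:
  fixes es :: "(real ^ 'n) list"
  assumes "orthonormal_basis es" "j < CARD('n)"
  shows "spec es ls *v (es ! j) = ls ! j *\<^sub>R es ! j"
proof -
  have "(ls ! i * (es ! i \<bullet> es ! j)) *\<^sub>R es ! i = (if i = j then ls ! j *\<^sub>R es ! j else 0)" if "i < CARD('n)" for i
    using assms that by (auto simp: orthonormal_basis_def orthonormal_list_def)
  then show ?thesis using assms(2) by (simp add: spec_mult)
qed

lemma matrix_eq_on_basis:
  fixes A B :: "real ^ 'n ^ 'n"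
  assumes es: "orthonormal_basis es" and eq: "\<And>j. j < CARD('n) \<Longrightarrow> A *v (es ! j) = B *v (es ! j)"
  shows "A = B"
proof -
  have "M *v v = (\<Sum>i<CARD('n). (es ! i \<bullet> v) *\<^sub>R (M *v (es ! i)))" for M :: "real ^ 'n ^ 'n" and v
    by (subst orthonormal_basis_expansion[OF es, of v, symmetric])
       (simp only: linear_sum[OF matrix_vector_mul_linear] matrix_vector_mult_scaleR)
  note exp = this
  have "A *v v = B *v v" for v using exp[of A v] exp[of B v] eq by simp
  then show ?thesis by (simp add: matrix_eq)
qed

lemma spec_unique:
  fixes A :: "real ^ 'n ^ 'n"
  assumes "orthonormal_basis es" "\<And>j. j < CARD('n) \<Longrightarrow> A *v (es ! j) = ls ! j *\<^sub>R es ! j"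
  shows "A = spec es ls"
  by (rule matrix_eq_on_basis[OF assms(1)]) (simp add: assms spec_eigenvector)

lemma symmetric_inner:
  fixes A :: "real ^ 'n ^ 'n"
  assumes "transpose A = A"
  shows "v \<bullet> (A *v w) = (A *v v) \<bullet> w"
  by (metis assms dot_lmul_matrix vector_transpose_matrix)

text \<open>A maximiser of the quadratic form on the unit sphere of \<open>V\<close>, the orthogonal
  complement of the eigenvectors already found, is a further eigenvector.\<close>

lemma spectral_step:
  fixes A :: "real ^ 'n ^ 'n"
  assumes sym: "transpose A = A" and on: "orthonormal_list es"
    and eig: "\<forall>e\<in>set es. \<exists>l. A *v e = l *\<^sub>R e" and len: "length es < CARD('n)"
  shows "\<exists>e l. orthonormal_list (es @ [e]) \<and> A *v e = l *\<^sub>R e"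
proof -
  define V where "V = {v. \<forall>e\<in>set es. e \<bullet> v = 0}"
  have sub: "subspace V" unfolding V_def by (auto simp: subspace_def inner_add_right)
  have "dim (span (set es)) < DIM(real ^ 'n)"
    using len dim_le_card[of "set es" "set es"] card_length[of es] by (simp add: span_superset)
  then obtain x where x: "x \<noteq> 0" "\<And>y. y \<in> span (set es) \<Longrightarrow> orthogonal x y"
    using orthogonal_to_subspace_exists by (metis dim_span)
  then have "x \<in> V" by (auto simp: V_def orthogonal_def inner_commute span_base)
  then have ne: "x /\<^sub>R norm x \<in> V \<inter> sphere 0 1"
    using x subspace_scale[OF sub] by auto
  have comp: "compact (V \<inter> sphere 0 1)"
    using closed_subspace[OF sub] by (intro closed_Int_compact) auto
  have cont: "continuous_on (V \<inter> sphere 0 1) (\<lambda>v. v \<bullet> (A *v v))"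
    by (intro continuous_intros matrix_vector_mult_linear_continuous_on)
  obtain v where v: "v \<in> V" "norm v = 1" and
    max: "\<And>y. y \<in> V \<Longrightarrow> norm y = 1 \<Longrightarrow> y \<bullet> (A *v y) \<le> v \<bullet> (A *v v)"
    using continuous_attains_sup[OF comp _ cont] ne by (metis IntE IntI empty_iff mem_sphere_0)
  define m where "m = v \<bullet> (A *v v)"
  have hom: "y \<bullet> (A *v y) \<le> m * (norm y)\<^sup>2" if "y \<in> V" for y
  proof (cases "y = 0")
    case False
    let ?z = "y /\<^sub>R norm y"
    have "?z \<bullet> (A *v ?z) \<le> m" unfolding m_def
      by (rule max) (use that False subspace_scale[OF sub] in auto)
    moreover have "?z \<bullet> (A *v ?z) = (y \<bullet> (A *v y)) / (norm y)\<^sup>2"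
      by (simp add: matrix_vector_mult_scaleR power2_eq_square divide_inverse)
    ultimately show ?thesis using False by (simp add: pos_divide_le_eq)
  qed simp
  \<comment> \<open>First variation at the maximum in the directions of \<open>V\<close> orthogonal
    to \<open>v\<close>.\<close>
  have crit: "w \<bullet> (A *v v) = 0" if w: "w \<in> V" "w \<bullet> v = 0" for w
  proof (rule ccontr)
    define a where "a = w \<bullet> (A *v v)"
    \<comment> \<open>\<open>c\<close> dominates the second-order coefficient, so that for t = a / c
      the first-order gain 2 t a beats t^2 c.\<close>
    define c where "c = \<bar>m * (norm w)\<^sup>2 - w \<bullet> (A *v w)\<bar> + 1"
    assume "w \<bullet> (A *v v) \<noteq> 0"
    then have a: "a \<noteq> 0" by (simp add: a_def)
    have c: "c > 0" by (simp add: c_def)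
    define t where "t = a / c"
    have "(v + t *\<^sub>R w) \<bullet> (A *v (v + t *\<^sub>R w)) \<le> m * (norm (v + t *\<^sub>R w))\<^sup>2"
      using w v sub by (intro hom) (auto simp: subspace_add subspace_scale)
    moreover have "(v + t *\<^sub>R w) \<bullet> (A *v (v + t *\<^sub>R w)) = m + 2 * t * a + t\<^sup>2 * (w \<bullet> (A *v w))"
      using symmetric_inner[OF sym, of v w]
      by (simp add: matrix_vector_mult_scaleR matrix_vector_right_distrib inner_add_left inner_add_right
          m_def a_def power2_eq_square inner_commute algebra_simps)
    moreover have "(norm (v + t *\<^sub>R w))\<^sup>2 = 1 + t\<^sup>2 * (norm w)\<^sup>2"
      using v w unfolding power2_norm_eq_inner
      by (simp add: inner_add_left inner_add_right norm_eq_1 inner_commute power2_eq_square)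
    ultimately have "2 * t * a \<le> t\<^sup>2 * (m * (norm w)\<^sup>2 - w \<bullet> (A *v w))" by (simp add: algebra_simps)
    also have "\<dots> \<le> t\<^sup>2 * c" unfolding c_def by (intro mult_left_mono) auto
    finally have "2 * (a\<^sup>2 / c) \<le> a\<^sup>2 / c" using c by (simp add: t_def power2_eq_square field_simps)
    moreover have "a\<^sup>2 / c > 0" using a c by simp
    ultimately show False by simp
  qed
  have AV: "A *v v \<in> V"
    unfolding V_def
  proof safe
    fix e assume e: "e \<in> set es"
    then obtain l where "A *v e = l *\<^sub>R e" using eig by auto
    then show "e \<bullet> (A *v v) = 0" using v e by (simp add: symmetric_inner[OF sym] V_def)
  qed
  \<comment> \<open>The residual lies in \<open>V\<close> and is orthogonal to \<open>v\<close>, so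
    \<open>crit\<close> applies to the residual itself and makes its norm vanish.\<close>
  define w where "w = A *v v - m *\<^sub>R v"
  have wV: "w \<in> V" using AV v sub by (auto simp: w_def subspace_diff subspace_scale)
  have vv: "v \<bullet> v = 1" using v by (simp add: norm_eq_1)
  have wv: "w \<bullet> v = 0" by (simp only: w_def m_def inner_diff_left inner_scaleR_left inner_commute[of "A *v v" v] vv mult_1_right diff_self)
  have "w \<bullet> w = w \<bullet> (A *v v) - m * (w \<bullet> v)" by (subst (2) w_def) (simp add: inner_diff_right)
  then have "w = 0" using crit[OF wV wv] wv by simp
  then have "A *v v = m *\<^sub>R v" by (simp add: w_def)
  moreover have "orthonormal_list (es @ [v])"
    using on v(1) vv unfolding orthonormal_list_def V_def
    by (auto simp: nth_append less_Suc_eq inner_commute)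
  ultimately show ?thesis by blast
qed

text \<open>Started from \<open>[]\<close> this gives the spectral theorem; started from a
  prescribed eigenvector, such as the unit normal of the boundary, it completes that vector to an
  eigenbasis.\<close>

lemma spectral_extend:
  fixes A :: "real ^ 'n ^ 'n"
  assumes sym: "transpose A = A" and on: "orthonormal_list es" and len: "length es \<le> CARD('n)"
    and eig: "\<forall>e\<in>set es. \<exists>l. A *v e = l *\<^sub>R e" 
  shows "\<exists>fs. orthonormal_basis (es @ fs) \<and> (\<forall>e\<in>set fs. \<exists>l. A *v e = l *\<^sub>R e)"
  using on len eig
proof (induction "CARD('n) - length es" arbitrary: es)
  case 0
  then show ?case by (intro exI[of _ "[]"]) (auto simp: orthonormal_basis_def)
next
  case (Suc m)
  then obtain e l where e: "orthonormal_list (es @ [e])" "A *v e = l *\<^sub>R e"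
    using spectral_step[OF sym, of es] by (metis diff_is_0_eq' linorder_not_less nat.simps(3))
  have "\<exists>fs. orthonormal_basis ((es @ [e]) @ fs) \<and> (\<forall>e\<in>set fs. \<exists>l. A *v e = l *\<^sub>R e)"
    using Suc e by (intro Suc(1)) auto
  then obtain fs where "orthonormal_basis (es @ e # fs)" "\<forall>e\<in>set fs. \<exists>l. A *v e = l *\<^sub>R e" by auto
  then show ?case using e by (intro exI[of _ "e # fs"]) auto
qed

lemma spectral_theorem:
  fixes A :: "real ^ 'n ^ 'n"
  assumes sym: "transpose A = A"
  obtains es ls where "orthonormal_basis es" "length ls = CARD('n)" "A = spec es ls"
proof -
  obtain es where es: "orthonormal_basis es" "\<forall>e\<in>set es. \<exists>l. A *v e = l *\<^sub>R e"
    using spectral_extend[OF sym, of "[]"] by (auto simp: orthonormal_list_def)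
  define ls where "ls = map (\<lambda>e. SOME l. A *v e = l *\<^sub>R e) es"
  have len: "length es = CARD('n)" using es(1) by (simp add: orthonormal_basis_def)
  have "A *v (es ! j) = ls ! j *\<^sub>R es ! j" if "j < CARD('n)" for j
    using es(2) that someI_ex[of "\<lambda>l. A *v (es ! j) = l *\<^sub>R es ! j"] by (simp add: ls_def len)
  then have "A = spec es ls" by (rule spec_unique[OF es(1)])
  moreover have "length ls = CARD('n)" by (simp add: ls_def len)
  ultimately show ?thesis using that es(1) by blast
qed

lemma det_spec:
  fixes es :: "(real ^ 'n) list"
  assumes "orthonormal_basis es"
  shows "det (spec es ls) = (\<Prod>i<CARD('n). ls ! i)"
proof -
  \<comment> \<open>Lists are indexed by numbers, matrices by the type \<open>'n\<close>;
    \<open>g\<close> translates between the two.\<close>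
  obtain g :: "'n \<Rightarrow> nat" where g: "bij_betw g UNIV {..<CARD('n)}"
    by (metis atLeast0LessThan ex_bij_betw_finite_nat finite)
  have gl: "g j < CARD('n)" for j using g by (auto simp: bij_betw_def)
  have gi: "g i = g j \<longleftrightarrow> i = j" for i j using g by (auto simp: bij_betw_def inj_on_def)
  define E :: "real ^ 'n ^ 'n" where "E = (\<chi> a j. es ! g j $ a)"
  define L :: "real ^ 'n ^ 'n" where "L = (\<chi> i j. if i = j then ls ! g i else 0)"
  have EE: "transpose E ** E = mat 1"
  proof -
    have "(\<Sum>k\<in>UNIV. es ! g i $ k * es ! g j $ k) = (if i = j then 1 else 0)" for i j
      using assms gl[of i] gl[of j] gi[of i j]
      by (auto simp: orthonormal_basis_def orthonormal_list_def inner_vec_def)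
    then show ?thesis by (simp add: vec_eq_iff matrix_matrix_mult_def transpose_def E_def mat_def)
  qed
  have "spec es ls = E ** (L ** transpose E)"
  proof -
    have "(L ** transpose E) $ j $ b = ls ! g j * es ! g j $ b" for j b
      by (simp add: matrix_matrix_mult_def L_def transpose_def E_def if_distrib[of "\<lambda>x. x * _"] cong: if_cong)
    then have "(E ** (L ** transpose E)) $ a $ b = (\<Sum>j\<in>UNIV. ls ! g j * es ! g j $ a * es ! g j $ b)" for a b
      by (subst matrix_matrix_mult_def) (simp add: E_def mult_ac)
    then show ?thesis
      unfolding spec_def by (simp add: vec_eq_iff sum.reindex_bij_betw[OF g, where g="\<lambda>i. ls ! i * es ! i $ _ * es ! i $ _"])
  qed
  then have "det (spec es ls) = det L * (det (transpose E) * det E)" by (simp add: det_mul)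
  also have "det (transpose E) * det E = 1" using EE by (metis det_I det_mul)
  also have "det L = (\<Prod>j\<in>UNIV. ls ! g j)" by (subst det_diagonal) (auto simp: L_def)
  also have "\<dots> = (\<Prod>i<CARD('n). ls ! i)" by (rule prod.reindex_bij_betw[OF g])
  finally show ?thesis by simp
qed

lemma spec_affine:
  fixes es :: "(real ^ 'n) list"
  assumes "orthonormal_basis es" "length ls = CARD('n)"
  shows "mat z + x *\<^sub>R spec es ls = spec es (map (\<lambda>l. z + x * l) ls)"
proof (rule spec_unique[OF assms(1)])
  fix j assume j: "j < CARD('n)"
  have "mat z *v (es ! j) = z *\<^sub>R es ! j"
    by (simp add: vec_eq_iff matrix_vector_mult_def mat_def if_distrib[of "\<lambda>x. x * _"] cong: if_cong)
  then show "(mat z + x *\<^sub>R spec es ls) *v (es ! j) = map (\<lambda>l. z + x * l) ls ! j *\<^sub>R es ! j"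
    using j assms by (simp add: matrix_vector_mult_add_rdistrib scaleR_matrix_vector_assoc[symmetric]
        spec_eigenvector scaleR_add_left)
qed

lemma prod_lessThan_list: "(\<Prod>i<length ls. h (ls ! i)) = (\<Prod>l\<leftarrow>ls. h l)"
  for h :: "'a \<Rightarrow> 'b::comm_monoid_mult"
  by (induction ls rule: rev_induct) (simp_all add: nth_append mult.commute)

lemma det_spec_affine:
  fixes es :: "(real ^ 'n) list"
  assumes "orthonormal_basis es" "length ls = CARD('n)"
  shows "det (mat z + x *\<^sub>R spec es ls) = (\<Prod>l\<leftarrow>ls. z + x * l)"
  using assms prod_lessThan_list[of "\<lambda>l. z + x * l" ls] by (simp add: spec_affine det_spec)

lemma poly_det:
  fixes M :: "real poly ^ 'n ^ 'n"
  shows "poly (det M) x = det (\<chi> i j. poly (M $ i $ j) x)"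
  by (simp add: det_def poly_sum poly_prod)

lemma poly_prod_list_map: "poly (\<Prod>l\<leftarrow>ls. h l) x = (\<Prod>l\<leftarrow>ls. poly (h l) x)"
  by (induction ls) simp_all

lemma charpoly_spec:
  fixes es :: "(real ^ 'n) list"
  assumes "orthonormal_basis es" "length ls = CARD('n)"
  shows "charpoly (spec es ls) = (\<Prod>l\<leftarrow>ls. [:- l, 1:])"
proof (rule poly_eq_poly_eq_iff[THEN iffD1], rule ext)
  fix x
  have "(\<chi> i j. poly ((\<chi> i j. (if i = j then [:0, 1:] else 0) - [:spec es ls $ i $ j:]) $ i $ j) x)
      = mat x + (-1) *\<^sub>R spec es ls"
    by (simp add: vec_eq_iff mat_def)
  then show "poly (charpoly (spec es ls)) x = poly (\<Prod>l\<leftarrow>ls. [:- l, 1:]) x"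
    unfolding charpoly_def poly_det
    by (simp only: det_spec_affine[OF assms]) (simp add: poly_prod_list_map)
qed

lemma mset_eigenvalues_spec:
  fixes es :: "(real ^ 'n) list"
  assumes "orthonormal_basis es" "length ls = CARD('n)"
  shows "mset (eigenvalues (spec es ls)) = mset ls"
proof -
  have "proots (\<Prod>l\<leftarrow>ls. [:- l, 1:]) = mset ls" for ls :: "real list"
  proof (induction ls)
    case (Cons l ls)
    have "(\<Prod>l\<leftarrow>ls. [:- l, 1:]) \<noteq> 0" by (auto simp: prod_list_zero_iff)
    then show ?case using Cons by (simp only: list.map prod_list.Cons proots_mult[of "[:- l, 1:]"] pCons_eq_0_iff one_neq_zero simp_thms proots_linear_factor) simp
  qed simp
  then show ?thesis unfolding eigenvalues_def charpoly_spec[OF assms] by simp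
qed

lemma elem_sym_eigenvalues_spec:
  fixes es :: "(real ^ 'n) list"
  assumes "orthonormal_basis es" "length ls = CARD('n)"
  shows "elem_sym k (eigenvalues (spec es ls)) = elem_sym k ls"
  using mset_eigenvalues_spec[OF assms] by (rule elem_sym_mset)

text \<open>The sorted list of eigenvalues is not visibly continuous in the matrix, but the
  coefficients of det (1 + t A) are polynomials in the entries. This gives the continuity of the
  curvature functions along the boundary.\<close>

lemma coeff_det_elem_sym:
  fixes A :: "real ^ 'n ^ 'n"
  assumes "transpose A = A"
  shows "elem_sym k (eigenvalues A) = coeff (det (\<chi> i j. [:if i = j then 1 else 0, A $ i $ j:])) k"
proof -
  obtain es ls where es: "orthonormal_basis es" "length ls = CARD('n)" "A = spec es ls"
    using spectral_theorem[OF assms] .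
  have "det (\<chi> i j. [:if i = j then 1 else 0, A $ i $ j:]) = (\<Prod>l\<leftarrow>ls. [:1, l:])"
  proof (rule poly_eq_poly_eq_iff[THEN iffD1], rule ext)
    fix x
    have "(\<chi> i j. poly ((\<chi> i j. [:if i = j then 1 else 0, A $ i $ j:]) $ i $ j) x) = mat 1 + x *\<^sub>R A"
      by (simp add: vec_eq_iff mat_def)
    then show "poly (det (\<chi> i j. [:if i = j then 1 else 0, A $ i $ j:])) x = poly (\<Prod>l\<leftarrow>ls. [:1, l:]) x"
      unfolding poly_det by (simp add: es det_spec_affine poly_prod_list_map)
  qed
  then show ?thesis using es by (simp only: elem_sym_eigenvalues_spec) (simp only: elem_sym_eq_coeff)
qed

lemma continuous_on_coeff_prod:
  fixes p :: "'a::topological_space \<Rightarrow> 'b \<Rightarrow> real poly"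
  assumes "\<And>i k. i \<in> I \<Longrightarrow> continuous_on S (\<lambda>y. coeff (p y i) k)"
  shows "continuous_on S (\<lambda>y. coeff (\<Prod>i\<in>I. p y i) k)"
  using assms
proof (induction I arbitrary: k rule: infinite_finite_induct)
  case (insert i I)
  then show ?case by (simp add: coeff_mult) (intro continuous_intros, auto)
qed simp_all

lemma continuous_on_elem_sym_eigenvalues:
  fixes A :: "'a::topological_space \<Rightarrow> real ^ 'n ^ 'n"
  assumes cont: "continuous_on S A" and sym: "\<And>y. y \<in> S \<Longrightarrow> transpose (A y) = A y"
  shows "continuous_on S (\<lambda>y. elem_sym k (eigenvalues (A y)))"
proof -
  have e: "continuous_on S (\<lambda>y. A y $ i $ j)" for i j
    by (intro continuous_intros cont)
  have "continuous_on S (\<lambda>y. coeff (\<Prod>i\<in>UNIV. [:if i = p i then 1 else 0, A y $ i $ p i:]) k)" for p k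
  proof (rule continuous_on_coeff_prod)
    fix i :: 'n and k
    consider "k = 0" | "k = 1" | m where "k = Suc (Suc m)" by (metis One_nat_def not0_implies_Suc)
    then show "continuous_on S (\<lambda>y. coeff [:if i = p i then 1 else 0, A y $ i $ p i:] k)"
      by cases (auto simp: e)
  qed
  then have "continuous_on S (\<lambda>y. coeff (det (\<chi> i j. [:if i = j then 1 else 0, A y $ i $ j:])) k)"
    unfolding det_def coeff_sum
    by (auto simp: sign_def intro!: continuous_intros)
  then show ?thesis
    by (rule continuous_on_eq) (simp add: coeff_det_elem_sym sym)
qed

section \<open>Rank-one perturbations and monotonicity on the Garding cone\<close>

lemma det_mat1_plus_outer: "det (mat 1 + outer g) = 1 + g \<bullet> g"
  for g :: "real ^ 'n"
proof (cases "g = 0")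
  case True
  then have "outer g = 0" by (simp add: outer_def vec_eq_iff)
  then show ?thesis by (simp add: True)
next
  case False
  let ?A = "mat 1 + outer g"
  let ?e = "g /\<^sub>R norm g"
  have A: "?A *v v = v + (g \<bullet> v) *\<^sub>R g" for v
    by (simp add: matrix_vector_mult_add_rdistrib outer_mult)
  \<comment> \<open>The normalised \<open>g\<close> has eigenvalue 1 + |g|^2; every other vector of
    a completing orthonormal frame is orthogonal to \<open>g\<close>, hence fixed.\<close>
  have Ae: "?A *v ?e = (1 + g \<bullet> g) *\<^sub>R ?e"
    using False by (simp add: A scaleR_add_left distrib_right distrib_left inverse_eq_divide add_divide_distrib dot_square_norm power2_eq_square)
  have sym: "transpose ?A = ?A"
    by (simp add: transpose_def outer_def vec_eq_iff mat_def mult_ac)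
  have on: "orthonormal_list [?e]" using False by (simp add: orthonormal_list_def dot_square_norm power2_eq_square)
  have "\<exists>fs. orthonormal_basis ([?e] @ fs) \<and> (\<forall>e\<in>set fs. \<exists>l. ?A *v e = l *\<^sub>R e)"
    by (rule spectral_extend[OF sym on]) (use Ae in \<open>auto simp: Suc_le_eq\<close>)
  then obtain fs where fs: "orthonormal_basis (?e # fs)" by auto
  then have len: "length fs = CARD('n) - 1" by (auto simp: orthonormal_basis_def)
  define ls where "ls = (1 + g \<bullet> g) # replicate (CARD('n) - 1) 1"
  have "?A = spec (?e # fs) ls"
  proof (rule spec_unique[OF fs])
    fix j assume j: "j < CARD('n)"
    show "?A *v (?e # fs) ! j = ls ! j *\<^sub>R (?e # fs) ! j"
    proof (cases j)
      case 0
      then show ?thesis by (simp add: ls_def Ae)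
    next
      case (Suc i)
      have "(?e # fs) ! 0 \<bullet> (?e # fs) ! j = 0"
        using fs j Suc unfolding orthonormal_basis_def orthonormal_list_def by (metis nat.simps(3) zero_less_card_finite)
      then have "g \<bullet> (?e # fs) ! j = 0" using False by simp
      then show ?thesis using Suc j by (simp add: A ls_def)
    qed
  qed
  then have "det ?A = (\<Prod>i<CARD('n). ls ! i)" using det_spec[OF fs] by simp
  also have "\<dots> = prod_list ls"
    using prod_lessThan_list[of "\<lambda>x. x" ls] by (simp add: ls_def)
  finally show ?thesis by (simp add: ls_def)
qed

text \<open>With R the positive square root of the spectral matrix and R g = f, the sum factors as R
  (1 + g g^T) R. Positivity of \<open>ls\<close> makes R invertible, so that such a g
  exists.\<close>

lemma det_spec_plus_outer:
  fixes es :: "(real ^ 'n) list"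
  assumes es: "orthonormal_basis es" and len: "length ls = CARD('n)" and pos: "\<forall>l\<in>set ls. l > 0"
  shows "det (spec es ls + outer f) = (\<Prod>i<CARD('n). ls ! i) * (1 + (\<Sum>i<CARD('n). (es ! i \<bullet> f)\<^sup>2 / ls ! i))"
proof -
  let ?R = "spec es (map sqrt ls)"
  define g where "g = (\<Sum>i<CARD('n). ((es ! i \<bullet> f) / sqrt (ls ! i)) *\<^sub>R es ! i)"
  have lp: "ls ! i > 0" if "i < CARD('n)" for i using pos len that by auto
  have eg: "es ! j \<bullet> g = (es ! j \<bullet> f) / sqrt (ls ! j)" if "j < CARD('n)" for j
  proof -
    have "(es ! i \<bullet> f / sqrt (ls ! i)) * (es ! j \<bullet> es ! i) = (if i = j then es ! j \<bullet> f / sqrt (ls ! j) else 0)"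
      if "i < CARD('n)" for i
      using es that \<open>j < CARD('n)\<close> by (auto simp: orthonormal_basis_def orthonormal_list_def)
    then show ?thesis using that by (simp add: g_def inner_sum_right)
  qed
  have Rg: "?R *v g = f"
  proof -
    have "?R *v g = (\<Sum>i<CARD('n). (es ! i \<bullet> f) *\<^sub>R es ! i)"
      unfolding spec_mult using len by (intro sum.cong) (auto simp: eg dest: lp)
    then show ?thesis using orthonormal_basis_expansion[OF es] by simp
  qed
  have "spec es ls + outer f = ?R ** ((mat 1 + outer g) ** ?R)"
  proof (rule matrix_eq_on_basis[OF es])
    fix j assume j: "j < CARD('n)"
    have "(?R ** ((mat 1 + outer g) ** ?R)) *v (es ! j) = ls ! j *\<^sub>R es ! j + (g \<bullet> (sqrt (ls ! j) *\<^sub>R es ! j)) *\<^sub>R f"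
      using j len lp[OF j] Rg
      by (simp add: matrix_vector_mul_assoc[symmetric] spec_eigenvector[OF es] matrix_vector_mult_add_rdistrib
          matrix_vector_mult_scaleR matrix_vector_right_distrib outer_mult scaleR_add_right less_imp_le)
    also have "g \<bullet> (sqrt (ls ! j) *\<^sub>R es ! j) = f \<bullet> es ! j"
      using eg[OF j] lp[OF j] by (simp add: inner_commute)
    finally show "(spec es ls + outer f) *v es ! j = (?R ** ((mat 1 + outer g) ** ?R)) *v es ! j"
      using j by (simp add: spec_eigenvector[OF es] matrix_vector_mult_add_rdistrib outer_mult inner_commute)
  qed
  then have "det (spec es ls + outer f) = (det ?R * det ?R) * (1 + g \<bullet> g)"
    by (simp add: det_mul det_mat1_plus_outer)
  also have "det ?R * det ?R = (\<Prod>i<CARD('n). ls ! i)"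
    unfolding det_spec[OF es] prod.distrib[symmetric] using len lp by (intro prod.cong) (auto simp: abs_of_pos)
  also have "g \<bullet> g = (\<Sum>i<CARD('n). (es ! i \<bullet> f)\<^sup>2 / ls ! i)"
    unfolding orthonormal_basis_inner[OF es, of g g]
    by (intro sum.cong) (auto simp: eg power2_eq_square less_imp_le lp)
  finally show ?thesis .
qed

lemma prod_list_remove_nth:
  fixes xs :: "'a::comm_monoid_mult list"
  assumes "i < length xs"
  shows "prod_list xs = xs ! i * prod_list (take i xs @ drop (Suc i) xs)"
proof -
  have "prod_list xs = prod_list (take i xs @ xs ! i # drop (Suc i) xs)"
    using assms by (simp add: id_take_nth_drop[symmetric])
  then show ?thesis by (simp add: mult_ac)
qed

text \<open>Both sides are coefficients of polynomials in x. For small positive x the matrix 1 + x A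
  is positive definite and the determinant formula applies to the vector sqrt x f; agreement on an
  interval gives equality of the coefficients, although A itself may be indefinite.\<close>

lemma elem_sym_rank_one:
  fixes es :: "(real ^ 'n) list"
  assumes es: "orthonormal_basis es" and len: "length ls = CARD('n)"
  shows "elem_sym (Suc k) (eigenvalues (spec es ls + outer f)) = elem_sym (Suc k) ls
     + (\<Sum>i<CARD('n). (es ! i \<bullet> f)\<^sup>2 * elem_sym k (take i ls @ drop (Suc i) ls))"
proof -
  let ?B = "spec es ls + outer f"
  let ?rm = "\<lambda>i. take i ls @ drop (Suc i) ls"
  have "transpose ?B = ?B"
    using spec_symmetric[of es ls] by (simp add: transpose_def outer_def vec_eq_iff mult_ac)
  then obtain fs ms where fs: "orthonormal_basis fs" "length ms = CARD('n)" "?B = spec fs ms"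
    using spectral_theorem by blast
  define P where "P = (\<Prod>l\<leftarrow>ms. [:1, l:])"
  define Q where "Q = (\<Prod>l\<leftarrow>ls. [:1, l:]) + pCons 0 (\<Sum>i<CARD('n). smult ((es ! i \<bullet> f)\<^sup>2) (\<Prod>l\<leftarrow>?rm i. [:1, l:]))"
  have PQ: "poly P x = poly Q x" if x: "x > 0" "\<forall>l\<in>set ls. 1 + x * l > 0" for x
  proof -
    have lp: "1 + x * ls ! i > 0" if "i < CARD('n)" for i using x(2) len that by auto
    have "poly P x = det (mat 1 + x *\<^sub>R ?B)"
      unfolding fs(3) using fs by (simp add: det_spec_affine P_def poly_prod_list_map)
    also have "mat 1 + x *\<^sub>R ?B = spec es (map (\<lambda>l. 1 + x * l) ls) + outer (sqrt x *\<^sub>R f)"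
      unfolding spec_affine[OF es len, symmetric] using x by (simp add: vec_eq_iff outer_def algebra_simps)
    also have "det \<dots> = (\<Prod>i<CARD('n). 1 + x * ls ! i) * (1 + (\<Sum>i<CARD('n). x * (es ! i \<bullet> f)\<^sup>2 / (1 + x * ls ! i)))"
      using x len by (subst det_spec_plus_outer[OF es]) (auto simp: power_mult_distrib)
    also have "\<dots> = (\<Prod>l\<leftarrow>ls. 1 + x * l) + x * (\<Sum>i<CARD('n). (es ! i \<bullet> f)\<^sup>2 * (\<Prod>l\<leftarrow>?rm i. 1 + x * l))"
    proof -
      have 1: "(\<Prod>l\<leftarrow>ls. 1 + x * l) = (1 + x * ls ! i) * (\<Prod>l\<leftarrow>?rm i. 1 + x * l)" if "i < CARD('n)" for i
        using prod_list_remove_nth[of i "map (\<lambda>l. 1 + x * l) ls"] that len by (simp add: take_map drop_map)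
      have "(\<Prod>l\<leftarrow>ls. 1 + x * l) * (x * (es ! i \<bullet> f)\<^sup>2 / (1 + x * ls ! i)) = x * ((es ! i \<bullet> f)\<^sup>2 * (\<Prod>l\<leftarrow>?rm i. 1 + x * l))"
        if "i < CARD('n)" for i
        using lp[OF that] unfolding 1[OF that] by (simp add: field_simps)
      then show ?thesis
        using prod_lessThan_list[of "\<lambda>l. 1 + x * l" ls]
        by (simp add: len distrib_left sum_distrib_left)
    qed
    also have "\<dots> = poly Q x"
      by (simp add: Q_def poly_prod_list_map poly_sum)
    finally show ?thesis .
  qed
  \<comment> \<open>\<open>m\<close> exceeds every |l|, so 1 + x l > 0 on the whole interval 0 < x <
    1 / m.\<close>
  define m where "m = 1 + (\<Sum>l\<leftarrow>ls. \<bar>l\<bar>)"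
  have m1: "m \<ge> 1" unfolding m_def by (simp add: order_trans[OF abs_ge_zero sum_list_abs])
  have lm: "\<bar>l\<bar> < m" if "l \<in> set ls" for l
  proof -
    have "\<bar>l\<bar> \<le> (\<Sum>l\<leftarrow>ls. \<bar>l\<bar>)"
      using that
    proof (induction ls)
      case (Cons a ls)
      have "0 \<le> (\<Sum>l\<leftarrow>ls. \<bar>l\<bar>)" by (rule sum_list_nonneg) auto
      then show ?case using Cons by auto
    qed simp
    then show ?thesis by (simp add: m_def)
  qed
  have "{0<..<1/m} \<subseteq> {x. poly (P - Q) x = 0}"
  proof
    fix x assume x: "x \<in> {0<..<1/m}"
    have "1 + x * l > 0" if "l \<in> set ls" for l
    proof -
      have "\<bar>x * l\<bar> \<le> x * m" unfolding abs_mult using x lm[OF that] by (intro mult_mono) auto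
      also have "\<dots> < 1" using x m1 by (simp add: field_simps)
      finally show ?thesis by linarith
    qed
    then show "x \<in> {x. poly (P - Q) x = 0}" using PQ[of x] x by auto
  qed
  moreover have "infinite {0<..<1/m}" using m1 by (intro infinite_Ioo) auto
  ultimately have "P = Q"
    by (metis eq_iff_diff_eq_0 finite_subset poly_roots_finite)
  then have "coeff P (Suc k) = coeff Q (Suc k)" by simp
  then show ?thesis
    unfolding fs(3) elem_sym_eigenvalues_spec[OF fs(1,2)]
    by (simp add: elem_sym_eq_coeff P_def Q_def coeff_sum)
qed

text \<open>The coefficients in the rank-one formula are symmetric functions of the eigenvalues with
  one removed, nonnegative by the deletion property of the cone. All orders up to k grow together,
  so the perturbed matrix is again in the cone and the step can be repeated.\<close>

lemma elem_sym_rank_one_mono: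
  fixes A :: "real ^ 'n ^ 'n"
  assumes sym: "transpose A = A" and cone: "\<forall>i\<le>k. elem_sym i (eigenvalues A) \<ge> 0" and "i \<le> k"
  shows "elem_sym i (eigenvalues A) \<le> elem_sym i (eigenvalues (A + outer f))"
proof (cases i)
  case (Suc j)
  obtain es ls where es: "orthonormal_basis es" "length ls = CARD('n)" "A = spec es ls"
    using spectral_theorem[OF sym] .
  have "\<forall>i\<le>k. elem_sym i ls \<ge> 0" using cone es by (simp add: elem_sym_eigenvalues_spec)
  then have "elem_sym j (take i ls @ drop (Suc i) ls) \<ge> 0" if "i < CARD('n)" for i
    using elem_sym_remove_nonneg[of k ls i j] that es Suc assms(3) by auto
  then show ?thesis unfolding es(3) Suc elem_sym_rank_one[OF es(1,2)]
    using es by (auto simp: elem_sym_eigenvalues_spec intro!: sum_nonneg)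
qed simp

text \<open>B - A is a sum of rank-one matrices, added one after another. The cone condition on the
  smaller matrix suffices: along the way no S_i with i <= k falls below its value at A.\<close>

lemma elem_sym_eigenvalues_mono:
  fixes A B :: "real ^ 'n ^ 'n"
  assumes symA: "transpose A = A" and symB: "transpose B = B"
    and le: "\<And>v. v \<bullet> (A *v v) \<le> v \<bullet> (B *v v)"
    and cone: "\<forall>i\<le>k. elem_sym i (eigenvalues A) \<ge> 0"
  shows "elem_sym k (eigenvalues A) \<le> elem_sym k (eigenvalues B)"
proof -
  have "transpose (B - A) = B - A" using symA symB by (simp add: transpose_def vec_eq_iff)
  then obtain es ls where es: "orthonormal_basis es" "length ls = CARD('n)" "B - A = spec es ls"
    using spectral_theorem by blast
  have lp: "ls ! i \<ge> 0" if "i < CARD('n)" for i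
  proof -
    have "es ! i \<bullet> ((B - A) *v (es ! i)) = ls ! i"
      unfolding es(3) spec_eigenvector[OF es(1) that]
      using es(1) that by (simp add: orthonormal_basis_def orthonormal_list_def)
    then show ?thesis using le[of "es ! i"] by (simp add: matrix_vector_mult_diff_rdistrib inner_diff_right)
  qed
  define M where "M m = A + (\<Sum>i<m. outer (sqrt (ls ! i) *\<^sub>R es ! i))" for m
  have MB: "M CARD('n) = B"
  proof -
    have "spec es ls = (\<Sum>i<CARD('n). outer (sqrt (ls ! i) *\<^sub>R es ! i))"
      using lp by (auto simp: spec_def outer_def vec_eq_iff algebra_simps intro!: sum.cong)
    then show ?thesis using es(3) by (simp add: M_def algebra_simps)
  qed
  have "transpose (M m) = M m \<and> (\<forall>i\<le>k. elem_sym i (eigenvalues A) \<le> elem_sym i (eigenvalues (M m)))" for m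
  proof (induction m)
    case (Suc m)
    have s: "M (Suc m) = M m + outer (sqrt (ls ! m) *\<^sub>R es ! m)" by (simp add: M_def add.assoc)
    have "transpose (M (Suc m)) = M (Suc m)"
      using Suc unfolding s by (simp add: transpose_def vec_eq_iff outer_def mult_ac)
    moreover have "elem_sym i (eigenvalues A) \<le> elem_sym i (eigenvalues (M (Suc m)))" if "i \<le> k" for i
    proof -
      have "elem_sym i (eigenvalues (M m)) \<le> elem_sym i (eigenvalues (M (Suc m)))"
        unfolding s using Suc cone that by (intro elem_sym_rank_one_mono[where k=k]) (auto intro: order_trans)
      then show ?thesis using Suc that by (meson order_trans)
    qed
    ultimately show ?case by blast
  qed (simp add: M_def symA)
  from this[of "CARD('n)"] show ?thesis unfolding MB by simp
qed

section \<open>Second-order calculus\<close>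

lemma isCont_tendsto_nhds: "isCont g a \<Longrightarrow> (g \<longlongrightarrow> g a) (nhds a)"
  by (simp add: continuous_at tendsto_at_iff_tendsto_nhds)

text \<open>If \<open>g2\<close> were positive, the first derivative, zero at 0, would be positive
  just to the right, and the mean value theorem would put g above its maximum.\<close>

lemma second_derivative_nonpos_at_max:
  fixes g g1 :: "real \<Rightarrow> real"
  assumes d1: "\<forall>\<^sub>F s in nhds 0. (g has_real_derivative g1 s) (at s)"
    and d2: "(g1 has_real_derivative g2) (at 0)"
    and mx: "\<forall>\<^sub>F s in nhds 0. g s \<le> g 0"
  shows "g2 \<le> 0"
proof (rule ccontr)
  assume "\<not> g2 \<le> 0"
  then have g2: "g2 > 0" by simp
  obtain d where d: "d > 0" "\<And>s. \<bar>s\<bar> < d \<Longrightarrow> (g has_real_derivative g1 s) (at s)" "\<And>s. \<bar>s\<bar> < d \<Longrightarrow> g s \<le> g 0"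
    using eventually_conj[OF d1 mx] unfolding eventually_nhds_metric by (auto simp: dist_real_def)
  have "g1 0 = 0"
    by (rule DERIV_local_max[OF d(2)[of 0] d(1)]) (use d in auto)
  moreover obtain e where e: "e > 0" "\<And>h. h > 0 \<Longrightarrow> h < e \<Longrightarrow> g1 0 < g1 (0 + h)"
    using DERIV_pos_inc_right[OF d2 g2] by auto
  ultimately have pos: "g1 h > 0" if "0 < h" "h < e" for h using that by auto
  define h where "h = min d e / 2"
  have h: "0 < h" "h < d" "h < e" using d e by (auto simp: h_def min_def)
  obtain z where z: "0 < z" "z < h" "g h - g 0 = (h - 0) * g1 z"
    using MVT2[of 0 h g g1] h d(2) by (metis abs_of_nonneg order_le_less_trans)
  then have "g h - g 0 > 0" using h pos[of z] by simp
  then have "g h > g 0" by simp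
  then show False using d(3)[of h] h by simp
qed

lemma Ck_on_Suc_imp: "Ck_on (Suc m) f S \<Longrightarrow> Ck_on m f S"
proof (induction m arbitrary: f)
  case 0
  then show ?case
    using differentiable_imp_continuous_within[of f _ UNIV]
    by (auto simp: continuous_on_eq_continuous_within intro: continuous_at_imp_continuous_at_within)
next
  case (Suc m)
  then show ?case by auto
qed

lemma Ck_on_realD:
  fixes f :: "real \<Rightarrow> real"
  assumes "Ck_on 1 f S" "x \<in> S"
  shows "(f has_real_derivative deriv f x) (at x)"
  using assms by (auto simp: DERIV_deriv_iff_real_differentiable)

lemma frechet_eq_gradient:
  fixes f :: "real ^ 'n \<Rightarrow> real"
  assumes "f differentiable (at x)"
  shows "frechet_derivative f (at x) v = gradient f x \<bullet> v"
proof -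
  interpret linear "frechet_derivative f (at x)" using assms by (rule linear_frechet_derivative)
  have "frechet_derivative f (at x) v = frechet_derivative f (at x) (\<Sum>i\<in>UNIV. v $ i *\<^sub>R axis i 1)"
    by (simp add: basis_expansion scalar_mult_eq_scaleR flip: scalar_mult_eq_scaleR)
  then show ?thesis by (simp add: sum scaleR gradient_def partial_def inner_vec_def mult.commute)
qed

lemma gradient_has_derivative:
  fixes f :: "real ^ 'n \<Rightarrow> real"
  assumes "f differentiable (at x)"
  shows "(f has_derivative (\<lambda>v. gradient f x \<bullet> v)) (at x)"
  using assms frechet_eq_gradient[OF assms] frechet_derivative_works[of f "at x"]
  by (metis (no_types, lifting) ext)

context
  fixes f :: "real ^ 'n \<Rightarrow> real" and S
  assumes C2: "Ck_on 2 f S"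
begin

lemma C2_differentiable: "x \<in> S \<Longrightarrow> f differentiable (at x)"
  using C2 by (simp add: numeral_2_eq_2)

lemma C2_partial: "Ck_on 1 (partial i f) S"
proof -
  have "axis i 1 \<in> (Basis :: (real ^ 'n) set)" by (simp add: axis_in_Basis_iff)
  then show ?thesis using C2 unfolding partial_def[abs_def] by (simp add: numeral_2_eq_2)
qed

lemma C2_partial_differentiable: "x \<in> S \<Longrightarrow> partial i f differentiable (at x)"
  using C2_partial[of i] by simp

lemma C2_partial_partial_continuous: "continuous_on S (partial j (partial i f))"
proof -
  have "axis j 1 \<in> (Basis :: (real ^ 'n) set)" by (simp add: axis_in_Basis_iff)
  then show ?thesis using C2_partial[of i] unfolding partial_def[of j, abs_def] by simp
qed

lemma C2_hessian_continuous: "continuous_on S (hessian f)"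
  unfolding hessian_def[abs_def] by (intro continuous_intros C2_partial_partial_continuous)

lemma C2_gradient_continuous: "continuous_on S (gradient f)"
proof -
  have "Ck_on 0 (partial i f) S" for i using Ck_on_Suc_imp[of 0] C2_partial[of i] by simp
  then show ?thesis unfolding gradient_def[abs_def] by (intro continuous_intros) auto
qed

lemma line_derivative:
  assumes "x + s *\<^sub>R v \<in> S"
  shows "((\<lambda>s. f (x + s *\<^sub>R v)) has_real_derivative gradient f (x + s *\<^sub>R v) \<bullet> v) (at s)"
proof -
  have "((\<lambda>s. x + s *\<^sub>R v) has_derivative (\<lambda>s. s *\<^sub>R v)) (at s)"
    by (auto intro!: derivative_eq_intros)
  from diff_chain_at[OF this gradient_has_derivative[OF C2_differentiable[OF assms]]]
  show ?thesis by (simp add: o_def has_field_derivative_def mult.commute mult_commute_abs)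
qed

end

lemma gradient_has_vector_derivative:
  fixes f :: "real ^ 'n \<Rightarrow> real"
  assumes C2: "Ck_on 2 f S" and x: "x \<in> S"
  shows "(gradient f has_derivative (\<lambda>v. transpose (hessian f x) *v v)) (at x)"
proof -
  have "((\<lambda>x. \<chi> i. partial i f x) has_derivative (\<lambda>v. \<chi> i. gradient (partial i f) x \<bullet> v)) (at x)"
    by (subst has_derivative_componentwise_within)
      (auto simp: Basis_vec_def inner_axis intro!: gradient_has_derivative C2_partial_differentiable[OF C2 x])
  moreover have "(\<lambda>v. \<chi> i. gradient (partial i f) x \<bullet> v) = (\<lambda>v. transpose (hessian f x) *v v)"
    by (auto simp: fun_eq_iff vec_eq_iff matrix_vector_mult_def transpose_def hessian_def gradient_def inner_vec_def)
  ultimately show ?thesis unfolding gradient_def[abs_def] by simp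
qed

text \<open>The mean value theorem in direction i and then in direction j. The second difference is
  symmetric in i and j while the right side is not; comparing both versions for small h gives the
  symmetry of the Hessian.\<close>

lemma mixed_difference:
  fixes f :: "real ^ 'n \<Rightarrow> real"
  assumes C2: "Ck_on 2 f S" and ball: "ball x (3 * h) \<subseteq> S" and h: "h > 0"
  shows "\<exists>p\<in>ball x (3 * h). f (x + h *\<^sub>R axis i 1 + h *\<^sub>R axis j 1) - f (x + h *\<^sub>R axis i 1)
     - f (x + h *\<^sub>R axis j 1) + f x = h * h * partial j (partial i f) p"
proof -
  let ?e = "\<lambda>i. axis i 1 :: real ^ 'n"
  \<comment> \<open>All points involved lie within 2 h of \<open>x\<close>, strictly inside the ball
    of radius 3 h.\<close>
  have inb: "x + s *\<^sub>R ?e i + t *\<^sub>R ?e j \<in> ball x (3 * h)" if "0 \<le> s" "s \<le> h" "0 \<le> t" "t \<le> h" for s t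
  proof -
    have "norm (s *\<^sub>R ?e i + t *\<^sub>R ?e j) \<le> s + t"
      by (rule norm_triangle_le) (use that in simp)
    also have "\<dots> < 3 * h" using that h by simp
    finally show ?thesis by (simp add: dist_norm add.assoc norm_minus_commute add.commute)
  qed
  define a where "a s = f ((x + h *\<^sub>R ?e j) + s *\<^sub>R ?e i) - f (x + s *\<^sub>R ?e i)" for s
  have D: "gradient g y \<bullet> ?e k = partial k g y" for g y k
    by (simp add: gradient_def inner_axis)
  have "DERIV a s :> partial i f ((x + h *\<^sub>R ?e j) + s *\<^sub>R ?e i) - partial i f (x + s *\<^sub>R ?e i)" if "0 \<le> s" "s \<le> h" for s
    unfolding a_def[abs_def] D[symmetric]
    by (intro DERIV_diff line_derivative[OF C2]) (use inb[of s h] inb[of s 0] that ball h in \<open>auto simp: ac_simps\<close>)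
  then obtain s where s: "0 < s" "s < h"
    "a h - a 0 = h * (partial i f ((x + h *\<^sub>R ?e j) + s *\<^sub>R ?e i) - partial i f (x + s *\<^sub>R ?e i))"
    using MVT2[OF h, of a "\<lambda>s. partial i f ((x + h *\<^sub>R ?e j) + s *\<^sub>R ?e i) - partial i f (x + s *\<^sub>R ?e i)"] by auto
  define b where "b t = partial i f ((x + s *\<^sub>R ?e i) + t *\<^sub>R ?e j)" for t
  have "DERIV b t :> partial j (partial i f) ((x + s *\<^sub>R ?e i) + t *\<^sub>R ?e j)" if "0 \<le> t" "t \<le> h" for t
  proof -
    have "((\<lambda>t. (x + s *\<^sub>R ?e i) + t *\<^sub>R ?e j) has_derivative (\<lambda>t. t *\<^sub>R ?e j)) (at t)"
      by (auto intro!: derivative_eq_intros)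
    moreover have "partial i f differentiable (at ((x + s *\<^sub>R ?e i) + t *\<^sub>R ?e j))"
      by (rule C2_partial_differentiable[OF C2]) (use inb[of s t] that s ball in auto)
    ultimately show ?thesis
      using diff_chain_at[OF _ gradient_has_derivative, of "\<lambda>t. (x + s *\<^sub>R ?e i) + t *\<^sub>R ?e j" "\<lambda>t. t *\<^sub>R ?e j" t "partial i f"]
      by (simp add: o_def b_def[abs_def] has_field_derivative_def D mult_commute_abs)
  qed
  then obtain t where t: "0 < t" "t < h" "b h - b 0 = h * partial j (partial i f) ((x + s *\<^sub>R ?e i) + t *\<^sub>R ?e j)"
    using MVT2[OF h, of b "\<lambda>t. partial j (partial i f) ((x + s *\<^sub>R ?e i) + t *\<^sub>R ?e j)"] by auto
  have "a h - a 0 = h * (b h - b 0)" using s(3) by (simp add: b_def ac_simps)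
  then have "a h - a 0 = h * h * partial j (partial i f) (x + s *\<^sub>R ?e i + t *\<^sub>R ?e j)" using t by simp
  moreover have "a h - a 0 = f (x + h *\<^sub>R axis i 1 + h *\<^sub>R axis j 1) - f (x + h *\<^sub>R axis i 1)
     - f (x + h *\<^sub>R axis j 1) + f x" by (simp add: a_def ac_simps)
  ultimately show ?thesis using inb[of s t] s t by (intro bexI[of _ "x + s *\<^sub>R ?e i + t *\<^sub>R ?e j"]) auto
qed

lemma hessian_symmetric:
  fixes f :: "real ^ 'n \<Rightarrow> real"
  assumes C2: "Ck_on 2 f S" and S: "open S" "x \<in> S"
  shows "transpose (hessian f x) = hessian f x"
proof -
  have "partial j (partial i f) x = partial i (partial j f) x" for i j
  proof (rule ccontr)
    let ?P = "partial j (partial i f)" and ?Q = "partial i (partial j f)"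
    \<comment> \<open>Near \<open>x\<close> both mixed partials stay within half of their supposed
      gap, yet they agree at the points \<open>p\<close> and \<open>q\<close> found below.\<close>
    define e where "e = \<bar>?P x - ?Q x\<bar> / 2"
    assume "?P x \<noteq> ?Q x"
    then have e: "e > 0" by (simp add: e_def)
    have cont: "isCont ?P x" "isCont ?Q x"
      using C2_partial_partial_continuous[OF C2] S by (auto simp: continuous_on_eq_continuous_at)
    obtain d1 where d1: "d1 > 0" "\<And>y. dist y x < d1 \<Longrightarrow> dist (?P y) (?P x) < e"
      using cont(1) e unfolding continuous_at_eps_delta by blast
    obtain d2 where d2: "d2 > 0" "\<And>y. dist y x < d2 \<Longrightarrow> dist (?Q y) (?Q x) < e"
      using cont(2) e unfolding continuous_at_eps_delta by blast
    obtain d3 where d3: "d3 > 0" "ball x d3 \<subseteq> S" using S open_contains_ball by blast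
    define h where "h = min d1 (min d2 d3) / 3"
    have h: "h > 0" "3 * h \<le> d1" "3 * h \<le> d2" "3 * h \<le> d3" using d1 d2 d3 by (auto simp: h_def)
    have b: "ball x (3 * h) \<subseteq> S" using h d3 by (meson subset_ball order_trans)
    obtain p where p: "p \<in> ball x (3 * h)" "f (x + h *\<^sub>R axis i 1 + h *\<^sub>R axis j 1) - f (x + h *\<^sub>R axis i 1)
     - f (x + h *\<^sub>R axis j 1) + f x = h * h * ?P p" using mixed_difference[OF C2 b h(1)] by blast
    obtain q where q: "q \<in> ball x (3 * h)" "f (x + h *\<^sub>R axis j 1 + h *\<^sub>R axis i 1) - f (x + h *\<^sub>R axis j 1)
     - f (x + h *\<^sub>R axis i 1) + f x = h * h * ?Q q" using mixed_difference[OF C2 b h(1)] by blast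
    have "x + h *\<^sub>R axis j 1 + h *\<^sub>R axis i 1 = x + h *\<^sub>R axis i 1 + h *\<^sub>R axis j (1::real)" by (simp add: ac_simps)
    from q(2)[unfolded this] p(2) have "h * h * ?P p = h * h * ?Q q" by linarith
    then have "?P p = ?Q q" using h by simp
    moreover have "\<bar>?P p - ?P x\<bar> < e" "\<bar>?Q q - ?Q x\<bar> < e"
      using d1(2)[of p] d2(2)[of q] p(1) q(1) h by (auto simp: dist_real_def dist_commute)
    moreover have "2 * e = \<bar>?P x - ?Q x\<bar>" by (simp add: e_def)
    ultimately show False by (smt (verit))
  qed
  then show ?thesis by (simp add: transpose_def hessian_def vec_eq_iff)
qed

lemma line_second_derivative:
  fixes f :: "real ^ 'n \<Rightarrow> real"
  assumes C2: "Ck_on 2 f S" and S: "open S" "x + s *\<^sub>R v \<in> S"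
  shows "((\<lambda>s. gradient f (x + s *\<^sub>R v) \<bullet> v) has_real_derivative v \<bullet> (hessian f (x + s *\<^sub>R v) *v v)) (at s)"
proof -
  have "((\<lambda>s. x + s *\<^sub>R v) has_derivative (\<lambda>s. s *\<^sub>R v)) (at s)"
    by (auto intro!: derivative_eq_intros)
  from diff_chain_at[OF this gradient_has_vector_derivative[OF C2 S(2)]]
  have "((\<lambda>s. gradient f (x + s *\<^sub>R v)) has_derivative (\<lambda>t. t *\<^sub>R (hessian f (x + s *\<^sub>R v) *v v))) (at s)"
    by (simp add: o_def hessian_symmetric[OF C2 S] matrix_vector_mult_scaleR)
  from has_derivative_inner_left[OF this, of v]
  show ?thesis by (simp add: has_field_derivative_def mult_commute_abs inner_commute[of v])
qed

lemma taylor_second_order: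
  fixes f :: "real ^ 'n \<Rightarrow> real"
  assumes C2: "Ck_on 2 f S" and S: "open S" and seg: "\<And>s. 0 \<le> s \<Longrightarrow> s \<le> 1 \<Longrightarrow> x + s *\<^sub>R v \<in> S"
  shows "\<exists>s. 0 < s \<and> s < 1 \<and> f (x + v) = f x + gradient f x \<bullet> v + (v \<bullet> (hessian f (x + s *\<^sub>R v) *v v)) / 2"
proof -
  define diff where "diff m s = (if m = 0 then f (x + s *\<^sub>R v) else if m = 1 then gradient f (x + s *\<^sub>R v) \<bullet> v
     else v \<bullet> (hessian f (x + s *\<^sub>R v) *v v))" for m :: nat and s
  have "\<exists>t>0. t < 1 \<and> f (x + 1 *\<^sub>R v) = (\<Sum>m<2. diff m 0 / fact m * 1 ^ m) + diff 2 t / fact 2 * 1 ^ 2"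
  proof (rule Maclaurin)
    show "\<forall>m t. m < 2 \<and> 0 \<le> t \<and> t \<le> 1 \<longrightarrow> (diff m has_real_derivative diff (Suc m) t) (at t)"
    proof (intro allI impI)
      fix m :: nat and t :: real assume *: "m < 2 \<and> 0 \<le> t \<and> t \<le> 1"
      then consider "m = 0" | "m = 1" by linarith
      then show "(diff m has_real_derivative diff (Suc m) t) (at t)"
        using line_derivative[OF C2 seg[of t]] line_second_derivative[OF C2 S seg[of t]] *
        by cases (simp_all add: diff_def[abs_def])
    qed
  qed (auto simp: diff_def)
  then show ?thesis by (auto simp: diff_def numeral_2_eq_2 algebra_simps)
qed

section \<open>Principal curvatures\<close>

lemma norm_matrix_vector_le: "norm (M *v v) \<le> norm M * norm v"
  for M :: "real ^ 'n ^ 'm"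
proof -
  have "norm (M *v v) = L2_set (\<lambda>i. norm ((M *v v) $ i)) UNIV" by (simp add: norm_vec_def)
  also have "\<dots> \<le> L2_set (\<lambda>i. norm (M $ i) * norm v) UNIV"
    by (rule L2_set_mono) (auto simp: matrix_vector_mul_component Cauchy_Schwarz_ineq2)
  also have "\<dots> = norm M * norm v" by (simp add: norm_vec_def L2_set_left_distrib)
  finally show ?thesis .
qed

lemma abs_inner_matrix_le: "\<bar>v \<bullet> (M *v w)\<bar> \<le> norm M * norm v * norm w"
  for M :: "real ^ 'n ^ 'm"
proof -
  have "\<bar>v \<bullet> (M *v w)\<bar> \<le> norm v * norm (M *v w)" by (rule Cauchy_Schwarz_ineq2)
  also have "\<dots> \<le> norm v * (norm M * norm w)" by (intro mult_left_mono norm_matrix_vector_le) auto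
  finally show ?thesis by (simp add: mult_ac)
qed

text \<open>The component of \<open>b\<close> orthogonal to \<open>a\<close> must vanish, for
  tilting it slightly against \<open>a\<close> leads into the open half-space. This serves both for
  the independence of the normal from the defining function and for the direction to the nearest
  boundary point.\<close>

lemma parallel_if_half_space:
  fixes a b :: "'a::real_inner"
  assumes a: "a \<noteq> 0" and half: "\<And>v. a \<bullet> v < 0 \<Longrightarrow> b \<bullet> v \<le> 0"
  shows "b = norm b *\<^sub>R (a /\<^sub>R norm a)"
proof -
  define l where "l = (a \<bullet> b) / (a \<bullet> a)"
  define w where "w = b - l *\<^sub>R a"
  have aa: "a \<bullet> a > 0" using a by simp
  have aw: "a \<bullet> w = 0" using aa by (simp add: w_def l_def inner_diff_right)
  have bw: "b \<bullet> w = w \<bullet> w"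
    using aw by (simp add: w_def inner_diff_left inner_commute)
  have "w = 0"
  proof (rule ccontr)
    assume "w \<noteq> 0"
    then have ww: "w \<bullet> w > 0" by simp
    \<comment> \<open>Small enough that e (a \<bullet> b) is at most half of w \<bullet> w; the
      added 1 keeps the denominator positive.\<close>
    define e where "e = (w \<bullet> w) / (2 * (\<bar>a \<bullet> b\<bar> + 1))"
    have e: "e > 0" using ww by (simp add: e_def)
    have "a \<bullet> (w - e *\<^sub>R a) < 0" using aw aa e by (simp add: inner_diff_right)
    from half[OF this] have "w \<bullet> w \<le> e * (a \<bullet> b)" by (simp add: inner_diff_right bw inner_commute)
    also have "\<dots> \<le> e * (\<bar>a \<bullet> b\<bar> + 1)" using e by (intro mult_left_mono) auto
    also have "\<dots> = (w \<bullet> w) / 2" by (simp add: e_def field_simps add_nonneg_eq_0_iff)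
    finally show False using ww by simp
  qed
  then have b: "b = l *\<^sub>R a" by (simp add: w_def)
  have "a \<bullet> - a < 0" using aa by simp
  from half[OF this] have "l \<ge> 0" using aa by (simp add: b zero_le_mult_iff)
  then show ?thesis using a by (simp add: b)
qed

text \<open>The definition prescribes only where \<rho> is negative. At a frontier point \<rho> is
  nonnegative because \<Omega> is open, and nonpositive because the point is a limit of points of
  \<Omega>.\<close>

lemma local_defining_function_zero:
  assumes ldf: "local_defining_function \<Omega> x U \<rho>" and op: "open \<Omega>" and y: "y \<in> frontier \<Omega>" "y \<in> U"
  shows "\<rho> y = 0" "local_defining_function \<Omega> y U \<rho>"
proof -
  have U: "open U" "smooth_on \<rho> U" "\<Omega> \<inter> U = {y \<in> U. \<rho> y < 0}"
    using ldf by (auto simp: local_defining_function_def)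
  have "Ck_on 0 \<rho> U" using U by (simp add: smooth_on_def)
  then have cont: "isCont \<rho> y" using U y by (simp add: continuous_on_eq_continuous_at)
  have "y \<notin> \<Omega>" using y op by (simp add: frontier_def interior_open)
  then have "\<rho> y \<ge> 0" using U y by (metis (no_types, lifting) IntD1 linorder_not_less mem_Collect_eq)
  moreover have "\<rho> y \<le> 0"
  proof (rule ccontr)
    assume "\<not> \<rho> y \<le> 0"
    then have "\<forall>\<^sub>F p in nhds y. \<rho> p > 0 \<and> p \<in> U"
      using cont U(1) y(2) by (intro eventually_conj order_tendstoD(1)[of \<rho> "\<rho> y"] eventually_nhds_in_open)
        (auto simp: continuous_at tendsto_at_iff_tendsto_nhds)
    then obtain V where V: "open V" "y \<in> V" "\<And>p. p \<in> V \<Longrightarrow> \<rho> p > 0 \<and> p \<in> U"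
      unfolding eventually_nhds by blast
    have "y \<in> closure \<Omega>" using y by (simp add: frontier_def)
    then obtain p where "p \<in> \<Omega>" "p \<in> V" using V by (meson closure_iff_nhds_not_empty disjoint_iff order_refl)
    then have "p \<in> \<Omega> \<inter> U" "\<rho> p > 0" using V(3) by auto
    then show False using U(3) by auto
  qed
  ultimately show "\<rho> y = 0" by simp
  show "local_defining_function \<Omega> y U \<rho>" using ldf y by (simp add: local_defining_function_def)
qed

lemma local_defining_functionD:
  assumes ldf: "local_defining_function \<Omega> x U \<rho>"
  shows "open U" "x \<in> U" "Ck_on 2 \<rho> U" "\<And>y. y \<in> U \<Longrightarrow> gradient \<rho> y \<noteq> 0"
    "\<And>y. y \<in> U \<Longrightarrow> y \<in> \<Omega> \<longleftrightarrow> \<rho> y < 0"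
  using ldf by (auto simp: local_defining_function_def smooth_on_def)

lemma ray_near_boundary:
  assumes ldf: "local_defining_function \<Omega> x U \<rho>" and op: "open \<Omega>" and x: "x \<in> frontier \<Omega>"
  shows "gradient \<rho> x \<bullet> v < 0 \<Longrightarrow> \<exists>d>0. \<forall>s. 0 < s \<longrightarrow> s < d \<longrightarrow> x + s *\<^sub>R v \<in> U \<and> \<rho> (x + s *\<^sub>R v) < 0"
    "gradient \<rho> x \<bullet> v > 0 \<Longrightarrow> \<exists>d>0. \<forall>s. 0 < s \<longrightarrow> s < d \<longrightarrow> x + s *\<^sub>R v \<in> U \<and> \<rho> (x + s *\<^sub>R v) > 0"
proof -
  note D = local_defining_functionD[OF ldf]
  have r0: "\<rho> x = 0" using local_defining_function_zero[OF ldf op x] D by simp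
  have der: "((\<lambda>s. \<rho> (x + s *\<^sub>R v)) has_real_derivative gradient \<rho> x \<bullet> v) (at 0)"
    using line_derivative[OF D(3), of x 0 v] D(2) by simp
  have "((\<lambda>s. x + s *\<^sub>R v) \<longlongrightarrow> x) (nhds 0)"
    by (auto intro!: tendsto_eq_intros filterlim_ident)
  from topological_tendstoD[OF this D(1) D(2)]
  obtain d1 where d1: "d1 > 0" "\<And>s. \<bar>s\<bar> < d1 \<Longrightarrow> x + s *\<^sub>R v \<in> U"
    unfolding eventually_nhds_metric by (auto simp: dist_real_def)
  { assume "gradient \<rho> x \<bullet> v < 0"
    from DERIV_neg_dec_right[OF der this] obtain d2 where "d2 > 0" "\<And>s. 0 < s \<Longrightarrow> s < d2 \<Longrightarrow> \<rho> (x + s *\<^sub>R v) < 0"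
      using r0 by auto
    then show "\<exists>d>0. \<forall>s. 0 < s \<longrightarrow> s < d \<longrightarrow> x + s *\<^sub>R v \<in> U \<and> \<rho> (x + s *\<^sub>R v) < 0"
      using d1 by (intro exI[of _ "min d1 d2"]) auto }
  { assume "gradient \<rho> x \<bullet> v > 0"
    from DERIV_pos_inc_right[OF der this] obtain d2 where "d2 > 0" "\<And>s. 0 < s \<Longrightarrow> s < d2 \<Longrightarrow> \<rho> (x + s *\<^sub>R v) > 0"
      using r0 by auto
    then show "\<exists>d>0. \<forall>s. 0 < s \<longrightarrow> s < d \<longrightarrow> x + s *\<^sub>R v \<in> U \<and> \<rho> (x + s *\<^sub>R v) > 0"
      using d1 by (intro exI[of _ "min d1 d2"]) auto }
qed

text \<open>This legitimises the definite description. A direction that decreases one defining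
  function enters \<Omega>, so it cannot increase another; hence the gradients are positively
  parallel.\<close>

lemma outer_normal_eq:
  assumes ldf: "local_defining_function \<Omega> x U \<rho>" and op: "open \<Omega>" and y: "y \<in> frontier \<Omega>" "y \<in> U"
  shows "outer_normal \<Omega> y = gradient \<rho> y /\<^sub>R norm (gradient \<rho> y)"
proof -
  note ly = local_defining_function_zero(2)[OF ldf op y]
  have "gradient \<rho>' y /\<^sub>R norm (gradient \<rho>' y) = gradient \<rho> y /\<^sub>R norm (gradient \<rho> y)"
    if l': "local_defining_function \<Omega> y U' \<rho>'" for U' \<rho>'
  proof -
    note D = local_defining_functionD[OF ly] and D' = local_defining_functionD[OF l']
    let ?a = "gradient \<rho> y" and ?b = "gradient \<rho>' y"
    have "?b = norm ?b *\<^sub>R (?a /\<^sub>R norm ?a)"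
    proof (rule parallel_if_half_space)
      show "?a \<noteq> 0" using D(4)[OF y(2)] .
      fix v assume v: "?a \<bullet> v < 0"
      show "?b \<bullet> v \<le> 0"
      proof (rule ccontr)
        assume "\<not> ?b \<bullet> v \<le> 0"
        then have v': "?b \<bullet> v > 0" by simp
        obtain d1 where d1: "d1 > 0" "\<And>s. 0 < s \<Longrightarrow> s < d1 \<Longrightarrow> y + s *\<^sub>R v \<in> U \<and> \<rho> (y + s *\<^sub>R v) < 0"
          using ray_near_boundary(1)[OF ly op y(1) v] by blast
        obtain d2 where d2: "d2 > 0" "\<And>s. 0 < s \<Longrightarrow> s < d2 \<Longrightarrow> y + s *\<^sub>R v \<in> U' \<and> \<rho>' (y + s *\<^sub>R v) > 0"
          using ray_near_boundary(2)[OF l' op y(1) v'] by blast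
        define s where "s = min d1 d2 / 2"
        have "0 < s" "s < d1" "s < d2" using d1 d2 by (auto simp: s_def)
        then show False using d1(2)[of s] d2(2)[of s] D(5) D'(5) by force
      qed
    qed
    moreover have "norm ?b \<noteq> 0" using D'(4)[OF D'(2)] by simp
    ultimately show ?thesis by (metis divideR_right scaleR_left_imp_eq)
  qed
  then show ?thesis unfolding outer_normal_def using ly by (intro the_equality) blast+
qed

text \<open>The shape operator of the level sets of \<rho>, extended by 0 to the normal direction.
  Unlike the principal curvatures it is given by an explicit formula on a full neighbourhood, from
  which continuity and symmetry can be read off.\<close>

definition weingarten :: "(real ^ 'n \<Rightarrow> real) \<Rightarrow> real ^ 'n \<Rightarrow> real ^ 'n ^ 'n" where
  "weingarten \<rho> y = (let P = mat 1 - outer (gradient \<rho> y /\<^sub>R norm (gradient \<rho> y))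
     in (1 / norm (gradient \<rho> y)) *\<^sub>R (P ** hessian \<rho> y ** P))"

context
  fixes \<Omega> :: "(real ^ 'n) set" and x U \<rho>
  assumes ldf: "local_defining_function \<Omega> x U \<rho>" and op: "open \<Omega>"
begin

abbreviation (input) "nu y \<equiv> gradient \<rho> y /\<^sub>R norm (gradient \<rho> y)"

lemma nu_unit: "y \<in> U \<Longrightarrow> nu y \<bullet> nu y = 1"
  using local_defining_functionD(4)[OF ldf, of y] by (simp add: dot_square_norm power2_eq_square)

lemma weingarten_mult:
  assumes y: "y \<in> U"
  shows "weingarten \<rho> y *v v =
    (1 / norm (gradient \<rho> y)) *\<^sub>R (let w = hessian \<rho> y *v (v - (nu y \<bullet> v) *\<^sub>R nu y) in w - (nu y \<bullet> w) *\<^sub>R nu y)"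
  by (simp add: weingarten_def Let_def scaleR_matrix_vector_assoc[symmetric] matrix_vector_mul_assoc[symmetric]
      matrix_vector_mult_diff_rdistrib outer_mult)

lemma weingarten_symmetric:
  assumes y: "y \<in> U"
  shows "transpose (weingarten \<rho> y) = weingarten \<rho> y"
proof -
  have "transpose (mat 1 - outer n) = mat 1 - outer n" for n :: "real ^ 'n"
    by (simp add: transpose_def outer_def vec_eq_iff mat_def mult_ac)
  moreover have "transpose (hessian \<rho> y) = hessian \<rho> y"
    using hessian_symmetric[OF local_defining_functionD(3)[OF ldf] local_defining_functionD(1)[OF ldf] y] .
  moreover have "transpose (c *\<^sub>R M) = c *\<^sub>R transpose M" for c and M :: "real ^ 'n ^ 'n"
    by (simp add: transpose_def vec_eq_iff)
  ultimately show ?thesis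
    by (simp add: weingarten_def Let_def matrix_transpose_mul matrix_mul_assoc)
qed

lemma weingarten_normal:
  assumes y: "y \<in> U"
  shows "weingarten \<rho> y *v nu y = 0"
  unfolding weingarten_mult[OF y] nu_unit[OF y] by (simp add: Let_def)

lemma weingarten_form:
  assumes y: "y \<in> U"
  shows "v \<bullet> (weingarten \<rho> y *v v) = (let w = v - (nu y \<bullet> v) *\<^sub>R nu y in w \<bullet> (hessian \<rho> y *v w)) / norm (gradient \<rho> y)"
proof -
  define n w where "n = nu y" and "w = v - (n \<bullet> v) *\<^sub>R n"
  show ?thesis
    unfolding weingarten_mult[OF y] n_def[symmetric] Let_def w_def[symmetric]
    by (subst (3) w_def) (simp add: inner_diff_left inner_diff_right inner_commute[of v n])
qed

lemma weingarten_continuous: "continuous_on U (weingarten \<rho>)"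
proof -
  note D = local_defining_functionD[OF ldf]
  have g: "continuous_on U (gradient \<rho>)" by (rule C2_gradient_continuous[OF D(3)])
  have H: "continuous_on U (hessian \<rho>)" by (rule C2_hessian_continuous[OF D(3)])
  have n: "continuous_on U (\<lambda>y. nu y $ i)" for i
    using D(4) by (intro continuous_intros g) auto
  have P: "continuous_on U (\<lambda>y. (mat 1 - outer (nu y)) $ i $ j)" for i j
    unfolding outer_def by (simp del: vector_scaleR_component) (intro continuous_intros n)
  have "continuous_on U (\<lambda>y. weingarten \<rho> y $ i $ j)" for i j
  proof -
    have "weingarten \<rho> y $ i $ j = (1 / norm (gradient \<rho> y)) * (\<Sum>k\<in>UNIV. (\<Sum>l\<in>UNIV. (mat 1 - outer (nu y)) $ i $ l * hessian \<rho> y $ l $ k) * (mat 1 - outer (nu y)) $ k $ j)" for y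
      by (simp add: weingarten_def Let_def matrix_matrix_mult_def)
    moreover have "continuous_on U (\<lambda>y. (1 / norm (gradient \<rho> y)) * (\<Sum>k\<in>UNIV. (\<Sum>l\<in>UNIV. (mat 1 - outer (nu y)) $ i $ l * hessian \<rho> y $ l $ k) * (mat 1 - outer (nu y)) $ k $ j))"
      by (intro continuous_on_mult continuous_on_sum P continuous_on_component H continuous_on_divide continuous_on_const
          continuous_on_norm g) (use D(4) in auto)
    ultimately show ?thesis by simp
  qed
  then have "continuous_on U (\<lambda>y. \<chi> i j. weingarten \<rho> y $ i $ j)"
    by (intro continuous_on_vec_lambda)
  then show ?thesis by simp
qed

text \<open>On tangent vectors the inner projection in \<open>weingarten\<close> acts trivially, and
  differentiating the norm of the gradient supplies the outer one.\<close>

lemma normal_derivative: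
  assumes y: "y \<in> frontier \<Omega>" "y \<in> U"
  obtains W where "(outer_normal \<Omega> has_derivative W) (at y within frontier \<Omega>)"
    "\<And>v. v \<bullet> nu y = 0 \<Longrightarrow> W v = weingarten \<rho> y *v v"
proof -
  note D = local_defining_functionD[OF ldf]
  let ?g = "gradient \<rho>" and ?H = "hessian \<rho> y"
  have g0: "?g y \<noteq> 0" using D(4) y by simp
  have dg: "(?g has_derivative (\<lambda>v. ?H *v v)) (at y)"
    using gradient_has_vector_derivative[OF D(3) y(2)] hessian_symmetric[OF D(3) D(1) y(2)] by simp
  have dn: "((\<lambda>p. norm (?g p)) has_derivative (\<lambda>v. sgn (?g y) \<bullet> (?H *v v))) (at y)"
    using has_derivative_compose[OF dg has_derivative_norm[OF g0]] by (simp add: inner_commute)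
  define W where "W v = inverse (norm (?g y)) *\<^sub>R (?H *v v)
      + (- (inverse (norm (?g y)) * (sgn (?g y) \<bullet> (?H *v v)) * inverse (norm (?g y)))) *\<^sub>R ?g y" for v
  have "(nu has_derivative W) (at y)"
    unfolding W_def[abs_def]
    by (rule has_derivative_scaleR[OF Deriv.has_derivative_inverse[OF _ dn] dg]) (use g0 in simp)
  then have "(nu has_derivative W) (at y within frontier \<Omega> \<inter> U)"
    by (rule has_derivative_at_withinI)
  then have "(outer_normal \<Omega> has_derivative W) (at y within frontier \<Omega> \<inter> U)"
    by (rule has_derivative_transform_within[of _ _ _ _ 1]) (use y outer_normal_eq[OF ldf op] in auto)
  then have "(outer_normal \<Omega> has_derivative W) (at y within frontier \<Omega>)"
    using at_within_nhd[of y U "frontier \<Omega>" "frontier \<Omega> \<inter> U"] y D(1) by auto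
  moreover have "W v = weingarten \<rho> y *v v" if "v \<bullet> nu y = 0" for v
  proof -
    have "nu y \<bullet> v = 0" using that by (simp add: inner_commute)
    then have "weingarten \<rho> y *v v = (1 / norm (?g y)) *\<^sub>R ((?H *v v) - (nu y \<bullet> (?H *v v)) *\<^sub>R nu y)"
      unfolding weingarten_mult[OF y(2)] by (simp only: scaleR_zero_left diff_zero Let_def)
    then show ?thesis by (simp add: W_def sgn_div_norm scaleR_diff_right divide_inverse mult_ac)
  qed
  ultimately show ?thesis by (rule that)
qed

text \<open>The points y + s (v - e n) and y + s (v + e n) lie on different sides of the boundary,
  so the short segment between them meets the frontier.\<close>

lemma frontier_tangent:
  assumes y: "y \<in> frontier \<Omega>" "y \<in> U" and v: "v \<bullet> nu y = 0" and e: "e > 0" "d > 0"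
  shows "\<exists>s p. 0 < s \<and> s < d \<and> p \<in> frontier \<Omega> \<and> norm (p - y - s *\<^sub>R v) \<le> e * s"
proof -
  note ly = local_defining_function_zero(2)[OF ldf op y]
  note D = local_defining_functionD[OF ly]
  let ?n = "nu y"
  have g0: "norm (gradient \<rho> y) > 0" using D(4) y by simp
  have gn: "gradient \<rho> y = norm (gradient \<rho> y) *\<^sub>R ?n" using g0 by simp
  have gv: "gradient \<rho> y \<bullet> v = 0" using v by (subst gn) (simp add: inner_commute)
  have gg: "gradient \<rho> y \<bullet> ?n > 0" by (subst gn) (simp only: inner_scaleR_left nu_unit[OF y(2)], use g0 in simp)
  have egg: "e * (gradient \<rho> y \<bullet> ?n) > 0" using gg e by (intro mult_pos_pos)
  have "gradient \<rho> y \<bullet> (v - e *\<^sub>R ?n) < 0" using gv egg by (simp only: inner_diff_right inner_scaleR_right[of _ e] diff_0)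
  then obtain d1 where d1: "d1 > 0" "\<And>s. 0 < s \<Longrightarrow> s < d1 \<Longrightarrow> y + s *\<^sub>R (v - e *\<^sub>R ?n) \<in> U \<and> \<rho> (y + s *\<^sub>R (v - e *\<^sub>R ?n)) < 0"
    using ray_near_boundary(1)[OF ly op y(1)] by blast
  have "gradient \<rho> y \<bullet> (v + e *\<^sub>R ?n) > 0" using gv egg by (simp only: inner_add_right inner_scaleR_right[of _ e] add_0)
  then obtain d2 where d2: "d2 > 0" "\<And>s. 0 < s \<Longrightarrow> s < d2 \<Longrightarrow> y + s *\<^sub>R (v + e *\<^sub>R ?n) \<in> U \<and> \<rho> (y + s *\<^sub>R (v + e *\<^sub>R ?n)) > 0"
    using ray_near_boundary(2)[OF ly op y(1)] by blast
  define s where "s = min d (min d1 d2) / 2"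
  have s: "0 < s" "s < d" "s < d1" "s < d2" using d1 d2 e by (auto simp: s_def)
  let ?p1 = "y + s *\<^sub>R (v - e *\<^sub>R ?n)" and ?p2 = "y + s *\<^sub>R (v + e *\<^sub>R ?n)"
  have "?p1 \<in> \<Omega>" "?p2 \<notin> \<Omega>" using d1(2)[OF s(1,3)] d2(2)[OF s(1,4)] D(5) by fastforce+
  then have "closed_segment ?p1 ?p2 \<inter> frontier \<Omega> \<noteq> {}"
    by (intro connected_Int_frontier) (auto simp del: scaleR_add_right scaleR_diff_right)
  then obtain p where p: "p \<in> frontier \<Omega>" "p \<in> closed_segment ?p1 ?p2" by blast
  have "closed_segment ?p1 ?p2 \<subseteq> cball (y + s *\<^sub>R v) (e * s)"
  proof (rule closed_segment_subset[OF _ _ convex_cball])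
    have nn: "norm ?n = 1" using nu_unit[OF y(2)] by (simp only: norm_eq_1)
    have "norm ((s * e) *\<^sub>R ?n) = \<bar>s * e\<bar> * norm ?n" by (rule norm_scaleR)
    then have "norm ((s * e) *\<^sub>R ?n) = e * s" unfolding nn using s e by simp
    moreover have "?p1 = (y + s *\<^sub>R v) - (s * e) *\<^sub>R ?n" "?p2 = (y + s *\<^sub>R v) + (s * e) *\<^sub>R ?n"
      by (simp_all add: scaleR_add_right scaleR_diff_right algebra_simps)
    ultimately show "?p1 \<in> cball (y + s *\<^sub>R v) (e * s)" "?p2 \<in> cball (y + s *\<^sub>R v) (e * s)"
      by (simp_all only: mem_cball dist_norm) (simp_all add: algebra_simps)
  qed
  then have "norm (p - y - s *\<^sub>R v) \<le> e * s"
    using p(2) by (auto simp: dist_norm norm_minus_commute algebra_simps)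
  then show ?thesis using s p by blast
qed

text \<open>Derivatives within a set without interior need not be unique. Along the frontier they
  are determined in tangent directions, because these are approximated by differences of frontier
  points up to an error e s.\<close>

lemma tangential_derivative_unique:
  assumes y: "y \<in> frontier \<Omega>" "y \<in> U"
    and W1: "(h has_derivative W1) (at y within frontier \<Omega>)" and W2: "(h has_derivative W2) (at y within frontier \<Omega>)"
    and v: "v \<bullet> nu y = 0"
  shows "W1 v = W2 v"
proof -
  define L where "L v = W1 v - W2 v" for v
  have "((\<lambda>y. h y - h y) has_derivative L) (at y within frontier \<Omega>)"
    unfolding L_def[abs_def] by (rule has_derivative_diff[OF W1 W2])
  then have d0: "((\<lambda>y. 0) has_derivative L) (at y within frontier \<Omega>)" by simp
  then have bl: "bounded_linear L" by (rule has_derivative_bounded_linear)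
  then interpret L: bounded_linear L .
  obtain K where K: "K > 0" "\<And>v. norm (L v) \<le> norm v * K" using L.pos_bounded by blast
  \<comment> \<open>The restriction e < 1 bounds the displacement to \<open>p\<close> by s (norm v +
    1).\<close>
  have bnd: "norm (L v) \<le> e * (norm v + 1 + K)" if e: "0 < e" "e < 1" for e
  proof -
    obtain d where d: "d > 0" "\<And>p. p \<in> frontier \<Omega> \<Longrightarrow> norm (p - y) < d \<Longrightarrow> norm (L (p - y)) \<le> e * norm (p - y)"
      using d0 e(1) unfolding has_derivative_within_alt by (auto simp: L.zero)
    obtain s p where s: "0 < s" "s < d / (norm v + 1)" and p: "p \<in> frontier \<Omega>" "norm (p - y - s *\<^sub>R v) \<le> e * s"
      using frontier_tangent[OF y v e(1), of "d / (norm v + 1)"] d by (auto simp: divide_pos_pos add_nonneg_pos)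
    have np: "norm (p - y) \<le> s * (norm v + 1)"
    proof -
      have "norm (p - y) \<le> norm (p - y - s *\<^sub>R v) + norm (s *\<^sub>R v)" by (metis diff_add_cancel norm_triangle_ineq)
      also have "\<dots> \<le> 1 * s + s * norm v" using p s e by (intro add_mono order_trans[OF p(2)]) auto
      finally show ?thesis by (simp add: algebra_simps)
    qed
    also have "\<dots> < d" using s(2) by (subst (asm) pos_less_divide_eq) (auto simp: add_nonneg_pos)
    finally have Lp: "norm (L (p - y)) \<le> e * norm (p - y)" using d(2) p by blast
    have "s * norm (L v) = norm (L (p - y) - L (p - y - s *\<^sub>R v))"
      using s by (simp add: L.diff[symmetric] L.scaleR)
    also have "\<dots> \<le> norm (L (p - y)) + norm (L (p - y - s *\<^sub>R v))" by (rule norm_triangle_ineq4)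
    also have "\<dots> \<le> e * (s * (norm v + 1)) + (e * s) * K"
      by (intro add_mono order_trans[OF Lp] order_trans[OF K(2)] mult_left_mono mult_right_mono np p(2)) (use e K in auto)
    finally have "s * norm (L v) \<le> s * (e * (norm v + 1 + K))" by (simp add: algebra_simps)
    then show ?thesis using s by simp
  qed
  have "norm (L v) \<le> 0"
  proof (rule field_le_epsilon)
    fix d :: real assume d: "d > 0"
    define e where "e = min (1/2) (d / (norm v + 1 + K))"
    have pos: "norm v + 1 + K > 0" using K by (simp add: add_nonneg_pos)
    have e: "0 < e" "e < 1" using d pos by (auto simp: e_def)
    have "norm (L v) \<le> e * (norm v + 1 + K)" using bnd e by blast
    also have "\<dots> \<le> d / (norm v + 1 + K) * (norm v + 1 + K)"
      using pos by (intro mult_right_mono) (auto simp: e_def)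
    finally show "norm (L v) \<le> 0 + d" using pos by simp
  qed
  then show ?thesis by (simp add: L_def)
qed

lemma orthonormal_list_iff:
  "orthonormal_list es \<longleftrightarrow> distinct es \<and> (\<forall>a\<in>set es. \<forall>b\<in>set es. a \<bullet> b = (if a = b then 1 else 0))"
  unfolding orthonormal_list_def
proof
  assume "\<forall>i<length es. \<forall>j<length es. es ! i \<bullet> es ! j = (if i = j then 1 else 0)"
  then show "distinct es \<and> (\<forall>a\<in>set es. \<forall>b\<in>set es. a \<bullet> b = (if a = b then 1 else 0))"
    using orthonormal_list_distinct[unfolded orthonormal_list_def, of es]
    by (auto simp: in_set_conv_nth nth_eq_iff_index_eq)
next
  assume *: "distinct es \<and> (\<forall>a\<in>set es. \<forall>b\<in>set es. a \<bullet> b = (if a = b then 1 else 0))"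
  show "\<forall>i<length es. \<forall>j<length es. es ! i \<bullet> es ! j = (if i = j then 1 else 0)"
  proof (intro allI impI)
    fix i j assume ij: "i < length es" "j < length es"
    then have "es ! i \<bullet> es ! j = (if es ! i = es ! j then 1 else 0)" using * by (meson nth_mem)
    then show "es ! i \<bullet> es ! j = (if i = j then 1 else 0)" using * ij by (simp add: nth_eq_iff_index_eq)
  qed
qed

text \<open>The definite description is realised by the tangential eigenvalues, sorted together with
  their eigenvectors. It is unique because any admissible list, extended by 0 for the normal, is the
  spectrum of one and the same matrix.\<close>

lemma principal_curvatures_frame:
  assumes y: "y \<in> frontier \<Omega>" "y \<in> U"
  obtains es where "orthonormal_basis (nu y # es)" "length (principal_curvatures \<Omega> y) = CARD('n) - 1"
    "weingarten \<rho> y = spec (nu y # es) (0 # principal_curvatures \<Omega> y)"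
proof -
  let ?A = "weingarten \<rho> y" and ?n = "nu y"
  have sym: "transpose ?A = ?A" by (rule weingarten_symmetric[OF y(2)])
  have nn: "?n \<bullet> ?n = 1" by (rule nu_unit[OF y(2)])
  have A0: "?A *v ?n = 0 *\<^sub>R ?n" using weingarten_normal[OF y(2)] by simp
  have "\<exists>fs. orthonormal_basis ([?n] @ fs) \<and> (\<forall>e\<in>set fs. \<exists>l. ?A *v e = l *\<^sub>R e)"
    by (rule spectral_extend[OF sym]) (use nn A0 in \<open>auto simp: orthonormal_list_def Suc_le_eq simp del: scaleR_zero_left\<close>)
  then obtain fs where fs: "orthonormal_basis (?n # fs)" and eig: "\<forall>e\<in>set fs. \<exists>l. ?A *v e = l *\<^sub>R e"
    by auto
  \<comment> \<open>On a unit eigenvector the quadratic form returns the eigenvalue, so sorting the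
    frame by \<open>q\<close> sorts the curvatures with it.\<close>
  define q where "q e = e \<bullet> (?A *v e)" for e
  define gs where "gs = sort_key q fs"
  define \<kappa> where "\<kappa> = map q gs"
  have sgs: "set gs = set fs" "length gs = length fs" "distinct gs = distinct fs"
    by (simp_all add: gs_def)
  have gs: "orthonormal_basis (?n # gs)"
    using fs sgs unfolding orthonormal_basis_def orthonormal_list_iff by simp
  have lgs: "length gs = CARD('n) - 1" using gs by (auto simp: orthonormal_basis_def)
  have lk: "length \<kappa> = CARD('n) - 1" by (simp add: \<kappa>_def lgs)
  have inn: "(?n # gs) ! i \<bullet> (?n # gs) ! j = (if i = j then 1 else 0)" if "i < CARD('n)" "j < CARD('n)" for i j
    using gs that by (auto simp: orthonormal_basis_def orthonormal_list_def)
  have Ae: "?A *v (gs ! i) = \<kappa> ! i *\<^sub>R gs ! i" if "i < CARD('n) - 1" for i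
  proof -
    have "gs ! i \<in> set fs" unfolding sgs(1)[symmetric] using that lgs by (intro nth_mem) simp
    then obtain l where l: "?A *v (gs ! i) = l *\<^sub>R gs ! i" using eig by blast
    moreover have "gs ! i \<bullet> gs ! i = 1" using inn[of "Suc i" "Suc i"] that by simp
    ultimately show ?thesis using that lgs by (simp add: \<kappa>_def q_def)
  qed
  have spec: "weingarten \<rho> y = spec (?n # gs) (0 # \<kappa>)"
  proof (rule spec_unique[OF gs])
    fix j assume j: "j < CARD('n)"
    show "?A *v ((?n # gs) ! j) = (0 # \<kappa>) ! j *\<^sub>R (?n # gs) ! j"
    proof (cases j)
      case 0
      then show ?thesis using A0 by (simp only: nth_Cons_0)
    next
      case (Suc i)
      then show ?thesis using Ae[of i] j by simp
    qed
  qed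
  have on: "outer_normal \<Omega> y = ?n" by (rule outer_normal_eq[OF ldf op y])
  obtain W where W: "(outer_normal \<Omega> has_derivative W) (at y within frontier \<Omega>)"
    "\<And>v. v \<bullet> nu y = 0 \<Longrightarrow> W v = ?A *v v"
    using normal_derivative[OF y] by blast
  have "principal_curvatures \<Omega> y = \<kappa>"
    unfolding principal_curvatures_def
  proof (rule the_equality)
    have "norm (gs ! i) = 1 \<and> gs ! i \<bullet> outer_normal \<Omega> y = 0 \<and> W (gs ! i) = (\<kappa> ! i) *\<^sub>R gs ! i" if "i < length \<kappa>" for i
    proof -
      have i: "i < CARD('n) - 1" using that lk by simp
      then have t: "gs ! i \<bullet> ?n = 0" using inn[of "Suc i" 0] by (simp only: nth_Cons_Suc nth_Cons_0) simp
      moreover have "norm (gs ! i) = 1" using inn[of "Suc i" "Suc i"] i by (simp add: norm_eq_1)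
      ultimately show ?thesis using W(2)[OF t] Ae[OF i] on by simp
    qed
    moreover have "gs ! i \<bullet> gs ! j = 0" if "i < length \<kappa>" "j < length \<kappa>" "i \<noteq> j" for i j
      using inn[of "Suc i" "Suc j"] that lk by simp
    moreover have "sorted \<kappa>" by (simp add: \<kappa>_def gs_def)
    ultimately show "sorted \<kappa> \<and> length \<kappa> = CARD('n) - 1 \<and>
     (\<exists>W e. (outer_normal \<Omega> has_derivative W) (at y within frontier \<Omega>) \<and>
        (\<forall>i<length \<kappa>. norm (e i) = 1 \<and> e i \<bullet> outer_normal \<Omega> y = 0 \<and> W (e i) = (\<kappa> ! i) *\<^sub>R e i) \<and>
        (\<forall>i<length \<kappa>. \<forall>j<length \<kappa>. i \<noteq> j \<longrightarrow> e i \<bullet> e j = 0))"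
      using lk W(1) by (intro conjI exI[of _ W] exI[of _ "\<lambda>i. gs ! i"]) auto
  next
    fix \<mu>
    assume mu: "sorted \<mu> \<and> length \<mu> = CARD('n) - 1 \<and>
     (\<exists>W e. (outer_normal \<Omega> has_derivative W) (at y within frontier \<Omega>) \<and>
        (\<forall>i<length \<mu>. norm (e i) = 1 \<and> e i \<bullet> outer_normal \<Omega> y = 0 \<and> W (e i) = (\<mu> ! i) *\<^sub>R e i) \<and>
        (\<forall>i<length \<mu>. \<forall>j<length \<mu>. i \<noteq> j \<longrightarrow> e i \<bullet> e j = 0))"
    then obtain W' e where W': "(outer_normal \<Omega> has_derivative W') (at y within frontier \<Omega>)"
      and e': "\<forall>i<length \<mu>. norm (e i) = 1 \<and> e i \<bullet> outer_normal \<Omega> y = 0 \<and> W' (e i) = (\<mu> ! i) *\<^sub>R e i"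
      and oe': "\<forall>i<length \<mu>. \<forall>j<length \<mu>. i \<noteq> j \<longrightarrow> e i \<bullet> e j = 0"
      by (elim conjE exE)
    have e: "norm (e i) = 1 \<and> e i \<bullet> ?n = 0 \<and> W' (e i) = (\<mu> ! i) *\<^sub>R e i" if "i < length \<mu>" for i
      using e'[rule_format, OF that] unfolding on .
    have oe: "e i \<bullet> e j = 0" if "i < length \<mu>" "j < length \<mu>" "i \<noteq> j" for i j
      using oe' that by simp
    have lm: "length \<mu> = CARD('n) - 1" using mu by simp
    define hs where "hs = ?n # map e [0..<length \<mu>]"
    have lh: "length hs = CARD('n)" using lm by (simp add: hs_def)
    have "hs ! i \<bullet> hs ! j = (if i = j then 1 else 0)" if "i < length hs" "j < length hs" for i j
    proof -
      have en: "e m \<bullet> ?n = 0" "?n \<bullet> e m = 0" if "m < length \<mu>" for m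
        using e[OF that] by (simp_all only: inner_commute[of ?n "e m"])
      have ee: "e m \<bullet> e m = 1" if "m < length \<mu>" for m using e[OF that] by (simp add: norm_eq_1)
      have h0: "hs ! 0 = ?n" and hS: "\<And>m. m < length \<mu> \<Longrightarrow> hs ! Suc m = e m" by (simp_all add: hs_def)
      have len: "length hs = Suc (length \<mu>)" by (simp add: hs_def)
      show ?thesis
      proof (cases i)
        case i: 0
        show ?thesis
        proof (cases j)
          case 0
          show ?thesis unfolding i 0 h0 nn by simp
        next
          case (Suc m)
          then have "m < length \<mu>" using that len by simp
          then show ?thesis unfolding i h0 Suc hS[OF \<open>m < length \<mu>\<close>] en(2)[OF \<open>m < length \<mu>\<close>] by simp
        qed
      next
        case (Suc l)
        then have l: "l < length \<mu>" using that len by simp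
        show ?thesis
        proof (cases j)
          case 0
          show ?thesis unfolding Suc 0 h0 hS[OF l] en(1)[OF l] by simp
        next
          case j: (Suc m)
          then have "m < length \<mu>" using that len by simp
          then show ?thesis unfolding Suc j hS[OF l] hS[OF \<open>m < length \<mu>\<close>] using ee oe l by simp
        qed
      qed
    qed
    then have hs: "orthonormal_basis hs" by (simp add: orthonormal_basis_def orthonormal_list_def lh)
    have "?A = spec hs (0 # \<mu>)"
    proof (rule spec_unique[OF hs])
      fix j assume j: "j < CARD('n)"
      show "?A *v (hs ! j) = (0 # \<mu>) ! j *\<^sub>R hs ! j"
      proof (cases j)
        case 0
        then show ?thesis using A0 by (simp only: hs_def nth_Cons_0)
      next
        case (Suc i)
        then have i: "i < length \<mu>" using j lm by simp
        \<comment> \<open>\<open>W\<close> and \<open>W'\<close> may differ off the tangent space;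
          on the tangent vector \<open>e i\<close> they agree.\<close>
        have "?A *v (e i) = W (e i)" using W(2)[of "e i"] e[OF i] by simp
        also have "\<dots> = W' (e i)" by (rule tangential_derivative_unique[OF y W(1) W']) (use e[OF i] in simp)
        finally show ?thesis using Suc i e[OF i] by (simp add: hs_def)
      qed
    qed
    then have "mset (0 # \<mu>) = mset (0 # \<kappa>)"
      using mset_eigenvalues_spec[OF hs, of "0 # \<mu>"] mset_eigenvalues_spec[OF gs, of "0 # \<kappa>"] lm lk spec by simp
    then have "mset \<mu> = mset \<kappa>" by simp
    then show "\<mu> = \<kappa>" using mu by (metis \<kappa>_def gs_def properties_for_sort sorted_sort_key)
  qed
  then show ?thesis using that[OF gs] lk spec by simp
qed

text \<open>The additional eigenvalue 0 in the normal direction leaves elementary symmetric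
  functions unchanged.\<close>

lemma S_curv_eq:
  assumes y: "y \<in> frontier \<Omega>" "y \<in> U"
  shows "S_curv j \<Omega> y = elem_sym j (eigenvalues (weingarten \<rho> y))"
proof -
  obtain es where es: "orthonormal_basis (nu y # es)" "length (principal_curvatures \<Omega> y) = CARD('n) - 1"
    "weingarten \<rho> y = spec (nu y # es) (0 # principal_curvatures \<Omega> y)"
    using principal_curvatures_frame[OF y] .
  have "elem_sym j (eigenvalues (weingarten \<rho> y)) = elem_sym j (0 # principal_curvatures \<Omega> y)"
    unfolding es(3) by (rule elem_sym_eigenvalues_spec[OF es(1)]) (simp add: es(2))
  also have "\<dots> = S_curv j \<Omega> y" by (cases j) (simp_all add: S_curv_def elem_sym_Cons)
  finally show ?thesis by simp
qed

end

lemma S_curv_continuous: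
  fixes \<Omega> :: "(real ^ 'n) set"
  assumes sm: "smooth_bounded_domain \<Omega>"
  shows "continuous_on (frontier \<Omega>) (S_curv j \<Omega>)"
  unfolding continuous_on_eq_continuous_within
proof
  fix x assume x: "x \<in> frontier \<Omega>"
  have op: "open \<Omega>" using sm by (simp add: smooth_bounded_domain_def)
  obtain U \<rho> where ldf: "local_defining_function \<Omega> x U \<rho>" using sm x unfolding smooth_bounded_domain_def by blast
  note D = local_defining_functionD[OF ldf]
  have "continuous_on U (\<lambda>y. elem_sym j (eigenvalues (weingarten \<rho> y)))"
    by (rule continuous_on_elem_sym_eigenvalues[OF weingarten_continuous[OF ldf op] weingarten_symmetric[OF ldf op]])
  then have "continuous_on (frontier \<Omega> \<inter> U) (S_curv j \<Omega>)"
    by (rule continuous_on_eq[OF continuous_on_subset]) (auto simp: S_curv_eq[OF ldf op])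
  then have "continuous (at x within frontier \<Omega> \<inter> U) (S_curv j \<Omega>)"
    using x D(2) by (simp add: continuous_on_eq_continuous_within)
  moreover have "at x within frontier \<Omega> \<inter> U = at x within frontier \<Omega>"
    by (rule at_within_nhd[of x U]) (use D in auto)
  ultimately show "continuous (at x within frontier \<Omega>) (S_curv j \<Omega>)" by simp
qed

lemma frontier_compact_nonempty:
  fixes \<Omega> :: "(real ^ 'n) set"
  assumes sm: "smooth_bounded_domain \<Omega>"
  shows "compact (frontier \<Omega>)" "frontier \<Omega> \<noteq> {}"
proof -
  have "open \<Omega>" "bounded \<Omega>" "\<Omega> \<noteq> {}" using sm by (auto simp: smooth_bounded_domain_def)
  then show "compact (frontier \<Omega>)" "frontier \<Omega> \<noteq> {}"
    using compact_frontier_bounded frontier_eq_empty[of \<Omega>] not_bounded_UNIV by auto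
qed

lemma M_plus_minus:
  fixes \<Omega> :: "(real ^ 'n) set"
  assumes sm: "smooth_bounded_domain \<Omega>"
  shows "\<exists>y\<in>frontier \<Omega>. M_plus j \<Omega> = S_curv j \<Omega> y" "\<exists>y\<in>frontier \<Omega>. M_minus j \<Omega> = S_curv j \<Omega> y"
    "\<And>y. y \<in> frontier \<Omega> \<Longrightarrow> S_curv j \<Omega> y \<le> M_plus j \<Omega>" "\<And>y. y \<in> frontier \<Omega> \<Longrightarrow> M_minus j \<Omega> \<le> S_curv j \<Omega> y"
proof -
  note fc = frontier_compact_nonempty[OF sm] and c = S_curv_continuous[OF sm, of j]
  obtain y1 where y1: "y1 \<in> frontier \<Omega>" "\<And>y. y \<in> frontier \<Omega> \<Longrightarrow> S_curv j \<Omega> y \<le> S_curv j \<Omega> y1"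
    using continuous_attains_sup[OF fc c] by blast
  obtain y2 where y2: "y2 \<in> frontier \<Omega>" "\<And>y. y \<in> frontier \<Omega> \<Longrightarrow> S_curv j \<Omega> y2 \<le> S_curv j \<Omega> y"
    using continuous_attains_inf[OF fc c] by blast
  have 1: "M_plus j \<Omega> = S_curv j \<Omega> y1" unfolding M_plus_def by (rule Greatest_equality) (use y1 in auto)
  have 2: "M_minus j \<Omega> = S_curv j \<Omega> y2" unfolding M_minus_def by (rule Least_equality) (use y2 in auto)
  show "\<exists>y\<in>frontier \<Omega>. M_plus j \<Omega> = S_curv j \<Omega> y" "\<exists>y\<in>frontier \<Omega>. M_minus j \<Omega> = S_curv j \<Omega> y"
    using 1 2 y1 y2 by auto
  show "\<And>y. y \<in> frontier \<Omega> \<Longrightarrow> S_curv j \<Omega> y \<le> M_plus j \<Omega>" "\<And>y. y \<in> frontier \<Omega> \<Longrightarrow> M_minus j \<Omega> \<le> S_curv j \<Omega> y"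
    using 1 2 y1 y2 by auto
qed

section \<open>The distance to the boundary\<close>

text \<open>The number r is both the size of the neighbourhood and the parameter of
  \<open>P\<close>; antitonicity lets the minimum over a finite subcover serve everywhere. Inserting
  1 keeps the minimum defined for an empty cover.\<close>

lemma compact_uniform_radius:
  fixes K :: "'a::metric_space set"
  assumes K: "compact K" and loc: "\<And>x. x \<in> K \<Longrightarrow> \<exists>r>0. \<forall>y\<in>K. dist x y < r \<longrightarrow> P r y"
    and anti: "\<And>r s y. 0 < s \<Longrightarrow> s \<le> r \<Longrightarrow> P r y \<Longrightarrow> P s y"
  shows "\<exists>r>0::real. \<forall>y\<in>K. P r y"
proof -
  obtain R where R: "\<And>x. x \<in> K \<Longrightarrow> R x > 0 \<and> (\<forall>y\<in>K. dist x y < R x \<longrightarrow> P (R x) y)"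
    using loc by metis
  have "K \<subseteq> (\<Union>x\<in>K. ball x (R x))" using R by force
  then obtain D where D: "D \<subseteq> K" "finite D" "K \<subseteq> (\<Union>x\<in>D. ball x (R x))"
    using compactE_image[OF K, of K "\<lambda>x. ball x (R x)"] by auto
  define r where "r = Min (insert 1 (R ` D))"
  have "r > 0" unfolding r_def using D R by (subst Min_gr_iff) auto
  moreover have "P r y" if yK: "y \<in> K" for y
  proof -
    obtain x where x: "x \<in> D" "y \<in> ball x (R x)" using D(3) yK by blast
    then have "P (R x) y" using R D(1) yK by auto
    moreover have "r \<le> R x" unfolding r_def using D x by (intro Min_le) auto
    ultimately show ?thesis using anti \<open>r > 0\<close> by blast
  qed
  ultimately show ?thesis by blast
qed

text \<open>Solves an inequality that is implicit in x. In the application x is, up to sign, the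
  height of a point over the tangent plane, q half the curvature form and w the squared tangential
  length; the height also occurs in the error term of Taylor's formula.\<close>

lemma absorb_error:
  fixes x :: real
  assumes x: "x \<le> q + e * (w + \<bar>x\<bar>)" and q: "\<bar>q\<bar> \<le> b * w" and w: "w \<ge> 0"
    and e: "0 < e" "e \<le> 1/2" "e * (2 + 2 * b) \<le> E"
  shows "x \<le> q + E * w"
proof -
  have x': "x \<le> q + e * w + e * \<bar>x\<bar>" using x by (simp add: algebra_simps)
  have b: "q \<le> b * w" "- (b * w) \<le> q" "b * w \<ge> 0" using q by auto
  have bw: "e * (b * w) \<ge> 0" using b e by simp
  have ew: "e * w \<ge> 0" using e w by simp
  have Ew: "2 * (e * w) + 2 * (e * (b * w)) \<le> E * w"
    using mult_right_mono[OF e(3) w] by (simp add: algebra_simps)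
  have h: "e * c \<le> c / 2" if "c \<ge> 0" for c using mult_right_mono[OF e(2) that] by simp
  show ?thesis
  proof (cases "x \<ge> 0")
    case True
    have "x \<le> 2 * (q + e * w)" using x' True h[of x] by simp
    then have "e * x \<le> e * (2 * (b * w + e * w))" using e b by (intro mult_left_mono) auto
    also have "\<dots> = 2 * (e * (b * w)) + 2 * (e * (e * w))" by (simp add: algebra_simps)
    finally have "e * x \<le> 2 * (e * (b * w)) + e * w" using h[OF ew] by linarith
    then show ?thesis using x' True Ew by simp
  next
    case False
    then have ex: "x + e * x \<le> q + e * w" using x' by simp
    show ?thesis
    proof (cases "q + e * w \<ge> 0")
      case True
      then show ?thesis using False Ew bw ew by linarith
    next
      case neg: False
      have "e * (q + e * w) \<ge> e * (- (b * w))" using b ew e by (intro mult_left_mono) auto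
      then have 1: "- (e * (q + e * w)) \<le> e * (b * w)" by simp
      \<comment> \<open>For negative c = q + e w the factor 1 / (1 + e) may be replaced by 1 - e,
        because (1 + e) (1 - e) c = c - e^2 c >= c.\<close>
      have "(1 + e) * ((q + e * w) - e * (q + e * w)) = (q + e * w) - e * (e * (q + e * w))" by (simp add: algebra_simps)
      also have "\<dots> \<ge> q + e * w" using neg e mult_pos_neg[of e "e * (q + e * w)"] mult_pos_neg[of e "q + e * w"] by auto
      finally have "(1 + e) * x \<le> (1 + e) * ((q + e * w) - e * (q + e * w))" using ex by (simp add: algebra_simps)
      then have "x \<le> (q + e * w) - e * (q + e * w)" using e by simp
      then show ?thesis using 1 Ew ew bw by linarith
    qed
  qed
qed

lemma frame_inner:
  fixes n :: "real ^ 'n"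
  assumes "orthonormal_basis (n # es)"
  shows "v \<bullet> w = (n \<bullet> v) * (n \<bullet> w) + (\<Sum>i<CARD('n) - 1. (es ! i \<bullet> v) * (es ! i \<bullet> w))"
  using orthonormal_basis_inner[OF assms, of v w] sum.lessThan_Suc_shift[of "\<lambda>i. ((n # es) ! i \<bullet> v) * ((n # es) ! i \<bullet> w)" "CARD('n) - 1"]
  by simp

lemma frame_spec_form:
  fixes n :: "real ^ 'n"
  shows "v \<bullet> (spec (n # es) (a # ls) *v v) = a * (n \<bullet> v)\<^sup>2 + (\<Sum>i<CARD('n) - 1. ls ! i * (es ! i \<bullet> v)\<^sup>2)"
  using spec_quadratic_form[of v "n # es" "a # ls"] sum.lessThan_Suc_shift[of "\<lambda>i. (a # ls) ! i * ((n # es) ! i \<bullet> v)\<^sup>2" "CARD('n) - 1"]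
  by simp

lemma frameD:
  fixes n :: "real ^ 'n"
  assumes "orthonormal_basis (n # es)"
  shows "n \<bullet> n = 1" "\<And>i. i < CARD('n) - 1 \<Longrightarrow> n \<bullet> es ! i = 0" "length es = CARD('n) - 1"
    "\<And>i. i < CARD('n) - 1 \<Longrightarrow> es ! i \<bullet> n = 0"
    "\<And>i j. i < CARD('n) - 1 \<Longrightarrow> j < CARD('n) - 1 \<Longrightarrow> es ! i \<bullet> es ! j = (if i = j then 1 else 0)"
proof -
  have len: "length es = CARD('n) - 1" using assms by (auto simp: orthonormal_basis_def)
  have *: "(n # es) ! i \<bullet> (n # es) ! j = (if i = j then 1 else 0)" if "i < Suc (length es)" "j < Suc (length es)" for i j
    using assms that by (auto simp: orthonormal_basis_def orthonormal_list_def)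
  show "n \<bullet> n = 1" using *[of 0 0] by simp
  show "\<And>i. i < CARD('n) - 1 \<Longrightarrow> n \<bullet> es ! i = 0" using *[of 0 "Suc _"] len by simp
  show "\<And>i. i < CARD('n) - 1 \<Longrightarrow> es ! i \<bullet> n = 0" using *[of "Suc _" 0] len by simp
  show "length es = CARD('n) - 1" by (rule len)
  show "\<And>i j. i < CARD('n) - 1 \<Longrightarrow> j < CARD('n) - 1 \<Longrightarrow> es ! i \<bullet> es ! j = (if i = j then 1 else 0)"
    using *[of "Suc _" "Suc _"] len by simp
qed

lemma orthonormal_basis_neg_Cons:
  assumes "orthonormal_basis (n # es)"
  shows "orthonormal_basis ((- n) # es)"
proof -
  have "((- n) # es) ! i \<bullet> ((- n) # es) ! j = (if i = j then 1 else 0)" if "i < Suc (length es)" "j < Suc (length es)" for i j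
  proof -
    have "(n # es) ! i \<bullet> (n # es) ! j = (if i = j then 1 else 0)"
      using assms that by (auto simp: orthonormal_basis_def orthonormal_list_def)
    then show ?thesis by (cases i; cases j) auto
  qed
  then show ?thesis using assms by (auto simp: orthonormal_basis_def orthonormal_list_def)
qed

lemma principal_curvatures_bounded:
  fixes \<Omega> :: "(real ^ 'n) set"
  assumes sm: "smooth_bounded_domain \<Omega>"
  shows "\<exists>B. \<forall>y\<in>frontier \<Omega>. length (principal_curvatures \<Omega> y) = CARD('n) - 1 \<and> (\<forall>a\<in>set (principal_curvatures \<Omega> y). \<bar>a\<bar> \<le> B)"
proof -
  have op: "open \<Omega>" using sm by (simp add: smooth_bounded_domain_def)
  \<comment> \<open>The bound is written 1 / r so that the property weakens as r decreases, as the
    compactness argument requires.\<close>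
  let ?P = "\<lambda>r y. length (principal_curvatures \<Omega> y) = CARD('n) - 1 \<and> (\<forall>a\<in>set (principal_curvatures \<Omega> y). \<bar>a\<bar> \<le> 1 / r)"
  have "\<exists>r>0. \<forall>y\<in>frontier \<Omega>. ?P r y"
  proof (rule compact_uniform_radius[OF frontier_compact_nonempty(1)[OF sm]])
    fix x assume x: "x \<in> frontier \<Omega>"
    obtain U \<rho> where ldf: "local_defining_function \<Omega> x U \<rho>" using sm x unfolding smooth_bounded_domain_def by blast
    note D = local_defining_functionD[OF ldf]
    define M where "M = norm (weingarten \<rho> x) + 1"
    have M: "M > 0" by (simp add: M_def add_nonneg_pos)
    have "isCont (\<lambda>y. norm (weingarten \<rho> y)) x"
      using weingarten_continuous[OF ldf op] D by (simp add: continuous_on_eq_continuous_at isCont_norm)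
    then have "\<forall>\<^sub>F y in nhds x. norm (weingarten \<rho> y) < M \<and> y \<in> U"
      by (intro eventually_conj order_tendstoD(2)[OF isCont_tendsto_nhds] eventually_nhds_in_open D(1,2))
        (auto simp: M_def)
    then obtain d where d: "d > 0" "\<And>y. dist y x < d \<Longrightarrow> norm (weingarten \<rho> y) < M \<and> y \<in> U"
      unfolding eventually_nhds_metric by blast
    have "?P (min d (1 / M)) y" if y: "y \<in> frontier \<Omega>" "dist x y < min d (1 / M)" for y
    proof -
      have yU: "y \<in> U" "norm (weingarten \<rho> y) < M" using d(2)[of y] y by (auto simp: dist_commute)
      obtain es where es: "orthonormal_basis ((gradient \<rho> y /\<^sub>R norm (gradient \<rho> y)) # es)"
        and len: "length (principal_curvatures \<Omega> y) = CARD('n) - 1"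
        and A: "weingarten \<rho> y = spec ((gradient \<rho> y /\<^sub>R norm (gradient \<rho> y)) # es) (0 # principal_curvatures \<Omega> y)"
        using principal_curvatures_frame[OF ldf op y(1) yU(1)] .
      have "\<bar>a\<bar> \<le> 1 / min d (1 / M)" if a: "a \<in> set (principal_curvatures \<Omega> y)" for a
      proof -
        obtain i where i: "i < CARD('n) - 1" "a = principal_curvatures \<Omega> y ! i"
          using a len by (metis in_set_conv_nth)
        let ?e = "es ! i"
        have ee: "norm ?e = 1" using frameD(5)[OF es i(1) i(1)] by (simp add: norm_eq_1)
        have "weingarten \<rho> y *v ?e = a *\<^sub>R ?e"
          using spec_eigenvector[OF es, of "Suc i" "0 # principal_curvatures \<Omega> y"] i A by simp
        then have "\<bar>a\<bar> = norm (weingarten \<rho> y *v ?e)" by (simp add: ee)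
        also have "\<dots> \<le> M" using norm_matrix_vector_le[of "weingarten \<rho> y" ?e] ee yU by simp
        also have "M \<le> 1 / min d (1 / M)" using d M by (simp add: field_simps min_def)
        finally show ?thesis .
      qed
      then show ?thesis using len by blast
    qed
    then show "\<exists>r>0. \<forall>y\<in>frontier \<Omega>. dist x y < r \<longrightarrow> ?P r y"
      using d M by (intro exI[of _ "min d (1 / M)"]) auto
  next
    fix r s y assume "0 < s" "s \<le> r" "?P r y"
    moreover from this have "1 / r \<le> 1 / s" by (intro divide_left_mono) auto
    ultimately show "?P s y" by force
  qed
  then show ?thesis by blast
qed

text \<open>Taylor's formula for \<rho> around a variable point y, divided by the norm of the
  gradient. The error is quadratic in the tangential part of z but only linear in the normal part.
  This allows the Hessian to be traded for its tangential part, since each mixed or normal term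
  carries a factor n \<bullet> z and a second factor of size r.\<close>

lemma local_expansion:
  fixes \<Omega> :: "(real ^ 'n) set"
  assumes ldf: "local_defining_function \<Omega> x U \<rho>" and op: "open \<Omega>" and e: "e > 0"
  shows "\<exists>r>0. \<forall>y. dist x y < r \<longrightarrow> y \<in> U \<and> (\<forall>z. norm z < r \<longrightarrow> y + z \<in> U \<and>
     (\<exists>n. n = gradient \<rho> y /\<^sub>R norm (gradient \<rho> y) \<and>
       \<bar>(\<rho> (y + z) - \<rho> y) / norm (gradient \<rho> y) - n \<bullet> z - (z \<bullet> (weingarten \<rho> y *v z)) / 2\<bar>
          \<le> e * ((norm (z - (n \<bullet> z) *\<^sub>R n))\<^sup>2 + \<bar>n \<bullet> z\<bar>)))"
proof -
  note D = local_defining_functionD[OF ldf]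
  let ?g = "\<lambda>y. norm (gradient \<rho> y)"
  define m where "m = ?g x / 2"
  have m: "m > 0" using D(4)[OF D(2)] by (simp add: m_def)
  define \<omega> where "\<omega> = e * m"
  have \<omega>: "\<omega> > 0" using e m by (simp add: \<omega>_def)
  define h where "h = norm (hessian \<rho> x) + \<omega>"
  have h: "h > 0" using \<omega> by (simp add: h_def add_nonneg_pos)
  have "isCont ?g x" using C2_gradient_continuous[OF D(3)] D(1,2) by (simp add: continuous_on_eq_continuous_at isCont_norm)
  then have "\<forall>\<^sub>F y in nhds x. ?g y > m"
    using m by (intro order_tendstoD(1)[OF isCont_tendsto_nhds]) (auto simp: m_def)
  moreover have "isCont (hessian \<rho>) x" using C2_hessian_continuous[OF D(3)] D(1,2) by (simp add: continuous_on_eq_continuous_at)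
  then have "\<forall>\<^sub>F y in nhds x. dist (hessian \<rho> y) (hessian \<rho> x) < \<omega> / 2"
    using \<omega> by (intro tendstoD) (auto simp: continuous_at tendsto_at_iff_tendsto_nhds)
  ultimately have "\<forall>\<^sub>F y in nhds x. ?g y > m \<and> dist (hessian \<rho> y) (hessian \<rho> x) < \<omega> / 2 \<and> y \<in> U"
    using eventually_nhds_in_open[OF D(1,2)] by eventually_elim auto
  then obtain d where d: "d > 0" "\<And>y. dist y x < d \<Longrightarrow> ?g y > m \<and> dist (hessian \<rho> y) (hessian \<rho> x) < \<omega> / 2 \<and> y \<in> U"
    unfolding eventually_nhds_metric by blast
  \<comment> \<open>Up to the factor |n \<bullet> z| r, the oscillation of the Hessian contributes
    \<omega>, and the two mixed terms and the normal term contribute h each.\<close>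
  define r where "r = min (d / 2) (2 * m * e / (\<omega> + 3 * h))"
  have r: "r > 0" "r \<le> d / 2" "r * (\<omega> + 3 * h) \<le> 2 * m * e"
  proof -
    show "r > 0" "r \<le> d / 2" using d m e \<omega> h by (auto simp: r_def)
    have "r \<le> 2 * m * e / (\<omega> + 3 * h)" by (simp add: r_def)
    then show "r * (\<omega> + 3 * h) \<le> 2 * m * e" using \<omega> h by (simp add: pos_le_divide_eq)
  qed
  show ?thesis
  proof (intro exI[of _ r] conjI allI impI r(1))
    fix y assume y: "dist x y < r"
    have dy: "dist y x < d" using y r d by (simp add: dist_commute)
    then show yU: "y \<in> U" using d(2) by blast
    fix z :: "real ^ 'n" assume z: "norm z < r"
    have seg: "dist (y + s *\<^sub>R z) x < d" if "0 \<le> s" "s \<le> 1" for s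
    proof -
      have "norm (s *\<^sub>R z) \<le> norm z" using that by (simp add: mult_left_le_one_le)
      moreover have "dist (y + s *\<^sub>R z) x \<le> dist y x + norm (s *\<^sub>R z)"
        by (metis add.commute add_diff_cancel_left' dist_norm dist_triangle norm_minus_commute)
      ultimately show ?thesis using y z r by (simp add: dist_commute)
    qed
    from seg[of 1] d(2)[of "y + z"] show "y + z \<in> U" by simp
    obtain s where s: "0 < s" "s < 1" "\<rho> (y + z) = \<rho> y + gradient \<rho> y \<bullet> z + (z \<bullet> (hessian \<rho> (y + s *\<^sub>R z) *v z)) / 2"
      using taylor_second_order[OF D(3,1), of y z] seg d(2) by blast
    define n where "n = gradient \<rho> y /\<^sub>R ?g y"
    define H where "H = hessian \<rho> y"
    define H' where "H' = hessian \<rho> (y + s *\<^sub>R z)"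
    define t where "t = n \<bullet> z"
    define w where "w = z - t *\<^sub>R n"
    have gm: "?g y > m" using d(2)[OF dy] by blast
    have g0: "?g y > 0" using gm m by linarith
    have gn: "gradient \<rho> y = ?g y *\<^sub>R n" using g0 by (simp add: n_def)
    have nn: "n \<bullet> n = 1" unfolding n_def by (rule nu_unit[OF ldf op yU])
    have n1: "norm n = 1" using nn by (simp add: norm_eq_1)
    have zw: "z = w + t *\<^sub>R n" by (simp add: w_def)
    have wn: "w \<bullet> n = 0" by (simp add: w_def inner_diff_left nn t_def inner_commute[of z n])
    have nz2: "(norm z)\<^sup>2 = (norm w)\<^sup>2 + t\<^sup>2"
    proof -
      have "z \<bullet> z = (w + t *\<^sub>R n) \<bullet> (w + t *\<^sub>R n)" by (simp only: zw[symmetric])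
      then show ?thesis unfolding power2_norm_eq_inner
        by (simp add: inner_add_left inner_add_right wn nn inner_commute[of n w] power2_eq_square)
    qed
    have tz: "\<bar>t\<bar> \<le> norm z" using Cauchy_Schwarz_ineq2[of n z] n1 by (simp add: t_def)
    have "(norm w)\<^sup>2 \<le> (norm z)\<^sup>2" using nz2 by simp
    then have wz: "norm w \<le> norm z" by (rule power2_le_imp_le) simp
    have H: "norm H \<le> h" "norm (H' - H) \<le> \<omega>"
    proof -
      have 1: "dist H (hessian \<rho> x) < \<omega> / 2" "dist H' (hessian \<rho> x) < \<omega> / 2"
        using d(2)[OF dy] d(2)[OF seg[of s]] s by (auto simp: H_def H'_def)
      have "norm H \<le> norm (hessian \<rho> x) + dist H (hessian \<rho> x)"
        using norm_triangle_ineq[of "H - hessian \<rho> x" "hessian \<rho> x"] by (simp add: dist_norm)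
      then show "norm H \<le> h" using 1 \<omega> by (simp add: h_def)
      have "norm (H' - H) = dist H' H" by (simp add: dist_norm)
      also have "\<dots> \<le> dist H' (hessian \<rho> x) + dist H (hessian \<rho> x)" by (rule dist_triangle2)
      finally show "norm (H' - H) \<le> \<omega>" using 1 by simp
    qed
    have form: "z \<bullet> (weingarten \<rho> y *v z) = (w \<bullet> (H *v w)) / ?g y"
      unfolding weingarten_form[OF ldf op yU] Let_def n_def[symmetric] t_def[symmetric] w_def[symmetric] H_def ..
    have "(\<rho> (y + z) - \<rho> y) / ?g y - n \<bullet> z - (z \<bullet> (weingarten \<rho> y *v z)) / 2
        = (z \<bullet> (H' *v z) - w \<bullet> (H *v w)) / (2 * ?g y)"
      unfolding form s(3) H'_def using g0 by (subst gn) (simp add: field_simps)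
    also have "z \<bullet> (H' *v z) - w \<bullet> (H *v w) = z \<bullet> ((H' - H) *v z) + (z \<bullet> (H *v z) - w \<bullet> (H *v w))"
      by (simp add: matrix_vector_mult_diff_rdistrib inner_diff_right)
    also have "z \<bullet> (H *v z) - w \<bullet> (H *v w) = t * (n \<bullet> (H *v w)) + t * (w \<bullet> (H *v n)) + t * t * (n \<bullet> (H *v n))"
    proof -
      have "z \<bullet> (H *v z) = (w + t *\<^sub>R n) \<bullet> (H *v (w + t *\<^sub>R n))" by (simp only: zw[symmetric])
      then show ?thesis
        by (simp add: matrix_vector_right_distrib matrix_vector_mult_scaleR inner_add_left inner_add_right algebra_simps)
    qed
    finally have eq: "(\<rho> (y + z) - \<rho> y) / ?g y - n \<bullet> z - (z \<bullet> (weingarten \<rho> y *v z)) / 2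
        = (z \<bullet> ((H' - H) *v z) + (t * (n \<bullet> (H *v w)) + t * (w \<bullet> (H *v n)) + t * t * (n \<bullet> (H *v n)))) / (2 * ?g y)" .
    have hr: "h * norm w \<le> h * r" "h * \<bar>t\<bar> \<le> h * r" "\<bar>t\<bar> \<le> r" using wz tz z h by (auto intro!: mult_left_mono)
    have b1: "\<bar>n \<bullet> (H *v w)\<bar> \<le> h * r"
      using abs_inner_matrix_le[of n H w] n1 mult_right_mono[OF H(1), of "norm w"] hr by simp
    have b2: "\<bar>w \<bullet> (H *v n)\<bar> \<le> h * r"
      using abs_inner_matrix_le[of w H n] n1 mult_right_mono[OF H(1), of "norm w"] hr by simp
    have "\<bar>t * (n \<bullet> (H *v n))\<bar> \<le> \<bar>t\<bar> * h"
      using abs_inner_matrix_le[of n H n] n1 H(1) unfolding abs_mult by (intro mult_left_mono) auto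
    then have b3: "\<bar>t * (n \<bullet> (H *v n))\<bar> \<le> h * r" using hr by (simp add: mult.commute)
    have "t * (n \<bullet> (H *v w)) + t * (w \<bullet> (H *v n)) + t * t * (n \<bullet> (H *v n))
       = t * (n \<bullet> (H *v w) + w \<bullet> (H *v n) + t * (n \<bullet> (H *v n)))" by (simp add: algebra_simps)
    then have c1: "\<bar>t * (n \<bullet> (H *v w)) + t * (w \<bullet> (H *v n)) + t * t * (n \<bullet> (H *v n))\<bar> \<le> \<bar>t\<bar> * (3 * (h * r))"
    proof -
      have "\<bar>n \<bullet> (H *v w) + w \<bullet> (H *v n) + t * (n \<bullet> (H *v n))\<bar> \<le> 3 * (h * r)" using b1 b2 b3 by linarith
      then have "\<bar>t\<bar> * \<bar>n \<bullet> (H *v w) + w \<bullet> (H *v n) + t * (n \<bullet> (H *v n))\<bar> \<le> \<bar>t\<bar> * (3 * (h * r))"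
        by (intro mult_left_mono) auto
      then show ?thesis unfolding \<open>t * (n \<bullet> (H *v w)) + t * (w \<bullet> (H *v n)) + t * t * (n \<bullet> (H *v n)) = _\<close> abs_mult[of t] .
    qed
    have "\<bar>z \<bullet> ((H' - H) *v z)\<bar> \<le> \<omega> * (norm z)\<^sup>2"
      using abs_inner_matrix_le[of z "H' - H" z] mult_right_mono[OF H(2), of "(norm z)\<^sup>2"] by (simp add: power2_eq_square mult.assoc)
    also have "\<dots> = \<omega> * (norm w)\<^sup>2 + \<omega> * (\<bar>t\<bar> * \<bar>t\<bar>)" unfolding nz2 by (simp add: distrib_left power2_eq_square)
    also have "\<dots> \<le> \<omega> * (norm w)\<^sup>2 + \<omega> * (\<bar>t\<bar> * r)" using hr \<omega> by (intro add_left_mono mult_left_mono) auto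
    finally have c2: "\<bar>z \<bullet> ((H' - H) *v z)\<bar> \<le> \<omega> * (norm w)\<^sup>2 + \<omega> * (\<bar>t\<bar> * r)" .
    have "\<bar>z \<bullet> ((H' - H) *v z) + (t * (n \<bullet> (H *v w)) + t * (w \<bullet> (H *v n)) + t * t * (n \<bullet> (H *v n)))\<bar>
       \<le> \<omega> * (norm w)\<^sup>2 + \<bar>t\<bar> * (r * (\<omega> + 3 * h))"
      using c1 c2 by (simp add: algebra_simps)
    also have "\<dots> \<le> (e * m) * (norm w)\<^sup>2 + \<bar>t\<bar> * (2 * m * e)"
      unfolding \<omega>_def[symmetric] using r(3) by (intro add_left_mono mult_left_mono) auto
    also have "\<dots> \<le> (2 * m) * (e * ((norm w)\<^sup>2 + \<bar>t\<bar>))"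
      using m e by (simp add: algebra_simps)
    also have "\<dots> \<le> (2 * ?g y) * (e * ((norm w)\<^sup>2 + \<bar>t\<bar>))"
      using gm e by (intro mult_right_mono) auto
    finally have "\<bar>(\<rho> (y + z) - \<rho> y) / ?g y - n \<bullet> z - (z \<bullet> (weingarten \<rho> y *v z)) / 2\<bar> \<le> e * ((norm w)\<^sup>2 + \<bar>t\<bar>)"
      unfolding eq abs_divide using g0 by (simp add: pos_divide_le_eq mult.commute)
    then show "\<exists>n. n = gradient \<rho> y /\<^sub>R norm (gradient \<rho> y) \<and>
       \<bar>(\<rho> (y + z) - \<rho> y) / norm (gradient \<rho> y) - n \<bullet> z - (z \<bullet> (weingarten \<rho> y *v z)) / 2\<bar>
          \<le> e * ((norm (z - (n \<bullet> z) *\<^sub>R n))\<^sup>2 + \<bar>n \<bullet> z\<bar>)"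
      using n_def by (intro exI[of _ n]) (simp only: w_def t_def)
  qed
qed

text \<open>The boundary near y as a graph over its tangent plane along the inner normal, with a
  radius uniform in y. Taylor's formula relates the height to the sign of \<rho>, and
  \<open>absorb_error\<close> removes the height from its own error term.\<close>

lemma frame_expansion:
  fixes \<Omega> :: "(real ^ 'n) set"
  assumes sm: "smooth_bounded_domain \<Omega>" and E: "E > 0"
  defines "\<kappa> \<equiv> principal_curvatures \<Omega>"
  shows "\<exists>r>0. \<forall>y\<in>frontier \<Omega>. \<exists>n es. orthonormal_basis (n # es) \<and> (\<forall>z. norm z < r \<longrightarrow>
     (y + z \<notin> \<Omega> \<longrightarrow> n \<bullet> z \<le> (\<Sum>i<CARD('n) - 1. \<kappa> y ! i * (es ! i \<bullet> z)\<^sup>2) / 2 + E * (\<Sum>i<CARD('n) - 1. (es ! i \<bullet> z)\<^sup>2)) \<and>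
     (y + z \<in> \<Omega> \<longrightarrow> n \<bullet> z \<ge> (\<Sum>i<CARD('n) - 1. \<kappa> y ! i * (es ! i \<bullet> z)\<^sup>2) / 2 - E * (\<Sum>i<CARD('n) - 1. (es ! i \<bullet> z)\<^sup>2)))"
    (is "\<exists>r>0. \<forall>y\<in>frontier \<Omega>. ?P r y")
proof -
  have op: "open \<Omega>" using sm by (simp add: smooth_bounded_domain_def)
  obtain B where B: "\<And>y. y \<in> frontier \<Omega> \<Longrightarrow> length (\<kappa> y) = CARD('n) - 1 \<and> (\<forall>a\<in>set (\<kappa> y). \<bar>a\<bar> \<le> B)"
    using principal_curvatures_bounded[OF sm] unfolding \<kappa>_def by blast
  define b where "b = \<bar>B\<bar>"
  \<comment> \<open>The two constraints under which \<open>absorb_error\<close> turns the error e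
    into E.\<close>
  define e where "e = min (1/2) (E / (2 + 2 * b))"
  have b0: "b \<ge> 0" by (simp add: b_def)
  have e: "0 < e" "e \<le> 1/2" using E b0 min.cobounded1[of "1/2" "E / (2 + 2 * b)"] unfolding e_def by simp_all
  have eE: "e * (2 + 2 * b) \<le> E"
  proof -
    have "e \<le> E / (2 + 2 * b)" by (simp add: e_def)
    then show ?thesis using b0 by (simp add: pos_le_divide_eq)
  qed
  show ?thesis
  proof (rule compact_uniform_radius[OF frontier_compact_nonempty(1)[OF sm]])
    fix x assume x: "x \<in> frontier \<Omega>"
    obtain U \<rho> where ldf: "local_defining_function \<Omega> x U \<rho>" using sm x unfolding smooth_bounded_domain_def by blast
    note D = local_defining_functionD[OF ldf]
    obtain r where r: "r > 0" and R: "\<forall>y. dist x y < r \<longrightarrow> y \<in> U \<and> (\<forall>z. norm z < r \<longrightarrow> y + z \<in> U \<and>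
     (\<exists>n. n = gradient \<rho> y /\<^sub>R norm (gradient \<rho> y) \<and>
       \<bar>(\<rho> (y + z) - \<rho> y) / norm (gradient \<rho> y) - n \<bullet> z - (z \<bullet> (weingarten \<rho> y *v z)) / 2\<bar>
          \<le> e * ((norm (z - (n \<bullet> z) *\<^sub>R n))\<^sup>2 + \<bar>n \<bullet> z\<bar>)))"
      using local_expansion[OF ldf op e(1)] by blast
    have "?P r y" if y: "y \<in> frontier \<Omega>" "dist x y < r" for y
    proof -
      have yU: "y \<in> U" using R y by blast
      define \<nu> where "\<nu> = gradient \<rho> y /\<^sub>R norm (gradient \<rho> y)"
      \<comment> \<open>The inner normal, so that heights into \<Omega> are positive.\<close>
      define n where "n = - \<nu>"
      obtain es where es0: "orthonormal_basis (\<nu> # es)"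
        and A: "weingarten \<rho> y = spec (\<nu> # es) (0 # \<kappa> y)"
        using principal_curvatures_frame[OF ldf op y(1) yU] unfolding \<nu>_def \<kappa>_def by metis
      have es: "orthonormal_basis (n # es)" unfolding n_def by (rule orthonormal_basis_neg_Cons[OF es0])
      have g0: "norm (gradient \<rho> y) > 0" using D(4)[OF yU] by simp
      have \<rho>0: "\<rho> y = 0" by (rule local_defining_function_zero(1)[OF ldf op y(1) yU])
      have "(y + z \<notin> \<Omega> \<longrightarrow> n \<bullet> z \<le> (\<Sum>i<CARD('n) - 1. \<kappa> y ! i * (es ! i \<bullet> z)\<^sup>2) / 2 + E * (\<Sum>i<CARD('n) - 1. (es ! i \<bullet> z)\<^sup>2)) \<and>
     (y + z \<in> \<Omega> \<longrightarrow> n \<bullet> z \<ge> (\<Sum>i<CARD('n) - 1. \<kappa> y ! i * (es ! i \<bullet> z)\<^sup>2) / 2 - E * (\<Sum>i<CARD('n) - 1. (es ! i \<bullet> z)\<^sup>2))"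
        if z: "norm z < r" for z
      proof -
        define t where "t = n \<bullet> z"
        define w where "w = (\<Sum>i<CARD('n) - 1. (es ! i \<bullet> z)\<^sup>2)"
        define q where "q = (\<Sum>i<CARD('n) - 1. \<kappa> y ! i * (es ! i \<bullet> z)\<^sup>2)"
        have w0: "w \<ge> 0" unfolding w_def by (intro sum_nonneg) auto
        have form: "z \<bullet> (weingarten \<rho> y *v z) = q" unfolding A frame_spec_form q_def by simp
        have nz: "\<nu> \<bullet> z = - t" by (simp add: t_def n_def)
        have "(norm z)\<^sup>2 = t\<^sup>2 + w"
          unfolding power2_norm_eq_inner frame_inner[OF es, of z z] by (simp add: t_def w_def power2_eq_square)
        moreover have "(norm (z - (\<nu> \<bullet> z) *\<^sub>R \<nu>))\<^sup>2 = (norm z)\<^sup>2 - t\<^sup>2"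
          using frameD(1)[OF es0] unfolding power2_norm_eq_inner
          by (simp add: inner_diff_left inner_diff_right inner_add_left inner_add_right nz inner_commute[of z \<nu>] power2_eq_square)
        ultimately have nw: "(norm (z - (\<nu> \<bullet> z) *\<^sub>R \<nu>))\<^sup>2 = w" by simp
        have zU: "y + z \<in> U" and
          "\<bar>(\<rho> (y + z) - \<rho> y) / norm (gradient \<rho> y) - \<nu> \<bullet> z - (z \<bullet> (weingarten \<rho> y *v z)) / 2\<bar>
            \<le> e * ((norm (z - (\<nu> \<bullet> z) *\<^sub>R \<nu>))\<^sup>2 + \<bar>\<nu> \<bullet> z\<bar>)"
          using R y z unfolding \<nu>_def by blast+
        then have main: "\<bar>\<rho> (y + z) / norm (gradient \<rho> y) + t - q / 2\<bar> \<le> e * (w + \<bar>t\<bar>)"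
          unfolding nw form unfolding nz \<rho>0 by simp
        have qb: "\<bar>q / 2\<bar> \<le> b * w"
        proof -
          have "\<bar>q\<bar> \<le> (\<Sum>i<CARD('n) - 1. \<bar>\<kappa> y ! i * (es ! i \<bullet> z)\<^sup>2\<bar>)" unfolding q_def by (rule sum_abs)
          also have "\<dots> \<le> (\<Sum>i<CARD('n) - 1. b * (es ! i \<bullet> z)\<^sup>2)"
          proof (rule sum_mono)
            fix i assume "i \<in> {..<CARD('n) - 1}"
            then have "\<kappa> y ! i \<in> set (\<kappa> y)" using B[OF y(1)] by simp
            then have "\<bar>\<kappa> y ! i\<bar> \<le> B" using B[OF y(1)] by blast
            then have "\<bar>\<kappa> y ! i\<bar> \<le> b" unfolding b_def by linarith
            then show "\<bar>\<kappa> y ! i * (es ! i \<bullet> z)\<^sup>2\<bar> \<le> b * (es ! i \<bullet> z)\<^sup>2"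
              unfolding abs_mult by (simp add: mult_right_mono)
          qed
          also have "\<dots> = b * w" by (simp add: w_def sum_distrib_left)
          finally show ?thesis by simp
        qed
        have "t \<le> q / 2 + E * w" if "y + z \<notin> \<Omega>"
        proof -
          have "\<rho> (y + z) / norm (gradient \<rho> y) \<ge> 0" using that D(5)[OF zU] g0 by simp
          then have "t \<le> q / 2 + e * (w + \<bar>t\<bar>)" using main by linarith
          then show ?thesis by (rule absorb_error[OF _ qb w0 e eE])
        qed
        moreover have "- t \<le> - (q / 2) + E * w" if "y + z \<in> \<Omega>"
        proof -
          have "\<rho> (y + z) / norm (gradient \<rho> y) < 0" using that D(5)[OF zU] g0 by (simp add: divide_neg_pos)
          then have "- t \<le> - (q / 2) + e * (w + \<bar>- t\<bar>)" using main unfolding abs_minus_cancel by linarith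
          then show ?thesis by (rule absorb_error[OF _ _ w0 e eE]) (use qb in simp)
        qed
        ultimately show ?thesis unfolding w_def[symmetric] q_def[symmetric] t_def[symmetric] by linarith
      qed
      then show ?thesis using es by blast
    qed
    then show "\<exists>r>0. \<forall>y\<in>frontier \<Omega>. dist x y < r \<longrightarrow> ?P r y" using r by blast
  next
    fix r s :: real and y assume rs: "0 < s" "s \<le> r" and P: "?P r y"
    have "norm z < r" if "norm z < s" for z :: "real ^ 'n" using that rs by simp
    with P show "?P s y" by blast
  qed
qed

section \<open>Nearest boundary points and polynomials touching the distance\<close>

lemma infdist_frontier_attained:
  fixes \<Omega> :: "(real ^ 'n) set"
  assumes sm: "smooth_bounded_domain \<Omega>"
  obtains y where "y \<in> frontier \<Omega>" "bdist \<Omega> x = dist x y"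
  using infdist_attains_inf[of "frontier \<Omega>" x] frontier_compact_nonempty[OF sm] unfolding bdist_def by auto

text \<open>The segment from x to a point outside \<Omega> crosses the frontier.\<close>

lemma bdist_le_dist:
  fixes \<Omega> :: "(real ^ 'n) set"
  assumes "x \<in> \<Omega>" "p \<notin> \<Omega>"
  shows "bdist \<Omega> x \<le> dist x p"
proof -
  have "closed_segment x p \<inter> frontier \<Omega> \<noteq> {}"
    using assms by (intro connected_Int_frontier) auto
  then obtain q where q: "q \<in> closed_segment x p" "q \<in> frontier \<Omega>" by blast
  have "bdist \<Omega> x \<le> dist x q" unfolding bdist_def by (rule infdist_le[OF q(2)])
  also have "\<dots> \<le> dist x p" using q(1) by (metis dist_commute dist_in_closed_segment dist_norm norm_minus_commute)
  finally show ?thesis .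
qed

lemma bdist_pos:
  fixes \<Omega> :: "(real ^ 'n) set"
  assumes sm: "smooth_bounded_domain \<Omega>" and x: "x \<in> \<Omega>"
  shows "bdist \<Omega> x > 0"
proof -
  have "open \<Omega>" using sm by (simp add: smooth_bounded_domain_def)
  then have "x \<notin> frontier \<Omega>" using x by (simp add: frontier_def interior_open)
  then show ?thesis unfolding bdist_def
    using infdist_pos_not_in_closed[of "frontier \<Omega>" x] frontier_compact_nonempty[OF sm] by (simp add: compact_imp_closed)
qed

lemma ball_bdist_subset:
  fixes \<Omega> :: "(real ^ 'n) set"
  assumes "x \<in> \<Omega>"
  shows "ball x (bdist \<Omega> x) \<subseteq> \<Omega>"
  using bdist_le_dist[OF assms] by force

text \<open>The ball about x through y lies in \<Omega>. A direction pointing from y into this ball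
  therefore enters \<Omega> and, up to second-order terms that vanish in the limit, is not directed
  against n; the half-space lemma does the rest.\<close>

lemma nearest_point_normal:
  fixes \<Omega> :: "(real ^ 'n) set"
  assumes x: "x \<in> \<Omega>" and y: "y \<notin> \<Omega>" "bdist \<Omega> x = dist x y" and r: "r > 0"
    and fr: "orthonormal_basis (n # es)"
    and inside: "\<And>z. norm z < r \<Longrightarrow> y + z \<in> \<Omega> \<Longrightarrow>
      n \<bullet> z \<ge> (\<Sum>i<CARD('n) - 1. k ! i * (es ! i \<bullet> z)\<^sup>2) / 2 - E * (\<Sum>i<CARD('n) - 1. (es ! i \<bullet> z)\<^sup>2)"
  shows "x - y = bdist \<Omega> x *\<^sub>R n"
proof -
  define a where "a = x - y"
  have a0: "a \<noteq> 0" using x y by (auto simp: a_def)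
  have na: "norm a = bdist \<Omega> x" by (simp add: y(2) a_def dist_norm)
  have nn: "norm n = 1" using frameD(1)[OF fr] by (simp add: norm_eq_1)
  have "n = norm n *\<^sub>R (a /\<^sub>R norm a)"
  proof (rule parallel_if_half_space[OF a0])
    fix v assume av: "a \<bullet> v < 0"
    define w where "w = - v"
    have aw: "a \<bullet> w > 0" using av by (simp add: w_def)
    define c where "c = (\<Sum>i<CARD('n) - 1. k ! i * (es ! i \<bullet> w)\<^sup>2) / 2 - E * (\<Sum>i<CARD('n) - 1. (es ! i \<bullet> w)\<^sup>2)"
    have "s * c \<le> n \<bullet> w" if s: "0 < s" "s * norm w < r" "s * (w \<bullet> w) < 2 * (a \<bullet> w)" for s
    proof -
      have "(norm (a - s *\<^sub>R w))\<^sup>2 < (norm a)\<^sup>2"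
      proof -
        have "s * (s * (w \<bullet> w)) < s * (2 * (a \<bullet> w))" using s by (intro mult_strict_left_mono)
        then show ?thesis unfolding power2_norm_eq_inner
          by (simp add: inner_diff_left inner_diff_right inner_commute[of w a] algebra_simps)
      qed
      then have "norm (a - s *\<^sub>R w) < norm a" by (rule power2_less_imp_less) simp
      then have "y + s *\<^sub>R w \<in> ball x (bdist \<Omega> x)" by (simp add: na[symmetric] dist_norm a_def algebra_simps)
      then have "y + s *\<^sub>R w \<in> \<Omega>" using ball_bdist_subset[OF x] by blast
      moreover have "norm (s *\<^sub>R w) < r" using s by simp
      ultimately have "n \<bullet> (s *\<^sub>R w) \<ge> (\<Sum>i<CARD('n) - 1. k ! i * (es ! i \<bullet> (s *\<^sub>R w))\<^sup>2) / 2 - E * (\<Sum>i<CARD('n) - 1. (es ! i \<bullet> (s *\<^sub>R w))\<^sup>2)"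
        by (rule inside[rotated])
      also have "(\<Sum>i<CARD('n) - 1. k ! i * (es ! i \<bullet> (s *\<^sub>R w))\<^sup>2) = s * s * (\<Sum>i<CARD('n) - 1. k ! i * (es ! i \<bullet> w)\<^sup>2)"
        by (simp add: sum_distrib_left power_mult_distrib power2_eq_square mult_ac)
      also have "(\<Sum>i<CARD('n) - 1. (es ! i \<bullet> (s *\<^sub>R w))\<^sup>2) = s * s * (\<Sum>i<CARD('n) - 1. (es ! i \<bullet> w)\<^sup>2)"
        by (simp add: sum_distrib_left power_mult_distrib power2_eq_square mult_ac)
      finally have "s * (s * c) \<le> s * (n \<bullet> w)" by (simp add: c_def algebra_simps)
      then show ?thesis using s by simp
    qed
    moreover have "\<forall>\<^sub>F s in at_right 0. 0 < s \<and> s * norm w < r \<and> s * (w \<bullet> w) < 2 * (a \<bullet> w)"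
    proof (intro eventually_conj)
      have 1: "((\<lambda>s. s * norm w) \<longlongrightarrow> 0) (at_right 0)" "((\<lambda>s. s * (w \<bullet> w)) \<longlongrightarrow> 0) (at_right 0)"
        by (auto intro!: tendsto_eq_intros)
      show "\<forall>\<^sub>F s in at_right 0. s * norm w < r" "\<forall>\<^sub>F s in at_right 0. s * (w \<bullet> w) < 2 * (a \<bullet> w)"
        using order_tendstoD(2)[OF 1(1) r] order_tendstoD(2)[OF 1(2), of "2 * (a \<bullet> w)"] aw by auto
    qed (auto simp: eventually_at_right_less)
    ultimately have "\<forall>\<^sub>F s in at_right 0. s * c \<le> n \<bullet> w" by (auto elim: eventually_mono)
    moreover have "((\<lambda>s. s * c) \<longlongrightarrow> 0) (at_right 0)" by (auto intro!: tendsto_eq_intros)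
    ultimately have "0 \<le> n \<bullet> w" by (intro tendsto_upperbound) auto
    then show "n \<bullet> v \<le> 0" by (simp add: w_def)
  qed
  then have "n = a /\<^sub>R norm a" using nn by simp
  then show ?thesis using a0 unfolding na[symmetric] a_def[symmetric] by simp
qed

text \<open>A function with gradient of length at most one that is nonpositive off \<open>\<Omega>\<close> lies below the
  distance to the boundary. The term \<open>K t w\<close> compensates the excess of the squared gradient of
  \<open>t - q / 2\<close> over one.\<close>

lemma barrier_lipschitz:
  fixes n :: "real ^ 'n"
  assumes fr: "orthonormal_basis (n # es)" and bd: "\<And>i. i < CARD('n) - 1 \<Longrightarrow> \<bar>k ! i\<bar> \<le> b"
    and b: "b \<ge> 0" and K: "K = (b + 1)\<^sup>2 + 1" and r: "K * r \<le> 1"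
    and uv: "norm u < r" "norm v < r"
  defines "\<phi> \<equiv> \<lambda>z. n \<bullet> z - (\<Sum>i<CARD('n) - 1. k ! i * (es ! i \<bullet> z)\<^sup>2) / 2 - K / 2 * (n \<bullet> z) * (\<Sum>i<CARD('n) - 1. (es ! i \<bullet> z)\<^sup>2)"
  shows "\<phi> u - \<phi> v \<le> norm (u - v)"
proof -
  let ?N = "CARD('n) - 1"
  define w where "w = u - v"
  define z where "z s = v + s *\<^sub>R w" for s
  define om where "om s = (\<Sum>i<?N. (es ! i \<bullet> z s)\<^sup>2)" for s
  define D where "D s = n \<bullet> w - (\<Sum>i<?N. k ! i * (2 * (es ! i \<bullet> z s) * (es ! i \<bullet> w))) / 2
     - (K / 2 * (n \<bullet> w) * om s + K / 2 * (n \<bullet> z s) * (\<Sum>i<?N. 2 * (es ! i \<bullet> z s) * (es ! i \<bullet> w)))" for s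
  have K0: "K > 0" using b by (simp add: K add_nonneg_pos)
  have der: "((\<lambda>s. \<phi> (z s)) has_real_derivative D s) (at s)" for s
  proof -
    have 1: "((\<lambda>s. a \<bullet> z s) has_real_derivative a \<bullet> w) (at s)" for a
      unfolding z_def inner_add_right inner_scaleR_right by (auto intro!: derivative_eq_intros)
    have q: "((\<lambda>s. (es ! i \<bullet> z s)\<^sup>2) has_real_derivative 2 * (es ! i \<bullet> z s) * (es ! i \<bullet> w)) (at s)" for i
      by (auto intro!: derivative_eq_intros 1)
    have 2: "((\<lambda>s. \<Sum>i<?N. k ! i * (es ! i \<bullet> z s)\<^sup>2) has_real_derivative (\<Sum>i<?N. k ! i * (2 * (es ! i \<bullet> z s) * (es ! i \<bullet> w)))) (at s)"
      by (intro DERIV_sum DERIV_cmult q)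
    have 3: "(om has_real_derivative (\<Sum>i<?N. 2 * (es ! i \<bullet> z s) * (es ! i \<bullet> w))) (at s)"
      unfolding om_def[abs_def] by (intro DERIV_sum q)
    have "\<phi> (z s) = n \<bullet> z s - (\<Sum>i<?N. k ! i * (es ! i \<bullet> z s)\<^sup>2) / 2 - K / 2 * (n \<bullet> z s) * om s" for s
      by (simp add: \<phi>_def om_def)
    then have eq: "(\<lambda>s. \<phi> (z s)) = (\<lambda>s. n \<bullet> z s - (\<Sum>i<?N. k ! i * (es ! i \<bullet> z s)\<^sup>2) / 2 - K / 2 * (n \<bullet> z s) * om s)"
      by (rule ext)
    note d = DERIV_diff[OF DERIV_diff[OF 1[of n] DERIV_cdivide[OF 2, of 2]] DERIV_mult[OF DERIV_cmult[OF 1[of n], of "K / 2"] 3]]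
    show ?thesis unfolding D_def eq by (rule DERIV_cong[OF d]) simp
  qed
  have bound: "D s \<le> norm w" if s: "0 \<le> s" "s \<le> 1" for s
  proof -
    have zr: "norm (z s) < r"
    proof -
      have "z s = (1 - s) *\<^sub>R v + s *\<^sub>R u" by (simp add: z_def w_def algebra_simps)
      then have "z s \<in> ball 0 r"
        using convexD_alt[OF convex_ball, of v 0 r u s] uv s by simp
      then show ?thesis by simp
    qed
    define t where "t = n \<bullet> z s"
    define zi where "zi i = es ! i \<bullet> z s" for i
    define wi where "wi i = es ! i \<bullet> w" for i
    have nn: "norm n = 1" using frameD(1)[OF fr] by (simp add: norm_eq_1)
    have "norm (z s) * norm (z s) = t * t + om s"
      unfolding om_def t_def power2_eq_square using frame_inner[OF fr, of "z s" "z s"] by (simp add: dot_square_norm power2_eq_square)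
    then have "t * t + om s < r * r" using mult_strict_mono'[OF zr zr] by simp
    then have omz: "om s \<le> r * r" using zero_le_square[of t] by linarith
    have om0: "om s \<ge> 0" unfolding om_def by (intro sum_nonneg) auto
    have tr: "\<bar>t\<bar> \<le> r" using Cauchy_Schwarz_ineq2[of n "z s"] nn zr by (simp add: t_def)
    have r0: "r > 0" using zr by (meson norm_ge_zero order_le_less_trans)
    \<comment> \<open>\<open>A\<close> and \<open>c i\<close> are the normal and tangential
      components of the gradient of \<phi> at \<open>z s\<close>.\<close>
    define A where "A = 1 - K / 2 * om s"
    define c where "c i = - ((k ! i + K * t) * zi i)" for i
    have Deq: "D s = A * (n \<bullet> w) + (\<Sum>i<?N. c i * wi i)"
      unfolding D_def A_def c_def zi_def[symmetric] wi_def[symmetric] t_def[symmetric]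
      by (simp add: algebra_simps sum.distrib sum_distrib_left sum_negf sum_subtractf sum_divide_distrib)
    have csum: "(\<Sum>i<?N. (c i)\<^sup>2) \<le> (b + 1)\<^sup>2 * om s"
      unfolding om_def sum_distrib_left
    proof (rule sum_mono)
      fix i assume i: "i \<in> {..<?N}"
      have "\<bar>k ! i + K * t\<bar> \<le> \<bar>k ! i\<bar> + K * \<bar>t\<bar>" using K0 by (simp add: abs_mult order_trans[OF abs_triangle_ineq])
      also have "\<dots> \<le> b + K * r" using bd[of i] i tr K0 by (intro add_mono mult_left_mono) auto
      also have "\<dots> \<le> b + 1" using r by simp
      finally have "\<bar>k ! i + K * t\<bar> \<le> \<bar>b + 1\<bar>" using b by simp
      then have "(k ! i + K * t)\<^sup>2 \<le> (b + 1)\<^sup>2" by (simp only: abs_le_square_iff)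
      then show "(c i)\<^sup>2 \<le> (b + 1)\<^sup>2 * (es ! i \<bullet> z s)\<^sup>2"
        unfolding c_def zi_def power2_minus power_mult_distrib by (intro mult_right_mono) auto
    qed
    have Ko: "K * om s \<le> 1"
    proof -
      have "K * om s \<le> K * (r * r)" using omz K0 by (intro mult_left_mono) auto
      also have "\<dots> = (K * r) * r" by simp
      also have "\<dots> \<le> 1 * r" using r r0 by (intro mult_right_mono) auto
      also have "r \<le> K * r" using r0 b by (simp add: K mult_le_cancel_right1)
      finally show ?thesis using r by simp
    qed
    have "A\<^sup>2 + (\<Sum>i<?N. (c i)\<^sup>2) \<le> 1"
    \<comment> \<open>The loss K om in the squared normal component, with K = (b + 1)^2 + 1, pays (b
      + 1)^2 om for the tangential components and om for the remainder (K om)^2 / 4.\<close>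
    proof -
      have "A\<^sup>2 = 1 - K * om s + (K * om s) * (K * om s) / 4" by (simp add: A_def power2_eq_square algebra_simps)
      moreover have "(K * om s) * (K * om s) \<le> om s"
      proof -
        have "K * K * om s \<le> K * K * (r * r)" using omz K0 by (intro mult_left_mono) auto
        also have "\<dots> = (K * r) * (K * r)" by simp
        also have "\<dots> \<le> 1 * 1" using r r0 K0 by (intro mult_mono) auto
        finally have "K * K * om s * om s \<le> 1 * om s" using om0 by (intro mult_right_mono) auto
        then show ?thesis by (simp add: mult_ac)
      qed
      moreover have "K * om s = (b + 1)\<^sup>2 * om s + om s" by (simp add: K algebra_simps)
      ultimately show ?thesis using csum om0 by linarith
    qed
    moreover have "(D s)\<^sup>2 \<le> (A\<^sup>2 + (\<Sum>i<?N. (c i)\<^sup>2)) * (w \<bullet> w)"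
    proof -
      \<comment> \<open>Cauchy-Schwarz with the normal component placed at index 0.\<close>
      have "(\<Sum>i<Suc ?N. (case i of 0 \<Rightarrow> A | Suc j \<Rightarrow> c j) * (case i of 0 \<Rightarrow> n \<bullet> w | Suc j \<Rightarrow> wi j))\<^sup>2
        \<le> (\<Sum>i<Suc ?N. (case i of 0 \<Rightarrow> A | Suc j \<Rightarrow> c j)\<^sup>2) * (\<Sum>i<Suc ?N. (case i of 0 \<Rightarrow> n \<bullet> w | Suc j \<Rightarrow> wi j)\<^sup>2)"
        by (rule Cauchy_Schwarz_ineq_sum)
      then show ?thesis
        unfolding Deq sum.lessThan_Suc_shift frame_inner[OF fr, of w w] by (simp add: wi_def power2_eq_square)
    qed
    ultimately have "(D s)\<^sup>2 \<le> 1 * (w \<bullet> w)"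
      by (meson inner_ge_zero mult_right_mono order_trans)
    then have "(D s)\<^sup>2 \<le> (norm w)\<^sup>2" by (simp add: power2_norm_eq_inner)
    then show ?thesis by (rule power2_le_imp_le) simp
  qed
  obtain s where s: "0 < s" "s < 1" "\<phi> (z 1) - \<phi> (z 0) = (1 - 0) * D s"
    using MVT2[of 0 1 "\<lambda>s. \<phi> (z s)" D] der by auto
  have "\<phi> u - \<phi> v = D s" using s(3) by (simp add: z_def w_def)
  then show ?thesis using bound[of s] s by (simp add: w_def)
qed

text \<open>Upper polynomial: going back from x + s v along the normal by its value leads out of
  \<Omega>. Lower polynomial: a barrier with curvatures raised by \<sigma> / 2 has slope at most one
  and is nonpositive at the nearest boundary point of x + s v. The base point and the frame depend
  on x only, so one model Hessian serves all directions v.\<close>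

lemma distance_touching:
  fixes \<Omega> :: "(real ^ 'n) set"
  assumes sm: "smooth_bounded_domain \<Omega>" and \<sigma>: "\<sigma> > 0"
  defines "\<kappa> \<equiv> principal_curvatures \<Omega>"
  shows "\<exists>r>0. \<forall>x\<in>\<Omega>. bdist \<Omega> x < r \<longrightarrow> (\<exists>y\<in>frontier \<Omega>. \<exists>n es. orthonormal_basis (n # es) \<and>
    (\<forall>v. \<forall>\<^sub>F s in nhds 0.
       bdist \<Omega> x + s * (n \<bullet> v) - s\<^sup>2 / 2 * (\<Sum>i<CARD('n) - 1. (\<kappa> y ! i + \<sigma>) * (es ! i \<bullet> v)\<^sup>2) \<le> bdist \<Omega> (x + s *\<^sub>R v) \<and>
       bdist \<Omega> (x + s *\<^sub>R v) \<le> bdist \<Omega> x + s * (n \<bullet> v) - s\<^sup>2 / 2 * (\<Sum>i<CARD('n) - 1. (\<kappa> y ! i - \<sigma>) * (es ! i \<bullet> v)\<^sup>2)))"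
proof -
  have op: "open \<Omega>" using sm by (simp add: smooth_bounded_domain_def)
  let ?N = "CARD('n) - 1"
  obtain B where B: "\<And>y. y \<in> frontier \<Omega> \<Longrightarrow> length (\<kappa> y) = ?N \<and> (\<forall>a\<in>set (\<kappa> y). \<bar>a\<bar> \<le> B)"
    using principal_curvatures_bounded[OF sm] unfolding \<kappa>_def by blast
  obtain r0 where r0: "r0 > 0" and fe: "\<And>y. y \<in> frontier \<Omega> \<Longrightarrow> \<exists>n es. orthonormal_basis (n # es) \<and> (\<forall>z. norm z < r0 \<longrightarrow>
     (y + z \<notin> \<Omega> \<longrightarrow> n \<bullet> z \<le> (\<Sum>i<?N. \<kappa> y ! i * (es ! i \<bullet> z)\<^sup>2) / 2 + \<sigma> / 8 * (\<Sum>i<?N. (es ! i \<bullet> z)\<^sup>2)) \<and>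
     (y + z \<in> \<Omega> \<longrightarrow> n \<bullet> z \<ge> (\<Sum>i<?N. \<kappa> y ! i * (es ! i \<bullet> z)\<^sup>2) / 2 - \<sigma> / 8 * (\<Sum>i<?N. (es ! i \<bullet> z)\<^sup>2)))"
    using frame_expansion[OF sm, of "\<sigma> / 8"] \<sigma> unfolding \<kappa>_def by auto
  define b where "b = \<bar>B\<bar> + \<sigma>"
  define K where "K = (b + 1)\<^sup>2 + 1"
  have b: "b \<ge> 0" using \<sigma> by (simp add: b_def)
  have K: "K > 0" by (simp add: K_def add_nonneg_pos)
  \<comment> \<open>1 / K is the range in which the barrier has slope at most one; \<sigma> / (4 K)
    makes its cubic term small against the surplus of curvature.\<close>
  define r where "r = min r0 (min (1 / K) (\<sigma> / (4 * K)))"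
  have r: "r > 0" "r \<le> r0" "K * r \<le> 1" "K * r \<le> \<sigma> / 4"
  proof -
    show "r > 0" "r \<le> r0" using r0 K \<sigma> by (auto simp: r_def)
    have "r \<le> 1 / K" "r \<le> \<sigma> / (4 * K)" unfolding r_def by (simp_all add: min.coboundedI2)
    then show "K * r \<le> 1" "K * r \<le> \<sigma> / 4" using K by (simp_all add: field_simps)
  qed
  show ?thesis
  \<comment> \<open>With d < r / 4 the nearest boundary points of x + s v, for small s, stay within
    r of \<open>y\<close>.\<close>
  proof (intro exI[of _ "r / 4"] conjI ballI impI)
    show "r / 4 > 0" using r by simp
    fix x assume x: "x \<in> \<Omega>" and dx: "bdist \<Omega> x < r / 4"
    define d0 where "d0 = bdist \<Omega> x"
    have d0: "d0 > 0" unfolding d0_def by (rule bdist_pos[OF sm x])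
    obtain y where y: "y \<in> frontier \<Omega>" "bdist \<Omega> x = dist x y" using infdist_frontier_attained[OF sm] .
    have y\<Omega>: "y' \<notin> \<Omega>" if "y' \<in> frontier \<Omega>" for y' using that op by (simp add: frontier_def interior_open)
    obtain n es where fr: "orthonormal_basis (n # es)"
      and out: "\<And>z. norm z < r0 \<Longrightarrow> y + z \<notin> \<Omega> \<Longrightarrow> n \<bullet> z \<le> (\<Sum>i<?N. \<kappa> y ! i * (es ! i \<bullet> z)\<^sup>2) / 2 + \<sigma> / 8 * (\<Sum>i<?N. (es ! i \<bullet> z)\<^sup>2)"
      and ins: "\<And>z. norm z < r0 \<Longrightarrow> y + z \<in> \<Omega> \<Longrightarrow> n \<bullet> z \<ge> (\<Sum>i<?N. \<kappa> y ! i * (es ! i \<bullet> z)\<^sup>2) / 2 - \<sigma> / 8 * (\<Sum>i<?N. (es ! i \<bullet> z)\<^sup>2)"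
      using fe[OF y(1)] by blast
    have xy: "x - y = d0 *\<^sub>R n"
      unfolding d0_def by (rule nearest_point_normal[OF x y\<Omega>[OF y(1)] y(2) r0 fr]) (rule ins)
    have kb: "\<bar>\<kappa> y ! i\<bar> \<le> \<bar>B\<bar>" if "i < ?N" for i
    proof -
      have "\<kappa> y ! i \<in> set (\<kappa> y)" using B[OF y(1)] that by simp
      then have "\<bar>\<kappa> y ! i\<bar> \<le> B" using B[OF y(1)] by blast
      then show ?thesis by linarith
    qed
    have nn: "n \<bullet> n = 1" by (rule frameD(1)[OF fr])
    have nn1: "norm n = 1" using nn by (simp add: norm_eq_1)
    have "(\<forall>\<^sub>F s in nhds 0.
       d0 + s * (n \<bullet> v) - s\<^sup>2 / 2 * (\<Sum>i<?N. (\<kappa> y ! i + \<sigma>) * (es ! i \<bullet> v)\<^sup>2) \<le> bdist \<Omega> (x + s *\<^sub>R v) \<and>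
       bdist \<Omega> (x + s *\<^sub>R v) \<le> d0 + s * (n \<bullet> v) - s\<^sup>2 / 2 * (\<Sum>i<?N. (\<kappa> y ! i - \<sigma>) * (es ! i \<bullet> v)\<^sup>2))" for v
    proof -
      define S where "S c = (\<Sum>i<?N. (\<kappa> y ! i + c) * (es ! i \<bullet> v)\<^sup>2)" for c
      define W where "W = (\<Sum>i<?N. (es ! i \<bullet> v)\<^sup>2)"
      have SW: "S c = S 0 + c * W" for c by (simp add: S_def W_def algebra_simps sum.distrib sum_distrib_left)
      have W0: "W \<ge> 0" unfolding W_def by (intro sum_nonneg) auto
      have ei: "es ! i \<bullet> (d *\<^sub>R n + s *\<^sub>R v) = s * (es ! i \<bullet> v)" if "i < ?N" for i d s
        using frameD(4)[OF fr that] by (simp add: inner_add_right)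
      \<comment> \<open>\<open>y + Z s\<close> is the point reached from x + s v by moving back
        along n by the value of the upper polynomial.\<close>
      define Z where "Z s = (s *\<^sub>R v - (s * (n \<bullet> v)) *\<^sub>R n) + (s\<^sup>2 / 2 * S (- \<sigma>)) *\<^sub>R n" for s
      have t1: "((\<lambda>s. norm (d0 *\<^sub>R n + s *\<^sub>R v)) \<longlongrightarrow> d0) (nhds 0)"
        using d0 nn1 by (auto intro!: tendsto_eq_intros filterlim_ident)
      have t2: "((\<lambda>s. norm (Z s)) \<longlongrightarrow> 0) (nhds 0)"
        unfolding Z_def by (auto intro!: tendsto_eq_intros filterlim_ident)
      have t3: "((\<lambda>s. d0 + s * (n \<bullet> v) - s\<^sup>2 / 2 * S (- \<sigma>)) \<longlongrightarrow> d0) (nhds 0)"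
        by (auto intro!: tendsto_eq_intros filterlim_ident)
      have t4: "((\<lambda>s. x + s *\<^sub>R v) \<longlongrightarrow> x) (nhds 0)"
        by (auto intro!: tendsto_eq_intros filterlim_ident)
      have "\<forall>\<^sub>F s in nhds 0. norm (d0 *\<^sub>R n + s *\<^sub>R v) < r / 2 \<and> norm (Z s) < r0 \<and>
          d0 + s * (n \<bullet> v) - s\<^sup>2 / 2 * S (- \<sigma>) > 0 \<and> x + s *\<^sub>R v \<in> \<Omega>"
        using order_tendstoD(2)[OF t1, of "r / 2"] order_tendstoD(2)[OF t2 r0] order_tendstoD(1)[OF t3 d0]
          topological_tendstoD[OF t4 op x] dx d0 unfolding d0_def[symmetric]
        by (auto intro!: eventually_conj)
      then show ?thesis unfolding S_def[symmetric]
      proof eventually_elim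
        case (elim s)
        let ?x = "x + s *\<^sub>R v" and ?z = "d0 *\<^sub>R n + s *\<^sub>R v"
        have xz: "?x = y + ?z" using xy by (simp add: algebra_simps)
        have "bdist \<Omega> ?x \<le> d0 + s * (n \<bullet> v) - s\<^sup>2 / 2 * S (- \<sigma>)"
        proof -
          let ?\<phi> = "d0 + s * (n \<bullet> v) - s\<^sup>2 / 2 * S (- \<sigma>)"
          have pz: "?x - ?\<phi> *\<^sub>R n = y + Z s" unfolding xz Z_def by (simp add: algebra_simps)
          \<comment> \<open>Were it inside, the expansion error \<sigma> / 8 against the deficit
            \<sigma> / 2 would force the tangential part of \<open>Z s\<close> to vanish; then
            \<open>Z s\<close> is 0 and the point is y itself.\<close>
          have "y + Z s \<notin> \<Omega>"
          proof
            assume a: "y + Z s \<in> \<Omega>"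
            have zn: "n \<bullet> Z s = s\<^sup>2 / 2 * S (- \<sigma>)" by (simp add: Z_def inner_add_right inner_diff_right nn)
            have zi: "es ! i \<bullet> Z s = s * (es ! i \<bullet> v)" if "i < ?N" for i
              using frameD(4)[OF fr that] by (simp add: Z_def inner_add_right inner_diff_right)
            have z1: "(\<Sum>i<?N. \<kappa> y ! i * (es ! i \<bullet> Z s)\<^sup>2) = s\<^sup>2 * S 0"
              unfolding S_def sum_distrib_left by (intro sum.cong) (auto simp: zi power_mult_distrib)
            have z2: "(\<Sum>i<?N. (es ! i \<bullet> Z s)\<^sup>2) = s\<^sup>2 * W"
              unfolding W_def sum_distrib_left by (intro sum.cong) (auto simp: zi power_mult_distrib)
            have "n \<bullet> Z s \<ge> (s\<^sup>2 * S 0) / 2 - \<sigma> / 8 * (s\<^sup>2 * W)"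
              using ins[of "Z s"] elim a unfolding z1 z2 by simp
            then have "s\<^sup>2 * W * (\<sigma> / 2 - \<sigma> / 8) \<le> 0" unfolding zn SW[of "- \<sigma>"] by (simp add: algebra_simps)
            then have "s\<^sup>2 * W \<le> 0" using \<sigma> by (simp add: mult_le_0_iff)
            then have sW: "s\<^sup>2 * W = 0" using W0 by (smt (verit) zero_le_mult_iff zero_le_power2)
            then have "\<forall>i<?N. (es ! i \<bullet> Z s)\<^sup>2 = 0"
              using z2 by (metis (no_types, lifting) finite_lessThan lessThan_iff sum_nonneg_eq_0_iff zero_le_power2)
            then have ze: "\<And>i. i < ?N \<Longrightarrow> es ! i \<bullet> Z s = 0" by simp
            have sS: "s\<^sup>2 * S 0 = 0" unfolding z1[symmetric] using ze by simp
            have nZ: "n \<bullet> Z s = 0" unfolding zn SW[of "- \<sigma>"] using sW sS by (cases "s = 0") auto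
            have "Z s \<bullet> Z s = 0" unfolding frame_inner[OF fr, of "Z s" "Z s"] using ze nZ by simp
            then have "Z s = 0" by simp
            then show False using a y\<Omega>[OF y(1)] by simp
          qed
          then have "bdist \<Omega> ?x \<le> dist ?x (?x - ?\<phi> *\<^sub>R n)"
            unfolding pz by (intro bdist_le_dist) (use elim in auto)
          also have "\<dots> = ?\<phi>" using elim nn1 by (simp add: dist_norm)
          finally show ?thesis .
        qed
        moreover have "d0 + s * (n \<bullet> v) - s\<^sup>2 / 2 * S \<sigma> \<le> bdist \<Omega> ?x"
        proof -
          \<comment> \<open>One half of \<sigma> covers the expansion error and the cubic term at
            the boundary point; the other half is kept for the cubic term at x + s v.\<close>
          define kk where "kk = map (\<lambda>a. a + \<sigma> / 2) (\<kappa> y)"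
          define \<phi> where "\<phi> z = n \<bullet> z - (\<Sum>i<?N. kk ! i * (es ! i \<bullet> z)\<^sup>2) / 2 - K / 2 * (n \<bullet> z) * (\<Sum>i<?N. (es ! i \<bullet> z)\<^sup>2)" for z
          have kk: "kk ! i = \<kappa> y ! i + \<sigma> / 2" if "i < ?N" for i using B[OF y(1)] that by (simp add: kk_def)
          obtain p where p: "p \<in> frontier \<Omega>" "bdist \<Omega> ?x = dist ?x p" using infdist_frontier_attained[OF sm] .
          define zp where "zp = p - y"
          have dxp: "dist ?x p \<le> norm ?z"
          proof -
            have "bdist \<Omega> ?x \<le> dist ?x y" unfolding bdist_def by (rule infdist_le[OF y(1)])
            moreover have "?x - y = ?z" unfolding xz by simp
            ultimately show ?thesis unfolding p(2) by (simp only: dist_norm)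
          qed
          have nzp: "norm zp < r"
          proof -
            have "norm zp \<le> dist p ?x + norm ?z"
              using dist_triangle[of p y ?x] unfolding zp_def dist_norm xz by simp
            then show ?thesis using dxp elim by (simp add: dist_commute)
          qed
          have "\<phi> zp \<le> 0"
          proof -
            define w where "w = (\<Sum>i<?N. (es ! i \<bullet> zp)\<^sup>2)"
            have w0: "w \<ge> 0" unfolding w_def by (intro sum_nonneg) auto
            have "(\<Sum>i<?N. kk ! i * (es ! i \<bullet> zp)\<^sup>2) = (\<Sum>i<?N. \<kappa> y ! i * (es ! i \<bullet> zp)\<^sup>2 + \<sigma> / 2 * (es ! i \<bullet> zp)\<^sup>2)"
              by (intro sum.cong) (auto simp: kk algebra_simps)
            also have "\<dots> = (\<Sum>i<?N. \<kappa> y ! i * (es ! i \<bullet> zp)\<^sup>2) + \<sigma> / 2 * w" by (simp add: w_def sum.distrib sum_distrib_left)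
            finally have k1: "(\<Sum>i<?N. kk ! i * (es ! i \<bullet> zp)\<^sup>2) = (\<Sum>i<?N. \<kappa> y ! i * (es ! i \<bullet> zp)\<^sup>2) + \<sigma> / 2 * w" .
            have "n \<bullet> zp \<le> (\<Sum>i<?N. \<kappa> y ! i * (es ! i \<bullet> zp)\<^sup>2) / 2 + \<sigma> / 8 * w"
              unfolding w_def by (rule out) (use nzp r y\<Omega>[OF p(1)] in \<open>auto simp: zp_def\<close>)
            moreover have "- (K / 2 * (n \<bullet> zp) * w) \<le> \<sigma> / 8 * w"
            proof -
              have "\<bar>n \<bullet> zp\<bar> \<le> r" using Cauchy_Schwarz_ineq2[of n zp] nn1 nzp by simp
              then have "- (n \<bullet> zp) \<le> r" by simp
              then have "K * - (n \<bullet> zp) \<le> K * r" using K by (intro mult_left_mono) auto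
              then have "(K * - (n \<bullet> zp) / 2) * w \<le> \<sigma> / 8 * w" using r(4) w0 by (intro mult_right_mono) auto
              then show ?thesis by simp
            qed
            moreover have "((\<Sum>i<?N. \<kappa> y ! i * (es ! i \<bullet> zp)\<^sup>2) + \<sigma> / 2 * w) / 2
                = (\<Sum>i<?N. \<kappa> y ! i * (es ! i \<bullet> zp)\<^sup>2) / 2 + \<sigma> / 8 * w + \<sigma> / 8 * w" by (simp add: field_simps)
            ultimately show ?thesis unfolding \<phi>_def w_def[symmetric] k1 by linarith
          qed
          moreover have "\<phi> ?z - \<phi> zp \<le> norm (?z - zp)"
            unfolding \<phi>_def
          proof (rule barrier_lipschitz[OF fr _ b K_def r(3)])
            show "\<bar>kk ! i\<bar> \<le> b" if "i < ?N" for i using kb[OF that] kk[OF that] \<sigma> unfolding b_def by linarith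
            show "norm ?z < r" using elim r by linarith
            show "norm zp < r" by (rule nzp)
          qed
          moreover have "norm (?z - zp) = dist ?x p" unfolding xz by (simp add: zp_def dist_norm algebra_simps)
          ultimately have le: "\<phi> ?z \<le> bdist \<Omega> ?x" using p by simp
          have nz: "n \<bullet> ?z = d0 + s * (n \<bullet> v)" by (simp add: inner_add_right nn)
          have z1: "(\<Sum>i<?N. kk ! i * (es ! i \<bullet> ?z)\<^sup>2) = s\<^sup>2 * S (\<sigma> / 2)"
            unfolding S_def sum_distrib_left by (intro sum.cong) (auto simp: ei kk power_mult_distrib)
          have z2: "(\<Sum>i<?N. (es ! i \<bullet> ?z)\<^sup>2) = s\<^sup>2 * W"
            unfolding W_def sum_distrib_left by (intro sum.cong) (auto simp: ei power_mult_distrib)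
          have "\<bar>n \<bullet> ?z\<bar> \<le> r" using Cauchy_Schwarz_ineq2[of n ?z] nn1 elim r(1) by simp
          then have "n \<bullet> ?z \<le> r" by linarith
          then have "K * (n \<bullet> ?z) \<le> \<sigma> / 2" using mult_left_mono[of "n \<bullet> ?z" r K] K r(4) \<sigma> by linarith
          then have "K * (n \<bullet> ?z) * (s\<^sup>2 * W) \<le> \<sigma> / 2 * (s\<^sup>2 * W)" using W0 by (intro mult_right_mono) auto
          note h1 = this
          have h2: "s\<^sup>2 / 2 * (S 0 + \<sigma> * W) = s\<^sup>2 * S 0 / 2 + \<sigma> / 2 * (s\<^sup>2 * W)"
            "(s\<^sup>2 * (S 0 + \<sigma> / 2 * W)) / 2 = s\<^sup>2 * S 0 / 2 + (\<sigma> / 2 * (s\<^sup>2 * W)) / 2"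
            "K / 2 * (n \<bullet> ?z) * (s\<^sup>2 * W) = (K * (n \<bullet> ?z) * (s\<^sup>2 * W)) / 2"
            by (simp_all add: field_simps)
          have aux: "c - L \<le> c - E - E'" if "X \<le> Y" "L = a + Y" "E = a + Y / 2" "E' = X / 2" for a c L E E' X Y :: real
            using that by simp
          have "d0 + s * (n \<bullet> v) - s\<^sup>2 / 2 * S \<sigma> \<le> \<phi> ?z"
            unfolding \<phi>_def z1 z2 SW[of \<sigma>] SW[of "\<sigma> / 2"] nz[symmetric] by (rule aux[OF h1 h2])
          then show ?thesis using le by simp
        qed
        ultimately show ?case by (simp add: S_def)
      qed
    qed
    then show "\<exists>y\<in>frontier \<Omega>. \<exists>n es. orthonormal_basis (n # es) \<and>
    (\<forall>v. \<forall>\<^sub>F s in nhds 0.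
       bdist \<Omega> x + s * (n \<bullet> v) - s\<^sup>2 / 2 * (\<Sum>i<?N. (\<kappa> y ! i + \<sigma>) * (es ! i \<bullet> v)\<^sup>2) \<le> bdist \<Omega> (x + s *\<^sub>R v) \<and>
       bdist \<Omega> (x + s *\<^sub>R v) \<le> bdist \<Omega> x + s * (n \<bullet> v) - s\<^sup>2 / 2 * (\<Sum>i<?N. (\<kappa> y ! i - \<sigma>) * (es ! i \<bullet> v)\<^sup>2))"
      using y(1) fr unfolding d0_def by blast
  qed
qed

section \<open>Asymptotics of the boundary profile\<close>

context
  fixes f \<psi> :: "real \<Rightarrow> real" and k :: nat and J :: "real set" and C :: real
  assumes k: "k \<ge> 1"
    and f_deriv_all: "\<forall>y>0. (f has_real_derivative deriv f y) (at y)"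
    and f_pos_all: "\<forall>y>0. f y > 0"
    and tail_all: "\<forall>y>0. tail_integrable k f y"
    and lim: "((\<lambda>t. deriv (\<lambda>s. f s powr (1 / real k)) t * tail_integral k f t) \<longlongrightarrow> C) at_top"
    and psi: "\<forall>\<^sub>F t in at_right 0. \<psi> t \<in> J \<and> tail_integrable k f (\<psi> t) \<and> tail_integral k f (\<psi> t) = t"
begin

abbreviation (input) "froot \<equiv> \<lambda>s. f s powr (1 / real k)"
abbreviation (input) "ftail \<equiv> tail_integral k f"

lemmas f_deriv = f_deriv_all[rule_format] and f_pos = f_pos_all[rule_format] and f_tail = tail_all[rule_format]

lemma F_pos: "y > 0 \<Longrightarrow> froot y > 0"
  using f_pos[of y] by simp

lemma F_deriv: "y > 0 \<Longrightarrow> (froot has_real_derivative deriv froot y) (at y)"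
  using f_pos[of y] by (intro DERIV_imp_deriv[THEN ssubst, of _ _ _ "\<lambda>d. (froot has_real_derivative d) (at y)"])
    (auto intro!: derivative_eq_intros f_deriv)

lemma F_power: "y > 0 \<Longrightarrow> froot y ^ k = f y"
  using f_pos[of y] k by (simp add: powr_realpow[symmetric] powr_powr del: powr_realpow)

lemma tail_mono:
  assumes "tail_integrable k f a" "a \<le> b"
  shows "ftail b \<le> ftail a"
proof -
  have "set_integrable lborel {b<..} (\<lambda>s. f s powr (- 1 / real k))"
    by (rule set_integrable_subset[OF assms(1)[unfolded tail_integrable_def]]) (use assms in auto)
  then show ?thesis
    unfolding tail_integral_def set_lebesgue_integral_def
    by (intro integral_mono) (use assms in \<open>auto simp: set_integrable_def tail_integrable_def indicator_def\<close>)
qed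

text \<open>Splitting off a proper integral from a point 0 < a < y leaves the fundamental theorem of
  calculus for a continuous integrand.\<close>

lemma tail_deriv:
  assumes y: "y > 0"
  shows "(ftail has_real_derivative - (1 / froot y)) (at y)"
proof -
  define g where "g s = f s powr (- 1 / real k)" for s
  define a b where "a = y / 2" and "b = 2 * y"
  have ab: "0 < a" "a < y" "y < b" using y by (auto simp: a_def b_def)
  have cont: "continuous_on {a..b} g"
  proof -
    have "isCont f s \<and> f s \<noteq> 0" if "s \<in> {a..b}" for s
      using f_pos[of s] DERIV_isCont[OF f_deriv[of s]] that ab by auto
    then show ?thesis unfolding g_def[abs_def]
      by (intro continuous_on_powr continuous_at_imp_continuous_on ballI continuous_on_const) auto
  qed
  have ftail: "ftail x = ftail a - integral {a..x} g" if "x \<in> {a..b}" for x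
  proof -
    have i1: "set_integrable lborel {a..x} g"
      by (rule borel_integrable_atLeastAtMost') (use that in \<open>auto intro: continuous_on_subset[OF cont]\<close>)
    then have i2: "set_integrable lborel {a<..x} g" by (rule set_integrable_subset) auto
    have i3: "set_integrable lborel {x<..} g"
      using f_tail[of x] that ab by (auto simp: tail_integrable_def g_def[abs_def])
    have sp: "{a<..} = {a<..x} \<union> {x<..}" using that by auto
    have "ftail a = (LINT s:{a<..x} \<union> {x<..}|lborel. g s)"
      by (simp only: tail_integral_def g_def sp[symmetric])
    also have "\<dots> = (LINT s:{a<..x}|lborel. g s) + (LINT s:{x<..}|lborel. g s)"
      by (rule set_integral_Un[OF _ i2 i3]) auto
    also have "(LINT s:{x<..}|lborel. g s) = ftail x" by (simp only: tail_integral_def g_def)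
    also have "(LINT s:{a<..x}|lborel. g s) = integral {a<..x} g" by (rule set_borel_integral_eq_integral[OF i2])
    also have "\<dots> = integral {a..x} g"
      by (rule integral_spike_set; rule negligible_subset[of "{a}"]; auto)
    finally show ?thesis by linarith
  qed
  have "((\<lambda>x. ftail a - integral {a..x} g) has_real_derivative - g y) (at y within {a..b})"
    using integral_has_real_derivative[OF cont, of y] ab by (auto intro!: derivative_eq_intros)
  then have "(ftail has_real_derivative - g y) (at y within {a..b})"
    by (rule has_field_derivative_transform_within[where d = 1]) (use ab ftail[symmetric] in simp_all)
  moreover have "at y within {a..b} = at y" using ab by (intro at_within_interior) auto
  moreover have "g y = 1 / froot y" using f_pos[OF y] by (simp add: g_def powr_minus_divide)
  ultimately show ?thesis by simp
qed

lemma tail_strict: "0 < a \<Longrightarrow> a < b \<Longrightarrow> ftail b < ftail a"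
proof (rule DERIV_neg_imp_decreasing[of a b ftail])
  fix x assume "0 < a" "a \<le> x"
  then show "\<exists>y. (ftail has_real_derivative y) (at x) \<and> y < 0"
    using tail_deriv[of x] F_pos[of x] by (intro exI[of _ "- (1 / froot x)"]) simp
qed

lemma tail_pos:
  assumes "0 < a"
  shows "ftail a > 0"
proof -
  have "0 \<le> ftail (a + 1)" unfolding tail_integral_def set_lebesgue_integral_def by (intro Bochner_Integration.integral_nonneg) auto
  then show ?thesis using tail_strict[of a "a + 1"] assms by simp
qed

text \<open>\<psi> is given only as a right inverse of the tail integral for small arguments. The
  weak monotonicity \<open>tail_mono\<close> is used because \<psi> t is not yet known to be
  positive.\<close>

lemma psi_large:
  assumes "Y > 0"
  shows "\<exists>T>0. T \<le> ftail Y \<and> (\<forall>t. 0 < t \<longrightarrow> t < T \<longrightarrow> \<psi> t \<in> J \<and> ftail (\<psi> t) = t \<and> \<psi> t > Y)"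
proof -
  obtain b where b: "b > 0" "\<And>t. 0 < t \<Longrightarrow> t < b \<Longrightarrow> \<psi> t \<in> J \<and> tail_integrable k f (\<psi> t) \<and> ftail (\<psi> t) = t"
    using psi unfolding eventually_at_right_field by auto
  have "\<psi> t > Y" if "0 < t" "t < b" "t < ftail Y" for t
    using tail_mono[of "\<psi> t" Y] b(2)[of t] that by force
  then show ?thesis using b tail_pos[OF assms] by (intro exI[of _ "min b (ftail Y)"]) auto
qed

text \<open>The tail integral is injective on positive arguments, so near \<psi> t the function
  \<psi> is also its left inverse, and the rule for the derivative of an inverse function
  applies.\<close>

lemma psi_regular:
  assumes "Y > 0"
  obtains T where "T > 0" "\<And>t. 0 < t \<Longrightarrow> t < T \<Longrightarrow> \<psi> t \<in> J \<and> ftail (\<psi> t) = t \<and> \<psi> t > Y"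
    "\<And>t. 0 < t \<Longrightarrow> t < T \<Longrightarrow> (\<psi> has_real_derivative - froot (\<psi> t)) (at t)"
proof -
  obtain T where T: "T > 0" "T \<le> ftail Y"
    and psiT: "\<And>t. 0 < t \<Longrightarrow> t < T \<Longrightarrow> \<psi> t \<in> J \<and> ftail (\<psi> t) = t \<and> \<psi> t > Y"
    using psi_large[OF assms] by blast
  have inj: "a = b" if "0 < a" "0 < b" "ftail a = ftail b" for a b
    using tail_strict[of a b] tail_strict[of b a] that by (metis less_irrefl linorder_neqE_linordered_idom)
  have "(\<psi> has_real_derivative - froot (\<psi> t)) (at t)" if t: "0 < t" "t < T" for t
  proof -
    define z where "z = \<psi> t"
    have z: "z > Y" "ftail z = t" using psiT[OF t] by (auto simp: z_def)
    have "\<forall>\<^sub>F w in nhds z. ftail w < T"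
      using DERIV_isCont[OF tail_deriv[of z]] z t assms
      by (intro order_tendstoD(2)[of ftail "ftail z"]) (auto simp: continuous_at tendsto_at_iff_tendsto_nhds)
    then obtain e where e: "e > 0" "\<And>w. \<bar>w - z\<bar> < e \<Longrightarrow> ftail w < T"
      unfolding eventually_nhds_metric by (auto simp: dist_real_def)
    \<comment> \<open>Close enough to z that the tail integral stays below T and the point itself
      above Y.\<close>
    define a where "a = z - min e (z - Y) / 2"
    have a: "a < z" "Y < a" "z - a < e" using e z by (auto simp: a_def min_def field_simps)
    have left: "\<psi> (ftail w) = w" if "a \<le> w" for w
    proof -
      have "ftail w \<le> ftail a" using tail_strict[of a w] that a assms by (cases "a = w") auto
      then have "ftail w < T" using e(2)[of a] a by (simp add: abs_minus_commute)
      moreover have "ftail w > 0" using tail_pos[of w] that a assms by simp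
      ultimately have "ftail (\<psi> (ftail w)) = ftail w" "\<psi> (ftail w) > Y" using psiT[of "ftail w"] by auto
      then show ?thesis using inj[of "\<psi> (ftail w)" w] that a assms by simp
    qed
    have "isCont \<psi> (ftail z)"
      by (rule isCont_inverse_function2[of a z "z + 1"]) (use a left assms DERIV_isCont[OF tail_deriv] in auto)
    then have "(\<psi> has_real_derivative inverse (- (1 / froot z))) (at t)"
      using tail_deriv[of z] F_pos[of z] z t psiT order_less_trans[OF assms z(1)]
      by (intro DERIV_inverse_function[of ftail _ \<psi> t 0 T]) (auto simp: z_def)
    then show ?thesis by (simp add: z_def)
  qed
  then show ?thesis using that T psiT by blast
qed

lemma psi_at_top: "filterlim \<psi> at_top (at_right 0)"
  unfolding filterlim_at_top_gt[where c = 0]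
proof (intro allI impI)
  fix Y :: real assume "Y > 0"
  from psi_large[OF this] show "\<forall>\<^sub>F t in at_right 0. Y \<le> \<psi> t"
    unfolding eventually_at_right_field by (meson less_imp_le)
qed

lemma psi_tail: "\<forall>\<^sub>F t in at_right 0. ftail (\<psi> t) = t"
  using psi by eventually_elim auto

lemma F_deriv_psi: "((\<lambda>t. deriv froot (\<psi> t) * t) \<longlongrightarrow> C) (at_right 0)"
proof -
  have "((\<lambda>t. deriv froot (\<psi> t) * ftail (\<psi> t)) \<longlongrightarrow> C) (at_right 0)"
    by (rule filterlim_compose[OF lim psi_at_top])
  moreover have "\<forall>\<^sub>F t in at_right 0. deriv froot (\<psi> t) * ftail (\<psi> t) = deriv froot (\<psi> t) * t"
    using psi_tail by eventually_elim simp
  ultimately show ?thesis by (rule Lim_transform_eventually)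
qed

text \<open>l'Hospital's rule for F(y) tail(y) / y: the numerator has derivative F' tail - 1, which
  tends to C - 1. In view of \<open>\<psi>' = - F(\<psi>)\<close> this is, up to sign, the
  elasticity of \<psi>.\<close>

lemma F_psi: "((\<lambda>t. t * froot (\<psi> t) / \<psi> t) \<longlongrightarrow> C - 1) (at_right 0)"
proof -
  have "((\<lambda>y. froot y * ftail y / y) \<longlongrightarrow> C - 1) at_top"
  proof (rule lhospital_at_top_at_top[where g' = "\<lambda>_. 1" and f' = "\<lambda>y. deriv froot y * ftail y - 1"])
    show "\<forall>\<^sub>F x in at_top. ((\<lambda>y. froot y * ftail y) has_real_derivative deriv froot x * ftail x - 1) (at x)"
      using eventually_gt_at_top[of 0]
    proof eventually_elim
      case (elim x)
      from DERIV_mult[OF F_deriv[OF elim] tail_deriv[OF elim]] show ?case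
        using F_pos[OF elim] by (simp add: field_simps)
    qed
    show "((\<lambda>x. (deriv froot x * ftail x - 1) / 1) \<longlongrightarrow> C - 1) at_top"
      using tendsto_diff[OF lim tendsto_const[of 1]] by simp
  qed (auto simp: filterlim_ident)
  then have "((\<lambda>t. froot (\<psi> t) * ftail (\<psi> t) / \<psi> t) \<longlongrightarrow> C - 1) (at_right 0)"
    by (rule filterlim_compose[OF _ psi_at_top])
  moreover have "\<forall>\<^sub>F t in at_right 0. froot (\<psi> t) * ftail (\<psi> t) / \<psi> t = t * froot (\<psi> t) / \<psi> t"
    using psi_tail by eventually_elim simp
  ultimately show ?thesis by (rule Lim_transform_eventually)
qed

text \<open>In the variable x = ln s the function ln \<psi> has slope tending to 1 - C, and
  multiplying s by \<tau> shifts x by the fixed length ln \<tau>.\<close>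

lemma psi_regularly_varying:
  assumes \<tau>: "\<tau> > 0"
  shows "((\<lambda>s. \<psi> (\<tau> * s) / \<psi> s) \<longlongrightarrow> \<tau> powr (1 - C)) (at_right 0)"
proof -
  obtain T where T: "T > 0" and pT: "\<And>t. 0 < t \<Longrightarrow> t < T \<Longrightarrow> \<psi> t \<in> J \<and> ftail (\<psi> t) = t \<and> \<psi> t > 1"
    and dT: "\<And>t. 0 < t \<Longrightarrow> t < T \<Longrightarrow> (\<psi> has_real_derivative - froot (\<psi> t)) (at t)"
    using psi_regular[of 1] by auto
  define c where "c = 1 - C"
  have "((\<lambda>s. ln (\<psi> (\<tau> * s)) - ln (\<psi> s)) \<longlongrightarrow> c * ln \<tau>) (at_right 0)"
  proof (rule tendstoI)
    fix e :: real assume e: "e > 0"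
    \<comment> \<open>The added 1 keeps the quotient meaningful for \<tau> = 1.\<close>
    define e' where "e' = e / (\<bar>ln \<tau>\<bar> + 1)"
    have e': "e' > 0" using e by (simp add: e'_def add_nonneg_pos)
    obtain d where d: "d > 0" "\<And>t. 0 < t \<Longrightarrow> t < d \<Longrightarrow> \<bar>t * froot (\<psi> t) / \<psi> t - (C - 1)\<bar> < e'"
      using tendstoD[OF F_psi e'] unfolding eventually_at_right_field by (auto simp: dist_real_def)
    define m where "m = min d T"
    have m: "m > 0" "m \<le> d" "m \<le> T" using d T by (auto simp: m_def)
    \<comment> \<open>Subtracting the expected slope leaves a function that is Lipschitz with
      constant e' near minus infinity.\<close>
    define L where "L x = ln (\<psi> (exp x)) - c * x" for x
    have bound: "norm (L x - L y) \<le> e' * norm (x - y)" if "x \<in> {..<ln m}" "y \<in> {..<ln m}" for x y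
    proof (rule field_differentiable_bound[of "{..<ln m}" L "\<lambda>x. - (exp x * froot (\<psi> (exp x)) / \<psi> (exp x)) - c"])
      fix z assume "z \<in> {..<ln m}"
      then have z: "0 < exp z" "exp z < m" using m by (auto simp flip: exp_less_cancel_iff[of z "ln m"])
      have p: "\<psi> (exp z) > 1" using pT[of "exp z"] z m by auto
      have "((\<lambda>x. \<psi> (exp x)) has_real_derivative - froot (\<psi> (exp z)) * exp z) (at z)"
        using dT[of "exp z"] z m by (intro DERIV_chain2[where f = \<psi>]) auto
      then have "(L has_real_derivative 1 / \<psi> (exp z) * (- froot (\<psi> (exp z)) * exp z) - c) (at z)"
        unfolding L_def[abs_def] using p by (auto intro!: derivative_eq_intros)
      then show "(L has_real_derivative - (exp z * froot (\<psi> (exp z)) / \<psi> (exp z)) - c) (at z within {..<ln m})"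
        using has_field_derivative_at_within by (simp add: mult.commute)
      have "\<bar>exp z * froot (\<psi> (exp z)) / \<psi> (exp z) - (C - 1)\<bar> < e'" using d(2)[of "exp z"] z m by auto
      then show "norm (- (exp z * froot (\<psi> (exp z)) / \<psi> (exp z)) - c) \<le> e'"
        unfolding real_norm_def c_def by linarith
    qed (use that in auto)
    have "\<forall>\<^sub>F s in at_right 0. 0 < s \<and> s < m \<and> s < m / \<tau>"
      using m \<tau> unfolding eventually_at_right_field by (intro exI[of _ "min m (m / \<tau>)"]) auto
    then show "\<forall>\<^sub>F s in at_right 0. dist (ln (\<psi> (\<tau> * s)) - ln (\<psi> s)) (c * ln \<tau>) < e"
    proof eventually_elim
      case (elim s)
      then have s: "0 < s" "s < m" "\<tau> * s < m" "0 < \<tau> * s" using \<tau> by (auto simp: field_simps)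
      have "norm (L (ln (\<tau> * s)) - L (ln s)) \<le> e' * norm (ln (\<tau> * s) - ln s)"
        using s m by (intro bound) auto
      moreover have l: "ln (\<tau> * s) - ln s = ln \<tau>" using s \<tau> by (simp add: ln_mult)
      moreover have "L (ln (\<tau> * s)) - L (ln s) = ln (\<psi> (\<tau> * s)) - ln (\<psi> s) - c * (ln (\<tau> * s) - ln s)"
        unfolding L_def exp_ln[OF s(1)] exp_ln[OF s(4)] by (simp only: algebra_simps)
      ultimately have "\<bar>ln (\<psi> (\<tau> * s)) - ln (\<psi> s) - c * ln \<tau>\<bar> \<le> e' * \<bar>ln \<tau>\<bar>"
        by (simp only: real_norm_def)
      also have "\<dots> < e" using e by (simp add: e'_def field_simps)
      finally show ?case by (simp add: dist_real_def)
    qed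
  qed
  from tendsto_exp[OF this]
  have "((\<lambda>s. exp (ln (\<psi> (\<tau> * s)) - ln (\<psi> s))) \<longlongrightarrow> \<tau> powr (1 - C)) (at_right 0)"
    using \<tau> by (simp add: powr_def c_def mult.commute)
  moreover have "\<forall>\<^sub>F s in at_right 0. exp (ln (\<psi> (\<tau> * s)) - ln (\<psi> s)) = \<psi> (\<tau> * s) / \<psi> s"
  proof -
    have "\<forall>\<^sub>F s in at_right 0. 0 < s \<and> s < T \<and> s < T / \<tau>"
      using T \<tau> unfolding eventually_at_right_field by (intro exI[of _ "min T (T / \<tau>)"]) auto
    then show ?thesis
    proof eventually_elim
      case (elim s)
      then have "\<psi> s > 1" "\<psi> (\<tau> * s) > 1" using pT[of s] pT[of "\<tau> * s"] \<tau> by (auto simp: field_simps)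
      then show ?case by (simp add: exp_diff)
    qed
  qed
  ultimately show ?thesis by (rule Lim_transform_eventually)
qed

text \<open>The profile \<open>h = \<psi> (\<tau> Y\<^sup>\<alpha>)\<close> with \<open>\<alpha> = (k + 1) / k\<close>: since \<open>f (h)\<close> is the \<open>k\<close>-th power of \<open>F (h)\<close>,
  both \<open>(- h')\<^sup>k\<close> and \<open>(- h')\<^bsup>k - 1\<^esup> h''\<close> are explicit multiples of \<open>f (h)\<close>.\<close>

lemma profile_derivatives:
  fixes Y y :: "real \<Rightarrow> real" and \<tau> :: real
  defines "\<alpha> \<equiv> (real k + 1) / real k"
  defines "h \<equiv> \<lambda>t. \<psi> (\<tau> * Y t powr \<alpha>)"
  assumes psiT: "\<And>s. 0 < s \<Longrightarrow> s < T \<Longrightarrow> \<psi> s > 0 \<and> (\<psi> has_real_derivative - froot (\<psi> s)) (at s)"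
    and \<tau>: "\<tau> > 0"
    and dY: "\<forall>\<^sub>F t in nhds t0. (Y has_real_derivative y t) (at t)"
    and dy: "(y has_real_derivative y') (at t0)"
    and Y0: "Y t0 > 0" "\<tau> * Y t0 powr \<alpha> < T" and y0: "y t0 > 0"
  obtains h1 h2 where "\<forall>\<^sub>F t in nhds t0. (h has_real_derivative h1 t) (at t)"
    "(h1 has_real_derivative h2) (at t0)" "h1 t0 < 0"
    "(- h1 t0) ^ k = f (h t0) * (\<tau> * \<alpha>) ^ k * Y t0 * y t0 ^ k"
    "(- h1 t0) ^ (k - 1) * h2 = f (h t0) * (\<tau> * \<alpha>) ^ k * y t0 ^ (k + 1) *
       (\<alpha> * (deriv froot (h t0) * (\<tau> * Y t0 powr \<alpha>)) - 1 / real k - Y t0 * y' / (y t0)\<^sup>2)"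
proof -
  define c where "c = \<tau> * \<alpha>"
  define h1 where "h1 t = - froot (h t) * (c * Y t powr (1 / real k) * y t)" for t
  have kr: "real k > 0" using k by simp
  have \<alpha>: "\<alpha> > 0" "\<alpha> - 1 = 1 / real k" using kr by (auto simp: \<alpha>_def field_simps)
  have c: "c > 0" using \<tau> \<alpha> by (simp add: c_def)
  have dY0: "(Y has_real_derivative y t0) (at t0)" using dY by (rule eventually_nhds_x_imp_x)
  have contY: "isCont Y t0" using dY0 by (rule DERIV_isCont)
  \<comment> \<open>The formula for h' has to hold on a neighbourhood, since it is differentiated
    once more.\<close>
  have ev: "\<forall>\<^sub>F t in nhds t0. Y t > 0 \<and> \<tau> * Y t powr \<alpha> < T"
  proof -
    have "isCont (\<lambda>t. \<tau> * Y t powr \<alpha>) t0" using Y0 contY by (intro continuous_intros) auto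
    then have "\<forall>\<^sub>F t in nhds t0. \<tau> * Y t powr \<alpha> < T"
      using Y0 by (intro order_tendstoD(2)[OF isCont_tendsto_nhds]) auto
    moreover have "\<forall>\<^sub>F t in nhds t0. Y t > 0"
      using Y0 contY by (intro order_tendstoD(1)[OF isCont_tendsto_nhds]) auto
    ultimately show ?thesis by (rule eventually_conj[rotated])
  qed
  have dh: "(h has_real_derivative h1 t) (at t)"
    if "(Y has_real_derivative y t) (at t)" "Y t > 0" "\<tau> * Y t powr \<alpha> < T" for t
  proof -
    have "((\<lambda>t. \<tau> * Y t powr \<alpha>) has_real_derivative \<tau> * (\<alpha> * Y t powr (\<alpha> - 1) * y t)) (at t)"
      using that by (auto intro!: derivative_eq_intros)
    moreover have "(\<psi> has_real_derivative - froot (h t)) (at (\<tau> * Y t powr \<alpha>))"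
      using psiT[of "\<tau> * Y t powr \<alpha>"] that \<tau> by (auto simp: h_def)
    ultimately have "(h has_real_derivative - froot (h t) * (\<tau> * (\<alpha> * Y t powr (\<alpha> - 1) * y t))) (at t)"
      unfolding h_def by (intro DERIV_chain2[where f = \<psi>])
    then show ?thesis by (simp add: h1_def c_def \<alpha>(2) mult_ac)
  qed
  have e1: "\<forall>\<^sub>F t in nhds t0. (h has_real_derivative h1 t) (at t)"
    using eventually_conj[OF dY ev] by eventually_elim (use dh in auto)
  define h0 where "h0 = h t0"
  have h0: "h0 > 0" using psiT[of "\<tau> * Y t0 powr \<alpha>"] Y0 \<tau> by (simp add: h0_def h_def)
  have d0: "(h has_real_derivative h1 t0) (at t0)" using e1 by (rule eventually_nhds_x_imp_x)
  define P where "P = froot h0 * c * Y t0 powr (1 / real k)"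
  have P: "P > 0" "h1 t0 = - P * y t0" using F_pos[OF h0] c Y0 by (auto simp: P_def h1_def h0_def)
  have "((\<lambda>t. froot (h t)) has_real_derivative deriv froot h0 * h1 t0) (at t0)"
    using F_deriv[OF h0] d0 by (intro DERIV_chain2[where f = froot]) (auto simp: h0_def)
  moreover have "((\<lambda>t. c * Y t powr (1 / real k) * y t) has_real_derivative
     c * (1 / real k * Y t0 powr (1 / real k - 1) * y t0) * y t0 + c * Y t0 powr (1 / real k) * y') (at t0)"
    using Y0 by (auto intro!: derivative_eq_intros dY0 dy)
  ultimately have d2: "(h1 has_real_derivative - (deriv froot h0 * h1 t0) * (c * Y t0 powr (1 / real k) * y t0)
     + (c * (1 / real k * Y t0 powr (1 / real k - 1) * y t0) * y t0 + c * Y t0 powr (1 / real k) * y') * - froot (h t0)) (at t0)"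
    (is "(_ has_real_derivative ?h2) _")
    unfolding h1_def[abs_def] by (intro DERIV_mult DERIV_minus) (auto simp: h1_def)
  \<comment> \<open>The three summands come from differentiating F (h), the power of Y and the
    factor y in the formula for h'.\<close>
  define B where "B = \<alpha> * (deriv froot h0 * (\<tau> * Y t0 powr \<alpha>)) - 1 / real k - Y t0 * y' / (y t0)\<^sup>2"
  have p1: "Y t0 powr (1 / real k - 1) = Y t0 powr (1 / real k) / Y t0"
    using Y0 by (simp add: powr_diff)
  have p2: "Y t0 powr \<alpha> = Y t0 powr (1 / real k) * Y t0"
    using Y0 \<alpha>(2) by (metis add.commute add_diff_cancel_left' diff_add_cancel less_imp_le powr_add powr_one)
  have h2: "?h2 = P * (y t0)\<^sup>2 / Y t0 * B"
    unfolding P(2) p1 B_def p2 unfolding P_def c_def h0_def using Y0 y0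
    by (simp add: field_simps power2_eq_square)
  have Pk: "P ^ k = f h0 * c ^ k * Y t0"
  proof -
    have "(Y t0 powr (1 / real k)) ^ k = Y t0"
      using Y0 kr by (simp add: powr_realpow[symmetric] powr_powr del: powr_realpow)
    then show ?thesis using F_power[OF h0] by (simp add: P_def power_mult_distrib)
  qed
  have 1: "(- h1 t0) ^ k = f (h t0) * (\<tau> * \<alpha>) ^ k * Y t0 * y t0 ^ k"
    using Pk by (simp add: P power_mult_distrib h0_def c_def)
  \<comment> \<open>k - 1 factors from h' and one from h'' make a full k-th power of
    \<open>P\<close>, so the k-th roots disappear.\<close>
  have "(- h1 t0) ^ (k - 1) * (P * (y t0)\<^sup>2 / Y t0) = P ^ k * (y t0) ^ (k + 1) / Y t0"
    using k by (cases k) (auto simp: P power_mult_distrib power2_eq_square)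
  also have "\<dots> = f (h t0) * (\<tau> * \<alpha>) ^ k * y t0 ^ (k + 1)"
    unfolding Pk using Y0 by (simp add: h0_def c_def)
  finally have 2: "(- h1 t0) ^ (k - 1) * ?h2 = f (h t0) * (\<tau> * \<alpha>) ^ k * y t0 ^ (k + 1) * B"
    unfolding h2 by (metis mult.assoc)
  show ?thesis
    by (rule that[OF e1 d2]) (use 1 2 P y0 in \<open>simp_all add: B_def h0_def\<close>)
qed

end

section \<open>The weight \<theta> and its perturbations\<close>

context
  fixes \<theta> :: "real \<Rightarrow> real" and \<delta>0 D :: real
  assumes \<delta>0: "\<delta>0 > 0"
    and pos_all: "\<forall>t. 0 < t \<longrightarrow> t < \<delta>0 \<longrightarrow> \<theta> t > 0"
    and monotone: "mono_on {0<..<\<delta>0} \<theta> \<or> antimono_on {0<..<\<delta>0} \<theta>"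
    and C1: "Ck_on 1 \<theta> {0<..<\<delta>0}"
    and intg: "set_integrable lborel {0<..<\<delta>0} \<theta>"
    and D: "(deriv (\<lambda>t. Theta \<theta> t / \<theta> t) \<longlongrightarrow> D) (at_right 0)"
begin

lemmas theta_pos = pos_all[rule_format]

lemma theta_deriv: "0 < t \<Longrightarrow> t < \<delta>0 \<Longrightarrow> (\<theta> has_real_derivative deriv \<theta> t) (at t)"
  using Ck_on_realD[OF C1] by simp

lemma theta_integrable: "t \<le> \<delta>0 \<Longrightarrow> \<theta> integrable_on {0..t}"
  unfolding integrable_on_open_interval_real[symmetric]
  by (rule set_borel_integral_eq_integral(1), rule set_integrable_subset[OF intg]) auto

lemma Theta_eq: "t \<le> \<delta>0 \<Longrightarrow> Theta \<theta> t = integral {0..t} \<theta>"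
  unfolding Theta_def integral_open_interval_real
  by (rule set_borel_integral_eq_integral(2), rule set_integrable_subset[OF intg]) auto

text \<open>The integral is split at a > 0 because a decreasing \<theta> may be unbounded at
  0.\<close>

lemma Theta_deriv:
  assumes "0 < t" "t < \<delta>0"
  shows "(Theta \<theta> has_real_derivative \<theta> t) (at t)"
proof -
  define a b where "a = t / 2" and "b = (t + \<delta>0) / 2"
  have ab: "0 < a" "a < t" "t < b" "b < \<delta>0" using assms by (auto simp: a_def b_def)
  have cont: "continuous_on {a..b} \<theta>"
    by (intro continuous_at_imp_continuous_on ballI DERIV_isCont[OF theta_deriv]) (use ab in auto)
  have eq: "integral {0..a} \<theta> + integral {a..x} \<theta> = Theta \<theta> x" if "x \<in> {a..b}" for x
  proof -
    have "integral {0..a} \<theta> + integral {a..x} \<theta> = integral {0..x} \<theta>"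
      by (rule Henstock_Kurzweil_Integration.integral_combine) (use that ab theta_integrable in auto)
    then show ?thesis using Theta_eq[of x] that ab by auto
  qed
  have "((\<lambda>x. integral {0..a} \<theta> + integral {a..x} \<theta>) has_real_derivative \<theta> t) (at t within {a..b})"
    using integral_has_real_derivative[OF cont, of t] ab by (auto intro!: derivative_eq_intros)
  then have "(Theta \<theta> has_real_derivative \<theta> t) (at t within {a..b})"
    by (rule has_field_derivative_transform_within[where d = 1]) (use ab eq in simp_all)
  moreover have "at t within {a..b} = at t" using ab by (intro at_within_interior) auto
  ultimately show ?thesis by simp
qed

lemma Theta_strict: "0 < s \<Longrightarrow> s < t \<Longrightarrow> t < \<delta>0 \<Longrightarrow> Theta \<theta> s < Theta \<theta> t"
proof (rule DERIV_pos_imp_increasing[of s t "Theta \<theta>"])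
  fix x assume "0 < s" "s \<le> x" "x \<le> t" "t < \<delta>0"
  then show "\<exists>y. (Theta \<theta> has_real_derivative y) (at x) \<and> y > 0"
    using Theta_deriv[of x] theta_pos[of x] by (intro exI[of _ "\<theta> x"]) auto
qed

lemma Theta_tendsto_0: "(Theta \<theta> \<longlongrightarrow> 0) (at_right 0)"
proof -
  have "continuous_on {0..\<delta>0} (\<lambda>x. integral {0..x} \<theta>)"
    by (rule indefinite_integral_continuous_1[OF theta_integrable]) simp
  from bspec[OF this[unfolded continuous_on_def], of 0]
  have "((\<lambda>x. integral {0..x} \<theta>) \<longlongrightarrow> 0) (at_right 0)"
    using \<delta>0 by (simp add: at_within_Icc_at_right)
  moreover have "\<forall>\<^sub>F x in at_right 0. integral {0..x} \<theta> = Theta \<theta> x"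
    using Theta_eq \<delta>0 unfolding eventually_at_right_field by (metis less_imp_le)
  ultimately show ?thesis by (rule Lim_transform_eventually)
qed

lemma Theta_pos:
  assumes t: "0 < t" "t < \<delta>0"
  shows "Theta \<theta> t > 0"
proof -
  have "\<forall>\<^sub>F s in at_right 0. Theta \<theta> s \<le> Theta \<theta> (t / 2)"
    using t Theta_strict[of _ "t / 2"] unfolding eventually_at_right_field
    by (intro exI[of _ "t / 2"]) (auto intro!: less_imp_le)
  then have "0 \<le> Theta \<theta> (t / 2)"
    using tendsto_upperbound[OF Theta_tendsto_0] by simp
  then show ?thesis using Theta_strict[of "t / 2" t] t by simp
qed

text \<open>The quotient rule for \<Theta> / \<theta>; this is the form in which D enters the second
  derivative of the barrier.\<close>

lemma theta_ratio_tendsto: "((\<lambda>t. Theta \<theta> t * deriv \<theta> t / (\<theta> t)\<^sup>2) \<longlongrightarrow> 1 - D) (at_right 0)"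
proof -
  have "((\<lambda>t. 1 - deriv (\<lambda>t. Theta \<theta> t / \<theta> t) t) \<longlongrightarrow> 1 - D) (at_right 0)"
    by (intro tendsto_intros D)
  moreover have "\<forall>\<^sub>F t in at_right 0. 1 - deriv (\<lambda>t. Theta \<theta> t / \<theta> t) t = Theta \<theta> t * deriv \<theta> t / (\<theta> t)\<^sup>2"
    unfolding eventually_at_right_field
  proof (intro exI[of _ \<delta>0] conjI allI impI)
    fix t assume t: "0 < t" "t < \<delta>0"
    have "((\<lambda>t. Theta \<theta> t / \<theta> t) has_real_derivative (\<theta> t * \<theta> t - Theta \<theta> t * deriv \<theta> t) / (\<theta> t * \<theta> t)) (at t)"
      by (rule DERIV_divide[OF Theta_deriv[OF t] theta_deriv[OF t]]) (use theta_pos[OF t] in simp)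
    then have "deriv (\<lambda>t. Theta \<theta> t / \<theta> t) t = (\<theta> t * \<theta> t - Theta \<theta> t * deriv \<theta> t) / (\<theta> t * \<theta> t)"
      by (rule DERIV_imp_deriv)
    then show "1 - deriv (\<lambda>t. Theta \<theta> t / \<theta> t) t = Theta \<theta> t * deriv \<theta> t / (\<theta> t)\<^sup>2"
      using theta_pos[OF t] by (simp add: diff_divide_distrib power2_eq_square)
  qed (use \<delta>0 in auto)
  ultimately show ?thesis by (rule Lim_transform_eventually)
qed

text \<open>Monotonicity supplies the bound: \<Theta>(t) <= t \<theta>(t) for increasing \<theta>,
  and \<theta> bounded below near 0 for decreasing \<theta>. The limit makes the term with S_k of
  the curvatures negligible against the one with S_{k-1}.\<close>

lemma Theta_over_theta_tendsto: "((\<lambda>t. Theta \<theta> t / \<theta> t) \<longlongrightarrow> 0) (at_right 0)"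
  using monotone
proof
  assume m: "mono_on {0<..<\<delta>0} \<theta>"
  have bound: "Theta \<theta> t / \<theta> t \<le> t" if t: "0 < t" "t < \<delta>0" for t
  proof -
    have "integral {0..t} \<theta> = integral {0<..<t} \<theta>" by (rule integral_open_interval_real)
    also have "\<dots> \<le> integral {0<..<t} (\<lambda>_. \<theta> t)"
      using theta_integrable[of t] t monotone_onD[OF m]
      by (intro integral_le) (auto simp: integrable_on_open_interval_real)
    also have "\<dots> = t * \<theta> t" unfolding integral_open_interval_real[symmetric] using t by simp
    finally show ?thesis using Theta_eq[of t] t theta_pos[OF t] by (simp add: field_simps)
  qed
  show ?thesis
  proof (rule tendsto_sandwich[of "\<lambda>_. 0" _ _ "\<lambda>t. t"])
    show "\<forall>\<^sub>F t in at_right 0. 0 \<le> Theta \<theta> t / \<theta> t" "\<forall>\<^sub>F t in at_right 0. Theta \<theta> t / \<theta> t \<le> t"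
      unfolding eventually_at_right_field using \<delta>0 bound less_imp_le[OF Theta_pos] theta_pos
      by (auto intro!: exI[of _ \<delta>0] divide_nonneg_pos)
  qed (auto intro: tendsto_eq_intros)
next
  assume m: "antimono_on {0<..<\<delta>0} \<theta>"
  let ?c = "\<theta> (\<delta>0 / 2)"
  have c: "?c > 0" using theta_pos[of "\<delta>0 / 2"] \<delta>0 by simp
  have bound: "Theta \<theta> t / \<theta> t \<le> Theta \<theta> t / ?c" if t: "0 < t" "t < \<delta>0 / 2" for t
    using Theta_pos[of t] t c monotone_onD[OF m, of t "\<delta>0 / 2"] \<delta>0 by (intro divide_left_mono) (auto intro!: mult_pos_pos theta_pos)
  show ?thesis
  proof (rule tendsto_sandwich[of "\<lambda>_. 0" _ _ "\<lambda>t. Theta \<theta> t / ?c"])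
    show "\<forall>\<^sub>F t in at_right 0. 0 \<le> Theta \<theta> t / \<theta> t" "\<forall>\<^sub>F t in at_right 0. Theta \<theta> t / \<theta> t \<le> Theta \<theta> t / ?c"
      unfolding eventually_at_right_field using \<delta>0 bound less_imp_le[OF Theta_pos] theta_pos
      by (auto intro!: exI[of _ "\<delta>0 / 2"] divide_nonneg_pos)
    show "((\<lambda>t. Theta \<theta> t / ?c) \<longlongrightarrow> 0) (at_right 0)"
      using tendsto_divide[OF Theta_tendsto_0 tendsto_const[of ?c]] c by simp
  qed auto
qed

lemma theta_estimates:
  assumes "\<eta> > 0"
  shows "\<exists>\<delta>>0. \<delta> \<le> \<delta>0 \<and> (\<forall>t. 0 < t \<longrightarrow> t < \<delta> \<longrightarrow>
    \<bar>Theta \<theta> t * deriv \<theta> t / (\<theta> t)\<^sup>2 - (1 - D)\<bar> < \<eta> \<and> Theta \<theta> t / \<theta> t < \<eta> \<and> Theta \<theta> t < \<eta>)"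
proof -
  have "\<forall>\<^sub>F t in at_right 0. \<bar>Theta \<theta> t * deriv \<theta> t / (\<theta> t)\<^sup>2 - (1 - D)\<bar> < \<eta> \<and> Theta \<theta> t / \<theta> t < \<eta> \<and> Theta \<theta> t < \<eta>"
    using tendstoD[OF theta_ratio_tendsto assms] order_tendstoD(2)[OF Theta_over_theta_tendsto assms]
      order_tendstoD(2)[OF Theta_tendsto_0 assms]
    by eventually_elim (simp add: dist_real_def)
  then obtain b where "b > 0" "\<And>t. 0 < t \<Longrightarrow> t < b \<Longrightarrow> \<bar>Theta \<theta> t * deriv \<theta> t / (\<theta> t)\<^sup>2 - (1 - D)\<bar> < \<eta> \<and> Theta \<theta> t / \<theta> t < \<eta> \<and> Theta \<theta> t < \<eta>"
    unfolding eventually_at_right_field by auto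
  then show ?thesis using \<delta>0 by (intro exI[of _ "min b \<delta>0"]) auto
qed

lemma deriv_theta_sign:
  assumes t: "0 < t" "t < \<delta>0"
  shows "mono_on {0<..<\<delta>0} \<theta> \<Longrightarrow> deriv \<theta> t \<ge> 0" "antimono_on {0<..<\<delta>0} \<theta> \<Longrightarrow> deriv \<theta> t \<le> 0"
proof -
  assume "mono_on {0<..<\<delta>0} \<theta>"
  then show "deriv \<theta> t \<ge> 0"
    by (rule mono_on_imp_deriv_nonneg[OF _ theta_deriv[OF t]]) (use t in auto)
next
  assume "antimono_on {0<..<\<delta>0} \<theta>"
  then have "mono_on {0<..<\<delta>0} (\<lambda>t. - \<theta> t)" by (auto simp: monotone_on_def)
  then have "- deriv \<theta> t \<ge> 0"
    by (rule mono_on_imp_deriv_nonneg[OF _ DERIV_minus[OF theta_deriv[OF t]]]) (use t in auto)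
  then show "deriv \<theta> t \<le> 0" by simp
qed

text \<open>The perturbed weights \<open>Y \<rho>\<close> replacing \<open>\<Theta>\<close> in the barriers: for increasing \<open>\<theta>\<close> the argument is
  translated, for decreasing \<open>\<theta>\<close> the value is, so that in both cases the derivative of \<open>Y \<rho>\<close>
  compares with \<open>\<theta>\<close> and \<open>Y Y'' / Y'\<^sup>2\<close> with \<open>\<Theta> \<theta>' / \<theta>\<^sup>2\<close> in the favourable direction.\<close>

lemma upper_profile:
  assumes \<eta>: "\<eta> > 0"
  obtains \<delta> Y y y' where "0 < \<delta>" "\<delta> \<le> \<delta>0"
    "\<And>\<rho> t. 0 < \<rho> \<Longrightarrow> \<rho> < t \<Longrightarrow> t < \<delta> \<Longrightarrow> Y \<rho> t > 0 \<and> (Y \<rho> has_real_derivative y \<rho> t) (at t) \<and>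
       (y \<rho> has_real_derivative y' \<rho> t) (at t) \<and> 0 < y \<rho> t \<and> y \<rho> t \<le> \<theta> t \<and>
       Y \<rho> t / y \<rho> t \<le> \<eta> \<and> - (Y \<rho> t * y' \<rho> t / (y \<rho> t)\<^sup>2) \<le> D - 1 + \<eta> \<and> Y \<rho> t \<le> Theta \<theta> t \<and> Theta \<theta> t < \<eta>"
    "\<And>\<rho>. 0 < \<rho> \<Longrightarrow> \<rho> < \<delta> \<Longrightarrow> (Y \<rho> \<longlongrightarrow> 0) (at_right \<rho>)"
    "\<And>t. 0 < t \<Longrightarrow> t < \<delta> \<Longrightarrow> ((\<lambda>\<rho>. Y \<rho> t) \<longlongrightarrow> Theta \<theta> t) (at_right 0)"
proof -
  obtain \<delta> where \<delta>: "0 < \<delta>" "\<delta> \<le> \<delta>0"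
    and e: "\<And>t. 0 < t \<Longrightarrow> t < \<delta> \<Longrightarrow> \<bar>Theta \<theta> t * deriv \<theta> t / (\<theta> t)\<^sup>2 - (1 - D)\<bar> < \<eta>"
      "\<And>t. 0 < t \<Longrightarrow> t < \<delta> \<Longrightarrow> Theta \<theta> t / \<theta> t < \<eta>" "\<And>t. 0 < t \<Longrightarrow> t < \<delta> \<Longrightarrow> Theta \<theta> t < \<eta>"
    using theta_estimates[OF \<eta>] by blast
  have cont: "isCont (Theta \<theta>) t" if "0 < t" "t < \<delta>" for t
    using DERIV_isCont[OF Theta_deriv[of t]] that \<delta> by simp
  from monotone show ?thesis
  proof
    assume m: "mono_on {0<..<\<delta>0} \<theta>"
    show ?thesis
    proof (rule that[of \<delta> "\<lambda>\<rho> t. Theta \<theta> (t - \<rho>)" "\<lambda>\<rho> t. \<theta> (t - \<rho>)" "\<lambda>\<rho> t. deriv \<theta> (t - \<rho>)"])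
      fix \<rho> t :: real assume r: "0 < \<rho>" "\<rho> < t" "t < \<delta>"
      have "(\<lambda>t. t - \<rho>) = (\<lambda>t. t + - \<rho>)" by simp
      then have "((\<lambda>t. Theta \<theta> (t - \<rho>)) has_real_derivative \<theta> (t - \<rho>)) (at t)"
        "((\<lambda>t. \<theta> (t - \<rho>)) has_real_derivative deriv \<theta> (t - \<rho>)) (at t)"
        using DERIV_at_within_shift[of "Theta \<theta>" _ "- \<rho>" t UNIV] DERIV_at_within_shift[of \<theta> _ "- \<rho>" t UNIV]
          Theta_deriv[of "t - \<rho>"] theta_deriv[of "t - \<rho>"] r \<delta> by auto
      moreover have "\<theta> (t - \<rho>) \<le> \<theta> t" using monotone_onD[OF m, of "t - \<rho>" t] r \<delta> by auto
      ultimately show "Theta \<theta> (t - \<rho>) > 0 \<and> ((\<lambda>t. Theta \<theta> (t - \<rho>)) has_real_derivative \<theta> (t - \<rho>)) (at t) \<and>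
       ((\<lambda>t. \<theta> (t - \<rho>)) has_real_derivative deriv \<theta> (t - \<rho>)) (at t) \<and> 0 < \<theta> (t - \<rho>) \<and> \<theta> (t - \<rho>) \<le> \<theta> t \<and>
       Theta \<theta> (t - \<rho>) / \<theta> (t - \<rho>) \<le> \<eta> \<and> - (Theta \<theta> (t - \<rho>) * deriv \<theta> (t - \<rho>) / (\<theta> (t - \<rho>))\<^sup>2) \<le> D - 1 + \<eta> \<and>
       Theta \<theta> (t - \<rho>) \<le> Theta \<theta> t \<and> Theta \<theta> t < \<eta>"
        using r \<delta> e(1,2)[of "t - \<rho>"] e(3)[of t] Theta_pos[of "t - \<rho>"] theta_pos[of "t - \<rho>"] Theta_strict[of "t - \<rho>" t] by auto
    next
      fix \<rho> assume "0 < \<rho>" "\<rho> < \<delta>"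
      have "filterlim (\<lambda>t. t - \<rho>) (at_right 0) (at_right \<rho>)"
        by (subst at_right_to_0) (simp add: filterlim_filtermap filterlim_ident)
      from filterlim_compose[OF Theta_tendsto_0 this]
      show "((\<lambda>t. Theta \<theta> (t - \<rho>)) \<longlongrightarrow> 0) (at_right \<rho>)" .
    next
      fix t assume t: "0 < t" "t < \<delta>"
      have "((\<lambda>\<rho>. t - \<rho>) \<longlongrightarrow> t) (at_right 0)" by (auto intro!: tendsto_eq_intros)
      from isCont_tendsto_compose[OF cont[OF t] this]
      show "((\<lambda>\<rho>. Theta \<theta> (t - \<rho>)) \<longlongrightarrow> Theta \<theta> t) (at_right 0)" .
    qed (use \<delta> in auto)
  next
    assume m: "antimono_on {0<..<\<delta>0} \<theta>"
    show ?thesis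
    proof (rule that[of \<delta> "\<lambda>\<rho> t. Theta \<theta> t - Theta \<theta> \<rho>" "\<lambda>\<rho>. \<theta>" "\<lambda>\<rho>. deriv \<theta>"])
      fix \<rho> t :: real assume r: "0 < \<rho>" "\<rho> < t" "t < \<delta>"
      have T: "0 < Theta \<theta> \<rho>" "Theta \<theta> \<rho> < Theta \<theta> t" "\<theta> t > 0"
        using r \<delta> Theta_pos[of \<rho>] Theta_strict[of \<rho> t] theta_pos[of t] by auto
      have d: "((\<lambda>t. Theta \<theta> t - Theta \<theta> \<rho>) has_real_derivative \<theta> t) (at t)"
        using Theta_deriv[of t] r \<delta> by (auto intro!: derivative_eq_intros)
      have "(Theta \<theta> t - Theta \<theta> \<rho>) / \<theta> t \<le> Theta \<theta> t / \<theta> t" using T by (intro divide_right_mono) auto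
      then have 1: "(Theta \<theta> t - Theta \<theta> \<rho>) / \<theta> t \<le> \<eta>" using e(2)[of t] r by auto
      \<comment> \<open>Here - \<theta>' >= 0, so lowering the first factor can only decrease the
        quantity that is bounded from above.\<close>
      have "(Theta \<theta> t - Theta \<theta> \<rho>) * - deriv \<theta> t / (\<theta> t)\<^sup>2 \<le> Theta \<theta> t * - deriv \<theta> t / (\<theta> t)\<^sup>2"
        using T r \<delta> deriv_theta_sign(2)[OF _ _ m, of t] by (intro divide_right_mono mult_right_mono) auto
      then have 2: "- ((Theta \<theta> t - Theta \<theta> \<rho>) * deriv \<theta> t / (\<theta> t)\<^sup>2) \<le> D - 1 + \<eta>" using e(1)[of t] r by auto
      show "Theta \<theta> t - Theta \<theta> \<rho> > 0 \<and> ((\<lambda>t. Theta \<theta> t - Theta \<theta> \<rho>) has_real_derivative \<theta> t) (at t) \<and>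
       (\<theta> has_real_derivative deriv \<theta> t) (at t) \<and> 0 < \<theta> t \<and> \<theta> t \<le> \<theta> t \<and>
       (Theta \<theta> t - Theta \<theta> \<rho>) / \<theta> t \<le> \<eta> \<and> - ((Theta \<theta> t - Theta \<theta> \<rho>) * deriv \<theta> t / (\<theta> t)\<^sup>2) \<le> D - 1 + \<eta> \<and>
       Theta \<theta> t - Theta \<theta> \<rho> \<le> Theta \<theta> t \<and> Theta \<theta> t < \<eta>"
        using T d 1 2 theta_deriv[of t] e(3)[of t] r \<delta> by auto
    next
      fix \<rho> assume r: "0 < \<rho>" "\<rho> < \<delta>"
      have "(Theta \<theta> \<longlongrightarrow> Theta \<theta> \<rho>) (at_right \<rho>)"
        using cont[OF r] by (simp add: continuous_at tendsto_within_subset[of _ _ _ UNIV])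
      from tendsto_diff[OF this tendsto_const[of "Theta \<theta> \<rho>"]]
      show "((\<lambda>t. Theta \<theta> t - Theta \<theta> \<rho>) \<longlongrightarrow> 0) (at_right \<rho>)" by simp
    next
      fix t assume t: "0 < t" "t < \<delta>"
      from tendsto_diff[OF tendsto_const[of "Theta \<theta> t"] Theta_tendsto_0]
      show "((\<lambda>\<rho>. Theta \<theta> t - Theta \<theta> \<rho>) \<longlongrightarrow> Theta \<theta> t) (at_right 0)" by simp
    qed (use \<delta> in auto)
  qed
qed

text \<open>The opposite shifts: Y \<rho> >= \<Theta>(\<rho>) > 0 keeps the barrier bounded up to
  the boundary, and the derivative now dominates \<theta>. The bound 2 \<eta> leaves room for a sum
  of two values of \<Theta>.\<close>

lemma lower_profile:
  assumes \<eta>: "\<eta> > 0"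
  obtains \<delta> Y y y' where "0 < \<delta>" "\<delta> \<le> \<delta>0"
    "\<And>\<rho> t. 0 < \<rho> \<Longrightarrow> \<rho> < \<delta> \<Longrightarrow> 0 < t \<Longrightarrow> t < \<delta> \<Longrightarrow> Y \<rho> t > 0 \<and> (Y \<rho> has_real_derivative y \<rho> t) (at t) \<and>
       (y \<rho> has_real_derivative y' \<rho> t) (at t) \<and> 0 < \<theta> t \<and> \<theta> t \<le> y \<rho> t \<and>
       - (Y \<rho> t * y' \<rho> t / (y \<rho> t)\<^sup>2) \<ge> D - 1 - \<eta> \<and> Theta \<theta> t \<le> Y \<rho> t \<and> Theta \<theta> \<rho> \<le> Y \<rho> t \<and> Y \<rho> t < 2 * \<eta>"
    "\<And>t. 0 < t \<Longrightarrow> t < \<delta> \<Longrightarrow> ((\<lambda>\<rho>. Y \<rho> t) \<longlongrightarrow> Theta \<theta> t) (at_right 0)"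
proof -
  obtain \<delta>' where \<delta>': "0 < \<delta>'" "\<delta>' \<le> \<delta>0"
    and e: "\<And>t. 0 < t \<Longrightarrow> t < \<delta>' \<Longrightarrow> \<bar>Theta \<theta> t * deriv \<theta> t / (\<theta> t)\<^sup>2 - (1 - D)\<bar> < \<eta>"
      "\<And>t. 0 < t \<Longrightarrow> t < \<delta>' \<Longrightarrow> Theta \<theta> t / \<theta> t < \<eta>" "\<And>t. 0 < t \<Longrightarrow> t < \<delta>' \<Longrightarrow> Theta \<theta> t < \<eta>"
    using theta_estimates[OF \<eta>] by blast
  \<comment> \<open>Halved so that t + \<rho> stays below \<delta>'.\<close>
  define \<delta> where "\<delta> = \<delta>' / 2"
  have \<delta>: "0 < \<delta>" "\<delta> \<le> \<delta>0" "2 * \<delta> = \<delta>'" "\<delta> < \<delta>'" using \<delta>' by (auto simp: \<delta>_def)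
  have cont: "isCont (Theta \<theta>) t" if "0 < t" "t < \<delta>" for t
    using DERIV_isCont[OF Theta_deriv[of t]] that \<delta> by simp
  from monotone show ?thesis
  proof
    assume m: "mono_on {0<..<\<delta>0} \<theta>"
    show ?thesis
    proof (rule that[of \<delta> "\<lambda>\<rho> t. Theta \<theta> (t + \<rho>)" "\<lambda>\<rho> t. \<theta> (t + \<rho>)" "\<lambda>\<rho> t. deriv \<theta> (t + \<rho>)"])
      fix \<rho> t :: real assume r: "0 < \<rho>" "\<rho> < \<delta>" "0 < t" "t < \<delta>"
      have tr: "0 < t + \<rho>" "t + \<rho> < \<delta>'" "t + \<rho> < \<delta>0" using r \<delta> \<delta>' by auto
      have "((\<lambda>t. Theta \<theta> (t + \<rho>)) has_real_derivative \<theta> (t + \<rho>)) (at t)"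
        "((\<lambda>t. \<theta> (t + \<rho>)) has_real_derivative deriv \<theta> (t + \<rho>)) (at t)"
        using DERIV_at_within_shift[of "Theta \<theta>" _ \<rho> t UNIV] DERIV_at_within_shift[of \<theta> _ \<rho> t UNIV]
          Theta_deriv[of "t + \<rho>"] theta_deriv[of "t + \<rho>"] tr by (auto simp: add.commute)
      moreover have "\<theta> t \<le> \<theta> (t + \<rho>)" using monotone_onD[OF m, of t "t + \<rho>"] r tr by auto
      ultimately show "Theta \<theta> (t + \<rho>) > 0 \<and> ((\<lambda>t. Theta \<theta> (t + \<rho>)) has_real_derivative \<theta> (t + \<rho>)) (at t) \<and>
       ((\<lambda>t. \<theta> (t + \<rho>)) has_real_derivative deriv \<theta> (t + \<rho>)) (at t) \<and> 0 < \<theta> t \<and> \<theta> t \<le> \<theta> (t + \<rho>) \<and>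
       - (Theta \<theta> (t + \<rho>) * deriv \<theta> (t + \<rho>) / (\<theta> (t + \<rho>))\<^sup>2) \<ge> D - 1 - \<eta> \<and>
       Theta \<theta> t \<le> Theta \<theta> (t + \<rho>) \<and> Theta \<theta> \<rho> \<le> Theta \<theta> (t + \<rho>) \<and> Theta \<theta> (t + \<rho>) < 2 * \<eta>"
        using r tr \<delta> \<delta>' \<eta> e(1,3)[of "t + \<rho>"] Theta_pos[of "t + \<rho>"] theta_pos[of t] Theta_strict[of t "t + \<rho>"] Theta_strict[of \<rho> "t + \<rho>"]
        by auto
    next
      fix t assume t: "0 < t" "t < \<delta>"
      have "((\<lambda>\<rho>. t + \<rho>) \<longlongrightarrow> t) (at_right 0)" by (auto intro!: tendsto_eq_intros)
      from isCont_tendsto_compose[OF cont[OF t] this]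
      show "((\<lambda>\<rho>. Theta \<theta> (t + \<rho>)) \<longlongrightarrow> Theta \<theta> t) (at_right 0)" .
    qed (use \<delta> in auto)
  next
    assume m: "antimono_on {0<..<\<delta>0} \<theta>"
    show ?thesis
    proof (rule that[of \<delta> "\<lambda>\<rho> t. Theta \<theta> t + Theta \<theta> \<rho>" "\<lambda>\<rho>. \<theta>" "\<lambda>\<rho>. deriv \<theta>"])
      fix \<rho> t :: real assume r: "0 < \<rho>" "\<rho> < \<delta>" "0 < t" "t < \<delta>"
      have T: "0 < Theta \<theta> \<rho>" "0 < Theta \<theta> t" "\<theta> t > 0"
        using r \<delta> Theta_pos[of \<rho>] Theta_pos[of t] theta_pos[of t] by auto
      have d: "((\<lambda>t. Theta \<theta> t + Theta \<theta> \<rho>) has_real_derivative \<theta> t) (at t)"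
        using Theta_deriv[of t] r \<delta> by (auto intro!: derivative_eq_intros)
      have "Theta \<theta> t * - deriv \<theta> t / (\<theta> t)\<^sup>2 \<le> (Theta \<theta> t + Theta \<theta> \<rho>) * - deriv \<theta> t / (\<theta> t)\<^sup>2"
        using T r \<delta> deriv_theta_sign(2)[OF _ _ m, of t] by (intro divide_right_mono mult_right_mono) auto
      then have 2: "- ((Theta \<theta> t + Theta \<theta> \<rho>) * deriv \<theta> t / (\<theta> t)\<^sup>2) \<ge> D - 1 - \<eta>" using e(1)[of t] r \<delta> by auto
      show "Theta \<theta> t + Theta \<theta> \<rho> > 0 \<and> ((\<lambda>t. Theta \<theta> t + Theta \<theta> \<rho>) has_real_derivative \<theta> t) (at t) \<and>
       (\<theta> has_real_derivative deriv \<theta> t) (at t) \<and> 0 < \<theta> t \<and> \<theta> t \<le> \<theta> t \<and>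
       - ((Theta \<theta> t + Theta \<theta> \<rho>) * deriv \<theta> t / (\<theta> t)\<^sup>2) \<ge> D - 1 - \<eta> \<and>
       Theta \<theta> t \<le> Theta \<theta> t + Theta \<theta> \<rho> \<and> Theta \<theta> \<rho> \<le> Theta \<theta> t + Theta \<theta> \<rho> \<and> Theta \<theta> t + Theta \<theta> \<rho> < 2 * \<eta>"
        using T d 2 theta_deriv[of t] e(3)[of t] e(3)[of \<rho>] r \<delta> by auto
    next
      fix t assume t: "0 < t" "t < \<delta>"
      from tendsto_add[OF tendsto_const[of "Theta \<theta> t"] Theta_tendsto_0]
      show "((\<lambda>\<rho>. Theta \<theta> t + Theta \<theta> \<rho>) \<longlongrightarrow> Theta \<theta> t) (at_right 0)" by simp
    qed (use \<delta> in auto)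
  qed
qed

end

section \<open>Comparison at a touching point\<close>

text \<open>A Lipschitz estimate in a common shift, uniform on bounded lists and in the order j. The
  bounds on the values are carried along because the recurrence for the difference also involves a
  value.\<close>

lemma elem_sym_shift_bound:
  "\<exists>L>0. \<forall>xs c j. length xs = N \<longrightarrow> (\<forall>x\<in>set xs. \<bar>x\<bar> \<le> B) \<longrightarrow> \<bar>c\<bar> \<le> 1 \<longrightarrow>
     \<bar>elem_sym j xs\<bar> \<le> L \<and> \<bar>elem_sym j (map (\<lambda>x. x + c) xs)\<bar> \<le> L \<and>
     \<bar>elem_sym j (map (\<lambda>x. x + c) xs) - elem_sym j xs\<bar> \<le> L * \<bar>c\<bar>"
proof (induction N)
  case 0
  have "\<bar>elem_sym j []\<bar> \<le> 1" for j by (cases j) (auto simp: elem_sym_length_less)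
  then show ?case by (intro exI[of _ 1]) auto
next
  case (Suc N)
  then obtain L where L: "L > 0" and IH: "\<And>xs c j. length xs = N \<Longrightarrow> \<forall>x\<in>set xs. \<bar>x\<bar> \<le> B \<Longrightarrow> \<bar>c\<bar> \<le> 1 \<Longrightarrow>
     \<bar>elem_sym j xs\<bar> \<le> L \<and> \<bar>elem_sym j (map (\<lambda>x. x + c) xs)\<bar> \<le> L \<and>
     \<bar>elem_sym j (map (\<lambda>x. x + c) xs) - elem_sym j xs\<bar> \<le> L * \<bar>c\<bar>"
    by blast
  \<comment> \<open>|B| + 3 adds up the three terms of the difference recurrence; the 1 covers
    \<open>elem_sym 0\<close>.\<close>
  define L' where "L' = (\<bar>B\<bar> + 3) * L + 1"
  have L': "L' > 0" using L by (simp add: L'_def add_pos_pos)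
  have "\<bar>elem_sym j xs\<bar> \<le> L' \<and> \<bar>elem_sym j (map (\<lambda>x. x + c) xs)\<bar> \<le> L' \<and>
     \<bar>elem_sym j (map (\<lambda>x. x + c) xs) - elem_sym j xs\<bar> \<le> L' * \<bar>c\<bar>"
    if xs: "length xs = Suc N" "\<forall>x\<in>set xs. \<bar>x\<bar> \<le> B" and c: "\<bar>c\<bar> \<le> 1" for xs c j
  proof (cases j)
    case 0
    then show ?thesis using L' L by (simp add: L'_def)
  next
    case (Suc i)
    obtain x ys where xy: "xs = x # ys" "length ys = N" using xs(1) by (cases xs) auto
    let ?ys = "map (\<lambda>x. x + c) ys"
    have ys: "\<forall>x\<in>set ys. \<bar>x\<bar> \<le> B" and x: "\<bar>x\<bar> \<le> \<bar>B\<bar>" "\<bar>x + c\<bar> \<le> \<bar>B\<bar> + 1" using xs(2) xy c by auto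
    note I = IH[OF xy(2) ys c]
    have p1: "\<bar>a * e\<bar> \<le> (\<bar>B\<bar> + 1) * L" if "\<bar>a\<bar> \<le> \<bar>B\<bar> + 1" "\<bar>e\<bar> \<le> L" for a e :: real
      unfolding abs_mult using that by (intro mult_mono) auto
    have "\<bar>elem_sym j xs\<bar> \<le> L + (\<bar>B\<bar> + 1) * L"
    proof -
      have "\<bar>x * elem_sym i ys\<bar> \<le> (\<bar>B\<bar> + 1) * L" using I[of i] x by (intro p1) auto
      moreover have "elem_sym j xs = elem_sym (Suc i) ys + x * elem_sym i ys" by (simp add: xy Suc elem_sym_Cons)
      ultimately show ?thesis using I[of "Suc i", THEN conjunct1] by linarith
    qed
    then have 1: "\<bar>elem_sym j xs\<bar> \<le> L'" using L by (simp add: L'_def algebra_simps)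
    have "\<bar>elem_sym j (map (\<lambda>x. x + c) xs)\<bar> \<le> L + (\<bar>B\<bar> + 1) * L"
    proof -
      have "\<bar>(x + c) * elem_sym i ?ys\<bar> \<le> (\<bar>B\<bar> + 1) * L" using I[of i] x by (intro p1) auto
      moreover have "elem_sym j (map (\<lambda>x. x + c) xs) = elem_sym (Suc i) ?ys + (x + c) * elem_sym i ?ys"
        by (simp add: xy Suc elem_sym_Cons)
      ultimately show ?thesis using I[of "Suc i", THEN conjunct2, THEN conjunct1] by linarith
    qed
    then have 2: "\<bar>elem_sym j (map (\<lambda>x. x + c) xs)\<bar> \<le> L'" using L by (simp add: L'_def algebra_simps)
    have "elem_sym j (map (\<lambda>x. x + c) xs) - elem_sym j xs
      = (elem_sym (Suc i) ?ys - elem_sym (Suc i) ys) + (x + c) * (elem_sym i ?ys - elem_sym i ys) + c * elem_sym i ys"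
      by (simp add: xy Suc elem_sym_Cons algebra_simps)
    also have "\<bar>\<dots>\<bar> \<le> L * \<bar>c\<bar> + (\<bar>B\<bar> + 1) * (L * \<bar>c\<bar>) + \<bar>c\<bar> * L"
    proof -
      have "\<bar>(x + c) * (elem_sym i ?ys - elem_sym i ys)\<bar> \<le> (\<bar>B\<bar> + 1) * (L * \<bar>c\<bar>)"
        unfolding abs_mult using x I[of i] by (intro mult_mono) auto
      moreover have "\<bar>c * elem_sym i ys\<bar> \<le> \<bar>c\<bar> * L" unfolding abs_mult using I[of i] by (intro mult_left_mono) auto
      ultimately show ?thesis using I[of "Suc i"] by linarith
    qed
    also have "\<dots> \<le> L' * \<bar>c\<bar>" by (simp add: L'_def algebra_simps)
    finally show ?thesis using 1 2 by blast
  qed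
  then show ?case using L' by blast
qed

text \<open>L precedes e: it is needed to fix the tolerance \<eta> of the barrier, which in turn
  determines e and thereby \<sigma>.\<close>

lemma curvature_shift:
  fixes \<Omega> :: "(real ^ 'n) set"
  assumes sm: "smooth_bounded_domain \<Omega>"
  shows "\<exists>L>0. \<forall>e>0. \<exists>\<sigma>>0. \<forall>y\<in>frontier \<Omega>. length (principal_curvatures \<Omega> y) = CARD('n) - 1 \<and> (\<forall>c j. \<bar>c\<bar> \<le> \<sigma> \<longrightarrow>
     \<bar>elem_sym j (map (\<lambda>a. a + c) (principal_curvatures \<Omega> y)) - S_curv j \<Omega> y\<bar> \<le> e \<and>
     \<bar>elem_sym j (map (\<lambda>a. a + c) (principal_curvatures \<Omega> y))\<bar> \<le> L)"
proof -
  obtain B where B: "\<And>y. y \<in> frontier \<Omega> \<Longrightarrow> length (principal_curvatures \<Omega> y) = CARD('n) - 1 \<and> (\<forall>a\<in>set (principal_curvatures \<Omega> y). \<bar>a\<bar> \<le> B)"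
    using principal_curvatures_bounded[OF sm] by blast
  obtain L where L: "L > 0" and LL: "\<And>xs c j. length xs = CARD('n) - 1 \<Longrightarrow> \<forall>x\<in>set xs. \<bar>x\<bar> \<le> B \<Longrightarrow> \<bar>c\<bar> \<le> 1 \<Longrightarrow>
     \<bar>elem_sym j xs\<bar> \<le> L \<and> \<bar>elem_sym j (map (\<lambda>x. x + c) xs)\<bar> \<le> L \<and>
     \<bar>elem_sym j (map (\<lambda>x. x + c) xs) - elem_sym j xs\<bar> \<le> L * \<bar>c\<bar>"
    using elem_sym_shift_bound[of "CARD('n) - 1" B] by blast
  show ?thesis
  proof (rule exI[of _ L], rule conjI[OF L], intro allI impI)
    fix e :: real assume e: "e > 0"
    define s where "s = min 1 (e / L)"
    have s: "s > 0" "s \<le> 1" "s \<le> e / L" using e L by (auto simp: s_def)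
    then have sL: "L * s \<le> e" using L by (simp add: field_simps)
    show "\<exists>\<sigma>>0. \<forall>y\<in>frontier \<Omega>. length (principal_curvatures \<Omega> y) = CARD('n) - 1 \<and> (\<forall>c j. \<bar>c\<bar> \<le> \<sigma> \<longrightarrow>
     \<bar>elem_sym j (map (\<lambda>a. a + c) (principal_curvatures \<Omega> y)) - S_curv j \<Omega> y\<bar> \<le> e \<and>
     \<bar>elem_sym j (map (\<lambda>a. a + c) (principal_curvatures \<Omega> y))\<bar> \<le> L)"
    proof (intro exI[of _ s] conjI s(1) ballI allI impI)
      fix y c j assume y: "y \<in> frontier \<Omega>"
      show "length (principal_curvatures \<Omega> y) = CARD('n) - 1" using B[OF y] by blast
      assume c: "\<bar>c\<bar> \<le> s"
      then have "\<bar>c\<bar> \<le> 1" using s by simp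
      then have *: "\<bar>elem_sym j (map (\<lambda>x. x + c) (principal_curvatures \<Omega> y))\<bar> \<le> L \<and>
         \<bar>elem_sym j (map (\<lambda>x. x + c) (principal_curvatures \<Omega> y)) - elem_sym j (principal_curvatures \<Omega> y)\<bar> \<le> L * \<bar>c\<bar>"
        using LL[of "principal_curvatures \<Omega> y" c j] B[OF y] by blast
      then show "\<bar>elem_sym j (map (\<lambda>a. a + c) (principal_curvatures \<Omega> y))\<bar> \<le> L" by blast
      have "L * \<bar>c\<bar> \<le> L * s" using c L by (intro mult_left_mono) auto
      then show "\<bar>elem_sym j (map (\<lambda>a. a + c) (principal_curvatures \<Omega> y)) - S_curv j \<Omega> y\<bar> \<le> e"
        using * sL unfolding S_curv_def by linarith
    qed
  qed
qed

text \<open>The second-derivative test along a line, with the distance replaced by a polynomial of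
  slope a and second derivative - S. The factor c is 1 at a maximum and - 1 at a minimum.\<close>

lemma second_order_touching:
  fixes u :: "real ^ 'n \<Rightarrow> real" and h h1 :: "real \<Rightarrow> real"
  assumes C2: "Ck_on 2 u \<Omega>" and op: "open \<Omega>" and x: "x \<in> \<Omega>"
    and dh: "\<forall>\<^sub>F t in nhds d0. (h has_real_derivative h1 t) (at t)" and dh1: "(h1 has_real_derivative h2) (at d0)"
    and mx: "\<forall>\<^sub>F s in nhds 0. c * (u (x + s *\<^sub>R v) - h (d0 + s * a - s\<^sup>2 / 2 * S)) \<le> c * (u x - h d0)"
  shows "c * (v \<bullet> (hessian u x *v v)) \<le> c * (h2 * a\<^sup>2 - h1 d0 * S)"
proof -
  define p where "p s = d0 + s * a - s\<^sup>2 / 2 * S" for s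
  define g where "g s = c * (u (x + s *\<^sub>R v) - h (p s))" for s
  define g1 where "g1 s = c * (gradient u (x + s *\<^sub>R v) \<bullet> v - h1 (p s) * (a - s * S))" for s
  have dp: "(p has_real_derivative (a - s * S)) (at s)" for s
    unfolding p_def[abs_def] by (auto intro!: derivative_eq_intros)
  have p0: "p 0 = d0" by (simp add: p_def)
  have t1: "((\<lambda>s. x + s *\<^sub>R v) \<longlongrightarrow> x) (nhds 0)" by (auto intro!: tendsto_eq_intros filterlim_ident)
  have t2: "(p \<longlongrightarrow> d0) (nhds 0)" unfolding p_def[abs_def] by (auto intro!: tendsto_eq_intros filterlim_ident)
  have e1: "\<forall>\<^sub>F s in nhds 0. x + s *\<^sub>R v \<in> \<Omega>" by (rule topological_tendstoD[OF t1 op x])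
  have e2: "\<forall>\<^sub>F s in nhds 0. (h has_real_derivative h1 (p s)) (at (p s))"
    using t2 dh unfolding filterlim_iff by blast
  have "c * (v \<bullet> (hessian u x *v v) - (h2 * a * a - h1 d0 * S)) \<le> 0"
  proof (rule second_derivative_nonpos_at_max[of g g1])
    show "\<forall>\<^sub>F s in nhds 0. (g has_real_derivative g1 s) (at s)"
      using e1 e2
    proof eventually_elim
      case (elim s)
      show ?case unfolding g_def[abs_def] g1_def
        by (intro DERIV_cmult DERIV_diff line_derivative[OF C2 elim(1)] DERIV_chain2[OF elim(2) dp])
    qed
    have l: "((\<lambda>s. gradient u (x + s *\<^sub>R v) \<bullet> v) has_real_derivative v \<bullet> (hessian u x *v v)) (at 0)"
      using line_second_derivative[OF C2 op, of x 0 v] x by simp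
    have m: "((\<lambda>s. h1 (p s)) has_real_derivative h2 * (a - 0 * S)) (at 0)"
      by (rule DERIV_chain2[OF _ dp]) (simp add: p0 dh1)
    have m2: "((\<lambda>s. a - s * S) has_real_derivative - S) (at 0)" by (auto intro!: derivative_eq_intros)
    show "(g1 has_real_derivative c * (v \<bullet> (hessian u x *v v) - (h2 * a * a - h1 d0 * S))) (at 0)"
      unfolding g1_def[abs_def]
      by (rule DERIV_cong[OF DERIV_cmult[OF DERIV_diff[OF l DERIV_mult[OF m m2]]]]) (simp add: p0)
    show "\<forall>\<^sub>F s in nhds 0. g s \<le> g 0" using mx by (simp add: g_def p_def)
  qed
  then show ?thesis by (simp add: algebra_simps power2_eq_square)
qed

text \<open>Since h decreases, a polynomial below the distance gives a function above h (d), and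
  conversely; this is needed only for values near the one at the contact point.\<close>

lemma decreasing_near:
  fixes h h1 :: "real \<Rightarrow> real"
  assumes dh: "\<forall>\<^sub>F t in nhds d0. (h has_real_derivative h1 t) (at t)" and c: "isCont h1 d0" and neg: "h1 d0 < 0"
  shows "\<exists>e>0. \<forall>s t. \<bar>s - d0\<bar> < e \<longrightarrow> \<bar>t - d0\<bar> < e \<longrightarrow> s \<le> t \<longrightarrow> h t \<le> h s"
proof -
  have "\<forall>\<^sub>F t in nhds d0. (h has_real_derivative h1 t) (at t) \<and> h1 t < 0"
    using order_tendstoD(2)[OF isCont_tendsto_nhds[OF c] neg] dh by eventually_elim auto
  then obtain e where e: "e > 0" "\<And>t. \<bar>t - d0\<bar> < e \<Longrightarrow> (h has_real_derivative h1 t) (at t) \<and> h1 t < 0"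
    unfolding eventually_nhds_metric by (auto simp: dist_real_def)
  have "h t \<le> h s" if st: "\<bar>s - d0\<bar> < e" "\<bar>t - d0\<bar> < e" "s \<le> t" for s t
  proof (rule DERIV_nonpos_imp_nonincreasing[OF st(3)])
    fix z assume "s \<le> z" "z \<le> t"
    then have "\<bar>z - d0\<bar> < e" using st by linarith
    then show "\<exists>y. (h has_real_derivative y) (at z) \<and> y \<le> 0" using e(2)[of z] by (intro exI[of _ "h1 z"]) auto
  qed
  then show ?thesis using e(1) by blast
qed

text \<open>The list holds the eigenvalues of the model Hessian: h'' in the normal direction and -
  h' (\<kappa> + c) along the boundary, with p standing for - h'.\<close>

lemma elem_sym_barrier:
  "elem_sym (Suc k) (h2 # map (\<lambda>a. p * (a + c)) ks)
   = p ^ Suc k * elem_sym (Suc k) (map (\<lambda>a. a + c) ks) + h2 * p ^ k * elem_sym k (map (\<lambda>a. a + c) ks)"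
proof -
  have "map (\<lambda>a. p * (a + c)) ks = map ((*) p) (map (\<lambda>a. a + c) ks)" by simp
  then show ?thesis by (simp only: elem_sym_Cons elem_sym_scale mult.assoc)
qed

lemma bdist_continuous: "isCont (bdist \<Omega>) x"
  unfolding bdist_def[abs_def] by (intro continuous_infdist continuous_ident)

lemma bdist_tendsto_line: "((\<lambda>s. bdist \<Omega> (x + s *\<^sub>R v)) \<longlongrightarrow> bdist \<Omega> x) (nhds 0)"
proof -
  have "((\<lambda>s. x + s *\<^sub>R v) \<longlongrightarrow> x) (nhds 0)" by (auto intro!: tendsto_eq_intros filterlim_ident)
  then show ?thesis by (rule isCont_tendsto_compose[OF bdist_continuous])
qed

text \<open>A maximum of u - h (d) persists when d is replaced by the polynomial touching it from
  below, so the Hessian of u lies below the model Hessian. It is the smaller matrix, and k-convexity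
  places it in the cone.\<close>

lemma hessian_comparison_upper:
  fixes u :: "real ^ 'n \<Rightarrow> real" and h h1 :: "real \<Rightarrow> real"
  assumes u: "k_convex_on (Suc k) \<Omega> u" and op: "open \<Omega>" and x: "x \<in> \<Omega>"
    and fr: "orthonormal_basis (n # es)" and len: "length ks = CARD('n) - 1"
    and touch: "\<And>v. \<forall>\<^sub>F s in nhds 0. bdist \<Omega> x + s * (n \<bullet> v) - s\<^sup>2 / 2 * (\<Sum>i<CARD('n) - 1. (ks ! i + c) * (es ! i \<bullet> v)\<^sup>2) \<le> bdist \<Omega> (x + s *\<^sub>R v)"
    and dh: "\<forall>\<^sub>F t in nhds (bdist \<Omega> x). (h has_real_derivative h1 t) (at t)"
    and dh1: "(h1 has_real_derivative h2) (at (bdist \<Omega> x))" and neg: "h1 (bdist \<Omega> x) < 0"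
    and mx: "\<forall>\<^sub>F z in nhds x. u z - h (bdist \<Omega> z) \<le> u x - h (bdist \<Omega> x)"
  defines "p \<equiv> - h1 (bdist \<Omega> x)"
  shows "S_hess (Suc k) u x \<le> p ^ Suc k * elem_sym (Suc k) (map (\<lambda>a. a + c) ks) + h2 * p ^ k * elem_sym k (map (\<lambda>a. a + c) ks)"
proof -
  let ?B = "spec (n # es) (h2 # map (\<lambda>a. p * (a + c)) ks)"
  have C2: "Ck_on 2 u \<Omega>" and cone: "\<And>i. i \<in> {1..Suc k} \<Longrightarrow> S_hess i u x \<ge> 0" using u x by (auto simp: k_convex_on_def)
  obtain e where e: "e > 0" and mono: "\<And>s t. \<bar>s - bdist \<Omega> x\<bar> < e \<Longrightarrow> \<bar>t - bdist \<Omega> x\<bar> < e \<Longrightarrow> s \<le> t \<Longrightarrow> h t \<le> h s"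
    using decreasing_near[OF dh DERIV_isCont[OF dh1] neg] by blast
  have "v \<bullet> (hessian u x *v v) \<le> v \<bullet> (?B *v v)" for v
  proof -
    define S where "S = (\<Sum>i<CARD('n) - 1. (ks ! i + c) * (es ! i \<bullet> v)\<^sup>2)"
    let ?p = "\<lambda>s. bdist \<Omega> x + s * (n \<bullet> v) - s\<^sup>2 / 2 * S"
    have t0: "((\<lambda>s. x + s *\<^sub>R v) \<longlongrightarrow> x) (nhds 0)" by (auto intro!: tendsto_eq_intros filterlim_ident)
    have t1: "(?p \<longlongrightarrow> bdist \<Omega> x) (nhds 0)" by (auto intro!: tendsto_eq_intros filterlim_ident)
    have "\<forall>\<^sub>F s in nhds 0. u (x + s *\<^sub>R v) - h (bdist \<Omega> (x + s *\<^sub>R v)) \<le> u x - h (bdist \<Omega> x)"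
      using t0 mx unfolding filterlim_iff by blast
    then have "\<forall>\<^sub>F s in nhds 0. 1 * (u (x + s *\<^sub>R v) - h (?p s)) \<le> 1 * (u x - h (bdist \<Omega> x))"
      using touch[of v] tendstoD[OF t1 e] tendstoD[OF bdist_tendsto_line e, of \<Omega> x v] unfolding S_def[symmetric]
    proof eventually_elim
      case (elim s)
      have "h (bdist \<Omega> (x + s *\<^sub>R v)) \<le> h (?p s)"
        by (rule mono) (use elim in \<open>auto simp: dist_real_def\<close>)
      then show ?case using elim by simp
    qed
    from second_order_touching[OF C2 op x dh dh1 this]
    have "v \<bullet> (hessian u x *v v) \<le> h2 * (n \<bullet> v)\<^sup>2 + p * S" by (simp add: p_def)
    also have "p * S = (\<Sum>i<CARD('n) - 1. map (\<lambda>a. p * (a + c)) ks ! i * (es ! i \<bullet> v)\<^sup>2)"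
      unfolding S_def sum_distrib_left by (intro sum.cong) (auto simp: len mult.assoc)
    finally show ?thesis unfolding frame_spec_form .
  qed
  moreover have "\<forall>i\<le>Suc k. elem_sym i (eigenvalues (hessian u x)) \<ge> 0"
    using cone unfolding S_hess_def by (metis atLeastAtMost_iff elem_sym_0 le_numeral_extra(1) not_less_eq_eq One_nat_def le0 not0_implies_Suc Suc_le_mono)
  ultimately have "S_hess (Suc k) u x \<le> elem_sym (Suc k) (eigenvalues ?B)"
    unfolding S_hess_def by (intro elem_sym_eigenvalues_mono hessian_symmetric[OF C2 op x] spec_symmetric)
  also have "\<dots> = elem_sym (Suc k) (h2 # map (\<lambda>a. p * (a + c)) ks)"
    by (rule elem_sym_eigenvalues_spec[OF fr]) (simp add: len)
  finally show ?thesis unfolding elem_sym_barrier .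
qed

text \<open>Now the model Hessian is the smaller matrix and must lie in the cone: this is the
  purpose of \<open>h2 \<ge> 0\<close> and of the sign condition on the shifted curvatures. The
  nonnegative term with \<open>elem_sym (Suc k)\<close> is dropped.\<close>

lemma hessian_comparison_lower:
  fixes u :: "real ^ 'n \<Rightarrow> real" and h h1 :: "real \<Rightarrow> real"
  assumes C2: "Ck_on 2 u \<Omega>" and op: "open \<Omega>" and x: "x \<in> \<Omega>"
    and fr: "orthonormal_basis (n # es)" and len: "length ks = CARD('n) - 1"
    and touch: "\<And>v. \<forall>\<^sub>F s in nhds 0. bdist \<Omega> (x + s *\<^sub>R v) \<le> bdist \<Omega> x + s * (n \<bullet> v) - s\<^sup>2 / 2 * (\<Sum>i<CARD('n) - 1. (ks ! i + c) * (es ! i \<bullet> v)\<^sup>2)"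
    and dh: "\<forall>\<^sub>F t in nhds (bdist \<Omega> x). (h has_real_derivative h1 t) (at t)"
    and dh1: "(h1 has_real_derivative h2) (at (bdist \<Omega> x))" and neg: "h1 (bdist \<Omega> x) < 0" and h2: "h2 \<ge> 0"
    and ks: "\<And>j. elem_sym j (map (\<lambda>a. a + c) ks) \<ge> 0"
    and mn: "\<forall>\<^sub>F z in nhds x. u z - h (bdist \<Omega> z) \<ge> u x - h (bdist \<Omega> x)"
  defines "p \<equiv> - h1 (bdist \<Omega> x)"
  shows "S_hess (Suc k) u x \<ge> h2 * p ^ k * elem_sym k (map (\<lambda>a. a + c) ks)"
proof -
  let ?ls = "h2 # map (\<lambda>a. p * (a + c)) ks"
  let ?B = "spec (n # es) ?ls"
  have p: "p > 0" using neg by (simp add: p_def)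
  obtain e where e: "e > 0" and mono: "\<And>s t. \<bar>s - bdist \<Omega> x\<bar> < e \<Longrightarrow> \<bar>t - bdist \<Omega> x\<bar> < e \<Longrightarrow> s \<le> t \<Longrightarrow> h t \<le> h s"
    using decreasing_near[OF dh DERIV_isCont[OF dh1] neg] by blast
  have "v \<bullet> (?B *v v) \<le> v \<bullet> (hessian u x *v v)" for v
  proof -
    define S where "S = (\<Sum>i<CARD('n) - 1. (ks ! i + c) * (es ! i \<bullet> v)\<^sup>2)"
    let ?p = "\<lambda>s. bdist \<Omega> x + s * (n \<bullet> v) - s\<^sup>2 / 2 * S"
    have t0: "((\<lambda>s. x + s *\<^sub>R v) \<longlongrightarrow> x) (nhds 0)" by (auto intro!: tendsto_eq_intros filterlim_ident)
    have t1: "(?p \<longlongrightarrow> bdist \<Omega> x) (nhds 0)" by (auto intro!: tendsto_eq_intros filterlim_ident)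
    have "\<forall>\<^sub>F s in nhds 0. u (x + s *\<^sub>R v) - h (bdist \<Omega> (x + s *\<^sub>R v)) \<ge> u x - h (bdist \<Omega> x)"
      using t0 mn unfolding filterlim_iff by blast
    then have "\<forall>\<^sub>F s in nhds 0. (-1) * (u (x + s *\<^sub>R v) - h (?p s)) \<le> (-1) * (u x - h (bdist \<Omega> x))"
      using touch[of v] tendstoD[OF t1 e] tendstoD[OF bdist_tendsto_line e, of \<Omega> x v] unfolding S_def[symmetric]
    proof eventually_elim
      case (elim s)
      have "h (?p s) \<le> h (bdist \<Omega> (x + s *\<^sub>R v))"
        by (rule mono) (use elim in \<open>auto simp: dist_real_def\<close>)
      then show ?case using elim by simp
    qed
    from second_order_touching[OF C2 op x dh dh1 this]
    have "h2 * (n \<bullet> v)\<^sup>2 + p * S \<le> v \<bullet> (hessian u x *v v)" by (simp add: p_def)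
    also have "p * S = (\<Sum>i<CARD('n) - 1. map (\<lambda>a. p * (a + c)) ks ! i * (es ! i \<bullet> v)\<^sup>2)"
      unfolding S_def sum_distrib_left by (intro sum.cong) (auto simp: len mult.assoc)
    finally show ?thesis unfolding frame_spec_form .
  qed
  moreover have eb: "elem_sym i (eigenvalues ?B) = elem_sym i ?ls" for i
    by (rule elem_sym_eigenvalues_spec[OF fr]) (simp add: len)
  have "elem_sym i (eigenvalues ?B) \<ge> 0" for i
    unfolding eb
  proof (cases i)
    case (Suc j)
    show "elem_sym i ?ls \<ge> 0" unfolding Suc elem_sym_barrier using p h2 ks by (intro add_nonneg_nonneg mult_nonneg_nonneg) auto
  qed simp
  ultimately have "elem_sym (Suc k) (eigenvalues ?B) \<le> S_hess (Suc k) u x"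
    unfolding S_hess_def by (intro elem_sym_eigenvalues_mono hessian_symmetric[OF C2 op x] spec_symmetric) auto
  moreover have "p ^ Suc k * elem_sym (Suc k) (map (\<lambda>a. a + c) ks) \<ge> 0" using p ks by (intro mult_nonneg_nonneg) auto
  ultimately show ?thesis unfolding eb elem_sym_barrier by linarith
qed

section \<open>The filter of approach to the boundary\<close>

lemma eventually_near_boundary:
  "eventually P (near_boundary \<Omega>) \<longleftrightarrow> (\<exists>d>0. \<forall>x\<in>\<Omega>. bdist \<Omega> x < d \<longrightarrow> P x)"
proof -
  have nn: "bdist \<Omega> x \<ge> 0" for x by (simp add: bdist_def infdist_nonneg)
  have "eventually P (near_boundary \<Omega>) \<longleftrightarrow> eventually (\<lambda>x. x \<in> \<Omega> \<longrightarrow> P x) (filtercomap (bdist \<Omega>) (nhds 0))"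
    unfolding near_boundary_def by (simp add: eventually_inf_principal)
  also have "\<dots> \<longleftrightarrow> (\<exists>d>0. \<forall>x. bdist \<Omega> x < d \<longrightarrow> x \<in> \<Omega> \<longrightarrow> P x)"
    unfolding eventually_filtercomap eventually_nhds_metric
  proof
    assume "\<exists>Q. (\<exists>d>0. \<forall>x. dist x 0 < d \<longrightarrow> Q x) \<and> (\<forall>x. Q (bdist \<Omega> x) \<longrightarrow> x \<in> \<Omega> \<longrightarrow> P x)"
    then obtain Q d where "d > 0" "\<And>x. dist x 0 < d \<Longrightarrow> Q x" "\<And>x. Q (bdist \<Omega> x) \<Longrightarrow> x \<in> \<Omega> \<Longrightarrow> P x" by blast
    then show "\<exists>d>0. \<forall>x. bdist \<Omega> x < d \<longrightarrow> x \<in> \<Omega> \<longrightarrow> P x"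
      using nn by (intro exI[of _ d]) (auto simp: dist_real_def)
  next
    assume "\<exists>d>0. \<forall>x. bdist \<Omega> x < d \<longrightarrow> x \<in> \<Omega> \<longrightarrow> P x"
    then obtain d where "d > 0" "\<And>x. bdist \<Omega> x < d \<Longrightarrow> x \<in> \<Omega> \<Longrightarrow> P x" by blast
    then show "\<exists>Q. (\<exists>d>0. \<forall>x. dist x 0 < d \<longrightarrow> Q x) \<and> (\<forall>x. Q (bdist \<Omega> x) \<longrightarrow> x \<in> \<Omega> \<longrightarrow> P x)"
      by (intro exI[of _ "\<lambda>t. t < d"]) (auto simp: dist_real_def intro!: exI[of _ d])
  qed
  finally show ?thesis by blast
qed

lemma near_boundary_nontrivial:
  fixes \<Omega> :: "(real ^ 'n) set"
  assumes sm: "smooth_bounded_domain \<Omega>"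
  shows "near_boundary \<Omega> \<noteq> bot"
proof
  assume "near_boundary \<Omega> = bot"
  then have "eventually (\<lambda>_. False) (near_boundary \<Omega>)" by simp
  then obtain d where d: "d > 0" "\<And>x. x \<in> \<Omega> \<Longrightarrow> \<not> bdist \<Omega> x < d" unfolding eventually_near_boundary by blast
  obtain y where y: "y \<in> frontier \<Omega>" using frontier_compact_nonempty[OF sm] by blast
  then have "y \<in> closure \<Omega>" by (simp add: frontier_def)
  then obtain x where x: "x \<in> \<Omega>" "dist x y < d" using d(1) by (meson closure_approachable)
  then have "bdist \<Omega> x < d" unfolding bdist_def using infdist_le[OF y, of x] by simp
  then show False using d(2)[OF x(1)] by blast
qed

lemma bdist_near_boundary:
  fixes \<Omega> :: "(real ^ 'n) set"
  assumes sm: "smooth_bounded_domain \<Omega>"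
  shows "filterlim (bdist \<Omega>) (at_right 0) (near_boundary \<Omega>)"
  unfolding filterlim_at
proof
  show "\<forall>\<^sub>F x in near_boundary \<Omega>. bdist \<Omega> x \<in> {0<..} \<and> bdist \<Omega> x \<noteq> 0"
    unfolding eventually_near_boundary using bdist_pos[OF sm] by (intro exI[of _ 1]) force
  show "(bdist \<Omega> \<longlongrightarrow> 0) (near_boundary \<Omega>)"
    unfolding tendsto_iff eventually_near_boundary using bdist_pos[OF sm] by (force simp: dist_real_def)
qed

text \<open>Points of the closure at positive distance from the frontier lie in \<Omega>, so the
  shell is closed as well as bounded.\<close>

lemma compact_distance_shell:
  fixes \<Omega> :: "(real ^ 'n) set"
  assumes sm: "smooth_bounded_domain \<Omega>" and a: "a > 0"
  shows "compact {x\<in>\<Omega>. a \<le> bdist \<Omega> x \<and> bdist \<Omega> x \<le> c}"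
proof -
  have op: "open \<Omega>" "bounded \<Omega>" using sm by (auto simp: smooth_bounded_domain_def)
  have "{x\<in>\<Omega>. a \<le> bdist \<Omega> x \<and> bdist \<Omega> x \<le> c} = closure \<Omega> \<inter> {x. a \<le> bdist \<Omega> x \<and> bdist \<Omega> x \<le> c}"
  proof -
    have "x \<in> \<Omega>" if "x \<in> closure \<Omega>" "a \<le> bdist \<Omega> x" for x
    proof (rule ccontr)
      assume "x \<notin> \<Omega>"
      then have "x \<in> frontier \<Omega>" using that op by (simp add: frontier_def interior_open)
      then show False using that a by (simp add: bdist_def)
    qed
    then show ?thesis using closure_subset by auto
  qed
  moreover have "closed {x. a \<le> bdist \<Omega> x \<and> bdist \<Omega> x \<le> c}"
    unfolding bdist_def by (intro closed_Collect_conj closed_Collect_le continuous_intros)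
  ultimately show ?thesis using op by (simp add: compact_Int_closed compact_closure)
qed

section \<open>Barriers\<close>

text \<open>The alternatives for f are reduced to facts on positive arguments and to strict growth
  on J, where u takes its values; the liminf and limsup of b become eventual inequalities, and the
  alternatives for C the positivity of \<beta>.\<close>

locale blowup_problem =
  fixes \<Omega> :: "(real ^ 'n) set" and k :: nat and f \<psi> \<theta> :: "real \<Rightarrow> real" and J :: "real set"
    and C D \<delta>0 b1 b2 :: real and b u :: "real ^ 'n \<Rightarrow> real"
  assumes sm: "smooth_bounded_domain \<Omega>" and sc: "strictly_convex_boundary \<Omega>"
    and k: "1 \<le> k" and kN: "k \<le> CARD('n)"
    and f_mono: "\<And>s t. s \<in> J \<Longrightarrow> t \<in> J \<Longrightarrow> s < t \<Longrightarrow> f s < f t"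
    and f_deriv_all: "\<forall>y>0. (f has_real_derivative deriv f y) (at y)"
    and f_pos_all: "\<forall>y>0. f y > 0"
    and tail_all: "\<forall>y>0. tail_integrable k f y"
    and lim: "((\<lambda>t. deriv (\<lambda>s. f s powr (1 / real k)) t * tail_integral k f t) \<longlongrightarrow> C) at_top"
    and psi: "\<forall>\<^sub>F t in at_right 0. \<psi> t \<in> J \<and> tail_integrable k f (\<psi> t) \<and> tail_integral k f (\<psi> t) = t"
    and \<delta>0: "\<delta>0 > 0"
    and th_pos_all: "\<forall>t. 0 < t \<longrightarrow> t < \<delta>0 \<longrightarrow> \<theta> t > 0"
    and th_mono: "mono_on {0<..<\<delta>0} \<theta> \<or> antimono_on {0<..<\<delta>0} \<theta>"
    and th_C1: "Ck_on 1 \<theta> {0<..<\<delta>0}"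
    and th_int: "set_integrable lborel {0<..<\<delta>0} \<theta>"
    and D: "(deriv (\<lambda>t. Theta \<theta> t / \<theta> t) \<longlongrightarrow> D) (at_right 0)"
    and b_pos: "\<And>x. x \<in> \<Omega> \<Longrightarrow> b x > 0"
    and b_lower: "\<And>e. e > 0 \<Longrightarrow> \<forall>\<^sub>F x in near_boundary \<Omega>. b1 - e \<le> b x / \<theta> (bdist \<Omega> x) ^ (k + 1)"
    and b_upper: "\<And>e. e > 0 \<Longrightarrow> \<forall>\<^sub>F x in near_boundary \<Omega>. b x / \<theta> (bdist \<Omega> x) ^ (k + 1) \<le> b2 + e"
    and \<beta>_pos: "(real k + 1) / real k * (C - 1) + D > 0"
    and sol: "classical_k_convex_solution k \<Omega> b J f u"
begin

definition \<alpha> :: real where "\<alpha> = (real k + 1) / real k"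
text \<open>The limit \<alpha> C - 1 / k + (D - 1) of the bracket in
  \<open>profile_derivatives\<close>, rewritten by \<alpha> = 1 + 1 / k.\<close>

definition \<beta> :: real where "\<beta> = \<alpha> * (C - 1) + D"

lemmas f_pos = f_pos_all[rule_format] and th_pos = th_pos_all[rule_format]
lemmas psi_regular' = psi_regular[OF k f_deriv_all f_pos_all tail_all lim psi]
lemmas F_deriv_psi' = F_deriv_psi[OF k f_deriv_all f_pos_all tail_all lim psi]
lemmas profile' = profile_derivatives[OF k f_deriv_all f_pos_all tail_all lim psi]
lemmas tail_strict' = tail_strict[OF k f_deriv_all f_pos_all tail_all lim psi]
lemmas upper_profile' = upper_profile[OF \<delta>0 th_pos_all th_mono th_C1 th_int D]
lemmas lower_profile' = lower_profile[OF \<delta>0 th_pos_all th_mono th_C1 th_int D]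
lemmas Theta_pos' = Theta_pos[OF \<delta>0 th_pos_all th_mono th_C1 th_int D]
lemmas Theta_tendsto' = Theta_tendsto_0[OF \<delta>0 th_pos_all th_mono th_C1 th_int D]

lemma \<alpha>_pos: "\<alpha> > 0" and \<alpha>_eq: "\<alpha> = 1 + 1 / real k" and \<beta>_gt: "\<beta> > 0"
  using k \<beta>_pos by (auto simp: \<alpha>_def \<beta>_def field_simps)

lemma op: "open \<Omega>" using sm by (simp add: smooth_bounded_domain_def)

lemma u_C2: "Ck_on 2 u \<Omega>" and u_kconv: "k_convex_on k \<Omega> u" and u_J: "x \<in> \<Omega> \<Longrightarrow> u x \<in> J"
  and u_eq: "x \<in> \<Omega> \<Longrightarrow> S_hess k u x = b x * f (u x)" and u_top: "filterlim u at_top (near_boundary \<Omega>)"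
  using sol by (auto simp: classical_k_convex_solution_def k_convex_on_def)

lemma u_cont: "continuous_on \<Omega> u"
  using Ck_on_Suc_imp[of 0 u \<Omega>] Ck_on_Suc_imp[of 1 u \<Omega>] u_C2 by (simp add: numeral_2_eq_2)

lemma S_curv_pos:
  assumes "y \<in> frontier \<Omega>" "j \<le> CARD('n) - 1"
  shows "S_curv j \<Omega> y > 0"
  using sc assms by (cases "j = 0") (auto simp: S_curv_def strictly_convex_boundary_def)

lemma M_minus_pos: "j \<le> CARD('n) - 1 \<Longrightarrow> M_minus j \<Omega> > 0"
  using M_plus_minus(2)[OF sm, of j] S_curv_pos by auto

lemma psi_control:
  assumes "\<eta> > 0"
  obtains T where "T > 0" "\<And>s. 0 < s \<Longrightarrow> s < T \<Longrightarrow> \<psi> s \<in> J \<and> \<psi> s > 1 \<and>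
      (\<psi> has_real_derivative - (f (\<psi> s) powr (1 / real k))) (at s) \<and> \<bar>deriv (\<lambda>s. f s powr (1 / real k)) (\<psi> s) * s - C\<bar> < \<eta>"
    "\<And>s t. 0 < s \<Longrightarrow> s \<le> t \<Longrightarrow> t < T \<Longrightarrow> \<psi> t \<le> \<psi> s"
proof -
  obtain T1 where T1: "T1 > 0" "\<And>t. 0 < t \<Longrightarrow> t < T1 \<Longrightarrow> \<psi> t \<in> J \<and> tail_integral k f (\<psi> t) = t \<and> \<psi> t > 1"
    "\<And>t. 0 < t \<Longrightarrow> t < T1 \<Longrightarrow> (\<psi> has_real_derivative - (f (\<psi> t) powr (1 / real k))) (at t)"
    using psi_regular'[of 1] by auto
  obtain T2 where T2: "T2 > 0" "\<And>t. 0 < t \<Longrightarrow> t < T2 \<Longrightarrow> \<bar>deriv (\<lambda>s. f s powr (1 / real k)) (\<psi> t) * t - C\<bar> < \<eta>"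
    using tendstoD[OF F_deriv_psi' assms] unfolding eventually_at_right_field by (auto simp: dist_real_def)
  have "\<psi> t \<le> \<psi> s" if st: "0 < s" "s \<le> t" "t < T1" for s t
  proof (rule ccontr)
    assume "\<not> \<psi> t \<le> \<psi> s"
    then have "tail_integral k f (\<psi> t) < tail_integral k f (\<psi> s)"
      using T1(2)[of s] st by (intro tail_strict') auto
    then show False using T1(2)[of s] T1(2)[of t] st by auto
  qed
  then show ?thesis using T1 T2 by (intro that[of "min T1 T2"]) auto
qed

lemma small_argument:
  assumes "\<tau> > 0" "T > 0"
  obtains e where "e > 0" "\<And>t. 0 < t \<Longrightarrow> t < e \<Longrightarrow> 0 < \<tau> * t powr \<alpha> \<and> \<tau> * t powr \<alpha> < T"
proof -
  define e where "e = (T / \<tau>) powr (1 / \<alpha>)"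
  have e: "e > 0" using assms by (simp add: e_def)
  have ea: "e powr \<alpha> = T / \<tau>" using assms \<alpha>_pos by (simp add: e_def powr_powr)
  have "0 < \<tau> * t powr \<alpha> \<and> \<tau> * t powr \<alpha> < T" if "0 < t" "t < e" for t
  proof -
    have "t powr \<alpha> < T / \<tau>" unfolding ea[symmetric] using that \<alpha>_pos by (intro powr_less_mono2) auto
    then show ?thesis using assms that by (simp add: field_simps)
  qed
  then show ?thesis using e that by blast
qed

lemma psi_profile_tendsto:
  assumes T: "\<And>s. 0 < s \<Longrightarrow> s < T \<Longrightarrow> (\<psi> has_real_derivative - (f (\<psi> s) powr (1 / real k))) (at s)"
    and Y: "(Y \<longlongrightarrow> Z) \<F>" and Z: "Z > 0" "0 < \<tau> * Z powr \<alpha>" "\<tau> * Z powr \<alpha> < T"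
  shows "((\<lambda>\<rho>. \<psi> (\<tau> * Y \<rho> powr \<alpha>)) \<longlongrightarrow> \<psi> (\<tau> * Z powr \<alpha>)) \<F>"
proof -
  have "((\<lambda>\<rho>. \<tau> * Y \<rho> powr \<alpha>) \<longlongrightarrow> \<tau> * Z powr \<alpha>) \<F>" using Y Z by (intro tendsto_intros) auto
  then show ?thesis by (rule isCont_tendsto_compose[OF DERIV_isCont[OF T[OF Z(2,3)]]])
qed

text \<open>The strict inequality leaves room for all error terms, collected in
  \<open>Q \<eta>\<close>. If u - h exceeded M somewhere it would have an interior maximum, because
  h blows up as d decreases to \<rho> and u <= M on d = \<delta>. M is read off from u alone and so
  does not depend on \<rho>.\<close>

lemma upper_bound:
  assumes \<tau>: "\<tau> > 0" and small: "(\<tau> * \<alpha>) ^ k * (\<beta> * M_plus (k - 1) \<Omega>) < b1"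
  shows "\<exists>\<delta>>0. \<exists>M. \<forall>x\<in>\<Omega>. bdist \<Omega> x < \<delta> \<longrightarrow> u x \<le> \<psi> (\<tau> * Theta \<theta> (bdist \<Omega> x) powr \<alpha>) + M"
proof -
  obtain m where km: "k = Suc m" using k by (cases k) auto
  have mN: "m \<le> CARD('n) - 1" using kN km by simp
  let ?d = "bdist \<Omega>"
  let ?F' = "deriv (\<lambda>s. f s powr (1 / real k))"
  define A where "A = (\<tau> * \<alpha>) ^ k"
  define Mp where "Mp = M_plus m \<Omega>"
  have A: "A > 0" using \<tau> \<alpha>_pos by (simp add: A_def)
  have Mm: "M_minus m \<Omega> > 0" by (rule M_minus_pos[OF mN])
  obtain y0 where "y0 \<in> frontier \<Omega>" using frontier_compact_nonempty[OF sm] by blast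
  then have Mp: "Mp > 0" using M_plus_minus(3)[OF sm, of y0 m] S_curv_pos[of y0 m] mN by (simp add: Mp_def)
  obtain L where L: "L > 0" and shift: "\<And>e. e > 0 \<Longrightarrow> \<exists>\<sigma>>0. \<forall>y\<in>frontier \<Omega>. length (principal_curvatures \<Omega> y) = CARD('n) - 1 \<and> (\<forall>c j. \<bar>c\<bar> \<le> \<sigma> \<longrightarrow>
     \<bar>elem_sym j (map (\<lambda>a. a + c) (principal_curvatures \<Omega> y)) - S_curv j \<Omega> y\<bar> \<le> e \<and>
     \<bar>elem_sym j (map (\<lambda>a. a + c) (principal_curvatures \<Omega> y))\<bar> \<le> L)"
    using curvature_shift[OF sm] by blast
  \<comment> \<open>\<eta> L bounds the contribution of S_k of the curvatures; the second summand is
    \<beta> times the maximal S_{k-1}, with its errors.\<close>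
  define Q where "Q \<eta> = \<eta> * L + (\<beta> + (\<alpha> + 1) * \<eta>) * (Mp + \<eta>)" for \<eta>
  have "((\<lambda>\<eta>. A * Q \<eta> + \<eta>) \<longlongrightarrow> A * (0 * L + (\<beta> + (\<alpha> + 1) * 0) * (Mp + 0)) + 0) (at_right 0)"
    unfolding Q_def by (intro tendsto_intros)
  moreover have "A * (0 * L + (\<beta> + (\<alpha> + 1) * 0) * (Mp + 0)) + 0 < b1"
    using small by (simp add: A_def Mp_def km)
  ultimately have "\<forall>\<^sub>F \<eta> in at_right 0. A * Q \<eta> + \<eta> < b1" by (rule order_tendstoD(2))
  then have "\<forall>\<^sub>F \<eta> in at_right 0. A * Q \<eta> + \<eta> < b1 \<and> \<eta> > 0"
    using eventually_at_right_less[of 0] by eventually_elim auto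
  then obtain \<eta> where \<eta>: "\<eta> > 0" "A * Q \<eta> + \<eta> < b1"
    using eventually_happens'[OF trivial_limit_at_right_real] by blast
  have Q: "Q \<eta> > 0" unfolding Q_def using \<eta> L \<beta>_gt \<alpha>_pos Mp by (intro add_pos_pos mult_pos_pos) auto
  \<comment> \<open>The bound by \<open>M_minus m \<Omega>\<close> keeps the shifted symmetric
    function of order m nonnegative, so that it may multiply an upper bound for
    \<open>Br\<close>.\<close>
  define e1 where "e1 = min \<eta> (M_minus m \<Omega>)"
  have e1: "e1 > 0" "e1 \<le> \<eta>" "e1 \<le> M_minus m \<Omega>" using \<eta> Mm by (auto simp: e1_def)
  obtain \<sigma> where \<sigma>: "\<sigma> > 0" and sh: "\<And>y. y \<in> frontier \<Omega> \<Longrightarrow> length (principal_curvatures \<Omega> y) = CARD('n) - 1 \<and> (\<forall>c j. \<bar>c\<bar> \<le> \<sigma> \<longrightarrow>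
     \<bar>elem_sym j (map (\<lambda>a. a + c) (principal_curvatures \<Omega> y)) - S_curv j \<Omega> y\<bar> \<le> e1 \<and>
     \<bar>elem_sym j (map (\<lambda>a. a + c) (principal_curvatures \<Omega> y))\<bar> \<le> L)"
    using shift[OF e1(1)] by blast
  obtain r where r: "r > 0" and touch: "\<And>x. x \<in> \<Omega> \<Longrightarrow> ?d x < r \<Longrightarrow> \<exists>y\<in>frontier \<Omega>. \<exists>n es. orthonormal_basis (n # es) \<and>
    (\<forall>v. \<forall>\<^sub>F s in nhds 0.
       ?d x + s * (n \<bullet> v) - s\<^sup>2 / 2 * (\<Sum>i<CARD('n) - 1. (principal_curvatures \<Omega> y ! i + \<sigma>) * (es ! i \<bullet> v)\<^sup>2) \<le> ?d (x + s *\<^sub>R v) \<and>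
       ?d (x + s *\<^sub>R v) \<le> ?d x + s * (n \<bullet> v) - s\<^sup>2 / 2 * (\<Sum>i<CARD('n) - 1. (principal_curvatures \<Omega> y ! i - \<sigma>) * (es ! i \<bullet> v)\<^sup>2))"
    using distance_touching[OF sm \<sigma>] by blast
  obtain T where T: "T > 0" and psiT: "\<And>s. 0 < s \<Longrightarrow> s < T \<Longrightarrow> \<psi> s \<in> J \<and> \<psi> s > 1 \<and>
      (\<psi> has_real_derivative - (f (\<psi> s) powr (1 / real k))) (at s) \<and> \<bar>?F' (\<psi> s) * s - C\<bar> < \<eta>"
    by (rule psi_control[OF \<eta>(1)]) (rule that, assumption+)
  obtain e2 where e2: "e2 > 0" and arg: "\<And>t. 0 < t \<Longrightarrow> t < e2 \<Longrightarrow> 0 < \<tau> * t powr \<alpha> \<and> \<tau> * t powr \<alpha> < T"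
    using small_argument[OF \<tau> T] by blast
  \<comment> \<open>Keeping \<Theta> below e2 keeps \<tau> Y^\<alpha> below T, where \<psi> is
    controlled.\<close>
  have m0: "min \<eta> e2 > 0" using \<eta> e2 by simp
  obtain \<delta>1 Y y y' where \<delta>1: "0 < \<delta>1" "\<delta>1 \<le> \<delta>0"
    and prof: "\<And>\<rho> t. 0 < \<rho> \<Longrightarrow> \<rho> < t \<Longrightarrow> t < \<delta>1 \<Longrightarrow> Y \<rho> t > 0 \<and> (Y \<rho> has_real_derivative y \<rho> t) (at t) \<and>
       (y \<rho> has_real_derivative y' \<rho> t) (at t) \<and> 0 < y \<rho> t \<and> y \<rho> t \<le> \<theta> t \<and>
       Y \<rho> t / y \<rho> t \<le> min \<eta> e2 \<and> - (Y \<rho> t * y' \<rho> t / (y \<rho> t)\<^sup>2) \<le> D - 1 + min \<eta> e2 \<and> Y \<rho> t \<le> Theta \<theta> t \<and> Theta \<theta> t < min \<eta> e2"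
    and Y0: "\<And>\<rho>. 0 < \<rho> \<Longrightarrow> \<rho> < \<delta>1 \<Longrightarrow> (Y \<rho> \<longlongrightarrow> 0) (at_right \<rho>)"
    and Y\<rho>: "\<And>t. 0 < t \<Longrightarrow> t < \<delta>1 \<Longrightarrow> ((\<lambda>\<rho>. Y \<rho> t) \<longlongrightarrow> Theta \<theta> t) (at_right 0)"
    by (rule upper_profile'[OF m0]) (rule that, assumption+)
  obtain \<delta>b where \<delta>b: "\<delta>b > 0" "\<And>x. x \<in> \<Omega> \<Longrightarrow> ?d x < \<delta>b \<Longrightarrow> b1 - \<eta> \<le> b x / \<theta> (?d x) ^ (k + 1)"
    using b_lower[OF \<eta>(1)] unfolding eventually_near_boundary by blast
  define \<delta>2 where "\<delta>2 = min \<delta>1 (min r \<delta>b)"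
  have \<delta>2: "\<delta>2 > 0" "\<delta>2 \<le> \<delta>1" "\<delta>2 \<le> r" "\<delta>2 \<le> \<delta>b" using \<delta>1 r \<delta>b by (auto simp: \<delta>2_def)
  define h where "h \<rho> t = \<psi> (\<tau> * Y \<rho> t powr \<alpha>)" for \<rho> t
  have argY: "0 < \<tau> * Y \<rho> t powr \<alpha> \<and> \<tau> * Y \<rho> t powr \<alpha> < T" if "0 < \<rho>" "\<rho> < t" "t < \<delta>1" for \<rho> t
    using prof[OF that] by (intro arg) auto
  have hJ: "h \<rho> t \<in> J \<and> h \<rho> t > 1" if "0 < \<rho>" "\<rho> < t" "t < \<delta>1" for \<rho> t
    using psiT argY[OF that] by (simp add: h_def)
  \<comment> \<open>From u > h and the strict growth of f, the equation gives a k-Hessian of u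
    strictly larger than the comparison permits.\<close>
  have no_touch: False
    if x: "x \<in> \<Omega>" and \<rho>: "0 < \<rho>" "\<rho> < ?d x" "?d x < \<delta>2" and gt: "u x > h \<rho> (?d x)"
      and mx: "\<forall>\<^sub>F z in nhds x. u z - h \<rho> (?d z) \<le> u x - h \<rho> (?d x)" for x \<rho>
  proof -
    define t where "t = ?d x"
    have t: "0 < t" "\<rho> < t" "t < \<delta>1" "t < \<delta>0" using \<rho> \<delta>2 \<delta>1 by (auto simp: t_def)
    note P = prof[OF \<rho>(1) t(2,3)]
    have "\<forall>\<^sub>F s in nhds t. \<rho> < s \<and> s < \<delta>1" using t by (intro eventually_conj order_tendstoD[of "\<lambda>x. x" t] filterlim_ident) auto
    then have dY: "\<forall>\<^sub>F s in nhds t. (Y \<rho> has_real_derivative y \<rho> s) (at s)"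
      by eventually_elim (use prof[OF \<rho>(1)] in blast)
    have psiT': "\<And>s. 0 < s \<Longrightarrow> s < T \<Longrightarrow> \<psi> s > 0 \<and> (\<psi> has_real_derivative - (f (\<psi> s) powr (1 / real k))) (at s)"
      using psiT by force
    have dy: "(y \<rho> has_real_derivative y' \<rho> t) (at t)" "Y \<rho> t > 0" "\<tau> * Y \<rho> t powr ((real k + 1) / real k) < T" "y \<rho> t > 0"
      using P argY[OF \<rho>(1) t(2,3)] unfolding \<alpha>_def by auto
    note pr = profile'[of T \<tau> "Y \<rho>" "y \<rho>" t "y' \<rho> t", OF psiT' \<tau> dY dy, folded \<alpha>_def, folded h_def]
    obtain h1 h2 where dh: "\<forall>\<^sub>F t in nhds t. (h \<rho> has_real_derivative h1 t) (at t)"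
      and dh1: "(h1 has_real_derivative h2) (at t)" and neg: "h1 t < 0"
      and pk: "(- h1 t) ^ k = f (h \<rho> t) * (\<tau> * \<alpha>) ^ k * Y \<rho> t * y \<rho> t ^ k"
      and pk1: "(- h1 t) ^ (k - 1) * h2 = f (h \<rho> t) * (\<tau> * \<alpha>) ^ k * y \<rho> t ^ (k + 1) *
        (\<alpha> * (?F' (h \<rho> t) * (\<tau> * Y \<rho> t powr \<alpha>)) - 1 / real k - Y \<rho> t * y' \<rho> t / (y \<rho> t)\<^sup>2)"
      by (rule pr, assumption, assumption, rule that, assumption+)
    obtain w n es where w: "w \<in> frontier \<Omega>" and fr: "orthonormal_basis (n # es)" and tc:
      "\<And>v. \<forall>\<^sub>F s in nhds 0.
       ?d x + s * (n \<bullet> v) - s\<^sup>2 / 2 * (\<Sum>i<CARD('n) - 1. (principal_curvatures \<Omega> w ! i + \<sigma>) * (es ! i \<bullet> v)\<^sup>2) \<le> ?d (x + s *\<^sub>R v) \<and>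
       ?d (x + s *\<^sub>R v) \<le> ?d x + s * (n \<bullet> v) - s\<^sup>2 / 2 * (\<Sum>i<CARD('n) - 1. (principal_curvatures \<Omega> w ! i - \<sigma>) * (es ! i \<bullet> v)\<^sup>2)"
      using touch[OF x] \<rho> \<delta>2 by (meson order_less_le_trans)
    define ek where "ek j = elem_sym j (map (\<lambda>a. a + \<sigma>) (principal_curvatures \<Omega> w))" for j
    have ek: "\<bar>ek j - S_curv j \<Omega> w\<bar> \<le> e1" "\<bar>ek j\<bar> \<le> L" for j using sh[OF w] \<sigma> by (auto simp: ek_def)
    have "S_hess (Suc m) u x \<le> (- h1 t) ^ Suc m * ek (Suc m) + h2 * (- h1 t) ^ m * ek m"
      unfolding t_def ek_def
    proof (rule hessian_comparison_upper[OF _ op x fr])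
      show "k_convex_on (Suc m) \<Omega> u" using u_kconv km by simp
      show "length (principal_curvatures \<Omega> w) = CARD('n) - 1" using sh[OF w] by blast
      show "\<forall>\<^sub>F s in nhds 0. ?d x + s * (n \<bullet> v) - s\<^sup>2 / 2 * (\<Sum>i<CARD('n) - 1. (principal_curvatures \<Omega> w ! i + \<sigma>) * (es ! i \<bullet> v)\<^sup>2) \<le> ?d (x + s *\<^sub>R v)" for v
        using tc[of v] by eventually_elim auto
      show "\<forall>\<^sub>F z in nhds x. u z - h \<rho> (?d z) \<le> u x - h \<rho> (?d x)" by (rule mx)
    qed (use dh dh1 neg in \<open>simp_all add: t_def\<close>)
    also have "\<dots> = (- h1 t) ^ k * ek k + ((- h1 t) ^ (k - 1) * h2) * ek m" by (simp add: km)
    finally have S1: "S_hess k u x \<le> (- h1 t) ^ k * ek k + ((- h1 t) ^ (k - 1) * h2) * ek m" by (simp add: km)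
    have y0: "y \<rho> t > 0" by (rule dy(4))
    define Br where "Br = \<alpha> * (?F' (h \<rho> t) * (\<tau> * Y \<rho> t powr \<alpha>)) - 1 / real k - Y \<rho> t * y' \<rho> t / (y \<rho> t)\<^sup>2"
    \<comment> \<open>In the model k-Hessian (- h')^k = c q accompanies S_k and (- h')^(k-1) h'' = c
      Br accompanies S_{k-1}; q is small.\<close>
    define q where "q = Y \<rho> t / y \<rho> t"
    define c where "c = f (h \<rho> t) * A * y \<rho> t ^ (k + 1)"
    have yp: "y \<rho> t > 0" "Y \<rho> t > 0" using P by auto
    have fh: "f (h \<rho> t) > 0" using f_pos[of "h \<rho> t"] hJ[OF \<rho>(1) t(2,3)] by simp
    have pk': "(- h1 t) ^ k = c * q" unfolding pk c_def q_def A_def using yp by simp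
    have pk1': "(- h1 t) ^ (k - 1) * h2 = c * Br" unfolding pk1 c_def Br_def A_def by simp
    have S2: "S_hess k u x \<le> c * (q * ek k + Br * ek m)" using S1 unfolding pk' pk1' by (simp add: algebra_simps)
    have q: "0 < q" "q \<le> \<eta>" using P yp by (auto simp: q_def)
    have "q * ek k \<le> q * L" using ek(2)[of k] q by (intro mult_left_mono) auto
    also have "\<dots> \<le> \<eta> * L" using q L by (intro mult_right_mono) auto
    finally have t1: "q * ek k \<le> \<eta> * L" .
    have "?F' (h \<rho> t) * (\<tau> * Y \<rho> t powr \<alpha>) \<le> C + \<eta>"
      using psiT[of "\<tau> * Y \<rho> t powr \<alpha>"] argY[OF \<rho>(1) t(2,3)] unfolding h_def by auto
    then have "\<alpha> * (?F' (h \<rho> t) * (\<tau> * Y \<rho> t powr \<alpha>)) \<le> \<alpha> * (C + \<eta>)" using \<alpha>_pos by (intro mult_left_mono) auto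
    moreover have "- (Y \<rho> t * y' \<rho> t / (y \<rho> t)\<^sup>2) \<le> D - 1 + \<eta>" using P by auto
    ultimately have "Br \<le> \<alpha> * (C + \<eta>) - 1 / real k + (D - 1 + \<eta>)" unfolding Br_def by linarith
    also have "\<dots> = \<beta> + (\<alpha> + 1) * \<eta>" unfolding \<beta>_def by (simp add: \<alpha>_eq algebra_simps add_divide_distrib diff_divide_distrib)
    finally have Br: "Br \<le> \<beta> + (\<alpha> + 1) * \<eta>" .
    have ekm: "0 \<le> ek m" "ek m \<le> Mp + \<eta>"
      using ek(1)[of m] e1 M_plus_minus(3,4)[OF sm w, of m] unfolding Mp_def by linarith+
    have "Br * ek m \<le> (\<beta> + (\<alpha> + 1) * \<eta>) * ek m" using Br ekm by (intro mult_right_mono) auto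
    also have "\<dots> \<le> (\<beta> + (\<alpha> + 1) * \<eta>) * (Mp + \<eta>)" using ekm \<beta>_gt \<alpha>_pos \<eta> by (intro mult_left_mono) auto
    finally have "q * ek k + Br * ek m \<le> Q \<eta>" using t1 unfolding Q_def by linarith
    moreover have c0: "c > 0" using fh A yp by (simp add: c_def)
    ultimately have "S_hess k u x \<le> c * Q \<eta>" using S2 by (meson less_imp_le mult_left_mono order_trans)
    also have "c \<le> f (h \<rho> t) * A * \<theta> t ^ (k + 1)"
      unfolding c_def using P fh A yp by (intro mult_left_mono power_mono) auto
    then have "c * Q \<eta> \<le> f (h \<rho> t) * A * \<theta> t ^ (k + 1) * Q \<eta>" using Q by (intro mult_right_mono) auto
    also have "\<dots> = f (h \<rho> t) * \<theta> t ^ (k + 1) * (A * Q \<eta>)" by simp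
    also have "\<dots> \<le> f (h \<rho> t) * \<theta> t ^ (k + 1) * (b1 - \<eta>)"
      using \<eta> fh th_pos[OF t(1,4)] by (intro mult_left_mono) auto
    also have "\<dots> = f (h \<rho> t) * ((b1 - \<eta>) * \<theta> t ^ (k + 1))" by simp
    also have "\<dots> \<le> f (h \<rho> t) * b x"
    proof -
      have "b1 - \<eta> \<le> b x / \<theta> t ^ (k + 1)" using \<delta>b(2)[OF x] \<rho> \<delta>2 by (simp add: t_def)
      then have "(b1 - \<eta>) * \<theta> t ^ (k + 1) \<le> b x" using th_pos[OF t(1,4)] by (simp add: pos_le_divide_eq)
      then show ?thesis using fh by (intro mult_left_mono) auto
    qed
    also have "\<dots> < f (u x) * b x"
      using f_mono[of "h \<rho> t" "u x"] hJ[OF \<rho>(1) t(2,3)] u_J[OF x] gt b_pos[OF x] unfolding t_def by (intro mult_strict_right_mono) auto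
    finally show False using u_eq[OF x] by (simp add: mult.commute)
  qed
  define \<delta> where "\<delta> = \<delta>2 / 2"
  have \<delta>: "\<delta> > 0" "\<delta> < \<delta>2" using \<delta>2 by (auto simp: \<delta>_def)
  have ucont: "continuous_on {x\<in>\<Omega>. a \<le> ?d x \<and> ?d x \<le> c} u" for a c
    by (rule continuous_on_subset[OF u_cont]) auto
  \<comment> \<open>The degenerate shell is the level set d = \<delta>.\<close>
  have "bdd_above (u ` {x\<in>\<Omega>. \<delta> \<le> ?d x \<and> ?d x \<le> \<delta>})"
    by (intro bounded_imp_bdd_above compact_imp_bounded compact_continuous_image ucont compact_distance_shell sm \<delta>)
  then obtain M0 where M0: "\<And>x. x \<in> \<Omega> \<Longrightarrow> ?d x = \<delta> \<Longrightarrow> u x \<le> M0" unfolding bdd_above_def by auto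
  \<comment> \<open>The maximum with 0 ensures that u - h > M implies u > h, as
    \<open>no_touch\<close> demands.\<close>
  define M where "M = max 0 M0"
  have claim: "u x1 \<le> h \<rho> (?d x1) + M" if x1: "x1 \<in> \<Omega>" and \<rho>: "0 < \<rho>" "\<rho> < ?d x1" "?d x1 \<le> \<delta>" for x1 \<rho>
  proof (rule ccontr)
    assume "\<not> ?thesis"
    then have bad: "u x1 - h \<rho> (?d x1) > M" by simp
    have "bdd_above (u ` {x\<in>\<Omega>. \<rho> \<le> ?d x \<and> ?d x \<le> \<delta>})"
      by (intro bounded_imp_bdd_above compact_imp_bounded compact_continuous_image ucont compact_distance_shell sm \<rho>)
    then obtain U0 where U0: "\<And>x. x \<in> \<Omega> \<Longrightarrow> \<rho> \<le> ?d x \<Longrightarrow> ?d x \<le> \<delta> \<Longrightarrow> u x \<le> U0" unfolding bdd_above_def by auto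
    have \<rho>\<delta>: "\<rho> < \<delta>1" "\<rho> < \<delta>" using \<rho> \<delta> \<delta>2 by auto
    have "((\<lambda>t. \<tau> * Y \<rho> t powr \<alpha>) \<longlongrightarrow> 0) (at_right \<rho>)"
    proof -
      have "((\<lambda>t. Y \<rho> t powr \<alpha>) \<longlongrightarrow> 0 powr \<alpha>) (at_right \<rho>)"
      proof (rule tendsto_powr'[OF Y0[OF \<rho>(1) \<rho>\<delta>(1)] tendsto_const])
        have "\<forall>\<^sub>F t in at_right \<rho>. 0 \<le> Y \<rho> t"
          using prof[OF \<rho>(1)] \<rho>\<delta> unfolding eventually_at_right_field by (intro exI[of _ \<delta>1]) (auto intro: less_imp_le)
        then show "0 \<noteq> (0::real) \<or> 0 < \<alpha> \<and> (\<forall>\<^sub>F t in at_right \<rho>. 0 \<le> Y \<rho> t)" using \<alpha>_pos by blast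
      qed
      from tendsto_mult[OF tendsto_const[of \<tau>] this] show ?thesis by simp
    qed
    moreover have "\<forall>\<^sub>F t in at_right \<rho>. \<tau> * Y \<rho> t powr \<alpha> \<in> {0<..} \<and> \<tau> * Y \<rho> t powr \<alpha> \<noteq> 0"
      using argY[OF \<rho>(1)] \<rho>\<delta> unfolding eventually_at_right_field by (intro exI[of _ \<delta>1]) force
    ultimately have "filterlim (\<lambda>t. \<tau> * Y \<rho> t powr \<alpha>) (at_right 0) (at_right \<rho>)" by (simp add: filterlim_at)
    from filterlim_compose[OF psi_at_top[OF k f_deriv_all f_pos_all tail_all lim psi] this]
    have "\<forall>\<^sub>F t in at_right \<rho>. h \<rho> t > U0" unfolding h_def filterlim_at_top_dense by blast
    then obtain \<rho>' where \<rho>': "\<rho>' > \<rho>" "\<And>t. \<rho> < t \<Longrightarrow> t < \<rho>' \<Longrightarrow> h \<rho> t > U0"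
      unfolding eventually_at_right_field by blast
    have near: "u x - h \<rho> (?d x) < 0" if "x \<in> \<Omega>" "\<rho> < ?d x" "?d x < \<rho>'" "?d x \<le> \<delta>" for x
      using U0[of x] \<rho>'(2)[of "?d x"] that by auto
    \<comment> \<open>The barrier is not controlled at d = \<rho> itself; between \<rho> and \<rho>'
      the difference is negative by the choice of \<open>U0\<close>, so no maximum above M is
      lost.\<close>
    define K where "K = {x\<in>\<Omega>. \<rho>' \<le> ?d x \<and> ?d x \<le> \<delta>}"
    have K: "compact K" unfolding K_def using compact_distance_shell[OF sm] \<rho>'(1) \<rho>(1) by simp
    have Mpos: "M \<ge> 0" by (simp add: M_def)
    have x1K: "x1 \<in> K" using bad near[of x1] x1 \<rho> Mpos by (force simp: K_def)
    have contK: "continuous_on K (\<lambda>x. u x - h \<rho> (?d x))"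
    proof (intro continuous_on_diff)
      show "continuous_on K u" unfolding K_def by (rule ucont)
      show "continuous_on K (\<lambda>x. h \<rho> (?d x))"
      proof (intro continuous_at_imp_continuous_on ballI)
        fix x assume "x \<in> K"
        then have dx: "\<rho> < ?d x" "?d x < \<delta>1" using \<rho>'(1) \<delta> \<delta>2 by (auto simp: K_def)
        have Yc: "(Y \<rho> \<longlongrightarrow> Y \<rho> (?d x)) (at (?d x))"
          using prof[OF \<rho>(1) dx] DERIV_isCont isCont_def by blast
        have "isCont (h \<rho>) (?d x)"
          unfolding isCont_def h_def using psiT prof[OF \<rho>(1) dx] argY[OF \<rho>(1) dx] by (intro psi_profile_tendsto[OF _ Yc]) auto
        then show "isCont (\<lambda>x. h \<rho> (?d x)) x" by (rule isCont_o2[OF bdist_continuous])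
      qed
    qed
    obtain x0 where x0: "x0 \<in> K" and max: "\<And>x. x \<in> K \<Longrightarrow> u x - h \<rho> (?d x) \<le> u x0 - h \<rho> (?d x0)"
      using continuous_attains_sup[OF K _ contK] x1K by blast
    have v0: "u x0 - h \<rho> (?d x0) > M" using max[OF x1K] bad by simp
    have x0': "x0 \<in> \<Omega>" "\<rho> < ?d x0" "?d x0 \<le> \<delta>" using x0 \<rho>'(1) by (auto simp: K_def)
    have "?d x0 \<noteq> \<delta>"
    proof
      assume "?d x0 = \<delta>"
      then have "u x0 \<le> M0" using M0 x0' by blast
      moreover have "h \<rho> (?d x0) > 1" using hJ[OF \<rho>(1), of "?d x0"] x0' \<delta> \<delta>2 by auto
      ultimately show False using v0 by (simp add: M_def)
    qed
    then have lt: "?d x0 < \<delta>" using x0' by simp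
    have "\<forall>\<^sub>F z in nhds x0. z \<in> \<Omega> \<and> \<rho> < ?d z \<and> ?d z < \<delta>"
      using isCont_tendsto_nhds[OF bdist_continuous, of \<Omega> x0] x0' lt
      by (intro eventually_conj eventually_nhds_in_open[OF op] order_tendstoD[of ?d "?d x0"]) auto
    then have "\<forall>\<^sub>F z in nhds x0. u z - h \<rho> (?d z) \<le> u x0 - h \<rho> (?d x0)"
    proof eventually_elim
      case (elim z)
      show ?case
      proof (cases "?d z < \<rho>'")
        case True
        then show ?thesis using near[of z] elim v0 Mpos by auto
      next
        case False
        then show ?thesis using max[of z] elim by (auto simp: K_def)
      qed
    qed
    then show False using no_touch[of x0 \<rho>] x0' \<rho>(1) lt \<delta> v0 Mpos by auto
  qed
  have "u x \<le> \<psi> (\<tau> * Theta \<theta> (?d x) powr \<alpha>) + M" if x: "x \<in> \<Omega>" "?d x < \<delta>" for x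
  proof -
    have dx: "0 < ?d x" "?d x < \<delta>1" "?d x < \<delta>0" using bdist_pos[OF sm x(1)] x(2) \<delta> \<delta>2 \<delta>1 by auto
    have Th: "Theta \<theta> (?d x) > 0" using Theta_pos'[of "?d x"] dx by simp
    have Th2: "Theta \<theta> (?d x) < e2" using prof[of "?d x / 2" "?d x"] dx by auto
    \<comment> \<open>With x fixed, the estimate for every 0 < \<rho> < d (x) passes to the limit by
      continuity of \<psi>.\<close>
    have "((\<lambda>\<rho>. h \<rho> (?d x)) \<longlongrightarrow> \<psi> (\<tau> * Theta \<theta> (?d x) powr \<alpha>)) (at_right 0)"
      unfolding h_def using psiT arg[OF Th Th2] Th by (intro psi_profile_tendsto[OF _ Y\<rho>[OF dx(1,2)]]) auto
    moreover have "\<forall>\<^sub>F \<rho> in at_right 0. u x - M \<le> h \<rho> (?d x)"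
      unfolding eventually_at_right_field
    proof (intro exI[of _ "?d x"] conjI allI impI dx(1))
      fix \<rho> assume "0 < \<rho>" "\<rho> < ?d x"
      then show "u x - M \<le> h \<rho> (?d x)" using claim[OF x(1), of \<rho>] x(2) by simp
    qed
    ultimately have "u x - M \<le> \<psi> (\<tau> * Theta \<theta> (?d x) powr \<alpha>)" by (rule tendsto_lowerbound) simp
    then show ?thesis by simp
  qed
  then show ?thesis using \<delta>(1) by blast
qed

text \<open>The barrier is bounded up to the boundary for each \<rho>, so the unbounded u exceeds it
  there. The comparison needs the model Hessian in the cone, hence convexity of the profile and
  nonnegative shifted curvature functions of every order.\<close>

lemma lower_bound:
  assumes \<tau>: "\<tau> > 0" and large: "b2 < (\<tau> * \<alpha>) ^ k * (\<beta> * M_minus (k - 1) \<Omega>)"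
  shows "\<exists>\<delta>>0. \<exists>M. \<forall>x\<in>\<Omega>. bdist \<Omega> x < \<delta> \<longrightarrow> \<psi> (\<tau> * Theta \<theta> (bdist \<Omega> x) powr \<alpha>) - M \<le> u x"
proof -
  obtain m where km: "k = Suc m" using k by (cases k) auto
  have mN: "m \<le> CARD('n) - 1" using kN km by simp
  let ?d = "bdist \<Omega>"
  let ?F' = "deriv (\<lambda>s. f s powr (1 / real k))"
  define A where "A = (\<tau> * \<alpha>) ^ k"
  define Mm where "Mm = M_minus m \<Omega>"
  have A: "A > 0" using \<tau> \<alpha>_pos by (simp add: A_def)
  have Mm: "Mm > 0" unfolding Mm_def by (rule M_minus_pos[OF mN])
  obtain L where shift: "\<And>e. e > 0 \<Longrightarrow> \<exists>\<sigma>>0. \<forall>y\<in>frontier \<Omega>. length (principal_curvatures \<Omega> y) = CARD('n) - 1 \<and> (\<forall>c j. \<bar>c\<bar> \<le> \<sigma> \<longrightarrow>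
     \<bar>elem_sym j (map (\<lambda>a. a + c) (principal_curvatures \<Omega> y)) - S_curv j \<Omega> y\<bar> \<le> e \<and>
     \<bar>elem_sym j (map (\<lambda>a. a + c) (principal_curvatures \<Omega> y))\<bar> \<le> L)"
    using curvature_shift[OF sm] by blast
  \<comment> \<open>Both factors stay positive by the choice of \<eta>, so that the lower bounds for
    \<open>Br\<close> and \<open>ek m\<close> may be multiplied.\<close>
  define Q where "Q \<eta> = (\<beta> - (\<alpha> + 1) * \<eta>) * (Mm - \<eta>)" for \<eta>
  have "((\<lambda>\<eta>. A * Q \<eta> - \<eta>) \<longlongrightarrow> A * ((\<beta> - (\<alpha> + 1) * 0) * (Mm - 0)) - 0) (at_right 0)"
    unfolding Q_def by (intro tendsto_intros)
  moreover have "A * ((\<beta> - (\<alpha> + 1) * 0) * (Mm - 0)) - 0 > b2"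
    using large by (simp add: A_def Mm_def km)
  ultimately have "\<forall>\<^sub>F \<eta> in at_right 0. A * Q \<eta> - \<eta> > b2" by (rule order_tendstoD(1))
  moreover have "((\<lambda>\<eta>. \<beta> - (\<alpha> + 1) * \<eta>) \<longlongrightarrow> \<beta> - (\<alpha> + 1) * 0) (at_right 0)" by (intro tendsto_intros)
  then have "\<forall>\<^sub>F \<eta> in at_right 0. \<beta> - (\<alpha> + 1) * \<eta> > 0" by (rule order_tendstoD(1)) (simp add: \<beta>_gt)
  moreover have "((\<lambda>\<eta>. Mm - \<eta>) \<longlongrightarrow> Mm - 0) (at_right 0)" by (intro tendsto_intros)
  then have "\<forall>\<^sub>F \<eta> in at_right 0. Mm - \<eta> > 0" by (rule order_tendstoD(1)) (simp add: Mm)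
  ultimately have "\<forall>\<^sub>F \<eta> in at_right 0. A * Q \<eta> - \<eta> > b2 \<and> \<beta> - (\<alpha> + 1) * \<eta> > 0 \<and> Mm - \<eta> > 0 \<and> \<eta> > 0"
    using eventually_at_right_less[of 0] by eventually_elim auto
  then obtain \<eta> where \<eta>: "\<eta> > 0" "A * Q \<eta> - \<eta> > b2" "\<beta> - (\<alpha> + 1) * \<eta> > 0" "Mm - \<eta> > 0"
    using eventually_happens'[OF trivial_limit_at_right_real] by blast
  \<comment> \<open>At most every \<open>M_minus j \<Omega>\<close>, so that all shifted symmetric
    functions stay nonnegative, not only the one of order m.\<close>
  define e1 where "e1 = min \<eta> (Min ((\<lambda>j. M_minus j \<Omega>) ` {..CARD('n) - 1}))"
  have e1: "e1 > 0" "e1 \<le> \<eta>" "\<And>j. j \<le> CARD('n) - 1 \<Longrightarrow> e1 \<le> M_minus j \<Omega>"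
  proof -
    have "Min ((\<lambda>j. M_minus j \<Omega>) ` {..CARD('n) - 1}) > 0" using M_minus_pos by (subst Min_gr_iff) auto
    then show "e1 > 0" "e1 \<le> \<eta>" using \<eta> by (auto simp: e1_def)
    fix j assume "j \<le> CARD('n) - 1"
    then have "Min ((\<lambda>j. M_minus j \<Omega>) ` {..CARD('n) - 1}) \<le> M_minus j \<Omega>" by (intro Min_le) auto
    then show "e1 \<le> M_minus j \<Omega>" by (simp add: e1_def)
  qed
  obtain \<sigma> where \<sigma>: "\<sigma> > 0" and sh: "\<And>y. y \<in> frontier \<Omega> \<Longrightarrow> length (principal_curvatures \<Omega> y) = CARD('n) - 1 \<and> (\<forall>c j. \<bar>c\<bar> \<le> \<sigma> \<longrightarrow>
     \<bar>elem_sym j (map (\<lambda>a. a + c) (principal_curvatures \<Omega> y)) - S_curv j \<Omega> y\<bar> \<le> e1 \<and>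
     \<bar>elem_sym j (map (\<lambda>a. a + c) (principal_curvatures \<Omega> y))\<bar> \<le> L)"
    using shift[OF e1(1)] by blast
  obtain r where r: "r > 0" and touch: "\<And>x. x \<in> \<Omega> \<Longrightarrow> ?d x < r \<Longrightarrow> \<exists>y\<in>frontier \<Omega>. \<exists>n es. orthonormal_basis (n # es) \<and>
    (\<forall>v. \<forall>\<^sub>F s in nhds 0.
       ?d x + s * (n \<bullet> v) - s\<^sup>2 / 2 * (\<Sum>i<CARD('n) - 1. (principal_curvatures \<Omega> y ! i + \<sigma>) * (es ! i \<bullet> v)\<^sup>2) \<le> ?d (x + s *\<^sub>R v) \<and>
       ?d (x + s *\<^sub>R v) \<le> ?d x + s * (n \<bullet> v) - s\<^sup>2 / 2 * (\<Sum>i<CARD('n) - 1. (principal_curvatures \<Omega> y ! i - \<sigma>) * (es ! i \<bullet> v)\<^sup>2))"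
    using distance_touching[OF sm \<sigma>] by blast
  obtain T where T: "T > 0" and psiT: "\<And>s. 0 < s \<Longrightarrow> s < T \<Longrightarrow> \<psi> s \<in> J \<and> \<psi> s > 1 \<and>
      (\<psi> has_real_derivative - (f (\<psi> s) powr (1 / real k))) (at s) \<and> \<bar>?F' (\<psi> s) * s - C\<bar> < \<eta>"
    and psi_anti: "\<And>s t. 0 < s \<Longrightarrow> s \<le> t \<Longrightarrow> t < T \<Longrightarrow> \<psi> t \<le> \<psi> s"
    by (rule psi_control[OF \<eta>(1)]) (rule that, assumption+)
  obtain e2 where e2: "e2 > 0" and arg: "\<And>t. 0 < t \<Longrightarrow> t < e2 \<Longrightarrow> 0 < \<tau> * t powr \<alpha> \<and> \<tau> * t powr \<alpha> < T"
    using small_argument[OF \<tau> T] by blast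
  \<comment> \<open>Y may come close to twice the bound, so half of e2 is requested.\<close>
  have m0: "min \<eta> (e2 / 2) > 0" using \<eta> e2 by simp
  obtain \<delta>1 Y y y' where \<delta>1: "0 < \<delta>1" "\<delta>1 \<le> \<delta>0"
    and prof: "\<And>\<rho> t. 0 < \<rho> \<Longrightarrow> \<rho> < \<delta>1 \<Longrightarrow> 0 < t \<Longrightarrow> t < \<delta>1 \<Longrightarrow> Y \<rho> t > 0 \<and> (Y \<rho> has_real_derivative y \<rho> t) (at t) \<and>
       (y \<rho> has_real_derivative y' \<rho> t) (at t) \<and> 0 < \<theta> t \<and> \<theta> t \<le> y \<rho> t \<and>
       - (Y \<rho> t * y' \<rho> t / (y \<rho> t)\<^sup>2) \<ge> D - 1 - min \<eta> (e2 / 2) \<and> Theta \<theta> t \<le> Y \<rho> t \<and> Theta \<theta> \<rho> \<le> Y \<rho> t \<and> Y \<rho> t < 2 * min \<eta> (e2 / 2)"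
    and Y\<rho>: "\<And>t. 0 < t \<Longrightarrow> t < \<delta>1 \<Longrightarrow> ((\<lambda>\<rho>. Y \<rho> t) \<longlongrightarrow> Theta \<theta> t) (at_right 0)"
    by (rule lower_profile'[OF m0]) (rule that, assumption+)
  obtain \<delta>b where \<delta>b: "\<delta>b > 0" "\<And>x. x \<in> \<Omega> \<Longrightarrow> ?d x < \<delta>b \<Longrightarrow> b x / \<theta> (?d x) ^ (k + 1) \<le> b2 + \<eta>"
    using b_upper[OF \<eta>(1)] unfolding eventually_near_boundary by blast
  define \<delta>2 where "\<delta>2 = min \<delta>1 (min r \<delta>b)"
  have \<delta>2: "\<delta>2 > 0" "\<delta>2 \<le> \<delta>1" "\<delta>2 \<le> r" "\<delta>2 \<le> \<delta>b" using \<delta>1 r \<delta>b by (auto simp: \<delta>2_def)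
  define h where "h \<rho> t = \<psi> (\<tau> * Y \<rho> t powr \<alpha>)" for \<rho> t
  have argY: "0 < \<tau> * Y \<rho> t powr \<alpha> \<and> \<tau> * Y \<rho> t powr \<alpha> < T" if "0 < \<rho>" "\<rho> < \<delta>1" "0 < t" "t < \<delta>1" for \<rho> t
    using prof[OF that] by (intro arg) auto
  have hJ: "h \<rho> t \<in> J \<and> h \<rho> t > 1" if "0 < \<rho>" "\<rho> < \<delta>1" "0 < t" "t < \<delta>1" for \<rho> t
    using psiT argY[OF that] by (simp add: h_def)
  have h_le: "h \<rho> t \<le> \<psi> (\<tau> * Z powr \<alpha>)" if "0 < \<rho>" "\<rho> < \<delta>1" "0 < t" "t < \<delta>1" "0 < Z" "Z \<le> Y \<rho> t" for \<rho> t Z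
    unfolding h_def using argY[OF that(1-4)] that(5,6) \<tau> \<alpha>_pos
    by (intro psi_anti) (auto intro!: mult_left_mono powr_mono2)
  have no_touch: False
    if x: "x \<in> \<Omega>" and \<rho>: "0 < \<rho>" "\<rho> < \<delta>1" "?d x < \<delta>2" and lt: "u x < h \<rho> (?d x)"
      and mn: "\<forall>\<^sub>F z in nhds x. u z - h \<rho> (?d z) \<ge> u x - h \<rho> (?d x)" for x \<rho>
  proof -
    define t where "t = ?d x"
    have t: "0 < t" "t < \<delta>1" "t < \<delta>0" using \<rho> \<delta>2 \<delta>1 bdist_pos[OF sm x] by (auto simp: t_def)
    note P = prof[OF \<rho>(1,2) t(1,2)]
    have "\<forall>\<^sub>F s in nhds t. 0 < s \<and> s < \<delta>1" using t by (intro eventually_conj order_tendstoD[of "\<lambda>x. x" t] filterlim_ident) auto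
    then have dY: "\<forall>\<^sub>F s in nhds t. (Y \<rho> has_real_derivative y \<rho> s) (at s)"
      by eventually_elim (use prof[OF \<rho>(1,2)] in blast)
    have psiT': "\<And>s. 0 < s \<Longrightarrow> s < T \<Longrightarrow> \<psi> s > 0 \<and> (\<psi> has_real_derivative - (f (\<psi> s) powr (1 / real k))) (at s)"
      using psiT by force
    have dy: "(y \<rho> has_real_derivative y' \<rho> t) (at t)" "Y \<rho> t > 0" "\<tau> * Y \<rho> t powr ((real k + 1) / real k) < T" "y \<rho> t > 0"
      using P argY[OF \<rho>(1,2) t(1,2)] order_less_le_trans[of 0 "\<theta> t" "y \<rho> t"] unfolding \<alpha>_def by auto
    note pr = profile'[of T \<tau> "Y \<rho>" "y \<rho>" t "y' \<rho> t", OF psiT' \<tau> dY dy, folded \<alpha>_def, folded h_def]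
    obtain h1 h2 where dh: "\<forall>\<^sub>F t in nhds t. (h \<rho> has_real_derivative h1 t) (at t)"
      and dh1: "(h1 has_real_derivative h2) (at t)" and neg: "h1 t < 0"
      and pk1: "(- h1 t) ^ (k - 1) * h2 = f (h \<rho> t) * (\<tau> * \<alpha>) ^ k * y \<rho> t ^ (k + 1) *
        (\<alpha> * (?F' (h \<rho> t) * (\<tau> * Y \<rho> t powr \<alpha>)) - 1 / real k - Y \<rho> t * y' \<rho> t / (y \<rho> t)\<^sup>2)"
      by (rule pr, assumption, assumption, rule that, assumption+)
    obtain w n es where w: "w \<in> frontier \<Omega>" and fr: "orthonormal_basis (n # es)" and tc:
      "\<And>v. \<forall>\<^sub>F s in nhds 0.
       ?d x + s * (n \<bullet> v) - s\<^sup>2 / 2 * (\<Sum>i<CARD('n) - 1. (principal_curvatures \<Omega> w ! i + \<sigma>) * (es ! i \<bullet> v)\<^sup>2) \<le> ?d (x + s *\<^sub>R v) \<and>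
       ?d (x + s *\<^sub>R v) \<le> ?d x + s * (n \<bullet> v) - s\<^sup>2 / 2 * (\<Sum>i<CARD('n) - 1. (principal_curvatures \<Omega> w ! i - \<sigma>) * (es ! i \<bullet> v)\<^sup>2)"
      using touch[OF x] \<rho> \<delta>2 by (meson order_less_le_trans)
    define ek where "ek j = elem_sym j (map (\<lambda>a. a + - \<sigma>) (principal_curvatures \<Omega> w))" for j
    have ek: "\<bar>ek j - S_curv j \<Omega> w\<bar> \<le> e1" for j
      unfolding ek_def using sh[OF w, THEN conjunct2, rule_format, of "- \<sigma>" j] \<sigma> by simp
    have len: "length (principal_curvatures \<Omega> w) = CARD('n) - 1" using sh[OF w] by blast
    have ek0: "ek j \<ge> 0" for j
    proof (cases "j \<le> CARD('n) - 1")
      case True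
      then show ?thesis using ek[of j] e1(3)[OF True] M_plus_minus(4)[OF sm w, of j] by linarith
    next
      \<comment> \<open>Orders beyond the number of curvatures are demanded as well; they
        vanish.\<close>
      case False
      then show ?thesis unfolding ek_def by (subst elem_sym_length_less) (auto simp: len)
    qed
    have y0: "y \<rho> t > 0" by (rule dy(4))
    define Br where "Br = \<alpha> * (?F' (h \<rho> t) * (\<tau> * Y \<rho> t powr \<alpha>)) - 1 / real k - Y \<rho> t * y' \<rho> t / (y \<rho> t)\<^sup>2"
    define c where "c = f (h \<rho> t) * A * y \<rho> t ^ (k + 1)"
    have fh: "f (h \<rho> t) > 0" using f_pos[of "h \<rho> t"] hJ[OF \<rho>(1,2) t(1,2)] by simp
    have c0: "c > 0" using fh A y0 by (simp add: c_def)
    have pk1': "(- h1 t) ^ m * h2 = c * Br" using pk1 unfolding c_def Br_def A_def by (simp add: km)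
    have "C - \<eta> \<le> ?F' (h \<rho> t) * (\<tau> * Y \<rho> t powr \<alpha>)"
      using psiT[of "\<tau> * Y \<rho> t powr \<alpha>"] argY[OF \<rho>(1,2) t(1,2)] unfolding h_def by auto
    then have "\<alpha> * (C - \<eta>) \<le> \<alpha> * (?F' (h \<rho> t) * (\<tau> * Y \<rho> t powr \<alpha>))" using \<alpha>_pos by (intro mult_left_mono) auto
    moreover have "- (Y \<rho> t * y' \<rho> t / (y \<rho> t)\<^sup>2) \<ge> D - 1 - \<eta>" using P by auto
    ultimately have "Br \<ge> \<alpha> * (C - \<eta>) - 1 / real k + (D - 1 - \<eta>)" unfolding Br_def by linarith
    also have "\<alpha> * (C - \<eta>) - 1 / real k + (D - 1 - \<eta>) = \<beta> - (\<alpha> + 1) * \<eta>"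
      unfolding \<beta>_def by (simp add: \<alpha>_eq algebra_simps add_divide_distrib diff_divide_distrib)
    finally have Br: "Br \<ge> \<beta> - (\<alpha> + 1) * \<eta>" .
    then have Br0: "Br > 0" using \<eta> by linarith
    \<comment> \<open>\<open>profile_derivatives\<close> gives h'' only inside this product; its
      sign and that of - h' yield h'' > 0.\<close>
    have "(- h1 t) ^ m * h2 > 0" unfolding pk1' using c0 Br0 by simp
    moreover have "(- h1 t) ^ m > 0" using neg by simp
    ultimately have h20: "h2 > 0" by (rule zero_less_mult_pos)
    have "h2 * (- h1 t) ^ m * ek m \<le> S_hess (Suc m) u x"
      unfolding t_def ek_def
    proof (rule hessian_comparison_lower[OF u_C2 op x fr len])
      show "\<forall>\<^sub>F s in nhds 0. ?d (x + s *\<^sub>R v) \<le> ?d x + s * (n \<bullet> v) - s\<^sup>2 / 2 * (\<Sum>i<CARD('n) - 1. (principal_curvatures \<Omega> w ! i + - \<sigma>) * (es ! i \<bullet> v)\<^sup>2)" for v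
        using tc[of v] by eventually_elim auto
      show "\<forall>\<^sub>F z in nhds x. u z - h \<rho> (?d z) \<ge> u x - h \<rho> (?d x)" by (rule mn)
      show "0 \<le> elem_sym j (map (\<lambda>a. a + - \<sigma>) (principal_curvatures \<Omega> w))" for j using ek0 by (simp add: ek_def)
    qed (use dh dh1 neg h20 in \<open>simp_all add: t_def\<close>)
    then have S2: "c * Br * ek m \<le> S_hess k u x" using pk1' by (simp add: km mult.commute)
    have ekm: "Mm - \<eta> \<le> ek m" using ek[of m] e1(2) M_plus_minus(4)[OF sm w, of m] unfolding Mm_def by linarith
    have "f (u x) * b x < f (h \<rho> t) * b x"
      using f_mono[of "u x" "h \<rho> t"] hJ[OF \<rho>(1,2) t(1,2)] u_J[OF x] lt b_pos[OF x] unfolding t_def by (intro mult_strict_right_mono) auto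
    also have "\<dots> \<le> f (h \<rho> t) * ((b2 + \<eta>) * \<theta> t ^ (k + 1))"
    proof -
      have "b x / \<theta> t ^ (k + 1) \<le> b2 + \<eta>" using \<delta>b(2)[OF x] \<rho> \<delta>2 by (simp add: t_def)
      then have "b x \<le> (b2 + \<eta>) * \<theta> t ^ (k + 1)" using th_pos[OF t(1,3)] by (simp add: pos_divide_le_eq)
      then show ?thesis using fh by (intro mult_left_mono) auto
    qed
    also have "\<dots> = f (h \<rho> t) * \<theta> t ^ (k + 1) * (b2 + \<eta>)" by simp
    also have "\<dots> \<le> f (h \<rho> t) * \<theta> t ^ (k + 1) * (A * Q \<eta>)"
      using \<eta> fh th_pos[OF t(1,3)] by (intro mult_left_mono) auto
    also have "\<dots> = f (h \<rho> t) * A * \<theta> t ^ (k + 1) * Q \<eta>" by simp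
    also have "\<dots> \<le> c * Q \<eta>"
    proof (rule mult_right_mono)
      show "f (h \<rho> t) * A * \<theta> t ^ (k + 1) \<le> c"
        unfolding c_def using P fh A by (intro mult_left_mono power_mono) auto
      show "0 \<le> Q \<eta>" using \<eta> by (simp add: Q_def)
    qed
    also have "\<dots> \<le> c * (Br * ek m)"
      unfolding Q_def using Br ekm c0 \<eta> Br0 by (intro mult_left_mono mult_mono) auto
    also have "\<dots> \<le> S_hess k u x" using S2 by (simp add: mult.assoc)
    finally show False using u_eq[OF x] by (simp add: mult.commute)
  qed
  define \<delta> where "\<delta> = \<delta>2 / 2"
  have \<delta>: "\<delta> > 0" "\<delta> < \<delta>2" "\<delta> < \<delta>1" "\<delta> < \<delta>0" using \<delta>2 \<delta>1 by (auto simp: \<delta>_def)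
  have ucont: "continuous_on {x\<in>\<Omega>. a \<le> ?d x \<and> ?d x \<le> c} u" for a c
    by (rule continuous_on_subset[OF u_cont]) auto
  have "bdd_below (u ` {x\<in>\<Omega>. \<delta> \<le> ?d x \<and> ?d x \<le> \<delta>})"
    by (intro bounded_imp_bdd_below compact_imp_bounded compact_continuous_image ucont compact_distance_shell sm \<delta>)
  then obtain M0 where M0: "\<And>x. x \<in> \<Omega> \<Longrightarrow> ?d x = \<delta> \<Longrightarrow> M0 \<le> u x" unfolding bdd_below_def by auto
  \<comment> \<open>An upper bound for the barrier on d = \<delta> valid for all \<rho>, because Y
    \<rho> >= \<Theta> there and \<psi> decreases; this makes M independent of \<rho>.\<close>
  define H where "H = \<psi> (\<tau> * Theta \<theta> \<delta> powr \<alpha>)"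
  define M where "M = max 0 (H - M0)"
  have claim: "h \<rho> (?d x1) - M \<le> u x1" if x1: "x1 \<in> \<Omega>" "?d x1 \<le> \<delta>" and \<rho>: "0 < \<rho>" "\<rho> < \<delta>1" for x1 \<rho>
  proof (rule ccontr)
    assume "\<not> ?thesis"
    then have bad: "u x1 - h \<rho> (?d x1) < - M" by simp
    have T\<rho>: "Theta \<theta> \<rho> > 0" using Theta_pos'[of \<rho>] \<rho> \<delta>1 by simp
    have "\<forall>\<^sub>F x in near_boundary \<Omega>. \<psi> (\<tau> * Theta \<theta> \<rho> powr \<alpha>) < u x"
      using u_top unfolding filterlim_at_top_dense by blast
    \<comment> \<open>For this \<rho> the barrier never exceeds \<psi> (\<tau>
      \<Theta>(\<rho>)^\<alpha>), whereas u does so near the boundary.\<close>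
    then obtain \<rho>' where \<rho>': "\<rho>' > 0" "\<And>x. x \<in> \<Omega> \<Longrightarrow> ?d x < \<rho>' \<Longrightarrow> \<psi> (\<tau> * Theta \<theta> \<rho> powr \<alpha>) < u x"
      unfolding eventually_near_boundary by blast
    have near: "u x - h \<rho> (?d x) > 0" if "x \<in> \<Omega>" "?d x < \<rho>'" "?d x \<le> \<delta>" for x
    proof -
      have dx: "0 < ?d x" "?d x < \<delta>1" using bdist_pos[OF sm that(1)] that \<delta> by auto
      have "h \<rho> (?d x) \<le> \<psi> (\<tau> * Theta \<theta> \<rho> powr \<alpha>)" using prof[OF \<rho> dx] by (intro h_le \<rho> dx T\<rho>) auto
      then show ?thesis using \<rho>'(2)[of x] that by simp
    qed
    define K where "K = {x\<in>\<Omega>. \<rho>' \<le> ?d x \<and> ?d x \<le> \<delta>}"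
    have K: "compact K" unfolding K_def using compact_distance_shell[OF sm] \<rho>'(1) by simp
    have Mpos: "M \<ge> 0" by (simp add: M_def)
    have x1K: "x1 \<in> K" using bad near[of x1] x1 Mpos by (force simp: K_def)
    have contK: "continuous_on K (\<lambda>x. u x - h \<rho> (?d x))"
    proof (intro continuous_on_diff)
      show "continuous_on K u" unfolding K_def by (rule ucont)
      show "continuous_on K (\<lambda>x. h \<rho> (?d x))"
      proof (intro continuous_at_imp_continuous_on ballI)
        fix x assume "x \<in> K"
        then have dx: "0 < ?d x" "?d x < \<delta>1" using \<rho>'(1) \<delta> by (auto simp: K_def)
        have Yc: "(Y \<rho> \<longlongrightarrow> Y \<rho> (?d x)) (at (?d x))"
          using prof[OF \<rho> dx] DERIV_isCont isCont_def by blast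
        have "isCont (h \<rho>) (?d x)"
          unfolding isCont_def h_def using psiT prof[OF \<rho> dx] argY[OF \<rho> dx] by (intro psi_profile_tendsto[OF _ Yc]) auto
        then show "isCont (\<lambda>x. h \<rho> (?d x)) x" by (rule isCont_o2[OF bdist_continuous])
      qed
    qed
    obtain x0 where x0: "x0 \<in> K" and min: "\<And>x. x \<in> K \<Longrightarrow> u x0 - h \<rho> (?d x0) \<le> u x - h \<rho> (?d x)"
      using continuous_attains_inf[OF K _ contK] x1K by blast
    have v0: "u x0 - h \<rho> (?d x0) < - M" using min[OF x1K] bad by simp
    have x0': "x0 \<in> \<Omega>" "0 < ?d x0" "?d x0 \<le> \<delta>" using x0 \<rho>'(1) by (auto simp: K_def)
    have "?d x0 \<noteq> \<delta>"
    proof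
      assume eq: "?d x0 = \<delta>"
      then have "M0 \<le> u x0" using M0 x0' by blast
      moreover have "h \<rho> \<delta> \<le> H" unfolding H_def
        using prof[OF \<rho> \<delta>(1,3)] Theta_pos'[of \<delta>] \<delta> by (intro h_le \<rho>) auto
      ultimately show False using v0 eq by (simp add: M_def)
    qed
    then have lt: "?d x0 < \<delta>" using x0' by simp
    have "\<forall>\<^sub>F z in nhds x0. z \<in> \<Omega> \<and> ?d z < \<delta>"
      using isCont_tendsto_nhds[OF bdist_continuous, of \<Omega> x0] x0' lt
      by (intro eventually_conj eventually_nhds_in_open[OF op] order_tendstoD[of ?d "?d x0"]) auto
    then have "\<forall>\<^sub>F z in nhds x0. u z - h \<rho> (?d z) \<ge> u x0 - h \<rho> (?d x0)"
    proof eventually_elim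
      case (elim z)
      show ?case
      proof (cases "?d z < \<rho>'")
        case True
        then show ?thesis using near[of z] elim v0 Mpos by auto
      next
        case False
        then show ?thesis using min[of z] elim by (auto simp: K_def)
      qed
    qed
    then show False using no_touch[of x0 \<rho>] x0' \<rho> lt \<delta> v0 Mpos by auto
  qed
  have "\<psi> (\<tau> * Theta \<theta> (?d x) powr \<alpha>) - M \<le> u x" if x: "x \<in> \<Omega>" "?d x < \<delta>" for x
  proof -
    have dx: "0 < ?d x" "?d x < \<delta>1" "?d x < \<delta>0" using bdist_pos[OF sm x(1)] x(2) \<delta> by auto
    have Th: "Theta \<theta> (?d x) > 0" using Theta_pos'[of "?d x"] dx by simp
    have Th2: "Theta \<theta> (?d x) < e2" using prof[of "?d x" "?d x"] dx by auto
    have "((\<lambda>\<rho>. h \<rho> (?d x)) \<longlongrightarrow> \<psi> (\<tau> * Theta \<theta> (?d x) powr \<alpha>)) (at_right 0)"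
      unfolding h_def using psiT arg[OF Th Th2] Th by (intro psi_profile_tendsto[OF _ Y\<rho>[OF dx(1,2)]]) auto
    moreover have "\<forall>\<^sub>F \<rho> in at_right 0. h \<rho> (?d x) \<le> u x + M"
      unfolding eventually_at_right_field
    proof (intro exI[of _ \<delta>1] conjI allI impI \<delta>1(1))
      fix \<rho> assume "0 < \<rho>" "\<rho> < \<delta>1"
      then show "h \<rho> (?d x) \<le> u x + M" using claim[OF x(1), of \<rho>] x(2) by simp
    qed
    ultimately have "\<psi> (\<tau> * Theta \<theta> (?d x) powr \<alpha>) \<le> u x + M" by (rule tendsto_upperbound) simp
    then show ?thesis by simp
  qed
  then show ?thesis using \<delta>(1) by blast
qed

end

section \<open>From the barriers to the bounds on the quotient\<close>

context blowup_problem
begin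

lemma argument_tendsto: "filterlim (\<lambda>x. Theta \<theta> (bdist \<Omega> x) powr \<alpha>) (at_right 0) (near_boundary \<Omega>)"
proof -
  have "((\<lambda>t. Theta \<theta> t powr \<alpha>) \<longlongrightarrow> 0) (at_right 0)"
  proof -
    have "\<forall>\<^sub>F t in at_right 0. 0 \<le> Theta \<theta> t"
      using Theta_pos' \<delta>0 unfolding eventually_at_right_field by (intro exI[of _ \<delta>0]) (auto intro: less_imp_le)
    then have "((\<lambda>t. Theta \<theta> t powr \<alpha>) \<longlongrightarrow> 0 powr \<alpha>) (at_right 0)"
      using \<alpha>_pos by (intro tendsto_powr'[OF Theta_tendsto' tendsto_const]) auto
    then show ?thesis by simp
  qed
  moreover have "\<forall>\<^sub>F t in at_right 0. Theta \<theta> t powr \<alpha> \<in> {0<..} \<and> Theta \<theta> t powr \<alpha> \<noteq> 0"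
    using Theta_pos' \<delta>0 unfolding eventually_at_right_field by (intro exI[of _ \<delta>0]) force
  ultimately have "filterlim (\<lambda>t. Theta \<theta> t powr \<alpha>) (at_right 0) (at_right 0)" by (simp add: filterlim_at)
  from filterlim_compose[OF this bdist_near_boundary[OF sm]] show ?thesis .
qed

text \<open>Regular variation handles the factor \<tau>; the additive constant of the comparison
  disappears because \<psi> tends to infinity.\<close>

lemma ratio_tendsto:
  assumes "\<tau> > 0"
  shows "((\<lambda>x. (\<psi> (\<tau> * Theta \<theta> (bdist \<Omega> x) powr \<alpha>) + M) / \<psi> (Theta \<theta> (bdist \<Omega> x) powr \<alpha>)) \<longlongrightarrow> \<tau> powr (1 - C))
    (near_boundary \<Omega>)"
proof -
  have "((\<lambda>s. \<psi> (\<tau> * s) / \<psi> s + M / \<psi> s) \<longlongrightarrow> \<tau> powr (1 - C) + 0) (at_right 0)"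
  proof (rule tendsto_add)
    show "((\<lambda>s. \<psi> (\<tau> * s) / \<psi> s) \<longlongrightarrow> \<tau> powr (1 - C)) (at_right 0)"
      by (rule psi_regularly_varying[OF k f_deriv_all f_pos_all tail_all lim psi assms])
    show "((\<lambda>s. M / \<psi> s) \<longlongrightarrow> 0) (at_right 0)"
      by (intro tendsto_divide_0[OF tendsto_const] filterlim_at_top_imp_at_infinity
          psi_at_top[OF k f_deriv_all f_pos_all tail_all lim psi])
  qed
  from filterlim_compose[OF this argument_tendsto] show ?thesis by (simp add: add_divide_distrib)
qed

lemma psi_argument_pos: "\<forall>\<^sub>F x in near_boundary \<Omega>. \<psi> (Theta \<theta> (bdist \<Omega> x) powr \<alpha>) > 0"
  using filterlim_compose[OF psi_at_top[OF k f_deriv_all f_pos_all tail_all lim psi] argument_tendsto]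
  unfolding filterlim_at_top_dense by blast

lemma power_threshold:
  assumes "x > 0" "y \<ge> 0"
  shows "y < x powr (1 / real k) \<Longrightarrow> y ^ k < x" "x powr (1 / real k) < y \<Longrightarrow> x < y ^ k"
proof -
  have e: "(x powr (1 / real k)) ^ k = x"
    using assms k by (simp add: powr_realpow[symmetric] powr_powr del: powr_realpow)
  show "y < x powr (1 / real k) \<Longrightarrow> y ^ k < x"
    using power_strict_mono[of y "x powr (1 / real k)" k] assms k e by simp
  show "x powr (1 / real k) < y \<Longrightarrow> x < y ^ k"
    using power_strict_mono[of "x powr (1 / real k)" y k] assms k e by simp
qed

lemma M_plus_pos: "M_plus (k - 1) \<Omega> > 0"
proof -
  obtain y0 where "y0 \<in> frontier \<Omega>" using frontier_compact_nonempty[OF sm] by blast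
  then show ?thesis using M_plus_minus(3)[OF sm, of y0 "k - 1"] S_curv_pos[of y0 "k - 1"] k kN by force
qed

lemma M_minus_pos_k: "M_minus (k - 1) \<Omega> > 0"
  using kN by (intro M_minus_pos diff_le_mono)

abbreviation (input) "ratio \<equiv> \<lambda>x. ereal (u x / \<psi> (Theta \<theta> (bdist \<Omega> x) powr \<alpha>))"

text \<open>At \<tau>9 the hypothesis of \<open>upper_bound\<close> becomes an equality, so \<tau>9
  is reached only as a limit: the bound holds for each smaller \<tau> and extends by continuity of
  the power.\<close>

lemma Limsup_ratio:
  assumes b1: "b1 > 0"
  defines "\<tau>9 \<equiv> 1 / \<alpha> * (b1 / (\<beta> * M_plus (k - 1) \<Omega>)) powr (1 / real k)"
  shows "Limsup (near_boundary \<Omega>) ratio \<le> ereal (\<tau>9 powr (1 - C))"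
proof -
  have \<beta>M: "\<beta> * M_plus (k - 1) \<Omega> > 0" using \<beta>_gt M_plus_pos by simp
  have \<tau>9: "\<tau>9 > 0" using b1 \<beta>_gt M_plus_pos \<alpha>_pos by (simp add: \<tau>9_def)
  have le: "Limsup (near_boundary \<Omega>) ratio \<le> ereal (\<tau> powr (1 - C))" if \<tau>: "0 < \<tau>" "\<tau> < \<tau>9" for \<tau>
  proof -
    have "\<tau> * \<alpha> < (b1 / (\<beta> * M_plus (k - 1) \<Omega>)) powr (1 / real k)"
      using \<tau>(2) \<alpha>_pos unfolding \<tau>9_def by (simp add: field_simps)
    then have "(\<tau> * \<alpha>) ^ k < b1 / (\<beta> * M_plus (k - 1) \<Omega>)"
      using \<tau> \<alpha>_pos b1 \<beta>M by (intro power_threshold(1)) auto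
    then have "(\<tau> * \<alpha>) ^ k * (\<beta> * M_plus (k - 1) \<Omega>) < b1" using \<beta>M by (simp add: pos_less_divide_eq)
    from upper_bound[OF \<tau>(1) this] obtain M where
      "\<forall>\<^sub>F x in near_boundary \<Omega>. u x \<le> \<psi> (\<tau> * Theta \<theta> (bdist \<Omega> x) powr \<alpha>) + M"
      unfolding eventually_near_boundary by blast
    then have "\<forall>\<^sub>F x in near_boundary \<Omega>. ratio x \<le> ereal ((\<psi> (\<tau> * Theta \<theta> (bdist \<Omega> x) powr \<alpha>) + M) / \<psi> (Theta \<theta> (bdist \<Omega> x) powr \<alpha>))"
      using psi_argument_pos by eventually_elim (simp add: divide_right_mono)
    then have "Limsup (near_boundary \<Omega>) ratio \<le> Limsup (near_boundary \<Omega>) (\<lambda>x. ereal ((\<psi> (\<tau> * Theta \<theta> (bdist \<Omega> x) powr \<alpha>) + M) / \<psi> (Theta \<theta> (bdist \<Omega> x) powr \<alpha>)))"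
      by (rule Limsup_mono)
    also have "\<dots> = ereal (\<tau> powr (1 - C))"
      by (intro lim_imp_Limsup near_boundary_nontrivial[OF sm] tendsto_ereal ratio_tendsto \<tau>)
    finally show ?thesis .
  qed
  have "((\<lambda>\<tau>. ereal (\<tau> powr (1 - C))) \<longlongrightarrow> ereal (\<tau>9 powr (1 - C))) (at_left \<tau>9)"
    using \<tau>9 by (intro tendsto_ereal tendsto_powr tendsto_const) auto
  moreover have "\<forall>\<^sub>F \<tau> in at_left \<tau>9. Limsup (near_boundary \<Omega>) ratio \<le> ereal (\<tau> powr (1 - C))"
    using le \<tau>9 unfolding eventually_at_left_field by blast
  ultimately show ?thesis by (rule tendsto_lowerbound) simp
qed

text \<open>\<tau>10 is approached from above, where the strict hypothesis of
  \<open>lower_bound\<close> holds.\<close>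

lemma Liminf_ratio:
  assumes b2: "b2 > 0"
  defines "\<tau>10 \<equiv> 1 / \<alpha> * (b2 / (\<beta> * M_minus (k - 1) \<Omega>)) powr (1 / real k)"
  shows "ereal (\<tau>10 powr (1 - C)) \<le> Liminf (near_boundary \<Omega>) ratio"
proof -
  have \<beta>M: "\<beta> * M_minus (k - 1) \<Omega> > 0" using \<beta>_gt M_minus_pos_k by simp
  have \<tau>10: "\<tau>10 > 0" using b2 \<beta>_gt M_minus_pos_k \<alpha>_pos by (simp add: \<tau>10_def)
  have le: "ereal (\<tau> powr (1 - C)) \<le> Liminf (near_boundary \<Omega>) ratio" if \<tau>: "\<tau>10 < \<tau>" for \<tau>
  proof -
    have \<tau>0: "\<tau> > 0" using \<tau> \<tau>10 by simp
    have "(b2 / (\<beta> * M_minus (k - 1) \<Omega>)) powr (1 / real k) < \<tau> * \<alpha>"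
      using \<tau> \<alpha>_pos unfolding \<tau>10_def by (simp add: field_simps)
    then have "b2 / (\<beta> * M_minus (k - 1) \<Omega>) < (\<tau> * \<alpha>) ^ k"
      using \<tau>0 \<alpha>_pos b2 \<beta>M by (intro power_threshold(2)) auto
    then have "b2 < (\<tau> * \<alpha>) ^ k * (\<beta> * M_minus (k - 1) \<Omega>)" using \<beta>M by (simp add: pos_divide_less_eq)
    from lower_bound[OF \<tau>0 this] obtain M where
      "\<forall>\<^sub>F x in near_boundary \<Omega>. \<psi> (\<tau> * Theta \<theta> (bdist \<Omega> x) powr \<alpha>) - M \<le> u x"
      unfolding eventually_near_boundary by blast
    then have "\<forall>\<^sub>F x in near_boundary \<Omega>. ereal ((\<psi> (\<tau> * Theta \<theta> (bdist \<Omega> x) powr \<alpha>) + - M) / \<psi> (Theta \<theta> (bdist \<Omega> x) powr \<alpha>)) \<le> ratio x"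
      using psi_argument_pos by eventually_elim (simp add: divide_right_mono)
    then have "Liminf (near_boundary \<Omega>) (\<lambda>x. ereal ((\<psi> (\<tau> * Theta \<theta> (bdist \<Omega> x) powr \<alpha>) + - M) / \<psi> (Theta \<theta> (bdist \<Omega> x) powr \<alpha>))) \<le> Liminf (near_boundary \<Omega>) ratio"
      by (rule Liminf_mono)
    moreover have "Liminf (near_boundary \<Omega>) (\<lambda>x. ereal ((\<psi> (\<tau> * Theta \<theta> (bdist \<Omega> x) powr \<alpha>) + - M) / \<psi> (Theta \<theta> (bdist \<Omega> x) powr \<alpha>))) = ereal (\<tau> powr (1 - C))"
      by (intro lim_imp_Liminf near_boundary_nontrivial[OF sm] tendsto_ereal ratio_tendsto \<tau>0)
    ultimately show ?thesis by simp
  qed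
  have "((\<lambda>\<tau>. ereal (\<tau> powr (1 - C))) \<longlongrightarrow> ereal (\<tau>10 powr (1 - C))) (at_right \<tau>10)"
    using \<tau>10 by (intro tendsto_ereal tendsto_powr tendsto_const) auto
  moreover have "\<forall>\<^sub>F \<tau> in at_right \<tau>10. ereal (\<tau> powr (1 - C)) \<le> Liminf (near_boundary \<Omega>) ratio"
    using le unfolding eventually_at_right_field by (meson gt_ex)
  ultimately show ?thesis by (rule tendsto_upperbound) simp
qed

end

theorem theorem2p7:
  fixes \<Omega> :: "(real ^ 'n) set"
    and k :: nat
    and f :: "real \<Rightarrow> real"
    and J :: "real set"
    and C :: real
    and b u :: "real ^ 'n \<Rightarrow> real"
    and \<theta> \<psi> :: "real \<Rightarrow> real"
    and b1 b2 \<tau>9 \<tau>10 :: real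
  assumes "CARD('n) \<ge> 2"
    and "smooth_bounded_domain \<Omega>"
    and "strictly_convex_boundary \<Omega>"
    and "k \<in> {1..CARD('n)}"
    and "(S1 f \<and> J = {0..} \<and> (\<forall>t>0. tail_integrable k f t)) \<or>
         (S01 f \<and> J = UNIV \<and> (\<forall>t. tail_integrable k f t))"
    and "C > 0"
    and "((\<lambda>t. deriv (\<lambda>s. f s powr (1 / real k)) t * tail_integral k f t) \<longlongrightarrow> C) at_top"
    and "\<forall>\<^sub>F t in at_right 0. \<psi> t \<in> J \<and> tail_integrable k f (\<psi> t) \<and> tail_integral k f (\<psi> t) = t"
    and "smooth_on b \<Omega>"
    and "\<forall>x\<in>\<Omega>. b x > 0"
    and "\<theta> \<in> Lambda"
    and "0 < b1" and "b1 < b2"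
    and "Liminf (near_boundary \<Omega>) (\<lambda>x. ereal (b x / \<theta> (bdist \<Omega> x) ^ (k + 1))) = ereal b1"
    and "Limsup (near_boundary \<Omega>) (\<lambda>x. ereal (b x / \<theta> (bdist \<Omega> x) ^ (k + 1))) = ereal b2"
    and "C > 1 \<or> (C = 1 \<and> D_of \<theta> > 0)"
    and "\<tau>9 = real k / (real k + 1) *
           (b1 * real k / (((real k + 1) * (C - 1) + real k * D_of \<theta>) * M_plus (k - 1) \<Omega>))
             powr (1 / real k)"
    and "\<tau>10 = real k / (real k + 1) *
           (b2 * real k / (((real k + 1) * (C - 1) + real k * D_of \<theta>) * M_minus (k - 1) \<Omega>))
             powr (1 / real k)"
    and "classical_k_convex_solution k \<Omega> b J f u"
  shows "ereal (\<tau>10 powr (1 - C))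
           \<le> Liminf (near_boundary \<Omega>)
               (\<lambda>x. ereal (u x / \<psi> (Theta \<theta> (bdist \<Omega> x) powr ((real k + 1) / real k))))
       \<and> Liminf (near_boundary \<Omega>)
               (\<lambda>x. ereal (u x / \<psi> (Theta \<theta> (bdist \<Omega> x) powr ((real k + 1) / real k))))
           \<le> Limsup (near_boundary \<Omega>)
               (\<lambda>x. ereal (u x / \<psi> (Theta \<theta> (bdist \<Omega> x) powr ((real k + 1) / real k))))
       \<and> Limsup (near_boundary \<Omega>)
               (\<lambda>x. ereal (u x / \<psi> (Theta \<theta> (bdist \<Omega> x) powr ((real k + 1) / real k))))
           \<le> ereal (\<tau>9 powr (1 - C))
       \<and> (C = 1 \<longrightarrow>
           ((\<lambda>x. u x / \<psi> (Theta \<theta> (bdist \<Omega> x) powr ((real k + 1) / real k))) \<longlongrightarrow> 1)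
             (near_boundary \<Omega>))"
proof -
  note a = assms
  have k: "1 \<le> k" "k \<le> CARD('n)" using a(4) by auto
  have kr: "real k > 0" using k by simp
  obtain \<delta>0 D where \<theta>: "\<delta>0 > 0" "\<forall>t\<in>{0<..<\<delta>0}. \<theta> t > 0" "mono_on {0<..<\<delta>0} \<theta> \<or> antimono_on {0<..<\<delta>0} \<theta>"
    "Ck_on 1 \<theta> {0<..<\<delta>0}" "set_integrable lborel {0<..<\<delta>0} \<theta>" "D \<ge> 0"
    "(deriv (\<lambda>t. Theta \<theta> t / \<theta> t) \<longlongrightarrow> D) (at_right 0)"
    using a(11) unfolding Lambda_def by blast
  have D_of: "D_of \<theta> = D" unfolding D_of_def by (rule tendsto_Lim[OF trivial_limit_at_right_real \<theta>(7)])
  \<comment> \<open>Under (S1), positivity at positive arguments comes from f 0 = 0 and strict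
    growth.\<close>
  have f: "(\<forall>y>0. (f has_real_derivative deriv f y) (at y)) \<and> (\<forall>y>0. f y > 0) \<and> (\<forall>y>0. tail_integrable k f y)
    \<and> (\<forall>s\<in>J. \<forall>t\<in>J. s < t \<longrightarrow> f s < f t)"
    using a(5)
  proof
    assume S: "S1 f \<and> J = {0..} \<and> (\<forall>t>0. tail_integrable k f t)"
    then have "Ck_on 1 f {0<..}" by (simp add: S1_def smooth_on_def)
    moreover have m: "f s < f t" if "s \<ge> 0" "s < t" for s t
      using S that by (auto simp: S1_def strict_mono_on_def monotone_on_def)
    moreover have "f y > 0" if "y > 0" for y using m[of 0 y] S that by (simp add: S1_def)
    ultimately show ?thesis using S Ck_on_realD[of f "{0<..}"] by auto
  next
    assume S: "S01 f \<and> J = UNIV \<and> (\<forall>t. tail_integrable k f t)"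
    then have "Ck_on 1 f UNIV" by (simp add: S01_def smooth_on_def)
    then show ?thesis using S Ck_on_realD[of f UNIV] by (auto simp: S01_def strict_mono_def)
  qed
  \<comment> \<open>For C > 1 the first summand is positive and D >= 0; for C = 1 it vanishes and D
    > 0.\<close>
  have \<beta>0: "(real k + 1) / real k * (C - 1) + D > 0"
    using a(16)
  proof
    assume "C > 1"
    then show ?thesis using \<theta>(6) kr by (intro add_pos_nonneg mult_pos_pos) auto
  qed (simp add: D_of)
  interpret blowup_problem \<Omega> k f \<psi> \<theta> J C D \<delta>0 b1 b2 b u
  proof unfold_locales
    show "\<forall>\<^sub>F x in near_boundary \<Omega>. b1 - e \<le> b x / \<theta> (bdist \<Omega> x) ^ (k + 1)" if "e > 0" for e
    proof -
      have "ereal (b1 - e) < Liminf (near_boundary \<Omega>) (\<lambda>x. ereal (b x / \<theta> (bdist \<Omega> x) ^ (k + 1)))"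
        unfolding a(14) using that by simp
      then show ?thesis by (rule less_LiminfD[THEN eventually_mono]) simp
    qed
    show "\<forall>\<^sub>F x in near_boundary \<Omega>. b x / \<theta> (bdist \<Omega> x) ^ (k + 1) \<le> b2 + e" if "e > 0" for e
    proof -
      have "Limsup (near_boundary \<Omega>) (\<lambda>x. ereal (b x / \<theta> (bdist \<Omega> x) ^ (k + 1))) < ereal (b2 + e)"
        unfolding a(15) using that by simp
      then show ?thesis by (rule Limsup_lessD[THEN eventually_mono]) simp
    qed
  qed (use a(2,3,7,8,10,19) k f \<theta> \<beta>0 in auto)
  have \<alpha>: "(real k + 1) / real k = \<alpha>" "real k / (real k + 1) = 1 / \<alpha>" by (simp_all add: \<alpha>_def)
  \<comment> \<open>The factor k appearing here cancels against the k in the numerators of \<tau>9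
    and \<tau>10.\<close>
  have k\<beta>: "(real k + 1) * (C - 1) + real k * D = \<beta> * real k"
    unfolding \<beta>_def \<alpha>_def using kr by (simp add: field_simps)
  have t9: "\<tau>9 = 1 / \<alpha> * (b1 / (\<beta> * M_plus (k - 1) \<Omega>)) powr (1 / real k)"
    unfolding a(17) D_of k\<beta> \<alpha> using kr by simp
  have t10: "\<tau>10 = 1 / \<alpha> * (b2 / (\<beta> * M_minus (k - 1) \<Omega>)) powr (1 / real k)"
    unfolding a(18) D_of k\<beta> \<alpha> using kr by simp
  have b2: "b2 > 0" using a(12,13) by simp
  have lo: "ereal (\<tau>10 powr (1 - C)) \<le> Liminf (near_boundary \<Omega>) ratio" unfolding t10 by (rule Liminf_ratio[OF b2])
  have up: "Limsup (near_boundary \<Omega>) ratio \<le> ereal (\<tau>9 powr (1 - C))" unfolding t9 by (rule Limsup_ratio[OF a(12)])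
  have mid: "Liminf (near_boundary \<Omega>) ratio \<le> Limsup (near_boundary \<Omega>) ratio"
    by (rule Liminf_le_Limsup[OF near_boundary_nontrivial[OF sm]])
  have "((\<lambda>x. u x / \<psi> (Theta \<theta> (bdist \<Omega> x) powr \<alpha>)) \<longlongrightarrow> 1) (near_boundary \<Omega>)" if C: "C = 1"
  proof -
    \<comment> \<open>Positivity matters because \<open>0 powr 0\<close> is 0; only for a positive
      base does the exponent 1 - C = 0 give 1.\<close>
    have "\<tau>9 > 0" unfolding t9 using \<alpha>_pos \<beta>_gt M_plus_pos a(12) by simp
    moreover have "\<tau>10 > 0" unfolding t10 using \<alpha>_pos \<beta>_gt M_minus_pos_k b2 by simp
    ultimately have "1 \<le> Liminf (near_boundary \<Omega>) ratio" "Limsup (near_boundary \<Omega>) ratio \<le> 1"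
      using lo up C by (simp_all add: one_ereal_def)
    then have "Liminf (near_boundary \<Omega>) ratio = 1" "Limsup (near_boundary \<Omega>) ratio = 1" using mid by auto
    then have "(ratio \<longlongrightarrow> 1) (near_boundary \<Omega>)"
      by (rule Liminf_eq_Limsup[OF near_boundary_nontrivial[OF sm]])
    then show ?thesis by (simp add: one_ereal_def)
  qed
  then show ?thesis using lo up mid unfolding \<alpha> by blast
qed

end
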